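(* Let $d\ge 2$ and $\lambda\in\mathbb{C}$ with $\mathrm{Re}(\lambda) > 0$. Let $w \in H^s(\mathbb{R}^d) \cap L^2(\mathbb{R}^d,\langle x \rangle^{2k}dx)$, with $s > \frac{d}{2}-1$ and $k \in \mathbb{N}$, $k \ge \frac d2$, be a solution to $$\Delta w - w + \lambda w^3 = 0 \quad\text{in } \mathbb{R}^d .$$ Suppose that, for some $c>0$ and $\alpha\in(0,1)$, $$w(c \log(n+1)^{\alpha}\, \xi)=0 \quad \text{for all integers } n \ge 0 \text{ and all } \xi \in \mathbb{S}^{d-1}.$$ Then $w \equiv 0$.
   Context: $\langle x\rangle = (1+|x|^2)^{1/2}$. The equation is understood in the sense of distributions (with $w^3\in L^1_{\mathrm{loc}}$), and the zero condition refers to the continuous representative of $w$. $\log(n+1)^\alpha$ means $(\log(n+1))^\alpha$. *)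

theory Defs
  imports "HOL-Analysis.Analysis"
begin

definition japanese_bracket :: "'a::euclidean_space \<Rightarrow> real" where
  "japanese_bracket x = sqrt (1 + (norm x)\<^sup>2)"

fun iter_deriv :: "'a::euclidean_space list \<Rightarrow> ('a \<Rightarrow> complex) \<Rightarrow> 'a \<Rightarrow> complex" where
  "iter_deriv [] f = f"
| "iter_deriv (v # vs) f = (\<lambda>x. frechet_derivative (iter_deriv vs f) (at x) v)"

(* Partial derivatives of all orders exist and are themselves (totally) differentiable,
   which is the same as being of class C-infinity. *)
definition smooth :: "('a::euclidean_space \<Rightarrow> complex) \<Rightarrow> bool" where
  "smooth f \<longleftrightarrow>
     (\<forall>vs. set vs \<subseteq> Basis \<longrightarrow> (\<forall>x. iter_deriv vs f differentiable (at x)))"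

definition schwartz :: "('a::euclidean_space \<Rightarrow> complex) \<Rightarrow> bool" where
  "schwartz f \<longleftrightarrow> smooth f \<and>
     (\<forall>vs N. set vs \<subseteq> Basis \<longrightarrow>
        bounded (range (\<lambda>x. japanese_bracket x ^ N *\<^sub>R iter_deriv vs f x)))"

definition test_function :: "('a::euclidean_space \<Rightarrow> complex) \<Rightarrow> bool" where
  "test_function f \<longleftrightarrow> smooth f \<and> compact (closure {x. f x \<noteq> 0})"

definition laplacian :: "('a::euclidean_space \<Rightarrow> complex) \<Rightarrow> 'a \<Rightarrow> complex" where
  "laplacian f x = (\<Sum>b\<in>Basis. iter_deriv [b, b] f x)"

(* The space L^2(<x>^(2k) dx). Elements of function spaces are Borel functions, with equality
   almost everywhere. *)
definition weighted_L2 :: "nat \<Rightarrow> ('a::euclidean_space \<Rightarrow> complex) set" where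
  "weighted_L2 k = {f. f \<in> borel_measurable lborel \<and>
     integrable lborel (\<lambda>x. (cmod (f x))\<^sup>2 * japanese_bracket x ^ (2 * k))}"

definition fourier :: "('a::euclidean_space \<Rightarrow> complex) \<Rightarrow> 'a \<Rightarrow> complex" where
  "fourier \<phi> \<xi> = (LINT x|lborel. exp (- (\<i> * complex_of_real (x \<bullet> \<xi>))) * \<phi> x)"

(* For w and g in L^2: g is the Fourier transform of w as a tempered distribution. *)
definition has_fourier_transform ::
    "('a::euclidean_space \<Rightarrow> complex) \<Rightarrow> ('a \<Rightarrow> complex) \<Rightarrow> bool" where
  "has_fourier_transform w g \<longleftrightarrow>
     (\<forall>\<phi>. schwartz \<phi> \<longrightarrow>
        (LINT x|lborel. w x * fourier \<phi> x) = (LINT \<xi>|lborel. g \<xi> * \<phi> \<xi>))"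

(* The fractional Sobolev space H^s for s >= 0, where it is a subspace of L^2 = weighted_L2 0.
   Not meant for s < 0. *)
definition sobolev_H :: "real \<Rightarrow> ('a::euclidean_space \<Rightarrow> complex) set" where
  "sobolev_H s = {w \<in> weighted_L2 0. \<exists>g \<in> borel_measurable lborel.
     has_fourier_transform w g \<and>
     integrable lborel (\<lambda>\<xi>. japanese_bracket \<xi> powr (2 * s) * (cmod (g \<xi>))\<^sup>2)}"

definition locally_integrable :: "('a::euclidean_space \<Rightarrow> complex) \<Rightarrow> bool" where
  "locally_integrable f \<longleftrightarrow> (\<forall>K. compact K \<longrightarrow> set_integrable lborel K f)"

(* Delta w - w + lambda w^3 = 0 in the sense of distributions. *)
definition distributional_solution :: "complex \<Rightarrow> ('a::euclidean_space \<Rightarrow> complex) \<Rightarrow> bool" where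
  "distributional_solution lam w \<longleftrightarrow>
     locally_integrable w \<and> locally_integrable (\<lambda>x. w x ^ 3) \<and>
     (\<forall>\<phi>. test_function \<phi> \<longrightarrow>
        (LINT x|lborel. w x * laplacian \<phi> x) - (LINT x|lborel. w x * \<phi> x)
          + lam * (LINT x|lborel. w x ^ 3 * \<phi> x) = 0)"

(* Unspecified if no continuous representative exists; otherwise unique, see below. *)
definition continuous_rep :: "('a::euclidean_space \<Rightarrow> complex) \<Rightarrow> 'a \<Rightarrow> complex" where
  "continuous_rep w = (THE u. continuous_on UNIV u \<and> (AE x in lborel. u x = w x))"

lemma continuous_AE_eq_imp_eq:
  fixes u v :: "'a::euclidean_space \<Rightarrow> complex"
  assumes "continuous_on UNIV u" "continuous_on UNIV v" "AE x in lborel. u x = v x"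
  shows "u = v"
proof
  fix x
  have "closed {x. u x = v x}"
    using assms(1,2) by (rule closed_Collect_eq)
  then have "x \<in> {x. u x = v x}"
    using mem_closed_if_AE_lebesgue_open[of UNIV "{x. u x = v x}" x] AE_completion[OF assms(3)]
    by auto
  then show "u x = v x" by simp
qed

lemma continuous_rep_eq:
  assumes "continuous_on UNIV u" "AE x in lborel. u x = w x"
  shows "continuous_rep w = u"
  unfolding continuous_rep_def
proof (rule the_equality)
  show "continuous_on UNIV u \<and> (AE x in lborel. u x = w x)"
    using assms by blast
next
  fix v assume v: "continuous_on UNIV v \<and> (AE x in lborel. v x = w x)"
  then have "AE x in lborel. v x = w x" by blast
  with assms(2) have "AE x in lborel. v x = u x" by eventually_elim simp
  with v assms(1) show "v = u" by (intro continuous_AE_eq_imp_eq) auto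
qed

end

theory Submission
  imports Defs "HOL-Probability.Probability" "HOL-Real_Asymp.Real_Asymp"
begin

text \<open>
  The zeros of \<open>w\<close> fill spheres whose radii tend to infinity, and two uniqueness principles for the
  equation \<open>\<Delta> w = (1 - lam w^2) w\<close> turn this into \<open>w = 0\<close>. Where \<open>lam w^2\<close> is small on average, the
  Dirichlet problem has no solution but 0, as for \<open>\<Delta> w = w\<close>. Since \<open>|w|^2\<close> is integrable, this is
  the case far from the origin, so \<open>w\<close> vanishes between any two of its distant zero spheres
  (\<open>shell_uniqueness\<close>) and has compact support. A solution of compact support vanishes by a Carleman
  estimate with a linear weight (\<open>compact_support_uniqueness\<close>): for large \<open>\<tau>\<close> the factor
  \<open>exp (\<tau> x \<bullet> e)\<close> makes the Laplacian dominate every bounded potential.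

  Smallness on average means smallness of the Newtonian potential of \<open>|w|^2\<close>. Its control is also the
  key to the continuity of \<open>w\<close>, which the assumption \<open>s > d/2 - 1\<close> does not give by Sobolev embedding.
  Duality, together with the representation of the Bessel weight as a superposition of Gaussians,
  bounds the functional \<open>\<psi> \<mapsto> \<integral> \<psi> w\<close> by a Riesz energy of \<open>\<psi>\<close> with an exponent \<open>2 b < 2\<close>
  (\<open>sobolev_pairing_bound\<close>). Testing it with \<open>cnj w\<close> times a singular weight gives
  \<open>\<integral> |w(y)|^2 |y - x|^(- a - e) dy \<le> K\<close> over unit balls, uniformly in their centre \<open>x\<close>, with
  \<open>a > d - 2\<close> and \<open>e > 0\<close> (\<open>kato_bound\<close>): \<open>|w|^2\<close> is a potential of Kato class with a power to
  spare.

  A parametrix of the Laplacian represents \<open>w\<close> as an integral of \<open>w - lam w^3\<close> against the Newtonian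
  kernel, up to a bounded kernel (\<open>parametrix_representation\<close>). Inserted into itself, this
  representation lowers the order of the singularity by \<open>e\<close> each time until the kernel is bounded
  (\<open>kato_iteration\<close>). Therefore \<open>w\<close> is locally bounded and has a continuous representative
  (\<open>continuous_solution\<close>).

  This representative is not differentiated anywhere. Maximum principle and Carleman estimate are
  applied to convolutions of it with explicit radial kernels, whose derivatives fall on the kernel,
  and to the weak equation tested with that kernel; the regularisation \<open>\<rho>\<close> tends to 0 at the end.
\<close>

section \<open>Smooth radial profiles\<close>

text \<open>Smoothness of a function built from finitely many kinds of generators is proved by closure: if the
  partial derivatives of every generator lie again in the generated algebra, then the algebra is
  closed under differentiation and all its members are smooth. The set is inductive, so that the
  product rule can be applied by induction.\<close>
inductive_set function_algebra :: "('a \<Rightarrow> 'b::comm_ring_1) set \<Rightarrow> ('a \<Rightarrow> 'b) set"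
  for C where
  gen: "f \<in> C \<Longrightarrow> f \<in> function_algebra C"
| const: "(\<lambda>_. c) \<in> function_algebra C"
| add: "f \<in> function_algebra C \<Longrightarrow> g \<in> function_algebra C \<Longrightarrow> (\<lambda>x. f x + g x) \<in> function_algebra C"
| mult: "f \<in> function_algebra C \<Longrightarrow> g \<in> function_algebra C \<Longrightarrow> (\<lambda>x. f x * g x) \<in> function_algebra C"

lemma function_algebra_real_deriv:
  fixes C :: "(real \<Rightarrow> real) set"
  assumes gen: "\<And>f. f \<in> C \<Longrightarrow> \<exists>f'\<in>function_algebra C. \<forall>t\<in>S. (f has_real_derivative f' t) (at t)"
    and "f \<in> function_algebra C"
  shows "\<exists>f'\<in>function_algebra C. \<forall>t\<in>S. (f has_real_derivative f' t) (at t)"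
  using assms(2)
proof induction
  case (gen f)
  then show ?case by (rule assms(1))
next
  case (const c)
  show ?case by (rule bexI[OF _ function_algebra.const[of 0]]) auto
next
  case (add f g)
  then obtain f' g' where "f' \<in> function_algebra C" "g' \<in> function_algebra C"
    "\<forall>t\<in>S. (f has_real_derivative f' t) (at t)" "\<forall>t\<in>S. (g has_real_derivative g' t) (at t)" by blast
  then show ?case
    by (intro bexI[of _ "\<lambda>t. f' t + g' t"]) (auto intro!: derivative_intros function_algebra.add)
next
  case (mult f g)
  then obtain f' g' where "f' \<in> function_algebra C" "g' \<in> function_algebra C"
    "\<forall>t\<in>S. (f has_real_derivative f' t) (at t)" "\<forall>t\<in>S. (g has_real_derivative g' t) (at t)" by blast
  then show ?case using mult.hyps
    by (intro bexI[of _ "\<lambda>t. f' t * g t + g' t * f t"])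
       (auto intro!: DERIV_mult function_algebra.add function_algebra.mult)
qed

lemma function_algebra_smooth:
  fixes C :: "('a::euclidean_space \<Rightarrow> complex) set"
  assumes gen: "\<And>f. f \<in> C \<Longrightarrow> \<exists>D. (\<forall>x. (f has_derivative D x) (at x)) \<and>
                  (\<forall>b\<in>Basis. (\<lambda>x. D x b) \<in> function_algebra C)"
    and f: "f \<in> function_algebra C"
  shows "smooth f" and "set vs \<subseteq> Basis \<Longrightarrow> iter_deriv vs f \<in> function_algebra C"
proof -
  have D: "\<exists>D. (\<forall>x. (f has_derivative D x) (at x)) \<and> (\<forall>b\<in>Basis. (\<lambda>x. D x b) \<in> function_algebra C)"
    if "f \<in> function_algebra C" for f
    using that
  proof induction
    case (gen f)
    then show ?case by (rule assms(1))
  next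
    case (const c)
    then show ?case
      by (intro exI[of _ "\<lambda>_ _. 0"]) (auto intro: function_algebra.const)
  next
    case (add f g)
    then obtain Df Dg where "\<forall>x. (f has_derivative Df x) (at x)" "\<forall>x. (g has_derivative Dg x) (at x)"
      "\<forall>b\<in>Basis. (\<lambda>x. Df x b) \<in> function_algebra C" "\<forall>b\<in>Basis. (\<lambda>x. Dg x b) \<in> function_algebra C"
      by blast
    then show ?case
      by (intro exI[of _ "\<lambda>x h. Df x h + Dg x h"])
         (auto intro!: has_derivative_add function_algebra.add)
  next
    case (mult f g)
    then obtain Df Dg where "\<forall>x. (f has_derivative Df x) (at x)" "\<forall>x. (g has_derivative Dg x) (at x)"
      "\<forall>b\<in>Basis. (\<lambda>x. Df x b) \<in> function_algebra C" "\<forall>b\<in>Basis. (\<lambda>x. Dg x b) \<in> function_algebra C"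
      by blast
    then show ?case using mult.hyps
      by (intro exI[of _ "\<lambda>x h. f x * Dg x h + Df x h * g x"])
         (auto intro!: has_derivative_mult function_algebra.add function_algebra.mult)
  qed
  have iter: "iter_deriv vs f \<in> function_algebra C" if "set vs \<subseteq> Basis" for vs
    using that
  proof (induction vs)
    case (Cons v vs)
    then obtain D where "\<And>x. (iter_deriv vs f has_derivative D x) (at x)"
      "\<And>b. b \<in> Basis \<Longrightarrow> (\<lambda>x. D x b) \<in> function_algebra C" using D by fastforce
    moreover from this(1) have "frechet_derivative (iter_deriv vs f) (at x) = D x" for x
      by (metis frechet_derivative_at)
    ultimately show ?case using Cons.prems by simp
  qed (use f in auto)
  show "set vs \<subseteq> Basis \<Longrightarrow> iter_deriv vs f \<in> function_algebra C" by (rule iter)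
  show "smooth f"
    unfolding smooth_def using D iter by (blast intro: differentiableI)
qed

text \<open>The polynomial factor makes the family closed under differentiation; \<open>flat_exp 1\<close> is the usual
  smooth function that is flat at 0.\<close>
definition flat_exp :: "real poly \<Rightarrow> real \<Rightarrow> real" where
  "flat_exp p t = (if t \<le> 0 then 0 else poly p (1 / t) * exp (- (1 / t)))"

lemma poly_exp_decay:
  fixes p :: "real poly"
  shows "((\<lambda>t. poly p t * exp (- t)) \<longlongrightarrow> 0) at_top"
proof (induction p)
  case 0
  then show ?case by simp
next
  case (pCons a p)
  have "((\<lambda>t. a * exp (-t) + t * (poly p t * exp (-t))) \<longlongrightarrow> 0) at_top"
  proof -
    have "((\<lambda>t::real. t ^ n * exp (-t)) \<longlongrightarrow> 0) at_top" for n :: nat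
      using tendsto_power_div_exp_0[of n] by (simp add: exp_minus divide_inverse)
    then have *: "((\<lambda>t. coeff p i * (t ^ Suc i * exp (-t))) \<longlongrightarrow> 0) at_top" for i
      by (intro tendsto_mult_right_zero)
    have "((\<lambda>t. \<Sum>i\<le>degree p. coeff p i * (t ^ Suc i * exp (-t))) \<longlongrightarrow> 0) at_top"
      by (intro tendsto_null_sum *)
    moreover have "(\<Sum>i\<le>degree p. coeff p i * (t ^ Suc i * exp (-t))) = t * (poly p t * exp (-t))" for t
      by (simp add: poly_altdef sum_distrib_left sum_distrib_right mult_ac)
    ultimately have "((\<lambda>t. t * (poly p t * exp (-t))) \<longlongrightarrow> 0) at_top" by simp
    moreover have "((\<lambda>t. a * exp (-t)) \<longlongrightarrow> 0) at_top" by real_asymp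
    ultimately show ?thesis using tendsto_add by fastforce
  qed
  then show ?case by (simp add: algebra_simps)
qed

text \<open>For \<open>t > 0\<close> this is the chain rule with \<open>d(1/t) = - (1/t)^2 dt\<close>; at 0 the exponential beats
  every polynomial in \<open>1/t\<close>.\<close>
lemma flat_exp_deriv:
  "(flat_exp p has_real_derivative flat_exp ([:0,0,1:] * (p - pderiv p)) t) (at t)"
proof -
  consider "t < 0" | "t > 0" | "t = 0" by linarith
  then show ?thesis
  proof cases
    case 1
    have "(flat_exp p has_real_derivative 0) (at t)"
      by (rule has_field_derivative_transform_within_open[of "\<lambda>_. 0" _ _ "{..<0}"])
         (use 1 in \<open>auto simp: flat_exp_def\<close>)
    then show ?thesis using 1 by (simp add: flat_exp_def)
  next
    case 2
    have "((\<lambda>t. poly p (1 / t) * exp (- (1 / t))) has_real_derivative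
       (poly (pderiv p) (1/t) * (- (1 / t^2))) * exp (- (1/t)) + poly p (1/t) * (exp (-(1/t)) * (1 / t^2))) (at t)"
      using 2 by (auto intro!: derivative_eq_intros poly_DERIV[THEN DERIV_chain2] simp: power2_eq_square)
    then have "((\<lambda>t. poly p (1 / t) * exp (- (1 / t))) has_real_derivative
       flat_exp ([:0,0,1:] * (p - pderiv p)) t) (at t)"
      using 2 by (simp add: flat_exp_def algebra_simps power2_eq_square)
    then show ?thesis
      by (rule has_field_derivative_transform_within_open[of _ _ _ "{0<..}"])
         (use 2 in \<open>auto simp: flat_exp_def\<close>)
  next
    case 3
    have r: "((\<lambda>h. flat_exp p h / h) \<longlongrightarrow> 0) (at_right 0)"
    proof -
      have "((\<lambda>t. poly (pCons 0 p) t * exp (-t)) \<longlongrightarrow> 0) at_top" by (rule poly_exp_decay)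
      then have "((\<lambda>h. poly (pCons 0 p) (inverse h) * exp (- inverse h)) \<longlongrightarrow> 0) (at_right 0)"
        using filterlim_compose filterlim_inverse_at_top_right by blast
      then show ?thesis
        by (rule Lim_transform_eventually)
           (auto simp: eventually_at_right_less flat_exp_def field_simps intro!: eventually_at_rightI[of 0 1])
    qed
    have l: "((\<lambda>h. flat_exp p h / h) \<longlongrightarrow> 0) (at_left 0)"
      by (rule Lim_transform_eventually[OF tendsto_const])
         (auto simp: flat_exp_def intro!: eventually_at_leftI[of "-1"])
    from l r show ?thesis unfolding 3
      by (simp add: DERIV_def flat_exp_def filterlim_split_at)
  qed
qed

lemma flat_exp_nonneg: "flat_exp 1 t \<ge> 0" and flat_exp_pos: "t > 0 \<Longrightarrow> flat_exp 1 t > 0"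
  by (auto simp: flat_exp_def)

definition cutoff :: "real \<Rightarrow> real" where
  "cutoff t = flat_exp 1 (2 - t) * (1 / (flat_exp 1 (2 - t) + flat_exp 1 (t - 1)))"

lemma cutoff_denominator_pos: "flat_exp 1 (2 - t) + flat_exp 1 (t - 1) > 0"
  using flat_exp_pos[of "2 - t"] flat_exp_pos[of "t - 1"] flat_exp_nonneg[of "2 - t"] flat_exp_nonneg[of "t - 1"]
  by (cases "t < 2") (auto intro: add_pos_nonneg add_nonneg_pos)

lemma cutoff_eq_1: "t \<le> 1 \<Longrightarrow> cutoff t = 1"
  using flat_exp_pos[of "2 - t"] by (simp add: cutoff_def flat_exp_def[of _ "t - 1"])
lemma cutoff_eq_0: "t \<ge> 2 \<Longrightarrow> cutoff t = 0"
  by (simp add: cutoff_def flat_exp_def)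
lemma cutoff_nonneg: "cutoff t \<ge> 0"
  using cutoff_denominator_pos[of t] flat_exp_nonneg by (simp add: cutoff_def)
lemma cutoff_le_1: "cutoff t \<le> 1"
  using cutoff_denominator_pos[of t] flat_exp_nonneg[of "t - 1"] by (simp add: cutoff_def)

lemma flat_exp_reflect_deriv:
  "((\<lambda>t. flat_exp p (2 - t)) has_real_derivative - flat_exp ([:0,0,1:] * (p - pderiv p)) (2 - t)) (at t)"
proof -
  have "((\<lambda>t::real. 2 - t) has_real_derivative -1) (at t)" by (auto intro!: derivative_eq_intros)
  from DERIV_chain2[OF flat_exp_deriv[of p] this] show ?thesis by (simp only: mult_minus1_right)
qed

lemma flat_exp_shift_deriv:
  "((\<lambda>t. flat_exp p (t - 1)) has_real_derivative flat_exp ([:0,0,1:] * (p - pderiv p)) (t - 1)) (at t)"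
proof -
  have "((\<lambda>t::real. t - 1) has_real_derivative 1) (at t)" by (auto intro!: derivative_eq_intros)
  from DERIV_chain2[OF flat_exp_deriv[of p] this] show ?thesis by (simp only: mult_1_right)
qed

lemma cutoff_deriv_exists: "\<exists>D. (cutoff has_real_derivative D) (at t)"
proof -
  have "flat_exp 1 (2 - t) + flat_exp 1 (t - 1) \<noteq> 0" using cutoff_denominator_pos[of t] by simp
  with DERIV_mult[OF flat_exp_reflect_deriv[of 1 t]
    DERIV_divide[OF DERIV_const DERIV_add[OF flat_exp_reflect_deriv[of 1 t] flat_exp_shift_deriv[of 1 t]]]]
  show ?thesis unfolding cutoff_def[abs_def] by blast
qed

lemma continuous_on_cutoff: "continuous_on A cutoff"
  by (meson DERIV_isCont continuous_at_imp_continuous_on cutoff_deriv_exists)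

text \<open>With \<open>m = d/2\<close>, the primitive of \<open>t powr (- m)\<close>, taken at \<open>t = |z|^2\<close>, is up to a constant
  factor the fundamental solution of the Laplacian, including the logarithm for \<open>d = 2\<close>. The cutoff
  and the upper limit 2 give it compact support without a case distinction on the dimension.\<close>
definition newton_profile :: "real \<Rightarrow> real \<Rightarrow> real" where
  "newton_profile m t = - integral {t..2} (\<lambda>s. s powr (- m) * cutoff s)"

lemma newton_profile_eq_0: "t \<ge> 2 \<Longrightarrow> newton_profile m t = 0"
  by (cases "t = 2") (auto simp: newton_profile_def)

lemma newton_profile_deriv:
  assumes "t > 0"
  shows "(newton_profile m has_real_derivative t powr (- m) * cutoff t) (at t)"
proof -
  let ?f = "\<lambda>s. s powr (- m) * cutoff s"
  define a K where "a = t / 2" and "K = max t 2 + 1"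
  have a: "0 < a" "a < t" "t < K" "2 < K" using assms by (auto simp: a_def K_def)
  have cont: "continuous_on {a..K} ?f"
    using a by (intro continuous_intros continuous_on_cutoff) auto
  have "((\<lambda>s. integral {a..s} ?f) has_real_derivative ?f t) (at t within {a..K})"
    using a by (intro integral_has_real_derivative cont) auto
  then have "((\<lambda>s. integral {a..s} ?f) has_real_derivative ?f t) (at t)"
    using a by (simp add: at_within_Icc_at)
  then have "((\<lambda>s. integral {a..s} ?f - integral {a..K} ?f) has_real_derivative ?f t) (at t)"
    by (auto intro!: derivative_eq_intros)
  then show ?thesis
  proof (rule has_field_derivative_transform_within_open[of _ _ _ "{a<..<K}"])
    fix s assume s: "s \<in> {a<..<K}"
    have int: "?f integrable_on {p..q}" if "a \<le> p" "q \<le> K" for p q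
      by (rule integrable_continuous_interval, rule continuous_on_subset[OF cont]) (use that in auto)
    have "integral {a..s} ?f + integral {s..K} ?f = integral {a..K} ?f"
      by (rule Henstock_Kurzweil_Integration.integral_combine) (use s int in auto)
    moreover have "integral {s..K} ?f = integral {s..2} ?f"
    proof (cases "s \<le> 2")
      case True
      have "integral {s..2} ?f + integral {2..K} ?f = integral {s..K} ?f"
        by (rule Henstock_Kurzweil_Integration.integral_combine) (use s True a int in auto)
      moreover have "integral {2..K} ?f = 0"
        using Henstock_Kurzweil_Integration.integral_cong[of "{2..K}" ?f "\<lambda>_. 0"] by (simp add: cutoff_eq_0)
      ultimately show ?thesis by simp
    next
      case False
      then have "integral {s..K} ?f = 0"
        using Henstock_Kurzweil_Integration.integral_cong[of "{s..K}" ?f "\<lambda>_. 0"] by (simp add: cutoff_eq_0)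
      then show ?thesis using False by simp
    qed
    ultimately show "integral {a..s} ?f - integral {a..K} ?f = newton_profile m s"
      by (simp add: newton_profile_def)
  qed (use a in auto)
qed

lemma newton_profile_mono:
  assumes "0 < s" "s \<le> t" shows "newton_profile m s \<le> newton_profile m t"
proof (rule DERIV_nonneg_imp_nondecreasing[OF assms(2)])
  fix x assume "s \<le> x" "x \<le> t"
  then have "(newton_profile m has_real_derivative x powr (- m) * cutoff x) (at x)"
    using assms by (intro newton_profile_deriv) auto
  then show "\<exists>y. (newton_profile m has_real_derivative y) (at x) \<and> 0 \<le> y"
    using cutoff_nonneg by (intro exI conjI) (assumption, simp)
qed

lemma newton_profile_nonpos:
  assumes "t > 0" shows "newton_profile m t \<le> 0"
  using newton_profile_mono[OF assms, of 2 m] newton_profile_eq_0[of t m] newton_profile_eq_0[of 2 m]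
  by (cases "t \<le> 2") auto

text \<open>The exponent \<open>q\<close> may exceed the natural decay rate \<open>m - 1\<close> but has to be positive: for
  \<open>m = 1\<close> the profile is logarithmic and no constant bounds it.\<close>
lemma newton_profile_bound:
  assumes t: "t > 0" and q: "q > 0" "m - 1 \<le> q"
  shows "\<bar>newton_profile m t\<bar> \<le> 2 powr (q + 1 - m) / q * t powr (- q)"
proof (cases "t \<le> 2")
  case True
  let ?C = "2 powr (q + 1 - m) / q"
  let ?G = "\<lambda>s. newton_profile m s + ?C * s powr (- q)"
  have "?G t \<ge> ?G 2"
  proof (rule DERIV_nonpos_imp_nonincreasing[OF True])
    fix s assume s: "t \<le> s" "s \<le> 2"
    have "(?G has_real_derivative s powr (- m) * cutoff s + ?C * (- q * s powr (- q - 1))) (at s)"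
      using s t by (intro derivative_intros newton_profile_deriv DERIV_cmult has_real_derivative_powr) auto
    moreover have "s powr (- m) * cutoff s \<le> ?C * (q * s powr (- q - 1))"
    proof -
      have "s powr (- m) * cutoff s \<le> s powr (- m)"
        using cutoff_le_1 by (simp add: mult_left_le)
      also have "\<dots> = s powr (q + 1 - m) * s powr (- q - 1)"
        by (simp add: powr_add[symmetric])
      also have "\<dots> \<le> 2 powr (q + 1 - m) * s powr (- q - 1)"
        using s t q by (intro mult_right_mono powr_mono2) auto
      finally show ?thesis using q by simp
    qed
    ultimately show "\<exists>y. (?G has_real_derivative y) (at s) \<and> y \<le> 0"
      by (intro exI conjI) (assumption, linarith)
  qed
  moreover have "?G 2 \<ge> 0" using q by (simp add: newton_profile_eq_0)
  ultimately have "newton_profile m t \<ge> - (?C * t powr (- q))" by linarith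
  then show ?thesis using newton_profile_nonpos[OF t, of m] by linarith
next
  case False
  then show ?thesis using q by (simp add: newton_profile_eq_0)
qed

text \<open>All profiles used below lie in the algebra of these functions. The powers and the reciprocal are
  differentiable for positive arguments only, which is why every kernel is evaluated at
  \<open>|z|^2 + \<rho>\<close> with \<open>\<rho> > 0\<close>.\<close>
definition profile_generators :: "real \<Rightarrow> (real \<Rightarrow> real) set" where
  "profile_generators m = {newton_profile m, \<lambda>t. 1 / (flat_exp 1 (2 - t) + flat_exp 1 (t - 1))} \<union>
     range (\<lambda>p t. t powr p) \<union> range (\<lambda>p t. flat_exp p (2 - t)) \<union> range (\<lambda>p t. flat_exp p (t - 1))"

abbreviation profiles :: "real \<Rightarrow> (real \<Rightarrow> real) set" where
  "profiles m \<equiv> function_algebra (profile_generators m)"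

lemma powr_in_profiles: "(\<lambda>t. t powr p) \<in> profiles m"
  and newton_profile_in_profiles: "newton_profile m \<in> profiles m"
  by (auto intro!: function_algebra.gen simp: profile_generators_def)

lemma cutoff_in_profiles: "cutoff \<in> profiles m"
proof -
  have "(\<lambda>t. flat_exp 1 (2 - t) * (1 / (flat_exp 1 (2 - t) + flat_exp 1 (t - 1)))) \<in> profiles m"
    by (intro function_algebra.mult; rule function_algebra.gen) (auto simp: profile_generators_def)
  then show ?thesis unfolding cutoff_def[abs_def] .
qed

lemma profiles_deriv:
  assumes "f \<in> profiles m"
  obtains f' where "f' \<in> profiles m" "\<And>t. t > 0 \<Longrightarrow> (f has_real_derivative f' t) (at t)"
proof -
  have "\<exists>f'\<in>profiles m. \<forall>t\<in>{0<..}. (f has_real_derivative f' t) (at t)"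
  proof (rule function_algebra_real_deriv[OF _ assms])
    fix f assume f: "f \<in> profile_generators m"
    have g1: "(\<lambda>t. flat_exp p (2 - t)) \<in> profiles m" and g2: "(\<lambda>t. flat_exp p (t - 1)) \<in> profiles m"
      and g3: "(\<lambda>t. 1 / (flat_exp 1 (2 - t) + flat_exp 1 (t - 1))) \<in> profiles m" for p
      by (auto intro!: function_algebra.gen simp: profile_generators_def)
    note c = function_algebra.const
    from f consider "f = newton_profile m" | "f = (\<lambda>t. 1 / (flat_exp 1 (2 - t) + flat_exp 1 (t - 1)))"
      | p where "f = (\<lambda>t. t powr p)" | p where "f = (\<lambda>t. flat_exp p (2 - t))"
      | p where "f = (\<lambda>t. flat_exp p (t - 1))"
      by (auto simp: profile_generators_def)
    then show "\<exists>f'\<in>profiles m. \<forall>t\<in>{0<..}. (f has_real_derivative f' t) (at t)"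
    proof cases
      case 1
      then show ?thesis
        by (intro bexI[of _ "\<lambda>t. t powr (- m) * cutoff t"])
           (auto intro!: function_algebra.mult cutoff_in_profiles powr_in_profiles newton_profile_deriv)
    next
      case 2
      let ?i = "\<lambda>t. 1 / (flat_exp 1 (2 - t) + flat_exp 1 (t - 1))"
      let ?q = "[:0,0,1:] * (1 - pderiv (1 :: real poly))"
      let ?f' = "\<lambda>t. ((-1) * (?i t * ?i t)) * ((-1) * flat_exp ?q (2 - t) + flat_exp ?q (t - 1))"
      have eq: "(0 * D - 1 * (- A + B)) / (D * D) = ((-1) * ((1 / D) * (1 / D))) * ((-1) * A + B)" for A B D :: real
        by (simp add: diff_divide_distrib algebra_simps)
      have "(?i has_real_derivative ?f' t) (at t)" for t
      proof -
        have "flat_exp 1 (2 - t) + flat_exp 1 (t - 1) \<noteq> 0" using cutoff_denominator_pos[of t] by simp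
        from DERIV_divide[OF DERIV_const[of 1] DERIV_add[OF flat_exp_reflect_deriv[of 1 t] flat_exp_shift_deriv[of 1 t]] this]
        show ?thesis by (rule DERIV_cong) (rule eq)
      qed
      moreover have "?f' \<in> profiles m"
        by (intro function_algebra.mult function_algebra.add c g1 g2 g3)
      ultimately show ?thesis unfolding 2 by (intro bexI[of _ ?f'] ballI)
    next
      case (3 p)
      have "\<forall>t\<in>{0<..}. (f has_real_derivative p * t powr (p - 1)) (at t)"
        unfolding 3 by (auto intro: has_real_derivative_powr)
      then show ?thesis by (intro bexI[of _ "\<lambda>t. p * t powr (p - 1)"] function_algebra.mult c powr_in_profiles)
    next
      case (4 p)
      have "\<forall>t\<in>{0<..}. (f has_real_derivative (-1) * flat_exp ([:0,0,1:] * (p - pderiv p)) (2 - t)) (at t)"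
        unfolding 4 using flat_exp_reflect_deriv[of p] by (metis mult_minus1)
      then show ?thesis
        by (rule bexI[of _ "\<lambda>t. (-1) * flat_exp ([:0,0,1:] * (p - pderiv p)) (2 - t)"]) (intro function_algebra.mult c g1)
    next
      case (5 p)
      have "\<forall>t\<in>{0<..}. (f has_real_derivative flat_exp ([:0,0,1:] * (p - pderiv p)) (t - 1)) (at t)"
        unfolding 5 using flat_exp_shift_deriv[of p] by blast
      then show ?thesis
        by (rule bexI[of _ "\<lambda>t. flat_exp ([:0,0,1:] * (p - pderiv p)) (t - 1)"]) (intro g2)
    qed
  qed
  then show ?thesis using that by auto
qed

lemma profile_continuous_on:
  assumes "f \<in> profiles m" "A \<subseteq> {0<..}" shows "continuous_on A f"
  using profiles_deriv[OF assms(1)] assms(2)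
  by (meson DERIV_isCont continuous_at_imp_continuous_on greaterThan_iff subsetD)

lemma radial_has_derivative:
  fixes x0 :: "'a::euclidean_space"
  assumes "\<rho> > 0" "(f has_real_derivative f') (at ((norm (y - x0))\<^sup>2 + \<rho>))"
  shows "((\<lambda>y. complex_of_real (f ((norm (y - x0))\<^sup>2 + \<rho>))) has_derivative
     (\<lambda>h. complex_of_real (f' * (2 * ((y - x0) \<bullet> h))))) (at y)"
proof -
  have "((\<lambda>y. (y - x0) \<bullet> (y - x0) + \<rho>) has_derivative (\<lambda>h. 2 * ((y - x0) \<bullet> h))) (at y)"
    by (auto intro!: derivative_eq_intros simp: inner_commute)
  moreover have "(f has_derivative (\<lambda>h. f' * h)) (at ((y - x0) \<bullet> (y - x0) + \<rho>))"
    using assms(2) by (simp add: has_field_derivative_def dot_square_norm)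
  ultimately have "((\<lambda>y. f ((y - x0) \<bullet> (y - x0) + \<rho>)) has_derivative (\<lambda>h. f' * (2 * ((y - x0) \<bullet> h)))) (at y)"
    by (rule has_derivative_compose)
  then show ?thesis
    unfolding dot_square_norm by (rule has_derivative_of_real)
qed

lemma radial_smooth:
  fixes x0 :: "'a::euclidean_space"
  assumes f: "f \<in> profiles m" and \<rho>: "\<rho> > 0"
  shows "smooth (\<lambda>y. complex_of_real (f ((norm (y - x0))\<^sup>2 + \<rho>)))"
proof -
  define C where "C = (\<lambda>f y. complex_of_real (f ((norm (y - x0))\<^sup>2 + \<rho>))) ` profiles m \<union>
     range (\<lambda>b y. complex_of_real ((y - x0) \<bullet> b))"
  show ?thesis
  proof (rule function_algebra_smooth(1)[of C])
    fix g assume "g \<in> C"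
    then consider f where "f \<in> profiles m" "g = (\<lambda>y. complex_of_real (f ((norm (y - x0))\<^sup>2 + \<rho>)))"
      | b where "g = (\<lambda>y. complex_of_real ((y - x0) \<bullet> b))"
      by (auto simp: C_def)
    then show "\<exists>D. (\<forall>x. (g has_derivative D x) (at x)) \<and> (\<forall>b\<in>Basis. (\<lambda>x. D x b) \<in> function_algebra C)"
    proof cases
      case 1
      obtain f' where f': "f' \<in> profiles m" "\<And>t. t > 0 \<Longrightarrow> (f has_real_derivative f' t) (at t)"
        using profiles_deriv[OF 1(1)] by blast
      let ?D = "\<lambda>y h. complex_of_real (f' ((norm (y - x0))\<^sup>2 + \<rho>)) * (2 * complex_of_real ((y - x0) \<bullet> h))"
      have "(g has_derivative ?D y) (at y)" for y
        using radial_has_derivative[OF \<rho> f'(2)] \<rho> unfolding 1(2) by (simp add: add_nonneg_pos)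
      moreover have "(\<lambda>y. ?D y b) \<in> function_algebra C" for b
        using f'(1)
        by (intro function_algebra.mult function_algebra.const; intro function_algebra.gen) (auto simp: C_def)
      ultimately show ?thesis by (intro exI[of _ ?D] conjI allI ballI)
    next
      case 2
      have "(g has_derivative (\<lambda>h. complex_of_real (h \<bullet> b))) (at y)" for y
        unfolding 2 by (auto intro!: derivative_eq_intros)
      then show ?thesis by (intro exI[of _ "\<lambda>y h. complex_of_real (h \<bullet> b)"]) (auto intro: function_algebra.const)
    qed
  next
    show "(\<lambda>y. complex_of_real (f ((norm (y - x0))\<^sup>2 + \<rho>))) \<in> function_algebra C"
      using f by (intro function_algebra.gen) (auto simp: C_def)
  qed
qed

lemma radial_test_function:
  fixes x0 :: "'a::euclidean_space"
  assumes f: "f \<in> profiles m" and \<rho>: "\<rho> > 0" and 0: "\<And>t. t \<ge> 2 \<Longrightarrow> f t = 0"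
  shows "test_function (\<lambda>y. complex_of_real (f ((norm (y - x0))\<^sup>2 + \<rho>)))"
proof -
  have "{y. complex_of_real (f ((norm (y - x0))\<^sup>2 + \<rho>)) \<noteq> 0} \<subseteq> cball x0 2"
  proof
    fix y assume "y \<in> {y. complex_of_real (f ((norm (y - x0))\<^sup>2 + \<rho>)) \<noteq> 0}"
    then have "(norm (y - x0))\<^sup>2 + \<rho> < 2"
      using 0[of "(norm (y - x0))\<^sup>2 + \<rho>"] by (cases "2 \<le> (norm (y - x0))\<^sup>2 + \<rho>") auto
    then have "(norm (y - x0))\<^sup>2 \<le> 2\<^sup>2" using \<rho> by simp
    then have "norm (y - x0) \<le> 2" by (rule power2_le_imp_le) simp
    then show "y \<in> cball x0 2" by (simp add: dist_norm norm_minus_commute)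
  qed
  then have "bounded {y. complex_of_real (f ((norm (y - x0))\<^sup>2 + \<rho>)) \<noteq> 0}"
    by (rule bounded_subset[OF bounded_cball])
  then show ?thesis
    using radial_smooth[OF f \<rho>] by (simp add: test_function_def compact_closure)
qed

lemma radial_laplacian:
  fixes x0 :: "'a::euclidean_space"
  assumes \<rho>: "\<rho> > 0"
    and f: "\<And>t. t > 0 \<Longrightarrow> (f has_real_derivative f' t) (at t)"
    and f': "\<And>t. t > 0 \<Longrightarrow> (f' has_real_derivative f'' t) (at t)"
  shows "laplacian (\<lambda>y. complex_of_real (f ((norm (y - x0))\<^sup>2 + \<rho>))) y =
    complex_of_real (2 * real DIM('a) * f' ((norm (y - x0))\<^sup>2 + \<rho>) +
      4 * (norm (y - x0))\<^sup>2 * f'' ((norm (y - x0))\<^sup>2 + \<rho>))"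
proof -
  have pos: "(norm (y - x0))\<^sup>2 + \<rho> > 0" for y using \<rho> by (simp add: add_nonneg_pos)
  have 1: "frechet_derivative (\<lambda>y. complex_of_real (f ((norm (y - x0))\<^sup>2 + \<rho>))) (at y) =
      (\<lambda>h. complex_of_real (f' ((norm (y - x0))\<^sup>2 + \<rho>) * (2 * ((y - x0) \<bullet> h))))" for y
    using frechet_derivative_at[OF radial_has_derivative[OF \<rho> f[OF pos]]] by metis
  have 2: "frechet_derivative (\<lambda>y. complex_of_real (f' ((norm (y - x0))\<^sup>2 + \<rho>) * (2 * ((y - x0) \<bullet> b)))) (at y) b =
     complex_of_real (f'' ((norm (y - x0))\<^sup>2 + \<rho>) * (4 * ((y - x0) \<bullet> b)\<^sup>2) + f' ((norm (y - x0))\<^sup>2 + \<rho>) * 2)"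
    if "b \<in> Basis" for b
  proof -
    have "((\<lambda>y. complex_of_real (2 * ((y - x0) \<bullet> b))) has_derivative (\<lambda>h. complex_of_real (2 * (h \<bullet> b)))) (at y)"
      by (auto intro!: derivative_eq_intros)
    from has_derivative_mult[OF radial_has_derivative[OF \<rho> f'[OF pos]] this]
    have "((\<lambda>y. complex_of_real (f' ((norm (y - x0))\<^sup>2 + \<rho>) * (2 * ((y - x0) \<bullet> b)))) has_derivative
      (\<lambda>h. complex_of_real (f' ((norm (y - x0))\<^sup>2 + \<rho>)) * complex_of_real (2 * (h \<bullet> b)) +
        complex_of_real (f'' ((norm (y - x0))\<^sup>2 + \<rho>) * (2 * ((y - x0) \<bullet> h))) * complex_of_real (2 * ((y - x0) \<bullet> b)))) (at y)"
      unfolding of_real_mult by blast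
    from frechet_derivative_at[OF this, symmetric] show ?thesis
      using that by (simp add: power2_eq_square algebra_simps)
  qed
  have "laplacian (\<lambda>y. complex_of_real (f ((norm (y - x0))\<^sup>2 + \<rho>))) y =
     (\<Sum>b\<in>Basis. complex_of_real (f'' ((norm (y - x0))\<^sup>2 + \<rho>) * (4 * ((y - x0) \<bullet> b)\<^sup>2) + f' ((norm (y - x0))\<^sup>2 + \<rho>) * 2))"
    unfolding laplacian_def by (intro sum.cong refl) (simp only: iter_deriv.simps 1 2)
  also have "\<dots> = complex_of_real (\<Sum>b\<in>Basis. f'' ((norm (y - x0))\<^sup>2 + \<rho>) * 4 * ((y - x0) \<bullet> b)\<^sup>2 + f' ((norm (y - x0))\<^sup>2 + \<rho>) * 2)"
    by (simp only: of_real_sum mult.assoc)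
  also have "(\<Sum>b\<in>Basis. f'' ((norm (y - x0))\<^sup>2 + \<rho>) * 4 * ((y - x0) \<bullet> b)\<^sup>2 + f' ((norm (y - x0))\<^sup>2 + \<rho>) * 2) =
     f'' ((norm (y - x0))\<^sup>2 + \<rho>) * 4 * (\<Sum>b\<in>Basis. ((y - x0) \<bullet> b)\<^sup>2) + real DIM('a) * (f' ((norm (y - x0))\<^sup>2 + \<rho>) * 2)"
    by (simp add: sum.distrib sum_distrib_left)
  also have "(\<Sum>b\<in>Basis. ((y - x0) \<bullet> b)\<^sup>2) = (norm (y - x0))\<^sup>2"
    by (subst power2_norm_eq_inner, subst euclidean_inner) (simp add: power2_eq_square)
  finally show ?thesis by (simp add: algebra_simps)
qed

section \<open>Lebesgue measure and the singular weight\<close>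

lemma cball_sets_borel[measurable]: "cball (x::'a::euclidean_space) r \<in> sets borel"
  by (simp add: borel_closed)

lemma cnj_measurable[measurable]: "cnj \<in> borel_measurable borel"
  by (intro borel_measurable_continuous_onI continuous_intros)

lemma nn_integral_euclidean_affine:
  fixes f :: "'a::euclidean_space \<Rightarrow> ennreal"
  assumes [measurable]: "f \<in> borel_measurable borel" and c: "c \<noteq> 0"
  shows "(\<integral>\<^sup>+x. f x \<partial>lborel) = ennreal (\<bar>c\<bar> ^ DIM('a)) * (\<integral>\<^sup>+x. f (t + c *\<^sub>R x) \<partial>lborel)"
  by (subst lborel_affine[OF c, of t]) (simp add: nn_integral_density nn_integral_distr nn_integral_cmult)

lemma integrable_euclidean_affine_iff:
  fixes f :: "'a::euclidean_space \<Rightarrow> 'b::{banach, second_countable_topology}"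
  assumes c: "c \<noteq> 0"
  shows "integrable lborel (\<lambda>x. f (t + c *\<^sub>R x)) \<longleftrightarrow> integrable lborel f"
proof -
  have *: "integrable lborel (\<lambda>x. g (s + r *\<^sub>R x))" if "integrable lborel g" "r \<noteq> 0"
    for g :: "'a \<Rightarrow> 'b" and s r
  proof -
    have [measurable]: "g \<in> borel_measurable borel" using that(1) by auto
    have "(\<integral>\<^sup>+x. norm (g x) \<partial>lborel) = ennreal (\<bar>r\<bar> ^ DIM('a)) * (\<integral>\<^sup>+x. norm (g (s + r *\<^sub>R x)) \<partial>lborel)"
      by (rule nn_integral_euclidean_affine[OF _ that(2)]) simp
    moreover have "(\<integral>\<^sup>+x. norm (g x) \<partial>lborel) < \<infinity>" using that(1) by (simp add: integrable_iff_bounded)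
    ultimately show ?thesis
      using that(2) by (auto simp: integrable_iff_bounded ennreal_mult_less_top)
  qed
  show ?thesis
  proof
    assume "integrable lborel (\<lambda>x. f (t + c *\<^sub>R x))"
    from *[OF this, of "1 / c" "- (1 / c) *\<^sub>R t"] show "integrable lborel f"
      using c by (simp add: scaleR_right_diff_distrib)
  qed (rule *[OF _ c])
qed

lemma integral_euclidean_affine:
  fixes f :: "'a::euclidean_space \<Rightarrow> 'b::{banach, second_countable_topology}"
  assumes c: "c \<noteq> 0"
  shows "(\<integral>x. f x \<partial>lborel) = \<bar>c\<bar> ^ DIM('a) *\<^sub>R (\<integral>x. f (t + c *\<^sub>R x) \<partial>lborel)"
proof cases
  assume f: "integrable lborel f"
  then have [measurable]: "f \<in> borel_measurable borel" by auto
  show ?thesis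
    by (subst lborel_affine[OF c, of t]) (simp add: integral_density integral_distr)
next
  assume "\<not> integrable lborel f"
  with integrable_euclidean_affine_iff[OF c, of f t] show ?thesis
    by (simp add: not_integrable_integral_eq)
qed

lemma nn_integral_shift:
  fixes f :: "'a::euclidean_space \<Rightarrow> ennreal"
  assumes [measurable]: "f \<in> borel_measurable borel"
  shows "(\<integral>\<^sup>+y. f (y - x) \<partial>lborel) = (\<integral>\<^sup>+z. f z \<partial>lborel)"
  using nn_integral_euclidean_affine[of f 1 "- x"] by simp

lemma integral_shift:
  fixes f :: "'a::euclidean_space \<Rightarrow> 'b::{banach, second_countable_topology}"
  shows "(\<integral>y. f (y - x) \<partial>lborel) = (\<integral>z. f z \<partial>lborel)"
    and "integrable lborel (\<lambda>y. f (y - x)) \<longleftrightarrow> integrable lborel f"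
    and "(\<integral>y. f (x - y) \<partial>lborel) = (\<integral>z. f z \<partial>lborel)"
    and "integrable lborel (\<lambda>y. f (x - y)) \<longleftrightarrow> integrable lborel f"
  using integral_euclidean_affine[of 1 f "- x"] integrable_euclidean_affine_iff[of 1 f "- x"]
    integral_euclidean_affine[of "-1" f x] integrable_euclidean_affine_iff[of "-1" f x]
  by simp_all

text \<open>The weight \<open>|z| powr (- a)\<close> near the origin, truncated to be at least 1 so that its powers are
  ordered by their exponents. At \<open>z = 0\<close> the convention \<open>1 / 0 = 0\<close> makes the value 1 instead of
  infinity, hence the exclusions of \<open>z = 0\<close> below, which concern a null set.\<close>
definition singularity :: "'a::euclidean_space \<Rightarrow> real" where
  "singularity z = max 1 (1 / norm z)"

lemma singularity_ge_1: "singularity z \<ge> 1" by (simp add: singularity_def)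
lemma singularity_pos: "singularity z > 0" by (simp add: singularity_def)
lemma singularity_commute: "singularity (x - y) = singularity (y - x)"
  by (simp add: singularity_def norm_minus_commute)
lemma singularity_measurable[measurable]: "singularity \<in> borel_measurable borel"
  unfolding singularity_def[abs_def] by measurable
lemma singularity_powr_mono: "a \<le> b \<Longrightarrow> singularity z powr a \<le> singularity z powr b"
  using singularity_ge_1 by (rule powr_mono[rotated])

text \<open>Dominating the weight by a sum over dyadic balls reduces its integrability to a geometric series
  in the volumes of balls, without polar coordinates.\<close>
lemma singularity_powr_dyadic:
  fixes z :: "'a::euclidean_space"
  assumes "p \<ge> 0"
  shows "ennreal (singularity z powr p) \<le>
     1 + (\<Sum>n. ennreal (2 powr (p * (real n + 1))) * indicator (cball (0::'a) (1 / 2 ^ n)) z)"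
proof (cases "z = 0 \<or> norm z \<ge> 1")
  case True
  then have "singularity z = 1" 
    by (cases "z = 0") (auto simp: singularity_def max_def field_simps)
  then show ?thesis by (simp add: ennreal_1[symmetric] del: ennreal_1)
next
  case False
  then have z: "0 < norm z" "norm z < 1" by auto
  define L where "L = log 2 (1 / norm z)"
  have "L \<ge> 0" using z by (simp add: L_def)
  define n where "n = nat \<lfloor>L\<rfloor>"
  have n: "real n \<le> L" "L < real n + 1" using \<open>L \<ge> 0\<close> by (auto simp: n_def)
  have L: "2 powr L = 1 / norm z" using z by (simp add: L_def)
  have "2 powr real n \<le> 1 / norm z" unfolding L[symmetric] using n by simp
  then have zn: "norm z \<le> 1 / 2 ^ n" using z by (simp add: powr_realpow field_simps)
  have "singularity z powr p = (2 powr L) powr p" using z L by (simp add: singularity_def max_def)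
  also have "\<dots> \<le> 2 powr (p * (real n + 1))"
    using n assms by (simp add: powr_powr mult.commute[of p] mult_right_mono)
  finally have "ennreal (singularity z powr p) \<le> ennreal (2 powr (p * (real n + 1))) * indicator (cball 0 (1 / 2 ^ n)) z"
    using zn by (simp add: ennreal_leI)
  also have "\<dots> \<le> (\<Sum>n. ennreal (2 powr (p * (real n + 1))) * indicator (cball 0 (1 / 2 ^ n)) z)"
  proof -
    have "f n \<le> (\<Sum>n. f n)" for f :: "nat \<Rightarrow> ennreal"
      using sum_le_suminf[OF summableI, of "{n}" f] by simp
    then show ?thesis .
  qed
  also have "\<dots> \<le> 1 + \<dots>" by simp
  finally show ?thesis .
qed

lemma singularity_integral_finite:
  fixes x :: "'a::euclidean_space"
  assumes p: "p < real DIM('a)"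
  shows "(\<integral>\<^sup>+y. ennreal (singularity (y - x) powr p) * indicator (cball x r) y \<partial>lborel) < \<infinity>"
proof -
  define q where "q = max 0 p"
  have q: "0 \<le> q" "p \<le> q" "q < real DIM('a)" using p by (auto simp: q_def)
  let ?V = "unit_ball_vol (real DIM('a))"
  let ?I = "\<lambda>n z. ennreal (2 powr (q * (real n + 1))) * indicator (cball (0::'a) (1 / 2 ^ n)) z"
  have "(\<integral>\<^sup>+y. ennreal (singularity (y - x) powr p) * indicator (cball x r) y \<partial>lborel) =
     (\<integral>\<^sup>+y. ennreal (singularity (y - x) powr p) * indicator (cball 0 r) (y - x) \<partial>lborel)"
    by (intro nn_integral_cong) (auto simp: indicator_def dist_norm norm_minus_commute)
  also have "\<dots> = (\<integral>\<^sup>+z. ennreal (singularity z powr p) * indicator (cball (0::'a) r) z \<partial>lborel)"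
    by (rule nn_integral_shift[where f = "\<lambda>z. ennreal (singularity z powr p) * indicator (cball 0 r) z"]) measurable
  also have "\<dots> \<le> (\<integral>\<^sup>+z. indicator (cball (0::'a) r) z + (\<Sum>n. ?I n z) \<partial>lborel)"
  proof (rule nn_integral_mono)
    fix z :: 'a
    have "ennreal (singularity z powr p) \<le> ennreal (singularity z powr q)"
      by (intro ennreal_leI singularity_powr_mono q)
    also have "\<dots> \<le> 1 + (\<Sum>n. ?I n z)" by (rule singularity_powr_dyadic[OF q(1)])
    finally show "ennreal (singularity z powr p) * indicator (cball 0 r) z \<le> indicator (cball 0 r) z + (\<Sum>n. ?I n z)"
      by (simp add: indicator_def)
  qed
  also have "\<dots> = emeasure lborel (cball (0::'a) r) + (\<Sum>n. \<integral>\<^sup>+z. ?I n z \<partial>lborel)"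
    by (subst nn_integral_add) (auto intro!: arg_cong2[where f="(+)"] nn_integral_suminf)
  also have "(\<Sum>n. \<integral>\<^sup>+z. ?I n z \<partial>lborel) = (\<Sum>n. ennreal (2 powr q * ?V * (2 powr (q - real DIM('a))) ^ n))"
  proof (rule suminf_cong)
    fix n
    have "(\<integral>\<^sup>+z. ?I n z \<partial>lborel) = ennreal (2 powr (q * (real n + 1))) * ennreal (?V * (1 / 2 ^ n) ^ DIM('a))"
      by (simp add: nn_integral_cmult emeasure_cball)
    also have "\<dots> = ennreal (2 powr (q * (real n + 1)) * (?V * (1 / 2 ^ n) ^ DIM('a)))"
      by (rule ennreal_mult[symmetric]) auto
    also have "2 powr (q * (real n + 1)) * (?V * (1 / 2 ^ n) ^ DIM('a)) = 2 powr q * ?V * (2 powr (q - real DIM('a))) ^ n"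
    proof -
      have "(1 / 2 ^ n :: real) ^ DIM('a) = 2 powr (- (real n * real DIM('a)))"
        by (simp add: powr_minus powr_realpow[symmetric] powr_powr inverse_powr divide_inverse)
      moreover have "(2 powr (q - real DIM('a))) ^ n = (2::real) powr (real n * (q - real DIM('a)))"
        by (simp add: powr_realpow[symmetric] powr_powr mult.commute)
      moreover have "2 powr (q * (real n + 1)) = (2::real) powr q * 2 powr (real n * q)"
        by (simp add: powr_add[symmetric] algebra_simps)
      moreover have "(2::real) powr (real n * q) * 2 powr (- (real n * real DIM('a))) = 2 powr (real n * (q - real DIM('a)))"
        by (simp add: powr_add[symmetric] algebra_simps)
      ultimately show ?thesis by simp
    qed
    finally show "(\<integral>\<^sup>+z. ?I n z \<partial>lborel) = ennreal (2 powr q * ?V * (2 powr (q - real DIM('a))) ^ n)" .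
  qed
  also have "emeasure lborel (cball (0::'a) r) + (\<Sum>n. ennreal (2 powr q * ?V * (2 powr (q - real DIM('a))) ^ n)) < \<infinity>"
  proof -
    have "2 powr (q - real DIM('a)) < (1::real)"
      using q powr_less_cancel_iff[of 2 "q - real DIM('a)" 0] by simp
    then have "summable (\<lambda>n. 2 powr q * ?V * (2 powr (q - real DIM('a))) ^ n)"
      by (intro summable_mult summable_geometric) auto
    then have "(\<Sum>n. ennreal (2 powr q * ?V * (2 powr (q - real DIM('a))) ^ n)) \<noteq> top"
      by (rule ennreal_suminf_neq_top) auto
    moreover have "emeasure lborel (cball (0::'a) r) < \<infinity>"
      by (rule emeasure_bounded_finite) simp
    ultimately show ?thesis by (simp add: less_top)
  qed
  finally show ?thesis .
qed

text \<open>Pointwise approximation by continuous functions, then truncated so that bound and support survive;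
  dominated convergence extends estimates from continuous to bounded functions of compact support.\<close>
lemma bounded_measurable_approx_continuous:
  fixes \<psi> :: "'a::euclidean_space \<Rightarrow> complex"
  assumes m: "\<psi> \<in> borel_measurable borel" and B: "\<And>x. norm (\<psi> x) \<le> B" "B > 0"
    and R: "\<And>x. norm x > R \<Longrightarrow> \<psi> x = 0"
  obtains g where "\<And>n::nat. continuous_on UNIV (g n)" "\<And>n x. norm (g n x) \<le> B"
    "\<And>n x. norm x > R + 1 \<Longrightarrow> g n x = 0" "AE x in lborel. (\<lambda>n. g n x) \<longlonglongrightarrow> \<psi> x"
proof -
  have "\<psi> measurable_on UNIV"
    by (rule lebesgue_measurable_imp_measurable_on) (use m in \<open>auto intro: measurable_completion\<close>)
  then obtain N h where N: "negligible N" and h: "\<And>n. continuous_on UNIV (h n)"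
    "\<And>x. x \<notin> N \<Longrightarrow> (\<lambda>n. h n x) \<longlonglongrightarrow> \<psi> x"
    unfolding measurable_on_def by auto
  \<comment> \<open>The first factor truncates the support, the second one the size.\<close>
  define g where "g n x = (max 0 (min 1 (R + 1 - norm x)) * (B / max B (norm (h n x)))) *\<^sub>R h n x" for n x
  have pos: "max B (norm (h n x)) > 0" for n x using B(2) by (simp add: less_max_iff_disj)
  show ?thesis
  proof (rule that[of g])
    show "continuous_on UNIV (g n)" for n
      unfolding g_def using pos by (intro continuous_intros h) (metis less_irrefl)
    show "norm (g n x) \<le> B" for n x
    proof -
      have "B / max B (norm (h n x)) * norm (h n x) = B * (norm (h n x) / max B (norm (h n x)))" by simp
      also have "\<dots> \<le> B" using pos[of n x] B(2) by (intro mult_left_le) auto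
      finally have "B / max B (norm (h n x)) * norm (h n x) \<le> B" .
      moreover have "norm (g n x) = max 0 (min 1 (R + 1 - norm x)) * (B / max B (norm (h n x)) * norm (h n x))"
        using pos[of n x] B(2) by (simp add: g_def abs_mult)
      moreover have "\<dots> \<le> B / max B (norm (h n x)) * norm (h n x)"
        using pos[of n x] B(2) by (intro mult_left_le_one_le) auto
      ultimately show ?thesis by linarith
    qed
    show "g n x = 0" if "norm x > R + 1" for n x using that by (simp add: g_def)
    have "(\<lambda>n. g n x) \<longlonglongrightarrow> \<psi> x" if "x \<notin> N" for x
    proof (cases "norm x > R")
      case True
      then have "\<psi> x = 0" by (rule R)
      have "norm (g n x) \<le> norm (h n x)" for n
      proof -
        have "max 0 (min 1 (R + 1 - norm x)) * (B / max B (norm (h n x))) \<le> 1"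
          using pos[of n x] B(2) by (intro mult_le_one) auto
        then show ?thesis unfolding g_def norm_scaleR
          using pos[of n x] B(2) by (intro mult_left_le_one_le) auto
      qed
      then show ?thesis
        using h(2)[OF that] unfolding \<open>\<psi> x = 0\<close>
        using tendsto_norm_zero_iff[of "\<lambda>n. h n x" sequentially] \<open>\<And>n. norm (g n x) \<le> norm (h n x)\<close>
        by (auto intro: Lim_null_comparison[where g="\<lambda>n. norm (h n x)"])
    next
      case False
      have "(\<lambda>n. (max 0 (min 1 (R + 1 - norm x)) * (B / max B (norm (h n x)))) *\<^sub>R h n x) \<longlonglongrightarrow>
         (max 0 (min 1 (R + 1 - norm x)) * (B / max B (norm (\<psi> x)))) *\<^sub>R \<psi> x"
        using h(2)[OF that] B(2) by (intro tendsto_intros) auto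
      then show ?thesis using False B(1)[of x] B(2) by (simp add: g_def max_def)
    qed
    moreover have "AE x in lebesgue. x \<notin> N"
      using N by (simp add: negligible_iff_null_sets AE_not_in)
    ultimately have "AE x in lebesgue. (\<lambda>n. g n x) \<longlonglongrightarrow> \<psi> x"
      by (auto elim: eventually_mono)
    then show "AE x in lborel. (\<lambda>n. g n x) \<longlonglongrightarrow> \<psi> x"
      by (simp only: AE_completion_iff)
  qed
qed

lemma locally_integrable_mult_bounded:
  fixes f g :: "'a::euclidean_space \<Rightarrow> complex"
  assumes "integrable lborel (\<lambda>x. indicator (cball 0 R) x *\<^sub>R f x)" and [measurable]: "g \<in> borel_measurable borel"
    and g: "\<And>x. norm (g x) \<le> B" and 0: "\<And>x. norm x > R \<Longrightarrow> g x = 0"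
  shows "integrable lborel (\<lambda>x. g x * f x)"
proof -
  have "integrable lborel (\<lambda>x. g x * (indicator (cball 0 R) x *\<^sub>R f x))"
  proof (rule Bochner_Integration.integrable_bound[of _ "\<lambda>x. B *\<^sub>R (indicator (cball 0 R) x *\<^sub>R f x)"])
    show "integrable lborel (\<lambda>x. B *\<^sub>R (indicator (cball 0 R) x *\<^sub>R f x))"
      using assms(1) by (rule integrable_scaleR_right)
    have "B \<ge> 0" using g[of 0] norm_ge_zero order_trans by blast
    then show "AE x in lborel. norm (g x * (indicator (cball 0 R) x *\<^sub>R f x)) \<le> norm (B *\<^sub>R (indicator (cball 0 R) x *\<^sub>R f x))"
      using g by (auto simp: norm_mult indicator_def intro!: mult_right_mono)
    show "(\<lambda>x. g x * (indicator (cball 0 R) x *\<^sub>R f x)) \<in> borel_measurable lborel"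
      using borel_measurable_integrable[OF assms(1)] by measurable
  qed
  also have "(\<lambda>x. g x * (indicator (cball 0 R) x *\<^sub>R f x)) = (\<lambda>x. g x * f x)"
    using 0 by (auto simp: indicator_def fun_eq_iff)
  finally show ?thesis .
qed

text \<open>The fundamental lemma of the calculus of variations: by approximation one may test with the
  conjugate sign of \<open>h\<close> on a ball, which gives the integral of \<open>|h|\<close>.\<close>
lemma integral_continuous_test_zero_imp_AE_zero:
  fixes h :: "'a::euclidean_space \<Rightarrow> complex"
  assumes [measurable]: "h \<in> borel_measurable borel"
    and h: "\<And>R. integrable lborel (\<lambda>x. indicator (cball 0 R) x *\<^sub>R h x)"
    and 0: "\<And>\<psi> R. continuous_on UNIV \<psi> \<Longrightarrow> (\<And>x. norm x > R \<Longrightarrow> \<psi> x = 0) \<Longrightarrow> (\<integral>x. \<psi> x * h x \<partial>lborel) = 0"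
  shows "AE x in lborel. h x = 0"
proof -
  have "AE x in lborel. norm x \<le> real k \<longrightarrow> h x = 0" for k :: nat
  proof -
    let ?R = "real k"
    define \<psi> where "\<psi> x = indicator (cball 0 ?R) x *\<^sub>R cnj (sgn (h x))" for x
    have \<psi>m: "\<psi> \<in> borel_measurable borel" unfolding \<psi>_def by measurable
    have \<psi>1: "norm (\<psi> x) \<le> 1" for x by (simp add: \<psi>_def indicator_def norm_sgn)
    have \<psi>0: "norm x > ?R \<Longrightarrow> \<psi> x = 0" for x by (simp add: \<psi>_def)
    obtain g where g: "\<And>n::nat. continuous_on UNIV (g n)" "\<And>n x. norm (g n x) \<le> 1"
      "\<And>n x. norm x > ?R + 1 \<Longrightarrow> g n x = 0" "AE x in lborel. (\<lambda>n. g n x) \<longlonglongrightarrow> \<psi> x"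
      by (rule bounded_measurable_approx_continuous[OF \<psi>m \<psi>1 _ \<psi>0]) auto
    have [measurable]: "g n \<in> borel_measurable borel" for n
      by (rule borel_measurable_continuous_onI[OF g(1)])
    have "(\<lambda>n. \<integral>x. g n x * h x \<partial>lborel) \<longlonglongrightarrow> (\<integral>x. \<psi> x * h x \<partial>lborel)"
    proof (rule integral_dominated_convergence[where w="\<lambda>x. norm (indicator (cball 0 (?R + 1)) x *\<^sub>R h x)"])
      show "integrable lborel (\<lambda>x. norm (indicator (cball 0 (?R + 1)) x *\<^sub>R h x))" by (intro integrable_norm h)
      show "AE x in lborel. (\<lambda>n. g n x * h x) \<longlonglongrightarrow> \<psi> x * h x"
        using g(4) by eventually_elim (intro tendsto_intros)
      show "AE x in lborel. norm (g n x * h x) \<le> norm (indicator (cball 0 (?R + 1)) x *\<^sub>R h x)" for n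
        using g(2,3) by (auto simp: norm_mult indicator_def not_le intro!: mult_left_le_one_le)
    qed (use \<psi>m in measurable)
    moreover have "(\<integral>x. g n x * h x \<partial>lborel) = 0" for n
      by (rule 0[OF g(1) g(3)])
    ultimately have "(\<integral>x. \<psi> x * h x \<partial>lborel) = 0"
      using LIMSEQ_unique[of "\<lambda>n. 0"] by auto
    moreover have "\<psi> x * h x = complex_of_real (norm (indicator (cball 0 ?R) x *\<^sub>R h x))" for x
      by (cases "h x = 0") (auto simp: \<psi>_def sgn_eq indicator_def mult.commute complex_norm_square[symmetric] power2_eq_square)
    ultimately have "(\<integral>x. norm (indicator (cball 0 ?R) x *\<^sub>R h x) \<partial>lborel) = 0"
      by (simp only: integral_complex_of_real of_real_eq_0_iff)
    then have "AE x in lborel. norm (indicator (cball 0 ?R) x *\<^sub>R h x) = 0"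
      using integral_nonneg_eq_0_iff_AE[OF integrable_norm[OF h[of ?R]]] by simp
    then show ?thesis by eventually_elim (auto simp: indicator_def split: if_splits)
  qed
  then have "AE x in lborel. \<forall>k::nat. norm x \<le> real k \<longrightarrow> h x = 0" by (subst AE_all_countable) blast
  then show ?thesis by eventually_elim (meson real_arch_simple)
qed

section \<open>Gaussians and their Fourier transforms\<close>

lemma quadratic_nonneg_discriminant:
  fixes A B X :: real
  assumes "\<And>\<tau>. A * \<tau>\<^sup>2 - 2 * X * \<tau> + B \<ge> 0" "A \<ge> 0"
  shows "X\<^sup>2 \<le> A * B"
proof (cases "A = 0")
  case True
  have "X = 0"
  proof (rule ccontr)
    assume "X \<noteq> 0"
    then show False using assms(1)[of "(B + 1) / (2 * X)"] True by simp
  qed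
  then show ?thesis using True by simp
next
  case False
  then have "A > 0" using assms(2) by simp
  have "A * (X / A)\<^sup>2 - 2 * X * (X / A) + B \<ge> 0" by (rule assms(1))
  then have "A * (A * (X / A)\<^sup>2 - 2 * X * (X / A) + B) \<ge> 0" using \<open>A > 0\<close> by simp
  then show ?thesis using \<open>A > 0\<close> by (simp add: field_simps power2_eq_square)
qed

lemma Cauchy_Schwarz_integral:
  fixes f g :: "'a \<Rightarrow> real"
  assumes [measurable]: "f \<in> borel_measurable M" "g \<in> borel_measurable M"
    and f: "integrable M (\<lambda>x. (f x)\<^sup>2)" and g: "integrable M (\<lambda>x. (g x)\<^sup>2)"
  shows "integrable M (\<lambda>x. f x * g x)" "(\<integral>x. f x * g x \<partial>M)\<^sup>2 \<le> (\<integral>x. (f x)\<^sup>2 \<partial>M) * (\<integral>x. (g x)\<^sup>2 \<partial>M)"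
proof -
  show fg: "integrable M (\<lambda>x. f x * g x)"
  proof (rule Bochner_Integration.integrable_bound[of _ "\<lambda>x. (f x)\<^sup>2 + (g x)\<^sup>2"])
    show "AE x in M. norm (f x * g x) \<le> norm ((f x)\<^sup>2 + (g x)\<^sup>2)"
    proof (rule AE_I2)
      fix x
      have "0 \<le> (\<bar>f x\<bar> - \<bar>g x\<bar>)\<^sup>2" "0 \<le> \<bar>f x\<bar> * \<bar>g x\<bar>" by auto
      then have "\<bar>f x\<bar> * \<bar>g x\<bar> \<le> (f x)\<^sup>2 + (g x)\<^sup>2"
        unfolding power2_diff power2_abs mult.assoc by linarith
      then show "norm (f x * g x) \<le> norm ((f x)\<^sup>2 + (g x)\<^sup>2)"
        by (simp add: abs_mult)
    qed
  qed (use f g in auto)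
  show "(\<integral>x. f x * g x \<partial>M)\<^sup>2 \<le> (\<integral>x. (f x)\<^sup>2 \<partial>M) * (\<integral>x. (g x)\<^sup>2 \<partial>M)"
  proof (rule quadratic_nonneg_discriminant)
    fix \<tau> :: real
    have "0 \<le> (\<integral>x. (\<tau> * f x - g x)\<^sup>2 \<partial>M)" by simp
    also have "(\<lambda>x. (\<tau> * f x - g x)\<^sup>2) = (\<lambda>x. \<tau>\<^sup>2 * (f x)\<^sup>2 - 2 * \<tau> * (f x * g x) + (g x)\<^sup>2)"
      by (auto simp: power2_eq_square algebra_simps)
    also have "(\<integral>x. \<tau>\<^sup>2 * (f x)\<^sup>2 - 2 * \<tau> * (f x * g x) + (g x)\<^sup>2 \<partial>M) =
        (\<integral>x. (f x)\<^sup>2 \<partial>M) * \<tau>\<^sup>2 - 2 * (\<integral>x. f x * g x \<partial>M) * \<tau> + (\<integral>x. (g x)\<^sup>2 \<partial>M)"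
      using f g fg by simp
    finally show "0 \<le> (\<integral>x. (f x)\<^sup>2 \<partial>M) * \<tau>\<^sup>2 - 2 * (\<integral>x. f x * g x \<partial>M) * \<tau> + (\<integral>x. (g x)\<^sup>2 \<partial>M)" .
  qed simp
qed

text \<open>Fubini for a kernel that is merely bounded, as for the oscillating Fourier kernel.\<close>
lemma integral_bounded_kernel_swap:
  fixes a b :: "'a::euclidean_space \<Rightarrow> complex" and k :: "'a \<Rightarrow> 'a \<Rightarrow> complex"
  assumes a: "integrable lborel a" and b: "integrable lborel b"
    and k[measurable]: "(\<lambda>p. k (fst p) (snd p)) \<in> borel_measurable (borel \<Otimes>\<^sub>M borel)"
    and B: "\<And>x y. norm (k x y) \<le> B"
  shows "(\<integral>x. a x * (\<integral>y. k x y * b y \<partial>lborel) \<partial>lborel) = (\<integral>y. (\<integral>x. a x * k x y \<partial>lborel) * b y \<partial>lborel)"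
    and "integrable lborel (\<lambda>x. a x * (\<integral>y. k x y * b y \<partial>lborel))"
proof -
  have [measurable]: "a \<in> borel_measurable borel" "b \<in> borel_measurable borel"
    using a b by auto
  have [measurable]: "(\<lambda>y. k x y) \<in> borel_measurable borel" "(\<lambda>x. k x y) \<in> borel_measurable borel" for x y
    using measurable_compose[OF _ k, of "\<lambda>y. (x, y)"] measurable_compose[OF _ k, of "\<lambda>x. (x, y)"] by auto
  have "B \<ge> 0" using B[of 0 0] norm_ge_zero order_trans by blast
  have int: "integrable (lborel \<Otimes>\<^sub>M lborel) (\<lambda>(x, y). a x * k x y * b y)"
  proof (rule Bochner_Integration.integrable_bound[of _ "\<lambda>(x, y). B * (norm (a x) * norm (b y))"])
    have "integrable (lborel \<Otimes>\<^sub>M lborel) (\<lambda>p. norm (a (fst p)) * norm (b (snd p)))"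
      by (rule lborel_pair.Fubini_integrable) (use a b in auto)
    then show "integrable (lborel \<Otimes>\<^sub>M lborel) (\<lambda>(x, y). B * (norm (a x) * norm (b y)))"
      by (simp add: case_prod_unfold)
    show "(\<lambda>(x, y). a x * k x y * b y) \<in> borel_measurable (lborel \<Otimes>\<^sub>M lborel)"
      unfolding case_prod_unfold by measurable
    show "AE p in lborel \<Otimes>\<^sub>M lborel. norm (case p of (x, y) \<Rightarrow> a x * k x y * b y)
         \<le> norm (case p of (x, y) \<Rightarrow> B * (norm (a x) * norm (b y)))"
    proof (rule AE_I2)
      fix p :: "'a \<times> 'a"
      obtain x y where p: "p = (x, y)" by (cases p)
      have "norm (k x y) * (norm (a x) * norm (b y)) \<le> B * (norm (a x) * norm (b y))"
        by (intro mult_right_mono B) auto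
      then show "norm (case p of (x, y) \<Rightarrow> a x * k x y * b y) \<le> norm (case p of (x, y) \<Rightarrow> B * (norm (a x) * norm (b y)))"
        using \<open>B \<ge> 0\<close> by (simp add: p norm_mult mult_ac)
    qed
  qed
  have eq: "(\<integral>y. a x * k x y * b y \<partial>lborel) = a x * (\<integral>y. k x y * b y \<partial>lborel)" for x
    by (simp add: mult.assoc)
  show "integrable lborel (\<lambda>x. a x * (\<integral>y. k x y * b y \<partial>lborel))"
    using lborel_pair.integrable_fst[OF int] unfolding eq .
  have "(\<integral>x. a x * (\<integral>y. k x y * b y \<partial>lborel) \<partial>lborel) = (\<integral>x. \<integral>y. a x * k x y * b y \<partial>lborel \<partial>lborel)"
    unfolding eq ..
  also have "\<dots> = (\<integral>y. \<integral>x. a x * k x y * b y \<partial>lborel \<partial>lborel)"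
    by (rule lborel_pair.Fubini_integral[OF int, symmetric])
  finally show "(\<integral>x. a x * (\<integral>y. k x y * b y \<partial>lborel) \<partial>lborel) = (\<integral>y. (\<integral>x. a x * k x y \<partial>lborel) * b y \<partial>lborel)"
    by simp
qed

text \<open>A Gaussian modulated by the frequency \<open>v\<close>. The value \<open>e = 0\<close> is allowed and gives the
  character that serves as kernel of the Fourier integral.\<close>
definition gauss :: "'a::euclidean_space \<Rightarrow> real \<Rightarrow> 'a \<Rightarrow> complex" where
  "gauss v e y = exp (\<i> * complex_of_real (v \<bullet> y) - complex_of_real (e / 2 * (y \<bullet> y)))"

lemma norm_gauss: "norm (gauss v e y) = exp (- (e / 2 * (norm y)\<^sup>2))"
  by (simp add: gauss_def norm_exp_eq_Re power2_norm_eq_inner)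

lemma gauss_measurable[measurable]: "gauss v e \<in> borel_measurable borel"
  unfolding gauss_def[abs_def] by measurable

lemma gauss_1d:
  assumes e: "e > 0"
  shows "integrable lborel (\<lambda>t. exp (\<i> * complex_of_real (a * t) - complex_of_real (e / 2 * (t * t))))" (is ?A)
    and "(\<integral>t. exp (\<i> * complex_of_real (a * t) - complex_of_real (e / 2 * (t * t))) \<partial>lborel) =
       complex_of_real (sqrt (2 * pi / e) * exp (- a\<^sup>2 / (2 * e)))" (is ?B)
proof -
  let ?f = "\<lambda>t. exp (\<i> * complex_of_real (a * t) - complex_of_real (e / 2 * (t * t)))"
  let ?g = "\<lambda>x. std_normal_density x *\<^sub>R iexp (a / sqrt e * x)"
  have s: "sqrt e > 0" "sqrt e * sqrt e = e" using e by auto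
  have fg: "?f (0 + (1 / sqrt e) * x) = complex_of_real (sqrt (2 * pi)) * ?g x" for x
  proof -
    have "e / 2 * ((1 / sqrt e * x) * (1 / sqrt e * x)) = x\<^sup>2 / 2"
      using s by (simp add: power2_eq_square field_simps)
    moreover have "complex_of_real (sqrt (2 * pi)) * (std_normal_density x *\<^sub>R iexp (a / sqrt e * x)) =
        complex_of_real (exp (- x\<^sup>2 / 2)) * iexp (a / sqrt e * x)"
      by (simp add: std_normal_density_def scaleR_conv_of_real flip: of_real_mult)
    moreover have "exp (A - complex_of_real r) = complex_of_real (exp (- r)) * exp A" for A r
      by (simp add: exp_diff exp_minus divide_inverse exp_of_real mult.commute)
    moreover have "a * (1 / sqrt e * x) = a / sqrt e * x" by simp
    ultimately show ?thesis by (simp only: add_0 minus_divide_left)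
  qed
  have int: "integrable std_normal_distribution (\<lambda>x. iexp (a / sqrt e * x))"
  proof -
    interpret prob_space std_normal_distribution by (rule prob_space_normal_density) simp
    show ?thesis by (rule integrable_const_bound[of _ 1]) auto
  qed
  have int': "integrable lborel ?g"
    using int by (subst (asm) integrable_density) auto
  then have "integrable lborel (\<lambda>x. ?f (0 + (1 / sqrt e) * x))"
    unfolding fg by (rule integrable_mult_right)
  then show ?A
    using s by (subst (asm) lborel_integrable_real_affine_iff) auto
  have "(\<integral>x. ?g x \<partial>lborel) = char std_normal_distribution (a / sqrt e)"
    unfolding char_def by (subst integral_density) auto
  also have "\<dots> = complex_of_real (exp (- a\<^sup>2 / (2 * e)))"
    using e by (simp add: char_std_normal_distribution power_divide)
  finally have *: "(\<integral>x. ?g x \<partial>lborel) = complex_of_real (exp (- a\<^sup>2 / (2 * e)))" .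
  have "(\<integral>t. ?f t \<partial>lborel) = \<bar>1 / sqrt e\<bar> *\<^sub>R (\<integral>x. ?f (0 + (1 / sqrt e) * x) \<partial>lborel)"
    using s by (intro lborel_integral_real_affine) auto
  also have "\<dots> = (1 / sqrt e) *\<^sub>R (complex_of_real (sqrt (2 * pi)) * (\<integral>x. ?g x \<partial>lborel))"
    unfolding fg integral_mult_right_zero using s by simp
  also have "\<dots> = complex_of_real (sqrt (2 * pi / e) * exp (- a\<^sup>2 / (2 * e)))"
    unfolding * by (simp add: real_sqrt_divide scaleR_conv_of_real)
  finally show ?B .
qed

lemma gauss_integral:
  fixes v :: "'a::euclidean_space"
  assumes e: "e > 0"
  shows "integrable lborel (gauss v e)"
    and "(\<integral>y. gauss v e y \<partial>lborel) =
       complex_of_real ((2 * pi / e) powr (real DIM('a) / 2) * exp (- (norm v)\<^sup>2 / (2 * e)))"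
proof -
  interpret product_sigma_finite "\<lambda>_::'a. lborel :: real measure" ..
  let ?h = "\<lambda>b t. exp (\<i> * complex_of_real ((v \<bullet> b) * t) - complex_of_real (e / 2 * (t * t)))"
  have eq: "gauss v e (\<Sum>b\<in>Basis. f b *\<^sub>R b) = (\<Prod>b\<in>Basis. ?h b (f b))" for f :: "'a \<Rightarrow> real"
  proof -
    have "v \<bullet> (\<Sum>b\<in>Basis. f b *\<^sub>R b) = (\<Sum>b\<in>Basis. (v \<bullet> b) * f b)"
      by (simp add: inner_sum_right mult.commute)
    moreover have "(\<Sum>b\<in>Basis. f b *\<^sub>R b) \<bullet> (\<Sum>b\<in>Basis. f b *\<^sub>R b) = (\<Sum>b\<in>Basis. f b * f b)"
      by (subst euclidean_inner) simp
    ultimately show ?thesis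
      by (simp add: gauss_def exp_sum[symmetric] sum_subtractf sum_distrib_left)
  qed
  have "integrable (\<Pi>\<^sub>M b\<in>Basis. lborel) (\<lambda>f. \<Prod>b\<in>Basis. ?h b (f b))"
    by (rule product_integrable_prod) (rule finite_Basis, rule gauss_1d(1)[OF e])
  then show "integrable lborel (gauss v e)"
    by (subst lborel_eq, subst integrable_distr_eq) (auto simp: eq)
  have "(\<integral>y. gauss v e y \<partial>lborel) = (\<integral>f. (\<Prod>b\<in>Basis. ?h b (f b)) \<partial>(\<Pi>\<^sub>M b\<in>Basis. lborel))"
    by (subst lborel_eq, subst integral_distr) (auto simp: eq)
  also have "\<dots> = (\<Prod>b\<in>Basis. \<integral>t. ?h b t \<partial>lborel)"
    by (rule product_integral_prod) (rule finite_Basis, rule gauss_1d(1)[OF e])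
  also have "\<dots> = (\<Prod>b\<in>Basis. complex_of_real (sqrt (2 * pi / e) * exp (- (v \<bullet> b)\<^sup>2 / (2 * e))))"
    by (intro prod.cong refl gauss_1d(2)[OF e])
  also have "\<dots> = complex_of_real (sqrt (2 * pi / e) ^ DIM('a) * exp (\<Sum>b\<in>Basis. - (v \<bullet> b)\<^sup>2 / (2 * e)))"
    by (simp only: of_real_prod[symmetric] prod.distrib prod_constant exp_sum[OF finite_Basis])
  also have "(\<Sum>b\<in>Basis. - (v \<bullet> b)\<^sup>2 / (2 * e)) = - (norm v)\<^sup>2 / (2 * e)"
  proof -
    have "(norm v)\<^sup>2 = (\<Sum>b\<in>Basis. (v \<bullet> b)\<^sup>2)"
      unfolding power2_norm_eq_inner by (subst euclidean_inner) (simp add: power2_eq_square)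
    then show ?thesis by (simp add: sum_negf sum_divide_distrib[symmetric])
  qed
  also have "sqrt (2 * pi / e) ^ DIM('a) = (2 * pi / e) powr (real DIM('a) / 2)"
    using e by (simp add: powr_half_sqrt[symmetric] powr_realpow[symmetric] powr_powr)
  finally show "(\<integral>y. gauss v e y \<partial>lborel) =
       complex_of_real ((2 * pi / e) powr (real DIM('a) / 2) * exp (- (norm v)\<^sup>2 / (2 * e)))" .
qed

lemma integral_norm_bound_nn:
  fixes f :: "'a \<Rightarrow> 'b::{banach, second_countable_topology}"
  shows "ennreal (norm (\<integral>x. f x \<partial>M)) \<le> (\<integral>\<^sup>+x. norm (f x) \<partial>M)"
  by (cases "integrable M f") (auto simp: integral_norm_bound_ennreal not_integrable_integral_eq)

lemma power_div_fact_le_exp: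
  fixes x :: real
  assumes "x \<ge> 0"
  shows "x ^ n / fact n \<le> exp x"
proof -
  have "summable (\<lambda>n. x ^ n / fact n)" using summable_exp_generic[of x] by (simp add: divide_inverse_commute)
  then have "sum (\<lambda>n. x ^ n / fact n) {n} \<le> (\<Sum>n. x ^ n / fact n)"
    by (rule sum_le_suminf) (use assms in auto)
  then show ?thesis by (simp add: exp_def divide_inverse_commute)
qed

lemma japanese_bracket_ge_1: "japanese_bracket x \<ge> 1"
  by (simp add: japanese_bracket_def)

lemma japanese_bracket_square: "(japanese_bracket x)\<^sup>2 = 1 + (norm x)\<^sup>2"
  by (simp add: japanese_bracket_def)

lemma japanese_bracket_measurable[measurable]: "japanese_bracket \<in> borel_measurable borel"
  unfolding japanese_bracket_def[abs_def] by measurable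

definition coordinates :: "('a::euclidean_space \<Rightarrow> complex) set" where
  "coordinates = range (\<lambda>b y. complex_of_real (y \<bullet> b))"

lemma coordinate_polynomial_has_derivative:
  assumes "f \<in> function_algebra coordinates"
  shows "\<exists>D. (\<forall>x. (f has_derivative D x) (at x)) \<and> (\<forall>b. (\<lambda>x. D x b) \<in> function_algebra coordinates)"
  using assms
proof induction
  case (gen f)
  then obtain b where f: "f = (\<lambda>y. complex_of_real (y \<bullet> b))" by (auto simp: coordinates_def)
  have "(f has_derivative (\<lambda>h. complex_of_real (h \<bullet> b))) (at y)" for y
    unfolding f by (auto intro!: derivative_eq_intros)
  then show ?case
    by (intro exI[of _ "\<lambda>y h. complex_of_real (h \<bullet> b)"]) (auto intro: function_algebra.const)
next
  case (const c)
  then show ?case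
    by (intro exI[of _ "\<lambda>_ _. 0"]) (auto intro: function_algebra.const)
next
  case (add f g)
  then obtain Df Dg where "\<forall>x. (f has_derivative Df x) (at x)" "\<forall>x. (g has_derivative Dg x) (at x)"
    "\<forall>b. (\<lambda>x. Df x b) \<in> function_algebra coordinates" "\<forall>b. (\<lambda>x. Dg x b) \<in> function_algebra coordinates"
    by blast
  then show ?case
    by (intro exI[of _ "\<lambda>x h. Df x h + Dg x h"]) (auto intro!: has_derivative_add function_algebra.add)
next
  case (mult f g)
  then obtain Df Dg where "\<forall>x. (f has_derivative Df x) (at x)" "\<forall>x. (g has_derivative Dg x) (at x)"
    "\<forall>b. (\<lambda>x. Df x b) \<in> function_algebra coordinates" "\<forall>b. (\<lambda>x. Dg x b) \<in> function_algebra coordinates"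
    by blast
  then show ?case using mult.hyps
    by (intro exI[of _ "\<lambda>x h. f x * Dg x h + Df x h * g x"])
       (auto intro!: has_derivative_mult function_algebra.add function_algebra.mult)
qed

lemma coordinate_polynomial_bound:
  assumes "f \<in> function_algebra coordinates"
  shows "\<exists>C n. \<forall>x. norm (f x) \<le> C * japanese_bracket x ^ n"
  using assms
proof induction
  case (gen f)
  then obtain b where f: "f = (\<lambda>y. complex_of_real (y \<bullet> b))" by (auto simp: coordinates_def)
  have "norm (f x) \<le> norm b * japanese_bracket x ^ 1" for x
  proof -
    have "norm x \<le> japanese_bracket x" unfolding japanese_bracket_def by (rule real_le_rsqrt) simp
    then have "norm x * norm b \<le> japanese_bracket x * norm b" by (rule mult_right_mono) simp
    then show ?thesis
      using Cauchy_Schwarz_ineq2[of x b] by (simp add: f mult.commute)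
  qed
  then show ?case by blast
next
  case (const c)
  show ?case by (intro exI[of _ "norm c"] exI[of _ 0]) auto
next
  case (add f g)
  then obtain A m B n where f: "\<And>x. norm (f x) \<le> A * japanese_bracket x ^ m"
    and g: "\<And>x. norm (g x) \<le> B * japanese_bracket x ^ n" by blast
  have "norm (f x + g x) \<le> (\<bar>A\<bar> + \<bar>B\<bar>) * japanese_bracket x ^ (m + n)" for x
  proof -
    have "A * japanese_bracket x ^ m \<le> \<bar>A\<bar> * japanese_bracket x ^ (m + n)"
      "B * japanese_bracket x ^ n \<le> \<bar>B\<bar> * japanese_bracket x ^ (m + n)"
      using japanese_bracket_ge_1[of x] by (intro mult_mono power_increasing; simp)+
    then show ?thesis
      using f[of x] g[of x] norm_triangle_ineq[of "f x" "g x"] by (simp add: distrib_right)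
  qed
  then show ?case by blast
next
  case (mult f g)
  then obtain A m B n where f: "\<And>x. norm (f x) \<le> A * japanese_bracket x ^ m"
    and g: "\<And>x. norm (g x) \<le> B * japanese_bracket x ^ n" by blast
  have "norm (f x * g x) \<le> (A * B) * japanese_bracket x ^ (m + n)" for x
  proof -
    have "norm (f x) * norm (g x) \<le> (A * japanese_bracket x ^ m) * (B * japanese_bracket x ^ n)"
      by (intro mult_mono f g order_trans[OF norm_ge_zero f]) auto
    then show ?thesis by (simp add: norm_mult power_add mult_ac)
  qed
  then show ?case by blast
qed

lemma japanese_bracket_gauss_bound:
  fixes y :: "'a::euclidean_space"
  assumes e: "e > 0"
  shows "japanese_bracket y ^ n * exp (- (e / 2 * (norm y)\<^sup>2)) \<le> fact n * (2 / e) ^ n * exp (e / 2)"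
proof -
  define u where "u = 1 + (norm y)\<^sup>2"
  have u: "u \<ge> 1" "u \<ge> 0" by (auto simp: u_def)
  have "japanese_bracket y ^ n \<le> japanese_bracket y ^ (2 * n)"
    using japanese_bracket_ge_1[of y] by (intro power_increasing) auto
  also have "\<dots> = u ^ n" by (simp add: power_mult japanese_bracket_square u_def)
  finally have 1: "japanese_bracket y ^ n \<le> u ^ n" .
  have "(e / 2 * u) ^ n / fact n \<le> exp (e / 2 * u)"
    using e u by (intro power_div_fact_le_exp) (auto)
  then have "(e / 2 * u) ^ n \<le> fact n * exp (e / 2 * u)" by (simp add: field_simps)
  then have "(2 / e) ^ n * (e / 2 * u) ^ n \<le> (2 / e) ^ n * (fact n * exp (e / 2 * u))"
    using e by (intro mult_left_mono) auto
  also have "(2 / e) ^ n * (e / 2 * u) ^ n = u ^ n"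
    using e by (simp add: power_mult_distrib[symmetric])
  finally have 2: "u ^ n \<le> (2 / e) ^ n * (fact n * exp (e / 2 * u))" .
  have "japanese_bracket y ^ n * exp (- (e / 2 * (norm y)\<^sup>2)) \<le>
      ((2 / e) ^ n * (fact n * exp (e / 2 * u))) * exp (- (e / 2 * (norm y)\<^sup>2))"
    using 1 2 by (intro mult_right_mono) auto
  also have "\<dots> = fact n * (2 / e) ^ n * (exp (e / 2 * u) * exp (- (e / 2 * (norm y)\<^sup>2)))" by simp
  also have "exp (e / 2 * u) * exp (- (e / 2 * (norm y)\<^sup>2)) = exp (e / 2)"
    by (simp add: exp_add[symmetric] u_def algebra_simps)
  finally show ?thesis .
qed

text \<open>Derivatives of a Gaussian are polynomials in the coordinates times the Gaussian, hence bounded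
  against every power of the bracket. This makes Gaussians
  admissible in the definition of the transform as a tempered distribution.\<close>
lemma gauss_schwartz:
  fixes v :: "'a::euclidean_space"
  assumes e: "e > 0"
  shows "schwartz (gauss v e)"
proof -
  let ?D = "\<lambda>y h. (\<i> * complex_of_real (v \<bullet> h) - complex_of_real (e * (y \<bullet> h))) * gauss v e y"
  have G: "(gauss v e has_derivative ?D y) (at y)" for y
  proof -
    have 1: "((\<lambda>y. \<i> * complex_of_real (v \<bullet> y) - complex_of_real (e / 2 * (y \<bullet> y))) has_derivative
       (\<lambda>h. \<i> * complex_of_real (v \<bullet> h) - complex_of_real (e * (y \<bullet> h)))) (at y)"
      by (auto intro!: derivative_eq_intros simp: inner_commute algebra_simps)
    have 2: "(exp has_derivative (\<lambda>h. exp z * h)) (at z)" for z :: complex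
      using DERIV_exp[of z] by (simp add: has_field_derivative_def)
    show ?thesis
      using has_derivative_compose[OF 1 2] unfolding gauss_def[abs_def] by (simp only: mult.commute)
  qed
  have PG: "\<exists>D. (\<forall>x. ((\<lambda>y. P y * gauss v e y) has_derivative D x) (at x)) \<and>
      (\<forall>b. \<exists>Q\<in>function_algebra coordinates. \<forall>x. D x b = Q x * gauss v e x)"
    if P: "P \<in> function_algebra coordinates" for P
  proof -
    obtain DP where DP: "\<And>x. (P has_derivative DP x) (at x)" "\<And>b. (\<lambda>x. DP x b) \<in> function_algebra coordinates"
      using coordinate_polynomial_has_derivative[OF P] by blast
    have "((\<lambda>y. P y * gauss v e y) has_derivative (\<lambda>h. P x * ?D x h + DP x h * gauss v e x)) (at x)" for x
      by (rule has_derivative_mult[OF DP(1) G])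
    moreover have "\<exists>Q\<in>function_algebra coordinates. \<forall>x. P x * ?D x b + DP x b * gauss v e x = Q x * gauss v e x" for b
    proof (rule bexI)
      let ?Q = "\<lambda>x. P x * (\<i> * complex_of_real (v \<bullet> b) + complex_of_real (- e) * complex_of_real (x \<bullet> b)) + DP x b"
      show "\<forall>x. P x * ?D x b + DP x b * gauss v e x = ?Q x * gauss v e x" by (simp add: algebra_simps)
      have "(\<lambda>x. complex_of_real (x \<bullet> b)) \<in> function_algebra coordinates"
        by (intro function_algebra.gen) (auto simp: coordinates_def)
      then show "?Q \<in> function_algebra coordinates"
        by (intro function_algebra.add function_algebra.mult P DP(2) function_algebra.const)
    qed
    ultimately show ?thesis by (intro exI[of _ "\<lambda>x h. P x * ?D x h + DP x h * gauss v e x"] conjI allI)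
  qed
  have iter: "\<exists>P\<in>function_algebra coordinates. iter_deriv vs (gauss v e) = (\<lambda>y. P y * gauss v e y)" for vs
  proof (induction vs)
    case Nil
    show ?case by (intro bexI[OF _ function_algebra.const[of 1]]) auto
  next
    case (Cons b vs)
    then obtain P where P: "P \<in> function_algebra coordinates"
      and eq: "iter_deriv vs (gauss v e) = (\<lambda>y. P y * gauss v e y)" by blast
    obtain D Q where D: "\<And>x. ((\<lambda>y. P y * gauss v e y) has_derivative D x) (at x)"
      and Q: "Q \<in> function_algebra coordinates" "\<And>x. D x b = Q x * gauss v e x"
      using PG[OF P] by metis
    have "frechet_derivative (\<lambda>y. P y * gauss v e y) (at x) = D x" for x
      using frechet_derivative_at[OF D] by metis
    then show ?case using Q by (intro bexI[OF _ Q(1)]) (simp add: eq)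
  qed
  have "smooth (gauss v e)"
    unfolding smooth_def using iter PG by (metis differentiableI)
  moreover have "bounded (range (\<lambda>x. japanese_bracket x ^ N *\<^sub>R iter_deriv vs (gauss v e) x))" for vs N
  proof -
    obtain P where P: "P \<in> function_algebra coordinates"
      and eq: "iter_deriv vs (gauss v e) = (\<lambda>y. P y * gauss v e y)" using iter by blast
    obtain C n where C: "\<And>x. norm (P x) \<le> C * japanese_bracket x ^ n"
      using coordinate_polynomial_bound[OF P] by blast
    have "C \<ge> 0" using order_trans[OF norm_ge_zero C[of 0]] by (simp add: japanese_bracket_def)
    have "norm (japanese_bracket x ^ N *\<^sub>R iter_deriv vs (gauss v e) x) \<le>
       C * (fact (N + n) * (2 / e) ^ (N + n) * exp (e / 2))" for x
    proof -
      have jp: "japanese_bracket x \<ge> 0" using japanese_bracket_ge_1[of x] by simp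
      have "norm (japanese_bracket x ^ N *\<^sub>R iter_deriv vs (gauss v e) x) =
        japanese_bracket x ^ N * (norm (P x) * exp (- (e / 2 * (norm x)\<^sup>2)))"
        using jp by (simp add: eq norm_mult norm_gauss)
      also have "\<dots> \<le> japanese_bracket x ^ N * ((C * japanese_bracket x ^ n) * exp (- (e / 2 * (norm x)\<^sup>2)))"
        using jp by (intro mult_left_mono mult_right_mono C) auto
      also have "\<dots> = C * (japanese_bracket x ^ (N + n) * exp (- (e / 2 * (norm x)\<^sup>2)))"
        by (simp add: power_add)
      also have "\<dots> \<le> C * (fact (N + n) * (2 / e) ^ (N + n) * exp (e / 2))"
        by (intro mult_left_mono japanese_bracket_gauss_bound e \<open>C \<ge> 0\<close>)
      finally show ?thesis .
    qed
    then show ?thesis by (intro boundedI[of _ "C * (fact (N + n) * (2 / e) ^ (N + n) * exp (e / 2))"]) auto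
  qed
  ultimately show ?thesis unfolding schwartz_def by blast
qed

lemma fourier_gauss:
  fixes v y :: "'a::euclidean_space"
  assumes e: "e > 0"
  shows "fourier (gauss v e) y = complex_of_real ((2 * pi / e) powr (real DIM('a) / 2) * exp (- (norm (v - y))\<^sup>2 / (2 * e)))"
proof -
  have "fourier (gauss v e) y = (\<integral>x. gauss (v - y) e x \<partial>lborel)"
    unfolding fourier_def gauss_def
    by (intro Bochner_Integration.integral_cong refl)
       (simp add: exp_add[symmetric] inner_diff_left inner_commute algebra_simps)
  then show ?thesis by (simp add: gauss_integral(2)[OF e])
qed

text \<open>Expanding \<open>|\<Psi>|^2\<close> into a double integral and integrating the Gaussian in \<open>\<xi>\<close> first leaves the
  heat kernel at time \<open>\<sigma>\<close> tested against \<open>\<psi>\<close>. Plancherel's theorem is thereby avoided.\<close>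
lemma weighted_gauss_integral_bound:
  fixes \<psi> :: "'a::euclidean_space \<Rightarrow> complex"
  assumes \<psi>: "integrable lborel \<psi>" and \<sigma>: "\<sigma> > 0"
  defines "\<Psi> \<equiv> \<lambda>\<xi>. (\<integral>x. gauss x 0 \<xi> * \<psi> x \<partial>lborel)"
  shows "(\<integral>\<^sup>+\<xi>. ennreal (exp (- (\<sigma> * (norm \<xi>)\<^sup>2)) * (norm (\<Psi> \<xi>))\<^sup>2) \<partial>lborel) \<le>
    (\<integral>\<^sup>+y. (\<integral>\<^sup>+x. ennreal (norm (\<psi> x) * norm (\<psi> y) * ((pi / \<sigma>) powr (real DIM('a) / 2) * exp (- (norm (x - y))\<^sup>2 / (4 * \<sigma>)))) \<partial>lborel) \<partial>lborel)"
proof -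
  have [measurable]: "\<psi> \<in> borel_measurable borel" using \<psi> by auto
  have gm'[measurable]: "(\<lambda>p. gauss (snd p) s (fst p :: 'a)) \<in> borel_measurable (borel \<Otimes>\<^sub>M borel)"
      "(\<lambda>p. gauss (fst p) s (snd p :: 'a)) \<in> borel_measurable (borel \<Otimes>\<^sub>M borel)" for s
    unfolding gauss_def by measurable
  have g1: "norm (gauss x 0 \<xi>) = 1" for x \<xi> :: 'a by (simp add: norm_gauss)
  let ?E = "\<lambda>\<xi>::'a. gauss 0 (2 * \<sigma>) \<xi>"
  have E: "?E \<xi> = complex_of_real (exp (- (\<sigma> * (norm \<xi>)\<^sup>2)))" for \<xi>
    by (simp add: gauss_def power2_norm_eq_inner exp_of_real[symmetric])
  have Eint: "integrable lborel ?E" using \<sigma> by (intro gauss_integral) auto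
  have [measurable]: "\<Psi> \<in> borel_measurable borel"
    unfolding \<Psi>_def by measurable
  define N where "N = (\<integral>x. norm (\<psi> x) \<partial>lborel)"
  have \<Psi>N: "norm (\<Psi> \<xi>) \<le> N" for \<xi>
    unfolding \<Psi>_def N_def by (rule order_trans[OF integral_norm_bound]) (simp add: norm_mult g1)
  have "N \<ge> 0" unfolding N_def by simp
  have int1: "integrable lborel (\<lambda>\<xi>. ?E \<xi> * \<Psi> \<xi>)"
    by (rule Bochner_Integration.integrable_bound[of _ "\<lambda>\<xi>. N * norm (?E \<xi>)"])
       (use Eint \<Psi>N \<open>N \<ge> 0\<close> in \<open>auto simp: norm_mult mult.commute[of N] intro!: mult_left_mono\<close>)
  have int2: "integrable lborel (\<lambda>\<xi>. exp (- (\<sigma> * (norm \<xi>)\<^sup>2)) * (norm (\<Psi> \<xi>))\<^sup>2)"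
  proof (rule Bochner_Integration.integrable_bound[of _ "\<lambda>\<xi>. N\<^sup>2 * norm (?E \<xi>)"])
    show "AE x in lborel. norm (exp (- (\<sigma> * (norm x)\<^sup>2)) * (norm (\<Psi> x))\<^sup>2) \<le> norm (N\<^sup>2 * norm (?E x))"
      using \<Psi>N by (auto simp: E norm_mult intro!: power_mono)
  qed (use Eint in auto)
  let ?K = "\<lambda>x y::'a. (pi / \<sigma>) powr (real DIM('a) / 2) * exp (- (norm (x - y))\<^sup>2 / (4 * \<sigma>))"
  have inner: "(\<integral>\<xi>. ?E \<xi> * \<Psi> \<xi> * gauss (- y) 0 \<xi> \<partial>lborel) = (\<integral>x. complex_of_real (?K x y) * \<psi> x \<partial>lborel)" for y
  proof -
    have "(\<integral>\<xi>. (?E \<xi> * gauss (- y) 0 \<xi>) * \<Psi> \<xi> \<partial>lborel) =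
       (\<integral>x. (\<integral>\<xi>. (?E \<xi> * gauss (- y) 0 \<xi>) * gauss x 0 \<xi> \<partial>lborel) * \<psi> x \<partial>lborel)"
      unfolding \<Psi>_def
    proof (rule integral_bounded_kernel_swap(1)[where B = 1])
      show "integrable lborel (\<lambda>\<xi>. ?E \<xi> * gauss (- y) 0 \<xi>)"
        by (rule Bochner_Integration.integrable_bound[OF Eint]) (auto simp: norm_mult g1)
    qed (auto simp: g1 \<psi> gm')
    also have "(\<lambda>x. (\<integral>\<xi>. (?E \<xi> * gauss (- y) 0 \<xi>) * gauss x 0 \<xi> \<partial>lborel)) = (\<lambda>x. complex_of_real (?K x y))"
    proof
      fix x
      have "(?E \<xi> * gauss (- y) 0 \<xi>) * gauss x 0 \<xi> = gauss (x - y) (2 * \<sigma>) \<xi>" for \<xi>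
        by (simp add: gauss_def exp_add[symmetric] inner_diff_left algebra_simps)
      then show "(\<integral>\<xi>. (?E \<xi> * gauss (- y) 0 \<xi>) * gauss x 0 \<xi> \<partial>lborel) = complex_of_real (?K x y)"
        using \<sigma> by (simp add: gauss_integral(2))
    qed
    finally show ?thesis by (simp add: mult_ac)
  qed
  have cnj\<Psi>: "cnj (\<Psi> \<xi>) = (\<integral>y. gauss (- y) 0 \<xi> * cnj (\<psi> y) \<partial>lborel)" for \<xi>
  proof -
    have "cnj (\<Psi> \<xi>) = (\<integral>y. cnj (gauss y 0 \<xi> * \<psi> y) \<partial>lborel)"
      unfolding \<Psi>_def by (rule Bochner_Integration.integral_cnj[symmetric])
    also have "(\<lambda>y. cnj (gauss y 0 \<xi> * \<psi> y)) = (\<lambda>y. gauss (- y) 0 \<xi> * cnj (\<psi> y))"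
      by (simp add: gauss_def exp_cnj)
    finally show ?thesis .
  qed
  have "complex_of_real (\<integral>\<xi>. exp (- (\<sigma> * (norm \<xi>)\<^sup>2)) * (norm (\<Psi> \<xi>))\<^sup>2 \<partial>lborel) =
     (\<integral>\<xi>. ?E \<xi> * \<Psi> \<xi> * cnj (\<Psi> \<xi>) \<partial>lborel)"
    unfolding integral_complex_of_real[symmetric] of_real_mult complex_norm_square E
    by (simp add: mult_ac)
  also have "\<dots> = (\<integral>y. (\<integral>\<xi>. ?E \<xi> * \<Psi> \<xi> * gauss (- y) 0 \<xi> \<partial>lborel) * cnj (\<psi> y) \<partial>lborel)"
    unfolding cnj\<Psi>
  proof (rule integral_bounded_kernel_swap(1)[where B = 1 and k = "\<lambda>\<xi> y. gauss (- y) 0 \<xi>"])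
    show "(\<lambda>p. gauss (- snd p) 0 (fst p)) \<in> borel_measurable (borel \<Otimes>\<^sub>M borel)"
      unfolding gauss_def by measurable
  qed (auto simp: g1 \<psi> int1)
  also have "\<dots> = (\<integral>y. (\<integral>x. complex_of_real (?K x y) * \<psi> x \<partial>lborel) * cnj (\<psi> y) \<partial>lborel)"
    unfolding inner ..
  finally have eq: "complex_of_real (\<integral>\<xi>. exp (- (\<sigma> * (norm \<xi>)\<^sup>2)) * (norm (\<Psi> \<xi>))\<^sup>2 \<partial>lborel) = \<dots>" .
  have "(\<integral>\<^sup>+\<xi>. ennreal (exp (- (\<sigma> * (norm \<xi>)\<^sup>2)) * (norm (\<Psi> \<xi>))\<^sup>2) \<partial>lborel) =
     ennreal (\<integral>\<xi>. exp (- (\<sigma> * (norm \<xi>)\<^sup>2)) * (norm (\<Psi> \<xi>))\<^sup>2 \<partial>lborel)"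
    by (rule nn_integral_eq_integral[OF int2]) auto
  also have "\<dots> = ennreal (norm (complex_of_real (\<integral>\<xi>. exp (- (\<sigma> * (norm \<xi>)\<^sup>2)) * (norm (\<Psi> \<xi>))\<^sup>2 \<partial>lborel)))"
    by (simp add: integral_nonneg_AE)
  also have "\<dots> \<le> (\<integral>\<^sup>+y. norm ((\<integral>x. complex_of_real (?K x y) * \<psi> x \<partial>lborel) * cnj (\<psi> y)) \<partial>lborel)"
    unfolding eq by (rule integral_norm_bound_nn)
  also have "\<dots> \<le> (\<integral>\<^sup>+y. (\<integral>\<^sup>+x. ennreal (norm (\<psi> x) * norm (\<psi> y) * ?K x y) \<partial>lborel) \<partial>lborel)"
  proof (rule nn_integral_mono)
    fix y
    have "ennreal (norm ((\<integral>x. complex_of_real (?K x y) * \<psi> x \<partial>lborel) * cnj (\<psi> y))) =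
       ennreal (norm (\<psi> y)) * ennreal (norm (\<integral>x. complex_of_real (?K x y) * \<psi> x \<partial>lborel))"
      by (simp add: norm_mult ennreal_mult' mult.commute)
    also have "\<dots> \<le> ennreal (norm (\<psi> y)) * (\<integral>\<^sup>+x. norm (complex_of_real (?K x y) * \<psi> x) \<partial>lborel)"
      by (intro mult_left_mono integral_norm_bound_nn) auto
    also have "\<dots> = (\<integral>\<^sup>+x. ennreal (norm (\<psi> y)) * norm (complex_of_real (?K x y) * \<psi> x) \<partial>lborel)"
      by (rule nn_integral_cmult[symmetric]) measurable
    also have "\<dots> = (\<integral>\<^sup>+x. ennreal (norm (\<psi> x) * norm (\<psi> y) * ?K x y) \<partial>lborel)"
      by (intro nn_integral_cong) (simp add: norm_mult ennreal_mult'[symmetric] mult_ac abs_mult)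
    finally show "ennreal (norm ((\<integral>x. complex_of_real (?K x y) * \<psi> x \<partial>lborel) * cnj (\<psi> y))) \<le>
       (\<integral>\<^sup>+x. ennreal (norm (\<psi> x) * norm (\<psi> y) * ?K x y) \<partial>lborel)" .
  qed
  finally show ?thesis .
qed

section \<open>Duality between Sobolev norms and Riesz energies\<close>

lemma power_nn_integral_exp:
  assumes s: "s > 0" and a: "a > (0::real)"
  shows "(\<integral>\<^sup>+t. ennreal (indicator {0..} t * t powr (s - 1) * exp (- (a * t))) \<partial>lborel) = ennreal (Gamma s * a powr (- s))"
proof -
  have "ennreal (Gamma s) = (\<integral>\<^sup>+t. ennreal (indicator {0..} t * t powr (s - 1) / exp t) \<partial>lborel)"
    by (rule Gamma_conv_nn_integral_real[OF s])
  also have "\<dots> = ennreal \<bar>a\<bar> * (\<integral>\<^sup>+t. ennreal (indicator {0..} (0 + a * t) * (0 + a * t) powr (s - 1) / exp (0 + a * t)) \<partial>lborel)"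
    by (rule nn_integral_real_affine) (use a in auto)
  also have "(\<lambda>t. ennreal (indicator {0..} (0 + a * t) * (0 + a * t) powr (s - 1) / exp (0 + a * t))) =
      (\<lambda>t. ennreal (a powr (s - 1)) * ennreal (indicator {0..} t * t powr (s - 1) * exp (- (a * t))))"
    using a by (auto simp: fun_eq_iff indicator_def zero_le_mult_iff powr_mult exp_minus divide_inverse ennreal_mult'[symmetric] mult_ac)
  also have "ennreal \<bar>a\<bar> * (\<integral>\<^sup>+t. ennreal (a powr (s - 1)) * ennreal (indicator {0..} t * t powr (s - 1) * exp (- (a * t))) \<partial>lborel) =
     ennreal (a powr s) * (\<integral>\<^sup>+t. ennreal (indicator {0..} t * t powr (s - 1) * exp (- (a * t))) \<partial>lborel)"
  proof -
    have "\<bar>a\<bar> * a powr (s - 1) = a powr s" using a by (simp add: powr_diff)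
    then show ?thesis
      by (subst nn_integral_cmult) (auto simp: mult.assoc[symmetric] ennreal_mult[symmetric])
  qed
  finally have eq: "ennreal (Gamma s) = ennreal (a powr s) * (\<integral>\<^sup>+t. ennreal (indicator {0..} t * t powr (s - 1) * exp (- (a * t))) \<partial>lborel)" (is "_ = _ * ?I") .
  have "ennreal (Gamma s * a powr (- s)) = ennreal (a powr (- s)) * ennreal (Gamma s)"
    using s Gamma_real_pos[OF s] by (simp add: ennreal_mult mult.commute)
  also have "\<dots> = ennreal (a powr (- s) * a powr s) * ?I"
    unfolding eq by (simp add: ennreal_mult mult.assoc)
  also have "a powr (- s) * a powr s = 1" using a by (simp add: powr_add[symmetric])
  finally show ?thesis by simp
qed

text \<open>The elementary inequality \<open>exp (- u) \<le> u powr (- b)\<close>, at \<open>u = |z|^2 / (4 \<sigma>)\<close>, trades part of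
  the time decay of the heat kernel for decay in space.\<close>
lemma gauss_kernel_le_singularity:
  fixes z :: "'a::euclidean_space"
  assumes t: "0 < t" "t \<le> \<sigma>" and z: "z \<noteq> 0" and b: "0 \<le> b" "b \<le> 1" and m: "b \<le> m"
  shows "(pi / \<sigma>) powr m * exp (- (norm z)\<^sup>2 / (4 * \<sigma>)) \<le> pi powr m * 4 powr b * t powr (b - m) * singularity z powr (2 * b)"
proof -
  define u where "u = (norm z)\<^sup>2 / (4 * \<sigma>)"
  have u: "u > 0" using t z by (simp add: u_def)
  have "u powr b \<le> exp u"
  proof -
    have "u powr b \<le> (1 + u) powr b" using u b by (intro powr_mono2) auto
    also have "\<dots> \<le> (1 + u) powr 1" using u b by (intro powr_mono) auto
    also have "\<dots> \<le> exp u" using u exp_ge_add_one_self[of u] by simp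
    finally show ?thesis .
  qed
  then have "exp (- u) \<le> u powr (- b)"
    using u by (simp add: exp_minus powr_minus le_imp_inverse_le)
  also have "u powr (- b) = (4 * \<sigma>) powr b * (norm z) powr (- (2 * b))"
  proof -
    have "u powr (- b) = (norm z)\<^sup>2 powr (- b) / (4 * \<sigma>) powr (- b)"
      unfolding u_def using t by (simp add: powr_divide)
    also have "\<dots> = norm z powr (- (2 * b)) / (4 * \<sigma>) powr (- b)"
    proof -
      have "(norm z)\<^sup>2 = norm z powr 2" using z by simp
      then show ?thesis by (simp only: powr_powr mult_minus_right)
    qed
    finally show ?thesis by (simp add: powr_minus divide_inverse mult.commute)
  qed
  also have "\<dots> \<le> (4 * \<sigma>) powr b * singularity z powr (2 * b)"
  proof (rule mult_left_mono)
    have "norm z powr (- (2 * b)) = (1 / norm z) powr (2 * b)"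
      using z by (simp add: powr_minus powr_divide inverse_eq_divide)
    also have "\<dots> \<le> singularity z powr (2 * b)"
      using b by (intro powr_mono2) (auto simp: singularity_def)
    finally show "norm z powr (- (2 * b)) \<le> singularity z powr (2 * b)" .
  qed auto
  finally have "(pi / \<sigma>) powr m * exp (- u) \<le> (pi / \<sigma>) powr m * ((4 * \<sigma>) powr b * singularity z powr (2 * b))"
    by (rule mult_left_mono) auto
  also have "\<dots> = pi powr m * 4 powr b * \<sigma> powr (b - m) * singularity z powr (2 * b)"
    using t by (simp add: powr_divide powr_mult powr_diff)
  also have "\<dots> \<le> pi powr m * 4 powr b * t powr (b - m) * singularity z powr (2 * b)"
    using t m by (intro mult_right_mono mult_left_mono powr_mono2') auto
  finally show ?thesis by (simp add: u_def)
qed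

text \<open>The energy of \<open>|\<psi>|\<close> for a truncated Riesz kernel. Since the modulus of \<open>\<psi>\<close> enters, it is monotone
  in \<open>|\<psi>|\<close>, unlike the Sobolev norm of negative order that it dominates.\<close>
definition riesz_energy :: "real \<Rightarrow> ('a::euclidean_space \<Rightarrow> complex) \<Rightarrow> ennreal" where
  "riesz_energy p \<psi> = (\<integral>\<^sup>+y. (\<integral>\<^sup>+x. ennreal (norm (\<psi> x) * norm (\<psi> y) * singularity (x - y) powr p) \<partial>lborel) \<partial>lborel)"

text \<open>The left-hand side is the norm of \<open>\<psi>\<close> in the Sobolev space of order \<open>- s\<close>, damped by a Gaussian.
  The weight is a superposition of Gaussians: \<open>\<Gamma>(s) (1 + |\<xi>|^2)^(-s)\<close> is the integral of
  \<open>t^(s-1) exp (- t (1 + |\<xi>|^2))\<close> over \<open>t > 0\<close>. Each Gaussian is estimated by the Riesz kernel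
  of exponent \<open>2 b\<close>, at the price \<open>t^(b-d/2)\<close>, and \<open>s + b > d/2\<close> makes the remaining integral
  in \<open>t\<close> converge.\<close>
lemma weighted_transform_le_riesz_energy:
  fixes \<psi> :: "'a::euclidean_space \<Rightarrow> complex"
  assumes \<psi>: "integrable lborel \<psi>" and e: "e > 0"
    and s: "s > 0" and b: "0 \<le> b" "b \<le> 1" "b \<le> real DIM('a) / 2" "s + b - real DIM('a) / 2 > 0"
  defines "\<Psi> \<equiv> \<lambda>\<xi>. (\<integral>x. gauss x 0 \<xi> * \<psi> x \<partial>lborel)"
  shows "(\<integral>\<^sup>+\<xi>. ennreal (japanese_bracket \<xi> powr (- (2 * s)) * exp (- (e * (norm \<xi>)\<^sup>2)) * (norm (\<Psi> \<xi>))\<^sup>2) \<partial>lborel) \<le>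
    ennreal (pi powr (real DIM('a) / 2) * 4 powr b * Gamma (s + b - real DIM('a) / 2) / Gamma s) * riesz_energy (2 * b) \<psi>"
proof -
  let ?m = "real DIM('a) / 2"
  have [measurable]: "\<psi> \<in> borel_measurable borel" using \<psi> by auto
  have [measurable]: "(\<lambda>p. gauss (snd p) q (fst p :: 'a)) \<in> borel_measurable (borel \<Otimes>\<^sub>M borel)" for q
    unfolding gauss_def by measurable
  have [measurable]: "\<Psi> \<in> borel_measurable borel" unfolding \<Psi>_def by measurable
  let ?h = "\<lambda>t. indicator {0..} t * t powr (s - 1) * exp (- t)"
  have G: "Gamma s > 0" "Gamma (s + b - ?m) > 0" using s b by (auto intro: Gamma_real_pos)
  have "ennreal (Gamma s) * (\<integral>\<^sup>+\<xi>. ennreal (japanese_bracket \<xi> powr (- (2 * s)) * exp (- (e * (norm \<xi>)\<^sup>2)) * (norm (\<Psi> \<xi>))\<^sup>2) \<partial>lborel) =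
     (\<integral>\<^sup>+\<xi>. (\<integral>\<^sup>+t. ennreal (?h t * (exp (- ((t + e) * (norm \<xi>)\<^sup>2)) * (norm (\<Psi> \<xi>))\<^sup>2)) \<partial>lborel) \<partial>lborel)"
  proof (subst nn_integral_cmult[symmetric], measurable, intro nn_integral_cong)
    fix \<xi> :: 'a
    have jb: "(1 + (norm \<xi>)\<^sup>2) powr (- s) = japanese_bracket \<xi> powr (- (2 * s))"
    proof -
      have "(1 + (norm \<xi>)\<^sup>2) = japanese_bracket \<xi> powr 2"
        using japanese_bracket_ge_1[of \<xi>] by (simp add: japanese_bracket_square)
      then show ?thesis by (simp add: powr_powr)
    qed
    have "(\<integral>\<^sup>+t. ennreal (?h t * (exp (- ((t + e) * (norm \<xi>)\<^sup>2)) * (norm (\<Psi> \<xi>))\<^sup>2)) \<partial>lborel) =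
      (\<integral>\<^sup>+t. ennreal (exp (- (e * (norm \<xi>)\<^sup>2)) * (norm (\<Psi> \<xi>))\<^sup>2) *
          ennreal (indicator {0..} t * t powr (s - 1) * exp (- ((1 + (norm \<xi>)\<^sup>2) * t))) \<partial>lborel)"
      by (intro nn_integral_cong)
         (simp add: ennreal_mult'[symmetric] algebra_simps exp_add[symmetric] exp_diff exp_minus divide_inverse)
    also have "\<dots> = ennreal (exp (- (e * (norm \<xi>)\<^sup>2)) * (norm (\<Psi> \<xi>))\<^sup>2) * ennreal (Gamma s * (1 + (norm \<xi>)\<^sup>2) powr (- s))"
      by (subst nn_integral_cmult, simp, subst power_nn_integral_exp[OF s]) (simp_all add: add_pos_nonneg)
    finally show "ennreal (Gamma s) * ennreal (japanese_bracket \<xi> powr (- (2 * s)) * exp (- (e * (norm \<xi>)\<^sup>2)) * (norm (\<Psi> \<xi>))\<^sup>2) =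
       (\<integral>\<^sup>+t. ennreal (?h t * (exp (- ((t + e) * (norm \<xi>)\<^sup>2)) * (norm (\<Psi> \<xi>))\<^sup>2)) \<partial>lborel)"
      using G by (simp add: ennreal_mult'[symmetric] jb mult_ac)
  qed
  also have "\<dots> = (\<integral>\<^sup>+t. (\<integral>\<^sup>+\<xi>. ennreal (?h t * (exp (- ((t + e) * (norm \<xi>)\<^sup>2)) * (norm (\<Psi> \<xi>))\<^sup>2)) \<partial>lborel) \<partial>lborel)"
    by (rule lborel_pair.Fubini') measurable
  also have "\<dots> \<le> (\<integral>\<^sup>+t. ennreal (pi powr ?m * 4 powr b * (indicator {0..} t * t powr (s + b - ?m - 1) * exp (- (1 * t)))) * riesz_energy (2 * b) \<psi> \<partial>lborel)"
  proof (rule nn_integral_mono)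
    fix t :: real
    show "(\<integral>\<^sup>+\<xi>. ennreal (?h t * (exp (- ((t + e) * (norm \<xi>)\<^sup>2)) * (norm (\<Psi> \<xi>))\<^sup>2)) \<partial>lborel) \<le>
       ennreal (pi powr ?m * 4 powr b * (indicator {0..} t * t powr (s + b - ?m - 1) * exp (- (1 * t)))) * riesz_energy (2 * b) \<psi>"
    proof (cases "t > 0")
      case False
      then have "?h t = 0" by (auto simp: indicator_def)
      then show ?thesis by (simp only: mult_zero_left) simp
    next
      case True
      have h0: "?h t \<ge> 0" by simp
      have "(\<integral>\<^sup>+\<xi>. ennreal (?h t * (exp (- ((t + e) * (norm \<xi>)\<^sup>2)) * (norm (\<Psi> \<xi>))\<^sup>2)) \<partial>lborel) =
         ennreal (?h t) * (\<integral>\<^sup>+\<xi>. ennreal (exp (- ((t + e) * (norm \<xi>)\<^sup>2)) * (norm (\<Psi> \<xi>))\<^sup>2) \<partial>lborel)"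
        by (subst nn_integral_cmult[symmetric]) (auto simp: ennreal_mult'[OF h0])
      also have "\<dots> \<le> ennreal (?h t) * (\<integral>\<^sup>+y. (\<integral>\<^sup>+x. ennreal (norm (\<psi> x) * norm (\<psi> y) *
          ((pi / (t + e)) powr ?m * exp (- (norm (x - y))\<^sup>2 / (4 * (t + e))))) \<partial>lborel) \<partial>lborel)"
        unfolding \<Psi>_def using True e by (intro mult_left_mono weighted_gauss_integral_bound \<psi>) auto
      also have "\<dots> \<le> ennreal (?h t) * (\<integral>\<^sup>+y. (\<integral>\<^sup>+x. ennreal (pi powr ?m * 4 powr b * t powr (b - ?m)) *
          ennreal (norm (\<psi> x) * norm (\<psi> y) * singularity (x - y) powr (2 * b)) \<partial>lborel) \<partial>lborel)"
      proof (rule mult_left_mono, rule nn_integral_mono, rule nn_integral_mono_AE)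
        fix y :: 'a
        have "AE x in lborel. x \<noteq> y" by (rule AE_lborel_singleton)
        then show "AE x in lborel. ennreal (norm (\<psi> x) * norm (\<psi> y) * ((pi / (t + e)) powr ?m * exp (- (norm (x - y))\<^sup>2 / (4 * (t + e)))))
          \<le> ennreal (pi powr ?m * 4 powr b * t powr (b - ?m)) * ennreal (norm (\<psi> x) * norm (\<psi> y) * singularity (x - y) powr (2 * b))"
        proof eventually_elim
          fix x assume "x \<noteq> y"
          then have "(pi / (t + e)) powr ?m * exp (- (norm (x - y))\<^sup>2 / (4 * (t + e))) \<le>
             pi powr ?m * 4 powr b * t powr (b - ?m) * singularity (x - y) powr (2 * b)"
            using True e b by (intro gauss_kernel_le_singularity) auto
          then have "norm (\<psi> x) * norm (\<psi> y) * ((pi / (t + e)) powr ?m * exp (- (norm (x - y))\<^sup>2 / (4 * (t + e)))) \<le>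
             norm (\<psi> x) * norm (\<psi> y) * (pi powr ?m * 4 powr b * t powr (b - ?m) * singularity (x - y) powr (2 * b))"
            by (rule mult_left_mono) auto
          then show "ennreal (norm (\<psi> x) * norm (\<psi> y) * ((pi / (t + e)) powr ?m * exp (- (norm (x - y))\<^sup>2 / (4 * (t + e)))))
          \<le> ennreal (pi powr ?m * 4 powr b * t powr (b - ?m)) * ennreal (norm (\<psi> x) * norm (\<psi> y) * singularity (x - y) powr (2 * b))"
            by (subst ennreal_mult'[symmetric]) (auto intro!: ennreal_leI simp: mult_ac)
        qed
      qed simp
      also have "\<dots> = ennreal (?h t) * (ennreal (pi powr ?m * 4 powr b * t powr (b - ?m)) * riesz_energy (2 * b) \<psi>)"
        unfolding riesz_energy_def by (simp add: nn_integral_cmult)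
      also have "\<dots> = ennreal (pi powr ?m * 4 powr b * (indicator {0..} t * t powr (s + b - ?m - 1) * exp (- (1 * t)))) * riesz_energy (2 * b) \<psi>"
      proof -
        have "t powr (s + b - ?m - 1) = t powr (s - 1) * t powr (b - ?m)"
          by (simp add: powr_add[symmetric] algebra_simps)
        then have "?h t * (pi powr ?m * 4 powr b * t powr (b - ?m)) =
            pi powr ?m * 4 powr b * (indicator {0..} t * t powr (s + b - ?m - 1) * exp (- (1 * t)))"
          by (simp only: mult_1) (simp only: mult_ac)
        then show ?thesis
          by (simp only: mult.assoc[symmetric] ennreal_mult'[OF h0, symmetric])
      qed
      finally show ?thesis .
    qed
  qed
  also have "\<dots> = ennreal (pi powr ?m * 4 powr b * Gamma (s + b - ?m)) * riesz_energy (2 * b) \<psi>"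
  proof -
    have "(\<integral>\<^sup>+t. ennreal (pi powr ?m * 4 powr b * (indicator {0..} t * t powr (s + b - ?m - 1) * exp (- (1 * t)))) \<partial>lborel) =
       (\<integral>\<^sup>+t. ennreal (pi powr ?m * 4 powr b) * ennreal (indicator {0..} t * t powr (s + b - ?m - 1) * exp (- (1 * t))) \<partial>lborel)"
      by (intro nn_integral_cong ennreal_mult') auto
    also have "\<dots> = ennreal (pi powr ?m * 4 powr b) * ennreal (Gamma (s + b - ?m) * 1 powr (- (s + b - ?m)))"
      by (subst nn_integral_cmult, simp, subst power_nn_integral_exp) (use b in auto)
    also have "\<dots> = ennreal (pi powr ?m * 4 powr b * Gamma (s + b - ?m))"
      by (subst ennreal_mult'[symmetric]) auto
    finally show ?thesis by (subst nn_integral_multc) auto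
  qed
  finally have *: "ennreal (Gamma s) * (\<integral>\<^sup>+\<xi>. ennreal (japanese_bracket \<xi> powr (- (2 * s)) * exp (- (e * (norm \<xi>)\<^sup>2)) * (norm (\<Psi> \<xi>))\<^sup>2) \<partial>lborel)
     \<le> ennreal (pi powr ?m * 4 powr b * Gamma (s + b - ?m)) * riesz_energy (2 * b) \<psi>" (is "_ * ?I \<le> ennreal ?c * ?R") .
  have "?I = ennreal (1 / Gamma s) * (ennreal (Gamma s) * ?I)"
    using G by (simp add: mult.assoc[symmetric] ennreal_mult'[symmetric])
  also have "\<dots> \<le> ennreal (1 / Gamma s) * (ennreal ?c * ?R)"
    by (rule mult_left_mono[OF *]) simp
  also have "\<dots> = ennreal (?c / Gamma s) * ?R"
    using G by (simp add: mult.assoc[symmetric] ennreal_mult'[symmetric])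
  finally show ?thesis .
qed

lemma integrable_bounded_support:
  fixes f :: "'a::euclidean_space \<Rightarrow> 'b::{banach, second_countable_topology}"
  assumes "f \<in> borel_measurable borel" "\<And>x. norm (f x) \<le> B" "\<And>x. norm x > R \<Longrightarrow> f x = 0"
  shows "integrable lborel f"
proof -
  have "integrable lborel (\<lambda>x. indicator (cball 0 R) x *\<^sub>R f x)"
    using assms by (intro integrableI_bounded_set_indicator[where B = B] emeasure_bounded_finite) auto
  also have "(\<lambda>x. indicator (cball 0 R) x *\<^sub>R f x) = f"
    using assms(3) by (auto simp: fun_eq_iff indicator_def)
  finally show ?thesis .
qed

text \<open>Taking the definition of the transform at the test function \<open>gauss x e\<close> turns the convolution of
  \<open>w\<close> with a heat kernel into a Fourier integral of \<open>g\<close>. The rescaling keeps the Gaussian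
  fixed, so that \<open>e\<close> can tend to 0.\<close>
lemma heat_kernel_fourier:
  fixes w g :: "'a::euclidean_space \<Rightarrow> complex"
  assumes hft: "has_fourier_transform w g" and e: "e > 0"
  shows "(\<integral>z. w (x + sqrt e *\<^sub>R z) * complex_of_real (exp (- (norm z)\<^sup>2 / 2)) \<partial>lborel) =
     complex_of_real ((2 * pi) powr (- (real DIM('a) / 2))) * (\<integral>\<xi>. g \<xi> * gauss x e \<xi> \<partial>lborel)"
proof -
  let ?m = "real DIM('a) / 2"
  have "(\<integral>\<xi>. g \<xi> * gauss x e \<xi> \<partial>lborel) = (\<integral>y. w y * fourier (gauss x e) y \<partial>lborel)"
    using hft gauss_schwartz[OF e, of x] by (simp add: has_fourier_transform_def)
  also have "\<dots> = \<bar>sqrt e\<bar> ^ DIM('a) *\<^sub>R (\<integral>z. w (x + sqrt e *\<^sub>R z) * fourier (gauss x e) (x + sqrt e *\<^sub>R z) \<partial>lborel)"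
    by (rule integral_euclidean_affine) (use e in auto)
  also have "(\<lambda>z. w (x + sqrt e *\<^sub>R z) * fourier (gauss x e) (x + sqrt e *\<^sub>R z)) =
     (\<lambda>z. complex_of_real ((2 * pi / e) powr ?m) * (w (x + sqrt e *\<^sub>R z) * complex_of_real (exp (- (norm z)\<^sup>2 / 2))))"
    using e by (simp add: fourier_gauss power_mult_distrib fun_eq_iff)
  also have "\<bar>sqrt e\<bar> ^ DIM('a) *\<^sub>R (\<integral>z. complex_of_real ((2 * pi / e) powr ?m) * (w (x + sqrt e *\<^sub>R z) * complex_of_real (exp (- (norm z)\<^sup>2 / 2))) \<partial>lborel) =
     complex_of_real (\<bar>sqrt e\<bar> ^ DIM('a) * (2 * pi / e) powr ?m) * (\<integral>z. w (x + sqrt e *\<^sub>R z) * complex_of_real (exp (- (norm z)\<^sup>2 / 2)) \<partial>lborel)"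
    unfolding integral_mult_right_zero by (simp add: scaleR_conv_of_real)
  also have "\<bar>sqrt e\<bar> ^ DIM('a) * (2 * pi / e) powr ?m = (2 * pi) powr ?m"
    using e by (simp add: powr_half_sqrt[symmetric] powr_realpow[symmetric] powr_powr powr_divide)
  finally have "(\<integral>\<xi>. g \<xi> * gauss x e \<xi> \<partial>lborel) = complex_of_real ((2 * pi) powr ?m) *
     (\<integral>z. w (x + sqrt e *\<^sub>R z) * complex_of_real (exp (- (norm z)\<^sup>2 / 2)) \<partial>lborel)" .
  moreover have "complex_of_real ((2 * pi) powr (- ?m)) * complex_of_real ((2 * pi) powr ?m) = 1"
    unfolding of_real_mult[symmetric] powr_add[symmetric] by simp
  ultimately show ?thesis by (simp add: mult.assoc[symmetric])
qed

lemma weighted_L2_0: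
  assumes "w \<in> weighted_L2 0"
  shows "w \<in> borel_measurable borel" "integrable lborel (\<lambda>x. (norm (w x))\<^sup>2)"
  using assms by (auto simp: weighted_L2_def)

lemma L2_locally_integrable:
  fixes w :: "'a::euclidean_space \<Rightarrow> complex"
  assumes [measurable]: "w \<in> borel_measurable borel" and w: "integrable lborel (\<lambda>x. (norm (w x))\<^sup>2)"
  shows "integrable lborel (\<lambda>x. indicator (cball 0 R) x *\<^sub>R w x)"
proof (rule Bochner_Integration.integrable_bound[of _ "\<lambda>x. indicator (cball 0 R) x + (norm (w x))\<^sup>2"])
  have "integrable lborel (\<lambda>x. indicator (cball (0::'a) R) x :: real)"
    by (rule integrable_bounded_support[of _ 1 R]) (auto simp: indicator_def)
  then show "integrable lborel (\<lambda>x. indicator (cball 0 R) x + (norm (w x))\<^sup>2)" using w by simp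
  have "t \<le> 1 + t\<^sup>2" for t :: real
    using zero_le_power2[of "t - 1"] zero_le_power2[of t] unfolding power2_diff power_one mult_1_right by linarith
  then show "AE x in lborel. norm (indicator (cball 0 R) x *\<^sub>R w x) \<le> norm (indicator (cball 0 R) x + (norm (w x))\<^sup>2)"
    by (auto simp: indicator_def)
qed auto

text \<open>Exchanging the integrals moves the translation from \<open>w\<close>, which is only measurable, to the
  continuous function \<open>\<psi>\<close>.\<close>
lemma gaussian_mollification_tendsto:
  fixes w \<psi> :: "'a::euclidean_space \<Rightarrow> complex"
  assumes w: "w \<in> weighted_L2 0" and \<psi>: "continuous_on UNIV \<psi>" "\<And>x. norm x > R \<Longrightarrow> \<psi> x = 0" "\<And>x. norm (\<psi> x) \<le> B"
    and e: "\<And>n. e n > 0" "e \<longlonglongrightarrow> 0"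
  shows "(\<lambda>n. \<integral>x. \<psi> x * (\<integral>z. w (x + sqrt (e n) *\<^sub>R z) * complex_of_real (exp (- (norm z)\<^sup>2 / 2)) \<partial>lborel) \<partial>lborel) \<longlonglongrightarrow>
     (2 * pi) powr (real DIM('a) / 2) *\<^sub>R (\<integral>x. \<psi> x * w x \<partial>lborel)"
proof -
  note [measurable] = weighted_L2_0(1)[OF w] borel_measurable_continuous_onI[OF \<psi>(1)]
  have w2: "integrable lborel (\<lambda>x. (norm (w x))\<^sup>2)" by (rule weighted_L2_0(2)[OF w])
  have "B \<ge> 0" using order_trans[OF norm_ge_zero \<psi>(3)] by blast
  have \<psi>2: "integrable lborel (\<lambda>x. (norm (\<psi> x))\<^sup>2)"
    by (rule integrable_bounded_support[of _ "B\<^sup>2" R]) (use \<psi> in \<open>auto intro: power_mono\<close>)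
  let ?G = "\<lambda>z::'a. exp (- (norm z)\<^sup>2 / 2)"
  have G: "gauss 0 1 = (\<lambda>z. complex_of_real (?G z))"
    by (simp add: gauss_def power2_norm_eq_inner exp_of_real[symmetric] fun_eq_iff)
  have Gint: "integrable lborel (\<lambda>z. complex_of_real (?G z))" "(\<integral>z. complex_of_real (?G z) \<partial>lborel) = complex_of_real ((2 * pi) powr (real DIM('a) / 2))"
    using gauss_integral[of 1 "0::'a"] unfolding G by simp_all
  have Gint': "integrable lborel ?G"
    using integrable_norm[OF Gint(1)] by simp
  define D where "D = (\<integral>x. (norm (\<psi> x))\<^sup>2 \<partial>lborel) + (\<integral>x. (norm (w x))\<^sup>2 \<partial>lborel)"
  have sh: "integrable lborel (\<lambda>x. (norm (w (x + v)))\<^sup>2)" "(\<integral>x. (norm (w (x + v)))\<^sup>2 \<partial>lborel) = (\<integral>x. (norm (w x))\<^sup>2 \<partial>lborel)" for v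
    using integral_shift(1,2)[of "\<lambda>x. (norm (w x))\<^sup>2" "- v"] w2 by simp_all
  have int\<psi>w: "integrable lborel (\<lambda>x. \<psi> x * w (x + v))" "(\<integral>x. norm (\<psi> x * w (x + v)) \<partial>lborel) \<le> D" for v
  proof -
    have b: "norm (\<psi> x * w (x + v)) \<le> (norm (\<psi> x))\<^sup>2 + (norm (w (x + v)))\<^sup>2" for x
    proof -
      have "0 \<le> (norm (\<psi> x) - norm (w (x + v)))\<^sup>2" "0 \<le> norm (\<psi> x) * norm (w (x + v))" by auto
      then show ?thesis unfolding power2_diff norm_mult mult.assoc by linarith
    qed
    show i: "integrable lborel (\<lambda>x. \<psi> x * w (x + v))"
      by (rule Bochner_Integration.integrable_bound[of _ "\<lambda>x. (norm (\<psi> x))\<^sup>2 + (norm (w (x + v)))\<^sup>2"])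
         (use b \<psi>2 sh in auto)
    have "(\<integral>x. norm (\<psi> x * w (x + v)) \<partial>lborel) \<le> (\<integral>x. (norm (\<psi> x))\<^sup>2 + (norm (w (x + v)))\<^sup>2 \<partial>lborel)"
      by (intro integral_mono integrable_norm i b) (use \<psi>2 sh in auto)
    then show "(\<integral>x. norm (\<psi> x * w (x + v)) \<partial>lborel) \<le> D"
      using \<psi>2 sh by (simp add: D_def)
  qed
  define H where "H v = (\<integral>x. \<psi> x * w (x + v) \<partial>lborel)" for v
  have HD: "norm (H v) \<le> D" for v
    unfolding H_def by (rule order_trans[OF integral_norm_bound int\<psi>w(2)])
  have swap: "(\<integral>x. \<psi> x * (\<integral>z. w (x + sqrt (e n) *\<^sub>R z) * complex_of_real (?G z) \<partial>lborel) \<partial>lborel) =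
     (\<integral>z. complex_of_real (?G z) * H (sqrt (e n) *\<^sub>R z) \<partial>lborel)" for n
  proof -
    let ?f = "\<lambda>(z, x). \<psi> x * w (x + sqrt (e n) *\<^sub>R z) * complex_of_real (?G z)"
    have int: "integrable (lborel \<Otimes>\<^sub>M lborel) ?f"
    proof (rule lborel_pair.Fubini_integrable)
      show [measurable]: "?f \<in> borel_measurable (lborel \<Otimes>\<^sub>M lborel)" unfolding case_prod_unfold by measurable
      have "(\<integral>x. norm (\<psi> x * w (x + sqrt (e n) *\<^sub>R z) * complex_of_real (?G z)) \<partial>lborel) =
        (\<integral>x. norm (\<psi> x * w (x + sqrt (e n) *\<^sub>R z)) \<partial>lborel) * ?G z" for z
        by (subst integral_mult_left_zero[symmetric]) (simp add: norm_mult)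
      then have eq: "(\<integral>x. norm (?f (z, x)) \<partial>lborel) = (\<integral>x. norm (\<psi> x * w (x + sqrt (e n) *\<^sub>R z)) \<partial>lborel) * ?G z" for z
        by simp
      show "integrable lborel (\<lambda>z. \<integral>x. norm (?f (z, x)) \<partial>lborel)"
      proof (rule Bochner_Integration.integrable_bound[of _ "\<lambda>z. D * ?G z"])
        show "integrable lborel (\<lambda>z. D * ?G z)" using Gint' by simp
        show "AE z in lborel. norm (\<integral>x. norm (?f (z, x)) \<partial>lborel) \<le> norm (D * ?G z)"
        proof (rule AE_I2)
          fix z :: 'a
          have "0 \<le> (\<integral>x. norm (\<psi> x * w (x + sqrt (e n) *\<^sub>R z)) \<partial>lborel)" by simp
          with int\<psi>w(2)[of "sqrt (e n) *\<^sub>R z"] have "(\<integral>x. norm (\<psi> x * w (x + sqrt (e n) *\<^sub>R z)) \<partial>lborel) * ?G z \<le> \<bar>D\<bar> * ?G z"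
            by (intro mult_right_mono) auto
          then show "norm (\<integral>x. norm (?f (z, x)) \<partial>lborel) \<le> norm (D * ?G z)"
            unfolding eq by (simp add: abs_mult)
        qed
      qed measurable
      show "AE z in lborel. integrable lborel (\<lambda>x. ?f (z, x))"
        using int\<psi>w(1) by simp
    qed
    have "(\<integral>x. \<psi> x * (\<integral>z. w (x + sqrt (e n) *\<^sub>R z) * complex_of_real (?G z) \<partial>lborel) \<partial>lborel) =
      (\<integral>x. (\<integral>z. \<psi> x * w (x + sqrt (e n) *\<^sub>R z) * complex_of_real (?G z) \<partial>lborel) \<partial>lborel)"
      by (simp only: mult.assoc integral_mult_right_zero)
    also have "\<dots> = (\<integral>z. (\<integral>x. \<psi> x * w (x + sqrt (e n) *\<^sub>R z) * complex_of_real (?G z) \<partial>lborel) \<partial>lborel)"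
      by (rule lborel_pair.Fubini_integral[OF int])
    also have "\<dots> = (\<integral>z. complex_of_real (?G z) * H (sqrt (e n) *\<^sub>R z) \<partial>lborel)"
      unfolding H_def by (simp only: integral_mult_right_zero mult.commute[of _ "complex_of_real (?G _)"])
    finally show ?thesis .
  qed
  have Hm[measurable]: "H \<in> borel_measurable borel" unfolding H_def by measurable
  have Hcont: "(\<lambda>n. H (v n)) \<longlonglongrightarrow> H 0" if v: "v \<longlonglongrightarrow> 0" for v
  proof -
    obtain K where K: "\<And>n. norm (v n) \<le> K" using convergent_imp_Bseq[OF convergentI[OF v]] by (auto simp: Bseq_def)
    have Hv: "H v = (\<integral>y. \<psi> (y - v) * w y \<partial>lborel)" for v
      unfolding H_def using integral_shift(1)[of "\<lambda>x. \<psi> x * w (x + v)" v] by simp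
    show ?thesis unfolding Hv
    proof (rule integral_dominated_convergence[where w = "\<lambda>y. B * norm (indicator (cball 0 (R + K)) y *\<^sub>R w y)"])
      show "integrable lborel (\<lambda>y. B * norm (indicator (cball 0 (R + K)) y *\<^sub>R w y))"
        by (intro integrable_mult_right integrable_norm L2_locally_integrable w2) measurable
      have "(\<lambda>n. \<psi> (y - v n)) \<longlonglongrightarrow> \<psi> (y - 0)" for y
        by (rule continuous_on_tendsto_compose[OF \<psi>(1)]) (intro tendsto_intros v, auto)
      then show "AE y in lborel. (\<lambda>n. \<psi> (y - v n) * w y) \<longlonglongrightarrow> \<psi> (y - 0) * w y"
        by (intro AE_I2 tendsto_intros)
      show "AE y in lborel. norm (\<psi> (y - v n) * w y) \<le> B * norm (indicator (cball 0 (R + K)) y *\<^sub>R w y)" for n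
      proof (rule AE_I2)
        fix y
        show "norm (\<psi> (y - v n) * w y) \<le> B * norm (indicator (cball 0 (R + K)) y *\<^sub>R w y)"
        proof (cases "norm y \<le> R + K")
          case True
          then show ?thesis using \<psi>(3)[of "y - v n"] by (simp add: norm_mult mult_right_mono)
        next
          case False
          then have "norm (y - v n) > R" using K[of n] norm_triangle_ineq2[of y "v n"] by linarith
          then show ?thesis using \<psi>(2) \<open>B \<ge> 0\<close> by simp
        qed
      qed
    qed measurable
  qed
  have "(\<lambda>n. \<integral>z. complex_of_real (?G z) * H (sqrt (e n) *\<^sub>R z) \<partial>lborel) \<longlonglongrightarrow> (\<integral>z. complex_of_real (?G z) * H 0 \<partial>lborel)"
  proof (rule integral_dominated_convergence[where w = "\<lambda>z. D * ?G z"])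
    show "integrable lborel (\<lambda>z. D * ?G z)" using Gint' by simp
    have "(\<lambda>n. sqrt (e n) *\<^sub>R z) \<longlonglongrightarrow> sqrt 0 *\<^sub>R z" for z :: 'a
      by (intro tendsto_intros e)
    then show "AE z in lborel. (\<lambda>n. complex_of_real (?G z) * H (sqrt (e n) *\<^sub>R z)) \<longlonglongrightarrow> complex_of_real (?G z) * H 0"
      by (intro AE_I2 tendsto_intros Hcont) simp
    show "AE z in lborel. norm (complex_of_real (?G z) * H (sqrt (e n) *\<^sub>R z)) \<le> D * ?G z" for n
      using HD by (auto simp: norm_mult mult.commute[of D] intro!: mult_left_mono)
  qed measurable
  also have "(\<integral>z. complex_of_real (?G z) * H 0 \<partial>lborel) = (2 * pi) powr (real DIM('a) / 2) *\<^sub>R (\<integral>x. \<psi> x * w x \<partial>lborel)"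
    unfolding integral_mult_left_zero Gint(2) by (simp add: H_def scaleR_conv_of_real)
  finally show ?thesis unfolding swap .
qed

text \<open>Cauchy-Schwarz in frequency space between \<open>\<langle>\<xi>\<rangle>^s g\<close> and \<open>\<langle>\<xi>\<rangle>^(-s) \<Psi>\<close>. The bound does not
  depend on the mollification parameter \<open>e\<close>.\<close>
lemma mollified_pairing_bound:
  fixes w g \<psi> :: "'a::euclidean_space \<Rightarrow> complex"
  assumes hft: "has_fourier_transform w g" and gm[measurable]: "g \<in> borel_measurable borel"
    and g: "integrable lborel (\<lambda>\<xi>. japanese_bracket \<xi> powr (2 * s) * (cmod (g \<xi>))\<^sup>2)"
    and \<psi>: "integrable lborel \<psi>" and e: "e > 0"
    and s: "s > 0" and b: "0 \<le> b" "b \<le> 1" "b \<le> real DIM('a) / 2" "s + b - real DIM('a) / 2 > 0"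
  shows "ennreal ((norm (\<integral>x. \<psi> x * (\<integral>z. w (x + sqrt e *\<^sub>R z) * complex_of_real (exp (- (norm z)\<^sup>2 / 2)) \<partial>lborel) \<partial>lborel))\<^sup>2) \<le>
     ennreal ((2 * pi) powr (- real DIM('a)) * (\<integral>\<xi>. japanese_bracket \<xi> powr (2 * s) * (cmod (g \<xi>))\<^sup>2 \<partial>lborel) *
       (pi powr (real DIM('a) / 2) * 4 powr b * Gamma (s + b - real DIM('a) / 2) / Gamma s)) * riesz_energy (2 * b) \<psi>"
proof -
  let ?m = "real DIM('a) / 2"
  let ?E = "gauss (0::'a) e"
  have E: "?E \<xi> = complex_of_real (exp (- (e / 2 * (norm \<xi>)\<^sup>2)))" for \<xi>
    by (simp add: gauss_def power2_norm_eq_inner exp_of_real[symmetric])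
  have [measurable]: "\<psi> \<in> borel_measurable borel" using \<psi> by auto
  have gm'[measurable]: "(\<lambda>p. gauss (snd p) q (fst p)) \<in> borel_measurable (borel \<Otimes>\<^sub>M borel)"
     "(\<lambda>p. gauss (fst p) q (snd p :: 'a)) \<in> borel_measurable (borel \<Otimes>\<^sub>M borel)" for q
    unfolding gauss_def by measurable
  define \<Psi> where "\<Psi> \<xi> = (\<integral>x. gauss x 0 \<xi> * \<psi> x \<partial>lborel)" for \<xi>
  have [measurable]: "\<Psi> \<in> borel_measurable borel" unfolding \<Psi>_def by measurable
  have g1: "norm (gauss x 0 \<xi>) = 1" for x \<xi> :: 'a by (simp add: norm_gauss)
  define N where "N = (\<integral>x. norm (\<psi> x) \<partial>lborel)"
  have \<Psi>N: "norm (\<Psi> \<xi>) \<le> N" for \<xi>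
    unfolding \<Psi>_def N_def by (rule order_trans[OF integral_norm_bound]) (simp add: norm_mult g1)
  have "N \<ge> 0" unfolding N_def by simp
  let ?f = "\<lambda>\<xi>. japanese_bracket \<xi> powr s * cmod (g \<xi>)"
  have jp: "japanese_bracket x > 0" for x :: 'a using japanese_bracket_ge_1[of x] by simp
  have f2: "(?f \<xi>)\<^sup>2 = japanese_bracket \<xi> powr (2 * s) * (cmod (g \<xi>))\<^sup>2" for \<xi>
    using jp[of \<xi>] by (simp add: power_mult_distrib powr_power mult.commute)
  have fint: "integrable lborel (\<lambda>\<xi>. (?f \<xi>)\<^sup>2)" unfolding f2 by (rule g)
  have eint: "integrable lborel (\<lambda>\<xi>::'a. exp (- (q * (norm \<xi>)\<^sup>2)))" if "q > 0" for q
  proof -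
    have "integrable lborel (\<lambda>\<xi>. norm (gauss (0::'a) (2 * q) \<xi>))"
      using that by (intro integrable_norm gauss_integral) auto
    then show ?thesis by (simp add: norm_gauss)
  qed
  have gE: "integrable lborel (\<lambda>\<xi>. g \<xi> * ?E \<xi>)"
  proof (rule Bochner_Integration.integrable_bound[of _ "\<lambda>\<xi>. ?f \<xi> * exp (- (e / 2 * (norm \<xi>)\<^sup>2))"])
    show "integrable lborel (\<lambda>\<xi>. ?f \<xi> * exp (- (e / 2 * (norm \<xi>)\<^sup>2)))"
      by (rule Cauchy_Schwarz_integral(1)[OF _ _ fint])
         (use eint[OF e] in \<open>auto simp: power2_eq_square exp_add[symmetric]\<close>)
    have "1 \<le> japanese_bracket \<xi> powr s" for \<xi> :: 'a
      using s japanese_bracket_ge_1[of \<xi>] by (simp add: ge_one_powr_ge_zero)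
    then have "1 * cmod (g \<xi>) \<le> ?f \<xi>" for \<xi>
      using mult_right_mono[of 1 "japanese_bracket \<xi> powr s" "cmod (g \<xi>)"] by simp
    then have "1 * cmod (g \<xi>) * exp (- (e / 2 * (norm \<xi>)\<^sup>2)) \<le> ?f \<xi> * exp (- (e / 2 * (norm \<xi>)\<^sup>2))" for \<xi>
      by (rule mult_right_mono) simp
    then show "AE \<xi> in lborel. norm (g \<xi> * ?E \<xi>) \<le> norm (?f \<xi> * exp (- (e / 2 * (norm \<xi>)\<^sup>2)))"
      by (auto simp: norm_mult norm_gauss)
  qed measurable
  let ?h = "\<lambda>\<xi>. japanese_bracket \<xi> powr (- s) * exp (- (e / 2 * (norm \<xi>)\<^sup>2)) * norm (\<Psi> \<xi>)"
  have h2: "(?h \<xi>)\<^sup>2 = japanese_bracket \<xi> powr (- (2 * s)) * exp (- (e * (norm \<xi>)\<^sup>2)) * (norm (\<Psi> \<xi>))\<^sup>2" for \<xi>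
  proof -
    have "(exp (- (e / 2 * (norm \<xi>)\<^sup>2)))\<^sup>2 = exp (- (e * (norm \<xi>)\<^sup>2))"
      by (simp add: power2_eq_square exp_add[symmetric])
    then show ?thesis using jp[of \<xi>] by (simp add: power_mult_distrib powr_power mult.commute)
  qed
  have hint: "integrable lborel (\<lambda>\<xi>. (?h \<xi>)\<^sup>2)"
  proof (rule Bochner_Integration.integrable_bound[of _ "\<lambda>\<xi>. N\<^sup>2 * exp (- (e * (norm \<xi>)\<^sup>2))"])
    show "integrable lborel (\<lambda>\<xi>::'a. N\<^sup>2 * exp (- (e * (norm \<xi>)\<^sup>2)))" using eint[OF e] by simp
    show "AE \<xi> in lborel. norm ((?h \<xi>)\<^sup>2) \<le> norm (N\<^sup>2 * exp (- (e * (norm \<xi>)\<^sup>2)))"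
    proof (rule AE_I2)
      fix \<xi> :: 'a
      have "japanese_bracket \<xi> powr (- (2 * s)) \<le> 1"
        using s japanese_bracket_ge_1[of \<xi>] powr_mono[of "- (2 * s)" 0 "japanese_bracket \<xi>"] jp[of \<xi>] by simp
      moreover have "(norm (\<Psi> \<xi>))\<^sup>2 \<le> N\<^sup>2" using \<Psi>N by (intro power_mono) auto
      ultimately have "japanese_bracket \<xi> powr (- (2 * s)) * exp (- (e * (norm \<xi>)\<^sup>2)) * (norm (\<Psi> \<xi>))\<^sup>2 \<le> 1 * exp (- (e * (norm \<xi>)\<^sup>2)) * N\<^sup>2"
        by (intro mult_mono) auto
      then show "norm ((?h \<xi>)\<^sup>2) \<le> norm (N\<^sup>2 * exp (- (e * (norm \<xi>)\<^sup>2)))"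
        unfolding h2 by (simp add: mult.commute)
    qed
  qed measurable
  have "(\<integral>x. \<psi> x * (\<integral>z. w (x + sqrt e *\<^sub>R z) * complex_of_real (exp (- (norm z)\<^sup>2 / 2)) \<partial>lborel) \<partial>lborel) =
    (\<integral>x. \<psi> x * (complex_of_real ((2 * pi) powr (- ?m)) * (\<integral>\<xi>. gauss x 0 \<xi> * (g \<xi> * ?E \<xi>) \<partial>lborel)) \<partial>lborel)"
  proof -
    have "gauss x e \<xi> = gauss x 0 \<xi> * ?E \<xi>" for x \<xi> :: 'a
      by (simp add: gauss_def exp_add[symmetric])
    then have "(\<integral>\<xi>. g \<xi> * gauss x e \<xi> \<partial>lborel) = (\<integral>\<xi>. gauss x 0 \<xi> * (g \<xi> * ?E \<xi>) \<partial>lborel)" for x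
      by (intro Bochner_Integration.integral_cong refl) (metis mult.left_commute)
    then show ?thesis by (simp only: heat_kernel_fourier[OF hft e])
  qed
  also have "\<dots> = complex_of_real ((2 * pi) powr (- ?m)) * (\<integral>x. \<psi> x * (\<integral>\<xi>. gauss x 0 \<xi> * (g \<xi> * ?E \<xi>) \<partial>lborel) \<partial>lborel)"
    by (subst integral_mult_right_zero[symmetric]) (simp add: mult_ac)
  also have "(\<integral>x. \<psi> x * (\<integral>\<xi>. gauss x 0 \<xi> * (g \<xi> * ?E \<xi>) \<partial>lborel) \<partial>lborel) = (\<integral>\<xi>. (\<integral>x. \<psi> x * gauss x 0 \<xi> \<partial>lborel) * (g \<xi> * ?E \<xi>) \<partial>lborel)"
    by (rule integral_bounded_kernel_swap(1)[where B = 1]) (use \<psi> gE g1 gm' in auto)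
  also have "\<dots> = (\<integral>\<xi>. \<Psi> \<xi> * (g \<xi> * ?E \<xi>) \<partial>lborel)" unfolding \<Psi>_def by (simp add: mult.commute)
  finally have eq: "(\<integral>x. \<psi> x * (\<integral>z. w (x + sqrt e *\<^sub>R z) * complex_of_real (exp (- (norm z)\<^sup>2 / 2)) \<partial>lborel) \<partial>lborel) =
     complex_of_real ((2 * pi) powr (- ?m)) * (\<integral>\<xi>. \<Psi> \<xi> * (g \<xi> * ?E \<xi>) \<partial>lborel)" (is "?L = _ * ?I") .
  have "norm ?I \<le> (\<integral>\<xi>. norm (\<Psi> \<xi> * (g \<xi> * ?E \<xi>)) \<partial>lborel)" by (rule integral_norm_bound)
  also have "\<dots> = (\<integral>\<xi>. ?f \<xi> * ?h \<xi> \<partial>lborel)"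
  proof (rule Bochner_Integration.integral_cong[OF refl])
    fix \<xi> :: 'a
    have "?f \<xi> * ?h \<xi> = (japanese_bracket \<xi> powr s * japanese_bracket \<xi> powr (- s)) *
        (cmod (g \<xi>) * exp (- (e / 2 * (norm \<xi>)\<^sup>2)) * norm (\<Psi> \<xi>))"
      by (simp only: mult_ac)
    also have "japanese_bracket \<xi> powr s * japanese_bracket \<xi> powr (- s) = 1"
      using jp[of \<xi>] by (simp add: powr_add[symmetric])
    finally have fh: "?f \<xi> * ?h \<xi> = 1 * (cmod (g \<xi>) * exp (- (e / 2 * (norm \<xi>)\<^sup>2)) * norm (\<Psi> \<xi>))" .
    show "norm (\<Psi> \<xi> * (g \<xi> * ?E \<xi>)) = ?f \<xi> * ?h \<xi>"
      unfolding fh by (simp add: norm_mult norm_gauss)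
  qed
  finally have "(norm ?I)\<^sup>2 \<le> (\<integral>\<xi>. ?f \<xi> * ?h \<xi> \<partial>lborel)\<^sup>2" by (rule power_mono) simp
  also have "\<dots> \<le> (\<integral>\<xi>. (?f \<xi>)\<^sup>2 \<partial>lborel) * (\<integral>\<xi>. (?h \<xi>)\<^sup>2 \<partial>lborel)"
    by (rule Cauchy_Schwarz_integral(2)[OF _ _ fint hint]) measurable
  finally have I: "(norm ?I)\<^sup>2 \<le> (\<integral>\<xi>. (?f \<xi>)\<^sup>2 \<partial>lborel) * (\<integral>\<xi>. (?h \<xi>)\<^sup>2 \<partial>lborel)" .
  have "(norm ?L)\<^sup>2 = (2 * pi) powr (- real DIM('a)) * (norm ?I)\<^sup>2"
    unfolding eq by (simp add: norm_mult power_mult_distrib powr_power)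
  also have "\<dots> \<le> (2 * pi) powr (- real DIM('a)) * ((\<integral>\<xi>. (?f \<xi>)\<^sup>2 \<partial>lborel) * (\<integral>\<xi>. (?h \<xi>)\<^sup>2 \<partial>lborel))"
    by (intro mult_left_mono I) auto
  finally have "ennreal ((norm ?L)\<^sup>2) \<le> ennreal ((2 * pi) powr (- real DIM('a)) * (\<integral>\<xi>. (?f \<xi>)\<^sup>2 \<partial>lborel)) * ennreal (\<integral>\<xi>. (?h \<xi>)\<^sup>2 \<partial>lborel)"
    by (subst ennreal_mult[symmetric]) (auto intro!: ennreal_leI simp: mult.assoc)
  also have "\<dots> \<le> ennreal ((2 * pi) powr (- real DIM('a)) * (\<integral>\<xi>. (?f \<xi>)\<^sup>2 \<partial>lborel)) *
     (ennreal (pi powr ?m * 4 powr b * Gamma (s + b - ?m) / Gamma s) * riesz_energy (2 * b) \<psi>)"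
  proof (rule mult_left_mono)
    have "ennreal (\<integral>\<xi>. (?h \<xi>)\<^sup>2 \<partial>lborel) = (\<integral>\<^sup>+\<xi>. ennreal ((?h \<xi>)\<^sup>2) \<partial>lborel)"
      by (rule nn_integral_eq_integral[OF hint, symmetric]) auto
    also have "\<dots> \<le> ennreal (pi powr ?m * 4 powr b * Gamma (s + b - ?m) / Gamma s) * riesz_energy (2 * b) \<psi>"
      unfolding h2 unfolding \<Psi>_def by (rule weighted_transform_le_riesz_energy[OF \<psi> e s b])
    finally show "ennreal (\<integral>\<xi>. (?h \<xi>)\<^sup>2 \<partial>lborel) \<le> ennreal (pi powr ?m * 4 powr b * Gamma (s + b - ?m) / Gamma s) * riesz_energy (2 * b) \<psi>" .
  qed simp
  also have "\<dots> = ennreal ((2 * pi) powr (- real DIM('a)) * (\<integral>\<xi>. (?f \<xi>)\<^sup>2 \<partial>lborel) *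
     (pi powr ?m * 4 powr b * Gamma (s + b - ?m) / Gamma s)) * riesz_energy (2 * b) \<psi>"
    by (subst ennreal_mult') (auto simp: mult.assoc)
  finally show ?thesis unfolding f2 .
qed

lemma singularity_integral_cball_bound:
  assumes p: "0 \<le> p" "p < real DIM('a::euclidean_space)"
  obtains M where "\<And>x y::'a. (\<integral>\<^sup>+z. ennreal (singularity (z - y) powr p) * indicator (cball x r) z \<partial>lborel) \<le> ennreal M" "M \<ge> 0"
proof -
  let ?I = "(\<integral>\<^sup>+z. ennreal (singularity (z - 0) powr p) * indicator (cball (0::'a) 1) z \<partial>lborel) + emeasure lborel (cball (0::'a) r)"
  have "?I < \<infinity>"
  proof -
    have "emeasure lborel (cball (0::'a) r) < \<infinity>" by (rule emeasure_bounded_finite) simp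
    then show ?thesis using singularity_integral_finite[OF p(2), of 0 1] by (simp add: ennreal_add_less_top)
  qed
  then have fin: "ennreal (enn2real ?I) = ?I" by simp
  have "(\<integral>\<^sup>+z. ennreal (singularity (z - y) powr p) * indicator (cball x r) z \<partial>lborel) \<le> ?I" for x y :: 'a
  proof -
    have "(\<integral>\<^sup>+z. ennreal (singularity (z - y) powr p) * indicator (cball x r) z \<partial>lborel) \<le>
      (\<integral>\<^sup>+z. ennreal (singularity (z - y) powr p) * indicator (cball 0 1) (z - y) + indicator (cball x r) z \<partial>lborel)"
    proof (rule nn_integral_mono)
      fix z :: 'a
      show "ennreal (singularity (z - y) powr p) * indicator (cball x r) z \<le>
        ennreal (singularity (z - y) powr p) * indicator (cball 0 1) (z - y) + indicator (cball x r) z"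
      proof (cases "norm (z - y) \<le> 1")
        case True
        then show ?thesis by (auto simp: indicator_def)
      next
        case False
        then have "1 / norm (z - y) \<le> 1" by (simp add: divide_le_eq_1)
        then have "singularity (z - y) = 1" by (simp add: singularity_def)
        then show ?thesis by (auto simp: indicator_def)
      qed
    qed
    also have "\<dots> = (\<integral>\<^sup>+z. ennreal (singularity (z - y) powr p) * indicator (cball 0 1) (z - y) \<partial>lborel) + emeasure lborel (cball x r)"
      by (subst nn_integral_add) auto
    also have "(\<integral>\<^sup>+z. ennreal (singularity (z - y) powr p) * indicator (cball 0 1) (z - y) \<partial>lborel) =
       (\<integral>\<^sup>+z. ennreal (singularity z powr p) * indicator (cball (0::'a) 1) z \<partial>lborel)"
      by (rule nn_integral_shift[where f = "\<lambda>z. ennreal (singularity z powr p) * indicator (cball 0 1) z"]) measurable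
    also have "emeasure lborel (cball x r) = emeasure lborel (cball (0::'a) r)"
    proof (cases "r \<ge> 0")
      case True then show ?thesis by (simp add: emeasure_cball)
    qed simp
    finally show ?thesis by simp
  qed
  then show ?thesis using that[of "enn2real ?I"] unfolding fin by simp
qed

lemma singularity_powr_product_le:
  assumes "p \<ge> 0" "q \<ge> 0"
  shows "singularity x powr p * singularity y powr q \<le> singularity x powr (p + q) + singularity y powr (p + q)"
proof (cases "singularity x \<le> singularity y")
  case True
  have "singularity x powr p * singularity y powr q \<le> singularity y powr p * singularity y powr q"
    using True singularity_pos[of x] assms by (intro mult_right_mono powr_mono2) auto
  also have "\<dots> = singularity y powr (p + q)" by (simp add: powr_add)
  finally show ?thesis by (simp add: add_increasing)
next
  case False
  have "singularity x powr p * singularity y powr q \<le> singularity x powr p * singularity x powr q"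
    using False singularity_pos[of y] assms by (intro mult_left_mono powr_mono2) auto
  also have "\<dots> = singularity x powr (p + q)" by (simp add: powr_add)
  finally show ?thesis by (simp add: add_increasing2)
qed

lemma riesz_energy_tendsto:
  fixes \<psi> :: "'a::euclidean_space \<Rightarrow> complex"
  assumes p: "0 \<le> p" "p < real DIM('a)"
    and [measurable]: "\<psi> \<in> borel_measurable borel" "\<And>n. g n \<in> borel_measurable borel"
    and g: "\<And>n x. norm (g n x) \<le> B" "\<And>n x. norm x > R \<Longrightarrow> g n x = 0"
    and lim: "AE x in lborel. (\<lambda>n. g n x) \<longlonglongrightarrow> \<psi> x"
  shows "(\<lambda>n. riesz_energy p (g n)) \<longlonglongrightarrow> riesz_energy p \<psi>"
proof -
  obtain M where M: "\<And>x y::'a. (\<integral>\<^sup>+z. ennreal (singularity (z - y) powr p) * indicator (cball x R) z \<partial>lborel) \<le> ennreal M" "M \<ge> 0"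
    using singularity_integral_cball_bound[OF p] by blast
  have "B \<ge> 0" using order_trans[OF norm_ge_zero g(1)] by blast
  have bnd: "ennreal (norm (g n x) * norm (g n y) * singularity (x - y) powr p) \<le>
     ennreal (B\<^sup>2) * indicator (cball 0 R) y * (ennreal (singularity (x - y) powr p) * indicator (cball 0 R) x)" for n x y
  proof (cases "norm x \<le> R \<and> norm y \<le> R")
    case True
    have "norm (g n x) * norm (g n y) * singularity (x - y) powr p \<le> B * B * singularity (x - y) powr p"
      using g(1) \<open>B \<ge> 0\<close> by (intro mult_right_mono mult_mono) auto
    then show ?thesis using True by (simp add: ennreal_mult'[symmetric] ennreal_leI power2_eq_square)
  next
    case False
    then show ?thesis using g(2)[of x n] g(2)[of y n] by (auto simp: not_le)
  qed
  have lim2: "(\<lambda>n. ennreal (norm (g n x) * norm (g n y) * singularity (x - y) powr p)) \<longlonglongrightarrow>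
      ennreal (norm (\<psi> x) * norm (\<psi> y) * singularity (x - y) powr p)"
    if "(\<lambda>n. g n x) \<longlonglongrightarrow> \<psi> x" "(\<lambda>n. g n y) \<longlonglongrightarrow> \<psi> y" for x y
    by (intro tendsto_ennrealI tendsto_intros that)
  have fin: "(\<integral>\<^sup>+x. ennreal (B\<^sup>2) * indicator (cball 0 R) y * (ennreal (singularity (x - y) powr p) * indicator (cball 0 R) x) \<partial>lborel) \<le>
     ennreal (B\<^sup>2 * M) * indicator (cball 0 R) y" for y :: 'a
    using M(1)[of y 0] \<open>M \<ge> 0\<close>
    by (subst nn_integral_cmult) (auto simp: ennreal_mult' indicator_def intro!: mult_left_mono)
  show ?thesis
    unfolding riesz_energy_def
  proof (rule nn_integral_dominated_convergence[where w = "\<lambda>y. ennreal (B\<^sup>2 * M) * indicator (cball 0 R) y"])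
    show "AE y in lborel. (\<integral>\<^sup>+x. ennreal (norm (g n x) * norm (g n y) * singularity (x - y) powr p) \<partial>lborel)
       \<le> ennreal (B\<^sup>2 * M) * indicator (cball 0 R) y" for n
      by (rule AE_I2, rule order_trans[OF nn_integral_mono[OF bnd] fin])
    have "emeasure lborel (cball (0::'a) R) < \<infinity>" by (rule emeasure_bounded_finite) simp
    then show "(\<integral>\<^sup>+y. ennreal (B\<^sup>2 * M) * indicator (cball (0::'a) R) y \<partial>lborel) < \<infinity>"
      by (simp add: nn_integral_cmult ennreal_mult_less_top)
    show "AE y in lborel. (\<lambda>n. \<integral>\<^sup>+x. ennreal (norm (g n x) * norm (g n y) * singularity (x - y) powr p) \<partial>lborel)
        \<longlonglongrightarrow> (\<integral>\<^sup>+x. ennreal (norm (\<psi> x) * norm (\<psi> y) * singularity (x - y) powr p) \<partial>lborel)"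
      using lim
    proof eventually_elim
      fix y assume y: "(\<lambda>n. g n y) \<longlonglongrightarrow> \<psi> y"
      show "(\<lambda>n. \<integral>\<^sup>+x. ennreal (norm (g n x) * norm (g n y) * singularity (x - y) powr p) \<partial>lborel)
        \<longlonglongrightarrow> (\<integral>\<^sup>+x. ennreal (norm (\<psi> x) * norm (\<psi> y) * singularity (x - y) powr p) \<partial>lborel)"
      proof (rule nn_integral_dominated_convergence[where w = "\<lambda>x. ennreal (B\<^sup>2) * indicator (cball 0 R) y * (ennreal (singularity (x - y) powr p) * indicator (cball 0 R) x)"])
        show "(\<integral>\<^sup>+x. ennreal (B\<^sup>2) * indicator (cball 0 R) y * (ennreal (singularity (x - y) powr p) * indicator (cball 0 R) x) \<partial>lborel) < \<infinity>"
          using le_less_trans[OF fin[of y], of \<infinity>] by (auto simp: indicator_def)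
        show "AE x in lborel. (\<lambda>n. ennreal (norm (g n x) * norm (g n y) * singularity (x - y) powr p)) \<longlonglongrightarrow>
            ennreal (norm (\<psi> x) * norm (\<psi> y) * singularity (x - y) powr p)"
          using lim by eventually_elim (rule lim2[OF _ y])
      qed (auto intro: bnd)
    qed
  qed measurable
qed

text \<open>Everything that is used of the Sobolev regularity of \<open>w\<close>: as a functional it is bounded by a Riesz
  energy. For \<open>s > d/2 - 1\<close> there is an admissible \<open>b < 1\<close>, and this gain over the exponent 2 of the
  Laplacian is what makes the cubic term subcritical.\<close>
lemma sobolev_pairing_bound:
  fixes w :: "'a::euclidean_space \<Rightarrow> complex"
  assumes w: "w \<in> sobolev_H s" and s: "s > 0"
    and b: "0 \<le> b" "b \<le> 1" "2 * b < real DIM('a)" "s + b - real DIM('a) / 2 > 0"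
  obtains C where "C \<ge> 0"
    "\<And>\<psi> B R. \<psi> \<in> borel_measurable borel \<Longrightarrow> (\<And>x. norm (\<psi> x) \<le> B) \<Longrightarrow> (\<And>x. norm x > R \<Longrightarrow> \<psi> x = 0) \<Longrightarrow>
      ennreal ((norm (\<integral>x. \<psi> x * w x \<partial>lborel))\<^sup>2) \<le> ennreal C * riesz_energy (2 * b) \<psi>"
proof -
  from w obtain g where w0: "w \<in> weighted_L2 0" and gm: "g \<in> borel_measurable borel" and hft: "has_fourier_transform w g"
    and g: "integrable lborel (\<lambda>\<xi>. japanese_bracket \<xi> powr (2 * s) * (cmod (g \<xi>))\<^sup>2)"
    unfolding sobolev_H_def by auto
  let ?m = "real DIM('a) / 2"
  have b3: "b \<le> ?m" using b by simp
  note [measurable] = weighted_L2_0(1)[OF w0]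
  define C0 where "C0 = (2 * pi) powr (- real DIM('a)) * (\<integral>\<xi>. japanese_bracket \<xi> powr (2 * s) * (cmod (g \<xi>))\<^sup>2 \<partial>lborel) *
       (pi powr (real DIM('a) / 2) * 4 powr b * Gamma (s + b - real DIM('a) / 2) / Gamma s)"
  define P where "P = (2 * pi) powr ?m"
  have "P > 0" by (simp add: P_def)
  have "C0 \<ge> 0" unfolding C0_def using Gamma_real_pos[OF s] Gamma_real_pos[OF b(4)] by simp
  have cont: "ennreal ((norm (\<integral>x. \<psi> x * w x \<partial>lborel))\<^sup>2) \<le> ennreal (C0 / P\<^sup>2) * riesz_energy (2 * b) \<psi>"
    if \<psi>: "continuous_on UNIV \<psi>" "\<And>x. norm (\<psi> x) \<le> B" "\<And>x. norm x > R \<Longrightarrow> \<psi> x = 0" for \<psi> B R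
  proof -
    have [measurable]: "\<psi> \<in> borel_measurable borel" by (rule borel_measurable_continuous_onI[OF \<psi>(1)])
    have \<psi>i: "integrable lborel \<psi>" by (rule integrable_bounded_support[of _ B R]) (use \<psi> in auto)
    define e where "e n = inverse (real (Suc n))" for n
    have e: "\<And>n. e n > 0" "e \<longlonglongrightarrow> 0" unfolding e_def using LIMSEQ_inverse_real_of_nat by auto
    let ?L = "\<lambda>n. \<integral>x. \<psi> x * (\<integral>z. w (x + sqrt (e n) *\<^sub>R z) * complex_of_real (exp (- (norm z)\<^sup>2 / 2)) \<partial>lborel) \<partial>lborel"
    have "?L \<longlonglongrightarrow> P *\<^sub>R (\<integral>x. \<psi> x * w x \<partial>lborel)"
      unfolding P_def by (rule gaussian_mollification_tendsto[OF w0 \<psi>(1,3,2) e])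
    then have "(\<lambda>n. ennreal ((norm (?L n))\<^sup>2)) \<longlonglongrightarrow> ennreal ((norm (P *\<^sub>R (\<integral>x. \<psi> x * w x \<partial>lborel)))\<^sup>2)"
      by (intro tendsto_ennrealI tendsto_power tendsto_norm)
    then have "ennreal ((norm (P *\<^sub>R (\<integral>x. \<psi> x * w x \<partial>lborel)))\<^sup>2) \<le> ennreal C0 * riesz_energy (2 * b) \<psi>"
    proof (rule LIMSEQ_le_const2, intro exI allI impI)
      show "ennreal ((norm (?L n))\<^sup>2) \<le> ennreal C0 * riesz_energy (2 * b) \<psi>" for n
        unfolding C0_def by (rule mollified_pairing_bound[OF hft gm g \<psi>i e(1) s b(1,2) b3 b(4)])
    qed
    then have "ennreal (1 / P\<^sup>2) * ennreal ((norm (P *\<^sub>R (\<integral>x. \<psi> x * w x \<partial>lborel)))\<^sup>2) \<le> ennreal (1 / P\<^sup>2) * (ennreal C0 * riesz_energy (2 * b) \<psi>)"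
      by (rule mult_left_mono) simp
    then show ?thesis
      using \<open>P > 0\<close> by (simp add: mult.assoc[symmetric] ennreal_mult'[symmetric] power_mult_distrib)
  qed
  show ?thesis
  proof (rule that[of "C0 / P\<^sup>2"])
    show "C0 / P\<^sup>2 \<ge> 0" using \<open>C0 \<ge> 0\<close> by simp
    fix \<psi> :: "'a \<Rightarrow> complex" and B R
    assume \<psi>m[measurable]: "\<psi> \<in> borel_measurable borel" and \<psi>: "\<And>x. norm (\<psi> x) \<le> B" "\<And>x. norm x > R \<Longrightarrow> \<psi> x = 0"
    have "norm (\<psi> x) \<le> \<bar>B\<bar> + 1" for x using \<psi>(1)[of x] by linarith
    then obtain g where g: "\<And>n::nat. continuous_on UNIV (g n)" "\<And>n x. norm (g n x) \<le> \<bar>B\<bar> + 1"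
      "\<And>n x. norm x > R + 1 \<Longrightarrow> g n x = 0" "AE x in lborel. (\<lambda>n. g n x) \<longlonglongrightarrow> \<psi> x"
      by (rule bounded_measurable_approx_continuous[OF \<psi>m _ _ \<psi>(2)]) auto
    have [measurable]: "g n \<in> borel_measurable borel" for n
      by (rule borel_measurable_continuous_onI[OF g(1)])
    have "(\<lambda>n. \<integral>x. g n x * w x \<partial>lborel) \<longlonglongrightarrow> (\<integral>x. \<psi> x * w x \<partial>lborel)"
    proof (rule integral_dominated_convergence[where w = "\<lambda>x. (\<bar>B\<bar> + 1) * norm (indicator (cball 0 (R + 1)) x *\<^sub>R w x)"])
      show "integrable lborel (\<lambda>x. (\<bar>B\<bar> + 1) * norm (indicator (cball 0 (R + 1)) x *\<^sub>R w x))"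
        by (intro integrable_mult_right integrable_norm L2_locally_integrable weighted_L2_0 w0)
      show "AE x in lborel. (\<lambda>n. g n x * w x) \<longlonglongrightarrow> \<psi> x * w x"
        using g(4) by eventually_elim (intro tendsto_intros)
      show "AE x in lborel. norm (g n x * w x) \<le> (\<bar>B\<bar> + 1) * norm (indicator (cball 0 (R + 1)) x *\<^sub>R w x)" for n
        using g(2,3) by (auto simp: norm_mult indicator_def not_le intro!: mult_right_mono)
    qed measurable
    then have 1: "(\<lambda>n. ennreal ((norm (\<integral>x. g n x * w x \<partial>lborel))\<^sup>2)) \<longlonglongrightarrow> ennreal ((norm (\<integral>x. \<psi> x * w x \<partial>lborel))\<^sup>2)"
      by (intro tendsto_ennrealI tendsto_power tendsto_norm)
    have "(\<lambda>n. riesz_energy (2 * b) (g n)) \<longlonglongrightarrow> riesz_energy (2 * b) \<psi>"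
      by (rule riesz_energy_tendsto[OF _ b(3) \<psi>m _ g(2) g(3) g(4)]) (use b in auto)
    then have 2: "(\<lambda>n. ennreal (C0 / P\<^sup>2) * riesz_energy (2 * b) (g n)) \<longlonglongrightarrow> ennreal (C0 / P\<^sup>2) * riesz_energy (2 * b) \<psi>"
      by (intro ennreal_tendsto_cmult) auto
    show "ennreal ((norm (\<integral>x. \<psi> x * w x \<partial>lborel))\<^sup>2) \<le> ennreal (C0 / P\<^sup>2) * riesz_energy (2 * b) \<psi>"
      by (rule LIMSEQ_le[OF 1 2]) (use cont[OF g(1,2,3)] in blast)
  qed
qed

text \<open>The pairing bound is tested with \<open>\<psi> = cnj w m\<close>, where \<open>m\<close> is the weight
  \<open>|y - x| powr (- a)\<close> on the unit ball at \<open>x\<close>. The pairing is then the integral \<open>X\<close> of \<open>|w|^2 m\<close>,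
  and by \<open>2 |w(z)| |w(y)| \<le> |w(z)|^2 + |w(y)|^2\<close> the energy is at most \<open>X\<close> times the
  supremum of the Riesz potential of \<open>m\<close>, which is finite for \<open>a + p < d\<close>. So \<open>X^2 \<le> C X\<close>; the
  truncations at height \<open>n\<close> make \<open>X\<close> finite and allow the division.\<close>
lemma kato_bound:
  fixes w :: "'a::euclidean_space \<Rightarrow> complex"
  assumes wm[measurable]: "w \<in> borel_measurable borel"
    and C: "C \<ge> 0" "\<And>\<psi> B R. \<psi> \<in> borel_measurable borel \<Longrightarrow> (\<And>x. norm (\<psi> x) \<le> B) \<Longrightarrow> (\<And>x. norm x > R \<Longrightarrow> \<psi> x = 0) \<Longrightarrow>
      ennreal ((norm (\<integral>x. \<psi> x * w x \<partial>lborel))\<^sup>2) \<le> ennreal C * riesz_energy p \<psi>"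
    and p: "0 \<le> p" "0 \<le> a" "a + p < real DIM('a)"
  obtains K where "K \<ge> 0"
    "\<And>x. (\<integral>\<^sup>+y. ennreal ((norm (w y))\<^sup>2 * singularity (y - x) powr a) * indicator (cball x 1) y \<partial>lborel) \<le> ennreal K"
proof -
  obtain M where M: "\<And>x y::'a. (\<integral>\<^sup>+z. ennreal (singularity (z - y) powr (a + p)) * indicator (cball x 1) z \<partial>lborel) \<le> ennreal M" "M \<ge> 0"
    using singularity_integral_cball_bound[of "a + p"] p by auto
  have "(\<integral>\<^sup>+y. ennreal ((norm (w y))\<^sup>2 * singularity (y - x) powr a) * indicator (cball x 1) y \<partial>lborel) \<le> ennreal (C * (2 * M))" for x
  proof -
    define m where "m n y = min (real n) (singularity (y - x) powr a) * indicator (cball x 1) y" for n y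
    define v where "v n y = (if norm (w y) \<le> real n then norm (w y) else 0)" for n :: nat and y
    have mm[measurable]: "m n \<in> borel_measurable borel" for n unfolding m_def by measurable
    have vm[measurable]: "v n \<in> borel_measurable borel" for n unfolding v_def by measurable
    have m0: "m n y \<ge> 0" "m n y \<le> real n" "m n y \<le> singularity (y - x) powr a * indicator (cball x 1) y" for n y
      by (auto simp: m_def indicator_def)
    have v0: "v n y \<ge> 0" "v n y \<le> real n" for n y by (auto simp: v_def)
    have X: "(\<integral>\<^sup>+y. ennreal ((v n y)\<^sup>2 * m n y) \<partial>lborel) \<le> ennreal (C * (2 * M))" for n
    proof -
      define \<psi> where "\<psi> y = (if norm (w y) \<le> real n then cnj (w y) else 0) * complex_of_real (m n y)" for y
      have \<psi>m[measurable]: "\<psi> \<in> borel_measurable borel" unfolding \<psi>_def by measurable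
      have n\<psi>: "norm (\<psi> y) = v n y * m n y" for y using m0 by (simp add: \<psi>_def v_def norm_mult)
      have supp: "m n y = 0" if "norm y > norm x + 1" for y
        using that norm_triangle_ineq2[of y x] by (auto simp: m_def indicator_def dist_norm norm_minus_commute)
      have nb: "v n y * m n y \<le> real n * real n" for y
        by (intro mult_mono v0 m0) auto
      have int: "integrable lborel (\<lambda>y. (v n y)\<^sup>2 * m n y)"
      proof (rule integrable_bounded_support[of _ "(real n)\<^sup>2 * real n" "norm x + 1"])
        show "norm ((v n y)\<^sup>2 * m n y) \<le> (real n)\<^sup>2 * real n" for y
          using m0[of n y] v0[of n y] by (auto simp: abs_mult intro!: mult_mono power_mono)
      qed (auto simp: supp)
      define X where "X = (\<integral>y. (v n y)\<^sup>2 * m n y \<partial>lborel)"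
      have "X \<ge> 0" unfolding X_def using m0 by (intro Bochner_Integration.integral_nonneg) auto
      have nnX: "(\<integral>\<^sup>+y. ennreal ((v n y)\<^sup>2 * m n y) \<partial>lborel) = ennreal X"
        unfolding X_def by (rule nn_integral_eq_integral[OF int]) (use m0 in auto)
      have \<psi>w: "\<psi> y * w y = complex_of_real ((v n y)\<^sup>2 * m n y)" for y
        by (cases "norm (w y) \<le> real n")
           (simp_all add: \<psi>_def v_def complex_norm_square mult_ac del: of_real_power)
      have "(\<integral>y. \<psi> y * w y \<partial>lborel) = complex_of_real X"
        unfolding X_def \<psi>w by (rule integral_complex_of_real)
      then have "ennreal (X\<^sup>2) \<le> ennreal C * riesz_energy p \<psi>"
        using C(2)[of \<psi> "real n * real n" "norm x + 1"] nb supp \<open>X \<ge> 0\<close> by (simp add: n\<psi>) (simp add: \<psi>_def)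
      also have "riesz_energy p \<psi> \<le> ennreal (2 * M * X)"
      proof -
        let ?s = "\<lambda>z y::'a. singularity (z - y) powr p"
        have inner: "(\<integral>\<^sup>+z. ennreal (m n z * ?s z y) \<partial>lborel) \<le> ennreal (2 * M)" for y
        proof -
          have "(\<integral>\<^sup>+z. ennreal (m n z * ?s z y) \<partial>lborel) \<le>
            (\<integral>\<^sup>+z. ennreal (singularity (z - x) powr (a + p)) * indicator (cball x 1) z + ennreal (singularity (z - y) powr (a + p)) * indicator (cball x 1) z \<partial>lborel)"
          proof (rule nn_integral_mono)
            fix z
            have "m n z * ?s z y \<le> (singularity (z - x) powr a * indicator (cball x 1) z) * ?s z y"
              by (intro mult_right_mono m0) simp
            also have "\<dots> \<le> (singularity (z - x) powr (a + p) + singularity (z - y) powr (a + p)) * indicator (cball x 1) z"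
              using singularity_powr_product_le[of a p "z - x" "z - y"] p by (simp add: indicator_def)
            finally have "ennreal (m n z * ?s z y) \<le> ennreal ((singularity (z - x) powr (a + p) + singularity (z - y) powr (a + p)) * indicator (cball x 1) z)"
              by (rule ennreal_leI)
            also have "\<dots> = ennreal (singularity (z - x) powr (a + p)) * indicator (cball x 1) z + ennreal (singularity (z - y) powr (a + p)) * indicator (cball x 1) z"
              by (cases "z \<in> cball x 1") simp_all
            finally show "ennreal (m n z * ?s z y) \<le> ennreal (singularity (z - x) powr (a + p)) * indicator (cball x 1) z + ennreal (singularity (z - y) powr (a + p)) * indicator (cball x 1) z" .
          qed
          also have "\<dots> \<le> ennreal M + ennreal M"
            by (subst nn_integral_add) (auto intro!: add_mono M)
          also have "\<dots> = ennreal (2 * M)" using M(2) by (simp add: ennreal_plus[symmetric] del: ennreal_plus)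
          finally show ?thesis .
        qed
        let ?F = "\<lambda>z y. ennreal (1 / 2 * ((v n y)\<^sup>2 * m n y)) * ennreal (m n z * ?s z y)"
        have F: "(\<integral>\<^sup>+y. (\<integral>\<^sup>+z. ?F z y \<partial>lborel) \<partial>lborel) \<le> ennreal (M * X)"
        proof -
          have "(\<integral>\<^sup>+y. (\<integral>\<^sup>+z. ?F z y \<partial>lborel) \<partial>lborel) \<le> (\<integral>\<^sup>+y. ennreal (1 / 2 * ((v n y)\<^sup>2 * m n y)) * ennreal (2 * M) \<partial>lborel)"
            by (rule nn_integral_mono, subst nn_integral_cmult) (auto intro!: mult_left_mono inner)
          also have "\<dots> = (\<integral>\<^sup>+y. ennreal M * ennreal ((v n y)\<^sup>2 * m n y) \<partial>lborel)"
            using M(2) m0 by (intro nn_integral_cong) (simp add: ennreal_mult[symmetric] mult_ac)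
          also have "\<dots> = ennreal M * (\<integral>\<^sup>+y. ennreal ((v n y)\<^sup>2 * m n y) \<partial>lborel)"
            by (rule nn_integral_cmult) measurable
          also have "\<dots> = ennreal (M * X)"
            unfolding nnX by (rule ennreal_mult'[OF M(2), symmetric])
          finally show ?thesis .
        qed
        have "riesz_energy p \<psi> \<le> (\<integral>\<^sup>+y. (\<integral>\<^sup>+z. ?F z y + ?F y z \<partial>lborel) \<partial>lborel)"
          unfolding riesz_energy_def
        proof (rule nn_integral_mono, rule nn_integral_mono)
          fix y z
          have s: "?s y z = ?s z y" by (simp add: singularity_commute)
          have "v n z * v n y \<le> 1 / 2 * (v n y)\<^sup>2 + 1 / 2 * (v n z)\<^sup>2"
            using zero_le_power2[of "v n z - v n y"] unfolding power2_diff by (simp add: algebra_simps)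
          then have "(v n z * v n y) * (m n y * (m n z * ?s z y)) \<le> (1 / 2 * (v n y)\<^sup>2 + 1 / 2 * (v n z)\<^sup>2) * (m n y * (m n z * ?s z y))"
            using m0 by (intro mult_right_mono) auto
          then have "norm (\<psi> z) * norm (\<psi> y) * ?s z y \<le> 1 / 2 * ((v n y)\<^sup>2 * m n y) * (m n z * ?s z y) + 1 / 2 * ((v n z)\<^sup>2 * m n z) * (m n y * ?s y z)"
            unfolding n\<psi> s by (simp add: algebra_simps)
          then have "ennreal (norm (\<psi> z) * norm (\<psi> y) * ?s z y) \<le> ennreal (1 / 2 * ((v n y)\<^sup>2 * m n y) * (m n z * ?s z y) + 1 / 2 * ((v n z)\<^sup>2 * m n z) * (m n y * ?s y z))"
            by (rule ennreal_leI)
          also have "\<dots> = ?F z y + ?F y z"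
          proof -
            have "ennreal (P * Q + P' * Q') = ennreal P * ennreal Q + ennreal P' * ennreal Q'"
              if "P \<ge> 0" "Q \<ge> 0" "P' \<ge> 0" "Q' \<ge> 0" for P Q P' Q' :: real
              using that by (simp add: ennreal_mult)
            then show ?thesis by this (use m0 in auto)
          qed
          finally show "ennreal (norm (\<psi> z) * norm (\<psi> y) * ?s z y) \<le> ?F z y + ?F y z" .
        qed
        also have "\<dots> = (\<integral>\<^sup>+y. (\<integral>\<^sup>+z. ?F z y \<partial>lborel) \<partial>lborel) + (\<integral>\<^sup>+y. (\<integral>\<^sup>+z. ?F y z \<partial>lborel) \<partial>lborel)"
          by (subst nn_integral_add[symmetric], measurable, intro nn_integral_cong, rule nn_integral_add) measurable
        also have "(\<integral>\<^sup>+y. (\<integral>\<^sup>+z. ?F y z \<partial>lborel) \<partial>lborel) = (\<integral>\<^sup>+y. (\<integral>\<^sup>+z. ?F z y \<partial>lborel) \<partial>lborel)"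
          by (rule lborel_pair.Fubini') measurable
        also have "(\<integral>\<^sup>+y. (\<integral>\<^sup>+z. ?F z y \<partial>lborel) \<partial>lborel) + (\<integral>\<^sup>+y. (\<integral>\<^sup>+z. ?F z y \<partial>lborel) \<partial>lborel) \<le> ennreal (M * X) + ennreal (M * X)"
          by (intro add_mono F)
        also have "\<dots> = ennreal (2 * M * X)"
          using M(2) \<open>X \<ge> 0\<close> by (simp add: ennreal_plus[symmetric] del: ennreal_plus)
        finally show ?thesis .
      qed
      finally have "ennreal (X\<^sup>2) \<le> ennreal C * ennreal (2 * M * X)" by (simp add: mult_left_mono)
      then have "X\<^sup>2 \<le> C * (2 * M * X)"
        using C(1) M(2) \<open>X \<ge> 0\<close> by (simp add: ennreal_mult[symmetric] ennreal_le_iff)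
      then have "X * X \<le> C * (2 * M) * X" by (simp add: power2_eq_square mult_ac)
      then have "X \<le> C * (2 * M)"
        using \<open>X \<ge> 0\<close> C(1) M(2) by (cases "X = 0") (auto simp: mult_le_cancel_right)
      then show ?thesis unfolding nnX by (rule ennreal_leI)
    qed
    have lim: "(\<lambda>n. ennreal ((v n y)\<^sup>2 * m n y)) \<longlonglongrightarrow> ennreal ((norm (w y))\<^sup>2 * singularity (y - x) powr a) * indicator (cball x 1) y" for y
    proof (rule tendsto_eventually)
      obtain N :: nat where N: "norm (w y) + singularity (y - x) powr a \<le> real N" using real_arch_simple by blast
      have "ennreal ((v n y)\<^sup>2 * m n y) = ennreal ((norm (w y))\<^sup>2 * singularity (y - x) powr a) * indicator (cball x 1) y" if "n \<ge> N" for n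
      proof -
        have "norm (w y) + singularity (y - x) powr a \<le> real n" using N that by linarith
        moreover have "singularity (y - x) powr a \<ge> 0" "norm (w y) \<ge> 0" by auto
        ultimately have "norm (w y) \<le> real n" "singularity (y - x) powr a \<le> real n" by linarith+
        then show ?thesis by (simp add: v_def m_def indicator_def)
      qed
      then show "\<forall>\<^sub>F n in sequentially. ennreal ((v n y)\<^sup>2 * m n y) = ennreal ((norm (w y))\<^sup>2 * singularity (y - x) powr a) * indicator (cball x 1) y"
        by (auto simp: eventually_sequentially)
    qed
    have "(\<integral>\<^sup>+y. ennreal ((norm (w y))\<^sup>2 * singularity (y - x) powr a) * indicator (cball x 1) y \<partial>lborel) =
       (\<integral>\<^sup>+y. liminf (\<lambda>n. ennreal ((v n y)\<^sup>2 * m n y)) \<partial>lborel)"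
      by (intro nn_integral_cong lim_imp_Liminf[OF _ lim, symmetric]) simp
    also have "\<dots> \<le> liminf (\<lambda>n. \<integral>\<^sup>+y. ennreal ((v n y)\<^sup>2 * m n y) \<partial>lborel)"
      by (rule nn_integral_liminf) measurable
    also have "\<dots> \<le> ennreal (C * (2 * M))"
      by (rule order_trans[OF Liminf_le_Limsup Limsup_bounded]) (simp, intro always_eventually allI X)
    finally show ?thesis .
  qed
  then show ?thesis using that[of "C * (2 * M)"] C M by auto
qed

section \<open>Regularised Newtonian kernels\<close>

definition cutoff' :: "real \<Rightarrow> real" where "cutoff' t = deriv cutoff t"

lemma cutoff_has_deriv: "(cutoff has_real_derivative cutoff' t) (at t)"
  using cutoff_deriv_exists[of t] DERIV_imp_deriv unfolding cutoff'_def by blast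

lemma cutoff'_continuous: "continuous_on {0<..} cutoff'"
proof -
  obtain f' where f': "f' \<in> profiles 0" "\<And>t. t > 0 \<Longrightarrow> (cutoff has_real_derivative f' t) (at t)"
    using profiles_deriv[OF cutoff_in_profiles] by blast
  have "continuous_on {0<..} f'" by (rule profile_continuous_on[OF f'(1)]) simp
  moreover have "cutoff' t = f' t" if "t \<in> {0<..}" for t
    using DERIV_unique[OF cutoff_has_deriv f'(2)] that by simp
  ultimately show ?thesis using continuous_on_cong by metis
qed

lemma cutoff'_eq_0: assumes "t < 1 \<or> t > 2" shows "cutoff' t = 0"
proof -
  have "(cutoff has_real_derivative 0) (at t)"
  proof (cases "t < 1")
    case True
    then show ?thesis
      by (intro has_field_derivative_transform_within_open[of "\<lambda>_. 1" 0 t "{..<1}" cutoff]) (auto simp: cutoff_eq_1)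
  next
    case False
    then have "t > 2" using assms by simp
    then show ?thesis
      by (intro has_field_derivative_transform_within_open[of "\<lambda>_. 0" 0 t "{2<..}" cutoff]) (auto simp: cutoff_eq_0)
  qed
  then show ?thesis using DERIV_unique[OF cutoff_has_deriv] by blast
qed

lemma cutoff'_bounded: obtains L where "L > 0" "\<And>t. \<bar>cutoff' t\<bar> \<le> L"
proof -
  have "compact (cutoff' ` {1..2})"
    by (intro compact_continuous_image continuous_on_subset[OF cutoff'_continuous]) auto
  then obtain L where L: "\<And>t. t \<in> {1..2} \<Longrightarrow> \<bar>cutoff' t\<bar> \<le> L"
    using compact_imp_bounded bounded_iff by (metis imageI real_norm_def)
  show ?thesis
  proof (rule that[of "\<bar>L\<bar> + 1"])
    show "\<bar>cutoff' t\<bar> \<le> \<bar>L\<bar> + 1" for t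
      using L[of t] cutoff'_eq_0[of t] by (cases "t \<in> {1..2}") auto
  qed simp
qed

abbreviation halfdim :: "'a::euclidean_space itself \<Rightarrow> real" where
  "halfdim _ \<equiv> real DIM('a) / 2"

text \<open>A regularised fundamental solution of the Laplacian, up to a constant factor, with compact
  support. Regularising inside the profile, instead
  of by convolution, keeps it an explicit radial function.\<close>
definition newton_kernel :: "real \<Rightarrow> 'a::euclidean_space \<Rightarrow> real" where
  "newton_kernel \<rho> z = newton_profile (halfdim TYPE('a)) ((norm z)\<^sup>2 + \<rho>)"

text \<open>The part of the Laplacian of the regularised Newtonian kernel that concentrates at the origin as
  \<open>\<rho>\<close> tends to 0: for \<open>m = d/2\<close> the derivative of \<open>t powr (- m)\<close> leaves a factor
  \<open>t - |z|^2 = \<rho>\<close>.\<close>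
definition mollifier_profile :: "real \<Rightarrow> real \<Rightarrow> real \<Rightarrow> real" where
  "mollifier_profile m \<rho> t = 4 * m * \<rho> * t powr (- m - 1) * cutoff t"

definition mollifier :: "real \<Rightarrow> 'a::euclidean_space \<Rightarrow> real" where
  "mollifier \<rho> z = mollifier_profile (halfdim TYPE('a)) \<rho> ((norm z)\<^sup>2 + \<rho>)"

text \<open>The other part of that Laplacian, produced by the cutoff; it lives where the cutoff varies and stays
  bounded uniformly in \<open>\<rho>\<close>.\<close>
definition remainder_kernel :: "real \<Rightarrow> 'a::euclidean_space \<Rightarrow> real" where
  "remainder_kernel \<rho> z = 4 * (norm z)\<^sup>2 * ((norm z)\<^sup>2 + \<rho>) powr (- halfdim TYPE('a)) * cutoff' ((norm z)\<^sup>2 + \<rho>)"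

lemma laplacian_newton_kernel:
  fixes x :: "'a::euclidean_space"
  assumes "\<rho> > 0"
  shows "laplacian (\<lambda>y. complex_of_real (newton_kernel \<rho> (y - x))) y =
     complex_of_real (mollifier \<rho> (y - x) + remainder_kernel \<rho> (y - x))"
proof -
  let ?m = "real DIM('a) / 2" and ?t = "(norm (y - x))\<^sup>2 + \<rho>"
  have t: "?t > 0" using assms by (simp add: add_nonneg_pos)
  have d2: "((\<lambda>t. t powr (- ?m) * cutoff t) has_real_derivative - ?m * t powr (- ?m - 1) * cutoff t + cutoff' t * t powr (- ?m)) (at t)"
    if "t > 0" for t
    using that by (intro DERIV_mult has_real_derivative_powr cutoff_has_deriv)
  have "laplacian (\<lambda>y. complex_of_real (newton_kernel \<rho> (y - x))) y =
    complex_of_real (2 * real DIM('a) * (?t powr (- ?m) * cutoff ?t) +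
      4 * (norm (y - x))\<^sup>2 * (- ?m * ?t powr (- ?m - 1) * cutoff ?t + cutoff' ?t * ?t powr (- ?m)))"
    unfolding newton_kernel_def by (rule radial_laplacian[OF assms newton_profile_deriv d2])
  also have "2 * real DIM('a) * (?t powr (- ?m) * cutoff ?t) +
      4 * (norm (y - x))\<^sup>2 * (- ?m * ?t powr (- ?m - 1) * cutoff ?t + cutoff' ?t * ?t powr (- ?m)) =
      mollifier \<rho> (y - x) + remainder_kernel \<rho> (y - x)"
  proof -
    have "?t powr (- ?m) = ?t * ?t powr (- ?m - 1)"
      using t by (simp add: powr_diff)
    then show ?thesis
      by (simp add: mollifier_def mollifier_profile_def remainder_kernel_def algebra_simps)
  qed
  finally show ?thesis .
qed

lemma mollifier_profile_in_profiles: "mollifier_profile m \<rho> \<in> profiles m'"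
proof -
  have "(\<lambda>t. 4 * m * \<rho> * t powr (- m - 1) * cutoff t) \<in> profiles m'"
    by (intro function_algebra.mult function_algebra.const powr_in_profiles cutoff_in_profiles)
  then show ?thesis unfolding mollifier_profile_def[abs_def] .
qed

lemma mollifier_profile_eq_0: "t \<ge> 2 \<Longrightarrow> mollifier_profile m \<rho> t = 0"
  by (simp add: mollifier_profile_def cutoff_eq_0)

lemma newton_kernel_test_function:
  "\<rho> > 0 \<Longrightarrow> test_function (\<lambda>y. complex_of_real (newton_kernel \<rho> (y - x)))"
  unfolding newton_kernel_def
  by (rule radial_test_function[OF newton_profile_in_profiles]) (auto simp: newton_profile_eq_0)

lemma mollifier_test_function:
  "\<rho> > 0 \<Longrightarrow> test_function (\<lambda>y. complex_of_real (mollifier \<rho> (y - x)))"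
  unfolding mollifier_def
  by (rule radial_test_function[OF mollifier_profile_in_profiles]) (auto simp: mollifier_profile_eq_0)

lemma norm_gt_2_imp: "norm z > 2 \<Longrightarrow> \<rho> \<ge> 0 \<Longrightarrow> (norm z)\<^sup>2 + \<rho> > 2"
  using power_strict_mono[of 2 "norm z" 2] by simp

lemma kernels_support:
  assumes "norm z > 2" "\<rho> \<ge> 0"
  shows "newton_kernel \<rho> z = 0" "mollifier \<rho> z = 0" "remainder_kernel \<rho> z = 0"
  using norm_gt_2_imp[OF assms]
  by (auto simp: newton_kernel_def newton_profile_eq_0 mollifier_def mollifier_profile_eq_0 remainder_kernel_def cutoff'_eq_0)

lemma newton_kernel_continuous: "\<rho> > 0 \<Longrightarrow> continuous_on UNIV (newton_kernel \<rho> :: 'a::euclidean_space \<Rightarrow> real)"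
  unfolding newton_kernel_def[abs_def]
  by (rule continuous_on_compose2[OF profile_continuous_on[OF newton_profile_in_profiles, of "{0<..}"]])
     (auto intro!: continuous_intros add_nonneg_pos)

lemma mollifier_continuous: "\<rho> > 0 \<Longrightarrow> continuous_on UNIV (mollifier \<rho> :: 'a::euclidean_space \<Rightarrow> real)"
  unfolding mollifier_def[abs_def]
  by (rule continuous_on_compose2[OF profile_continuous_on[OF mollifier_profile_in_profiles, of "{0<..}"]])
     (auto intro!: continuous_intros add_nonneg_pos)

lemma remainder_kernel_tendsto:
  fixes z :: "'a::euclidean_space"
  assumes "z \<noteq> 0" "z' \<longlonglongrightarrow> z" "\<rho> \<longlonglongrightarrow> 0" "\<And>n. \<rho> n \<ge> 0"
  shows "(\<lambda>n. remainder_kernel (\<rho> n) (z' n)) \<longlonglongrightarrow> remainder_kernel 0 z"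
proof -
  have 1: "(\<lambda>n. (norm (z' n))\<^sup>2 + \<rho> n) \<longlonglongrightarrow> (norm z)\<^sup>2 + 0" by (intro tendsto_intros assms)
  have "isCont cutoff' ((norm z)\<^sup>2 + 0)"
    using cutoff'_continuous assms(1) by (simp add: continuous_on_eq_continuous_at)
  from isCont_tendsto_compose[OF this 1] 1 show ?thesis
    unfolding remainder_kernel_def using assms(1) by (intro tendsto_mult tendsto_intros assms) auto
qed

lemma remainder_kernel_near_0: "norm z < 1 / 2 \<Longrightarrow> 0 \<le> \<rho> \<Longrightarrow> \<rho> \<le> 1 / 2 \<Longrightarrow> remainder_kernel \<rho> z = 0"
proof -
  assume a: "norm z < 1 / 2" "0 \<le> \<rho>" "\<rho> \<le> 1 / 2"
  have "(norm z)\<^sup>2 < (1 / 2)\<^sup>2" using a by (intro power_strict_mono) auto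
  then have "(norm z)\<^sup>2 + \<rho> < 1" using a by (simp add: power2_eq_square)
  then show ?thesis by (simp add: remainder_kernel_def cutoff'_eq_0)
qed

lemma remainder_kernel_bounded:
  obtains L where "L > 0" "\<And>\<rho> z::'a::euclidean_space. 0 \<le> \<rho> \<Longrightarrow> \<bar>remainder_kernel \<rho> z\<bar> \<le> L"
proof -
  obtain L where L: "L > 0" "\<And>t. \<bar>cutoff' t\<bar> \<le> L" using cutoff'_bounded by blast
  show ?thesis
  proof (rule that[of "8 * L"])
    fix \<rho> :: real and z :: 'a assume \<rho>: "0 \<le> \<rho>"
    let ?t = "(norm z)\<^sup>2 + \<rho>"
    show "\<bar>remainder_kernel \<rho> z\<bar> \<le> 8 * L"
    proof (cases "1 \<le> ?t \<and> ?t \<le> 2")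
      case True
      have "?t powr (- halfdim TYPE('a)) \<le> ?t powr 0"
        using True by (intro powr_mono) auto
      then have p: "?t powr (- halfdim TYPE('a)) \<le> 1" using True by simp
      have "4 * (norm z)\<^sup>2 * ?t powr (- halfdim TYPE('a)) * \<bar>cutoff' ?t\<bar> \<le> 8 * 1 * L"
        using True \<rho> p L by (intro mult_mono) auto
      then show ?thesis by (simp add: remainder_kernel_def abs_mult)
    next
      case False
      then show ?thesis using L(1) by (auto simp: remainder_kernel_def cutoff'_eq_0 not_le)
    qed
  qed (use L in simp)
qed

lemma kernels_measurable[measurable]:
  assumes "\<rho> \<ge> 0"
  shows "newton_kernel \<rho> \<in> borel_measurable borel" "mollifier \<rho> \<in> borel_measurable borel"
    "remainder_kernel \<rho> \<in> borel_measurable borel"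
proof -
  have A: "(\<lambda>z. f ((norm z)\<^sup>2 + \<rho>)) \<in> borel_measurable borel" if "continuous_on {0<..} f" for f :: "real \<Rightarrow> real"
  proof -
    have [measurable]: "(\<lambda>t. indicator {0<..} t *\<^sub>R f t) \<in> borel_measurable borel"
      by (rule borel_measurable_continuous_on_indicator) (use that in auto)
    have 1: "(\<lambda>t. indicator {0<..} t *\<^sub>R f t + indicator {0} t *\<^sub>R f 0) \<in> borel_measurable borel"
      by measurable
    have "(\<lambda>z. indicator {0<..} ((norm z)\<^sup>2 + \<rho>) *\<^sub>R f ((norm z)\<^sup>2 + \<rho>) + indicator {0} ((norm z)\<^sup>2 + \<rho>) *\<^sub>R f 0) \<in> borel_measurable borel"
      by (rule measurable_compose[OF _ 1]) measurable
    also have "(\<lambda>z. indicator {0<..} ((norm z)\<^sup>2 + \<rho>) *\<^sub>R f ((norm z)\<^sup>2 + \<rho>) + indicator {0} ((norm z)\<^sup>2 + \<rho>) *\<^sub>R f 0) =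
       (\<lambda>z. f ((norm z)\<^sup>2 + \<rho>))"
    proof
      fix z
      have "(norm z)\<^sup>2 + \<rho> > 0 \<or> (norm z)\<^sup>2 + \<rho> = 0" proof -
        have "0 \<le> (norm z)\<^sup>2 + \<rho>" using assms by simp
        then show ?thesis by linarith
      qed
      then show "indicator {0<..} ((norm z)\<^sup>2 + \<rho>) *\<^sub>R f ((norm z)\<^sup>2 + \<rho>) + indicator {0} ((norm z)\<^sup>2 + \<rho>) *\<^sub>R f 0 = f ((norm z)\<^sup>2 + \<rho>)"
        by auto
    qed
    finally show ?thesis .
  qed
  show "newton_kernel \<rho> \<in> borel_measurable borel"
    unfolding newton_kernel_def[abs_def] by (rule A, rule profile_continuous_on[OF newton_profile_in_profiles]) simp
  show "mollifier \<rho> \<in> borel_measurable borel"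
    unfolding mollifier_def[abs_def] by (rule A, rule profile_continuous_on[OF mollifier_profile_in_profiles]) simp
  have [measurable]: "(\<lambda>z. cutoff' ((norm z)\<^sup>2 + \<rho>)) \<in> borel_measurable borel" by (rule A, rule cutoff'_continuous)
  show "remainder_kernel \<rho> \<in> borel_measurable borel"
    unfolding remainder_kernel_def[abs_def] by measurable
qed

text \<open>The profile increases to its final value 0, so the regularisation only lowers its modulus.\<close>
lemma newton_kernel_mono:
  assumes "z \<noteq> 0" "0 \<le> \<rho>" shows "\<bar>newton_kernel \<rho> z\<bar> \<le> \<bar>newton_kernel 0 z\<bar>"
proof -
  have "(norm z)\<^sup>2 > 0" using assms by simp
  then show ?thesis
    unfolding newton_kernel_def using assms
      newton_profile_mono[of "(norm z)\<^sup>2 + 0" "(norm z)\<^sup>2 + \<rho>"] newton_profile_nonpos[of "(norm z)\<^sup>2 + \<rho>"]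
      newton_profile_nonpos[of "(norm z)\<^sup>2 + 0"]
    by (simp add: add_pos_nonneg)
qed

lemma newton_kernel_le_singularity:
  assumes a: "a > 0" "a > real DIM('a::euclidean_space) - 2"
  obtains C where "C > 0" "\<And>z::'a. z \<noteq> 0 \<Longrightarrow> \<bar>newton_kernel 0 z\<bar> \<le> C * singularity z powr a"
proof -
  let ?C = "2 powr (a / 2 + 1 - halfdim TYPE('a)) / (a / 2)"
  show ?thesis
  proof (rule that[of ?C])
    fix z :: 'a assume z: "z \<noteq> 0"
    have "\<bar>newton_kernel 0 z\<bar> \<le> ?C * ((norm z)\<^sup>2 + 0) powr (- (a / 2))"
      unfolding newton_kernel_def using z a by (intro newton_profile_bound) auto
    also have "((norm z)\<^sup>2 + 0) powr (- (a / 2)) = (1 / norm z) powr a"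
    proof -
      have "(norm z)\<^sup>2 + 0 = norm z powr 2" using z by simp
      then have "((norm z)\<^sup>2 + 0) powr (- (a / 2)) = norm z powr (- a)" by (simp only: powr_powr) simp
      then show ?thesis using z by (simp add: powr_minus powr_divide inverse_eq_divide)
    qed
    also have "?C * (1 / norm z) powr a \<le> ?C * singularity z powr a"
      using a by (intro mult_left_mono powr_mono2) (auto simp: singularity_def)
    finally show "\<bar>newton_kernel 0 z\<bar> \<le> ?C * singularity z powr a" .
  qed (use a in auto)
qed

lemma newton_kernel_tendsto:
  fixes z :: "'a::euclidean_space"
  assumes "z \<noteq> 0" "\<rho> \<longlonglongrightarrow> 0"
  shows "(\<lambda>n. newton_kernel (\<rho> n) z) \<longlonglongrightarrow> newton_kernel 0 z"
proof -
  have "isCont (newton_profile (halfdim TYPE('a))) ((norm z)\<^sup>2 + 0)"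
    using assms(1) by (intro DERIV_isCont[OF newton_profile_deriv]) simp
  moreover have "(\<lambda>n. (norm z)\<^sup>2 + \<rho> n) \<longlonglongrightarrow> (norm z)\<^sup>2 + 0" by (intro tendsto_intros assms)
  ultimately show ?thesis
    unfolding newton_kernel_def by (rule isCont_tendsto_compose)
qed

lemma newton_kernel_integrable:
  "integrable lborel (newton_kernel 0 :: 'a::euclidean_space \<Rightarrow> real)"
proof -
  define a where "a = real DIM('a) - 1 / 2"
  have a: "a > 0" "a > real DIM('a) - 2" "a < real DIM('a)"
  proof -
    have "1 \<le> DIM('a)" by (simp add: Suc_leI)
    then have "real 1 \<le> real DIM('a)" unfolding of_nat_le_iff .
    then show "a > 0" "a > real DIM('a) - 2" "a < real DIM('a)" unfolding a_def of_nat_1 by linarith+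
  qed
  obtain C where C: "C > 0" "\<And>z::'a. z \<noteq> 0 \<Longrightarrow> \<bar>newton_kernel 0 z\<bar> \<le> C * singularity z powr a"
    using newton_kernel_le_singularity[OF a(1,2)] by blast
  have fin: "integrable lborel (\<lambda>z::'a. singularity (z - 0) powr a * indicator (cball 0 2) z)"
    by (rule integrableI_nonneg) (use singularity_integral_finite[OF a(3), of 0 2] in \<open>auto simp: ennreal_mult ennreal_indicator\<close>)
  have "AE z in lborel. z \<noteq> (0::'a)" by (rule AE_lborel_singleton)
  then have "AE z in lborel. norm (newton_kernel 0 z) \<le> norm (C * (singularity (z - 0) powr a * indicator (cball 0 2) (z::'a)))"
  proof eventually_elim
    fix z :: 'a assume "z \<noteq> 0"
    then show "norm (newton_kernel 0 z) \<le> norm (C * (singularity (z - 0) powr a * indicator (cball 0 2) z))"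
      using C kernels_support(1)[of z 0] by (cases "norm z \<le> 2") (auto simp: abs_mult)
  qed
  then show ?thesis
    by (rule Bochner_Integration.integrable_bound[rotated 2]) (use fin in auto)
qed

text \<open>The limit of the integrals of the mollifiers as \<open>\<rho>\<close> tends to 0. Only its positivity matters, so
  its value is never computed.\<close>
definition mollifier_mass :: "'a::euclidean_space itself \<Rightarrow> real" where
  "mollifier_mass _ = (\<integral>z. 2 * real DIM('a) * (1 + (norm (z::'a))\<^sup>2) powr (- (halfdim TYPE('a) + 1)) \<partial>lborel)"

lemma mollifier_limit_integrable:
  "integrable lborel (\<lambda>z::'a::euclidean_space. 2 * real DIM('a) * (1 + (norm z)\<^sup>2) powr (- (halfdim TYPE('a) + 1)))"
proof -
  let ?m = "halfdim TYPE('a)" and ?s = "halfdim TYPE('a) + 1"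
  have s: "?s > 0" by (simp add: add_nonneg_pos)
  have G: "Gamma ?s > 0" using s by (rule Gamma_real_pos)
  have gs: "(\<integral>\<^sup>+z. ennreal (exp (- (t * (norm (z::'a))\<^sup>2))) \<partial>lborel) = ennreal ((pi / t) powr ?m)" if "t > 0" for t
  proof -
    have g: "gauss (0::'a) (2 * t) = (\<lambda>z. complex_of_real (exp (- (t * (norm z)\<^sup>2))))"
      by (auto simp: gauss_def power2_norm_eq_inner exp_of_real[symmetric] fun_eq_iff)
    have "integrable lborel (\<lambda>z::'a. complex_of_real (exp (- (t * (norm z)\<^sup>2))))"
      "(\<integral>z. complex_of_real (exp (- (t * (norm (z::'a))\<^sup>2))) \<partial>lborel) = complex_of_real ((pi / t) powr ?m)"
      using gauss_integral[of "2 * t" "0::'a"] that unfolding g by simp_all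
    then have "integrable lborel (\<lambda>z::'a. exp (- (t * (norm z)\<^sup>2)))" "(\<integral>z. exp (- (t * (norm (z::'a))\<^sup>2)) \<partial>lborel) = (pi / t) powr ?m"
      by (simp_all only: complex_of_real_integrable_eq integral_complex_of_real of_real_eq_iff)
    then show ?thesis by (subst nn_integral_eq_integral) auto
  qed
  have "(\<integral>\<^sup>+z. ennreal (Gamma ?s * (1 + (norm (z::'a))\<^sup>2) powr (- ?s)) \<partial>lborel) =
     (\<integral>\<^sup>+z. (\<integral>\<^sup>+t. ennreal (indicator {0..} t * t powr (?s - 1) * exp (- ((1 + (norm (z::'a))\<^sup>2) * t))) \<partial>lborel) \<partial>lborel)"
    by (intro nn_integral_cong power_nn_integral_exp[OF s, symmetric]) (simp add: add_pos_nonneg)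
  also have "\<dots> = (\<integral>\<^sup>+t. (\<integral>\<^sup>+z. ennreal (indicator {0..} t * t powr (?s - 1) * exp (- ((1 + (norm (z::'a))\<^sup>2) * t))) \<partial>lborel) \<partial>lborel)"
    by (rule lborel_pair.Fubini') measurable
  also have "\<dots> = (\<integral>\<^sup>+t. ennreal (pi powr ?m) * ennreal (indicator {0..} t * t powr (1 - 1) * exp (- (1 * t))) \<partial>lborel)"
  proof (rule nn_integral_cong)
    fix t :: real
    show "(\<integral>\<^sup>+z. ennreal (indicator {0..} t * t powr (?s - 1) * exp (- ((1 + (norm (z::'a))\<^sup>2) * t))) \<partial>lborel) =
      ennreal (pi powr ?m) * ennreal (indicator {0..} t * t powr (1 - 1) * exp (- (1 * t)))"
    proof (cases "t > 0")
      case True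
      have "(\<integral>\<^sup>+z. ennreal (indicator {0..} t * t powr (?s - 1) * exp (- ((1 + (norm (z::'a))\<^sup>2) * t))) \<partial>lborel) =
        (\<integral>\<^sup>+z. ennreal (t powr ?m * exp (- t)) * ennreal (exp (- (t * (norm (z::'a))\<^sup>2))) \<partial>lborel)"
        using True by (intro nn_integral_cong) (simp add: ennreal_mult'[symmetric] algebra_simps exp_add[symmetric])
      also have "\<dots> = ennreal (t powr ?m * exp (- t)) * ennreal ((pi / t) powr ?m)"
        by (subst nn_integral_cmult) (auto simp: gs[OF True])
      also have "\<dots> = ennreal (pi powr ?m) * ennreal (exp (- t))"
        using True by (simp add: ennreal_mult'[symmetric] powr_divide)
      finally show ?thesis using True by simp
    next
      case False
      then show ?thesis by (cases "t = 0") auto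
    qed
  qed
  also have "\<dots> = ennreal (pi powr ?m) * ennreal (Gamma 1 * 1 powr (-1))"
    by (subst nn_integral_cmult, simp, subst power_nn_integral_exp[of 1 1]) auto
  also have "\<dots> < \<infinity>" by (simp add: ennreal_mult_less_top)
  finally have "(\<integral>\<^sup>+z. ennreal (Gamma ?s * (1 + (norm (z::'a))\<^sup>2) powr (- ?s)) \<partial>lborel) < \<infinity>" .
  then have "integrable lborel (\<lambda>z::'a. Gamma ?s * (1 + (norm z)\<^sup>2) powr (- ?s))"
    using G by (intro integrableI_nonneg) auto
  then show ?thesis using G by simp
qed

lemma mollifier_mass_pos: "mollifier_mass TYPE('a::euclidean_space) > 0"
proof -
  let ?f = "\<lambda>z::'a. 2 * real DIM('a) * (1 + (norm z)\<^sup>2) powr (- (halfdim TYPE('a) + 1))"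
  have pos: "?f z > 0" for z :: 'a
    using add_pos_nonneg[of 1 "(norm z)\<^sup>2"] by (simp add: less_le)
  have "mollifier_mass TYPE('a) \<ge> 0"
    unfolding mollifier_mass_def using pos by (intro Bochner_Integration.integral_nonneg less_imp_le) auto
  moreover have "mollifier_mass TYPE('a) \<noteq> 0"
  proof
    assume "mollifier_mass TYPE('a) = 0"
    moreover have "mollifier_mass TYPE('a) = 0 \<longleftrightarrow> (AE z in lborel. ?f z = 0)"
      unfolding mollifier_mass_def
      by (rule integral_nonneg_eq_0_iff_AE[OF mollifier_limit_integrable]) (use pos in \<open>auto intro: less_imp_le\<close>)
    ultimately have "AE z in lborel. ?f z = 0" by blast
    then have "AE z in (lborel :: 'a measure). False"
      by eventually_elim (use pos in \<open>metis less_irrefl\<close>)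
    then have "emeasure lborel (UNIV :: 'a set) = 0"
      by (simp add: AE_iff_measurable[of UNIV])
    then show False by simp
  qed
  ultimately show ?thesis by simp
qed

text \<open>The substitution \<open>y = x + sqrt \<rho> z\<close> removes \<open>\<rho>\<close> from everything except the cutoff.\<close>
lemma mollifier_convolution_rescale:
  fixes h :: "'a::euclidean_space \<Rightarrow> 'b::{banach, second_countable_topology}"
  assumes "\<rho> > 0"
  shows "(\<integral>y. mollifier \<rho> (y - x) *\<^sub>R h y \<partial>lborel) =
     (\<integral>z. (2 * real DIM('a) * (1 + (norm (z::'a))\<^sup>2) powr (- (halfdim TYPE('a) + 1)) * cutoff (\<rho> * (1 + (norm z)\<^sup>2))) *\<^sub>R h (x + sqrt \<rho> *\<^sub>R z) \<partial>lborel)"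
proof -
  let ?m = "halfdim TYPE('a)"
  have eq: "\<bar>sqrt \<rho>\<bar> ^ DIM('a) * mollifier \<rho> (x + sqrt \<rho> *\<^sub>R z - x) =
     2 * real DIM('a) * (1 + (norm z)\<^sup>2) powr (- (?m + 1)) * cutoff (\<rho> * (1 + (norm z)\<^sup>2))" for z :: 'a
  proof -
    have t: "(norm (x + sqrt \<rho> *\<^sub>R z - x))\<^sup>2 + \<rho> = \<rho> * (1 + (norm z)\<^sup>2)"
      using assms by (simp add: power_mult_distrib algebra_simps)
    have "\<bar>sqrt \<rho>\<bar> ^ DIM('a) = \<rho> powr ?m"
      using assms by (simp add: powr_half_sqrt[symmetric] powr_realpow[symmetric] powr_powr)
    moreover have "(\<rho> * (1 + (norm z)\<^sup>2)) powr (- ?m - 1) = \<rho> powr (- ?m - 1) * (1 + (norm z)\<^sup>2) powr (- (?m + 1))"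
      using assms by (simp add: powr_mult)
    moreover have "\<rho> powr ?m * (\<rho> * \<rho> powr (- ?m - 1)) = 1"
    proof -
      have "\<rho> * \<rho> powr (- ?m - 1) = \<rho> powr (- ?m)" using assms by (simp add: powr_diff)
      then show ?thesis using assms by (simp add: powr_add[symmetric])
    qed
    moreover have "R * (4 * ?m * \<rho> * (Q * P) * X) = (R * (\<rho> * Q)) * (2 * real DIM('a) * P * X)" for R Q P X :: real
      by simp
    ultimately show ?thesis
      unfolding mollifier_def mollifier_profile_def t by simp
  qed
  have "(\<integral>y. mollifier \<rho> (y - x) *\<^sub>R h y \<partial>lborel) =
     \<bar>sqrt \<rho>\<bar> ^ DIM('a) *\<^sub>R (\<integral>z. mollifier \<rho> (x + sqrt \<rho> *\<^sub>R z - x) *\<^sub>R h (x + sqrt \<rho> *\<^sub>R z) \<partial>lborel)"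
    by (rule integral_euclidean_affine) (use assms in auto)
  also have "\<dots> = (\<integral>z. (\<bar>sqrt \<rho>\<bar> ^ DIM('a) * mollifier \<rho> (x + sqrt \<rho> *\<^sub>R z - x)) *\<^sub>R h (x + sqrt \<rho> *\<^sub>R z) \<partial>lborel)"
    by (subst integral_scaleR_right[symmetric]) (simp only: scaleR_scaleR)
  finally show ?thesis unfolding eq .
qed

lemma mollifier_convolution_tendsto:
  fixes h :: "'a::euclidean_space \<Rightarrow> 'b::{banach, second_countable_topology}"
  assumes h: "continuous_on UNIV h" and \<rho>: "\<And>n. 0 < \<rho> n" "\<rho> \<longlonglongrightarrow> 0" and x: "x \<longlonglongrightarrow> x0"
  shows "(\<lambda>n. \<integral>y. mollifier (\<rho> n) (y - x n) *\<^sub>R h y \<partial>lborel) \<longlonglongrightarrow> mollifier_mass TYPE('a) *\<^sub>R h x0"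
proof -
  let ?f = "\<lambda>z::'a. 2 * real DIM('a) * (1 + (norm z)\<^sup>2) powr (- (halfdim TYPE('a) + 1))"
  obtain K where K: "\<And>n. norm (x n) \<le> K" using convergent_imp_Bseq[OF convergentI[OF x]] by (auto simp: Bseq_def)
  have "compact (h ` cball 0 (K + 2))"
    by (intro compact_continuous_image continuous_on_subset[OF h]) auto
  then obtain B where B: "\<And>y. norm y \<le> K + 2 \<Longrightarrow> norm (h y) \<le> B"
    using compact_imp_bounded bounded_iff by (metis imageI mem_cball_0)
  have [measurable]: "h \<in> borel_measurable borel" by (rule borel_measurable_continuous_onI[OF h])
  have [measurable]: "cutoff \<in> borel_measurable borel" by (rule borel_measurable_continuous_onI[OF continuous_on_cutoff])
  have f0: "?f z \<ge> 0" for z by simp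
  have "(\<lambda>n. \<integral>z. (?f z * cutoff (\<rho> n * (1 + (norm z)\<^sup>2))) *\<^sub>R h (x n + sqrt (\<rho> n) *\<^sub>R z) \<partial>lborel) \<longlonglongrightarrow>
     (\<integral>z. ?f z *\<^sub>R h x0 \<partial>lborel)"
  proof (rule integral_dominated_convergence[where w = "\<lambda>z. ?f z * \<bar>B\<bar>"])
    show "integrable lborel (\<lambda>z. ?f z * \<bar>B\<bar>)" by (intro integrable_mult_left mollifier_limit_integrable)
    show "AE z in lborel. (\<lambda>n. (?f z * cutoff (\<rho> n * (1 + (norm z)\<^sup>2))) *\<^sub>R h (x n + sqrt (\<rho> n) *\<^sub>R z)) \<longlonglongrightarrow> ?f z *\<^sub>R h x0"
    proof (rule AE_I2)
      fix z :: 'a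
      have "(\<lambda>n. cutoff (\<rho> n * (1 + (norm z)\<^sup>2))) \<longlonglongrightarrow> cutoff (0 * (1 + (norm z)\<^sup>2))"
        by (rule continuous_on_tendsto_compose[OF continuous_on_cutoff[of UNIV]], intro tendsto_intros \<rho>) auto
      moreover have "(\<lambda>n. h (x n + sqrt (\<rho> n) *\<^sub>R z)) \<longlonglongrightarrow> h (x0 + sqrt 0 *\<^sub>R z)"
        by (rule continuous_on_tendsto_compose[OF h], intro tendsto_intros \<rho> x) auto
      ultimately have "(\<lambda>n. (?f z * cutoff (\<rho> n * (1 + (norm z)\<^sup>2))) *\<^sub>R h (x n + sqrt (\<rho> n) *\<^sub>R z)) \<longlonglongrightarrow>
         (?f z * cutoff (0 * (1 + (norm z)\<^sup>2))) *\<^sub>R h (x0 + sqrt 0 *\<^sub>R z)"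
        by (intro tendsto_intros)
      then show "(\<lambda>n. (?f z * cutoff (\<rho> n * (1 + (norm z)\<^sup>2))) *\<^sub>R h (x n + sqrt (\<rho> n) *\<^sub>R z)) \<longlonglongrightarrow> ?f z *\<^sub>R h x0"
        by (simp add: cutoff_eq_1)
    qed
    show "AE z in lborel. norm ((?f z * cutoff (\<rho> n * (1 + (norm z)\<^sup>2))) *\<^sub>R h (x n + sqrt (\<rho> n) *\<^sub>R z)) \<le> ?f z * \<bar>B\<bar>" for n
    proof (rule AE_I2)
      fix z :: 'a
      show "norm ((?f z * cutoff (\<rho> n * (1 + (norm z)\<^sup>2))) *\<^sub>R h (x n + sqrt (\<rho> n) *\<^sub>R z)) \<le> ?f z * \<bar>B\<bar>"
      proof (cases "\<rho> n * (1 + (norm z)\<^sup>2) \<ge> 2")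
        case True
        then show ?thesis using f0 by (simp add: cutoff_eq_0)
      next
        case False
        then have "(norm (sqrt (\<rho> n) *\<^sub>R z))\<^sup>2 \<le> 2\<^sup>2"
          using \<rho>(1)[of n] by (simp add: power_mult_distrib algebra_simps)
        then have "norm (sqrt (\<rho> n) *\<^sub>R z) \<le> 2" by (rule power2_le_imp_le) simp
        then have "norm (x n + sqrt (\<rho> n) *\<^sub>R z) \<le> K + 2"
          using K[of n] norm_triangle_ineq[of "x n" "sqrt (\<rho> n) *\<^sub>R z"] by linarith
        then have hB: "norm (h (x n + sqrt (\<rho> n) *\<^sub>R z)) \<le> \<bar>B\<bar>" using B by fastforce
        have fc: "?f z * cutoff (\<rho> n * (1 + (norm z)\<^sup>2)) \<le> ?f z"
          using cutoff_le_1 f0 by (intro mult_left_le) auto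
        have "(?f z * cutoff (\<rho> n * (1 + (norm z)\<^sup>2))) * norm (h (x n + sqrt (\<rho> n) *\<^sub>R z)) \<le> ?f z * \<bar>B\<bar>"
          by (rule mult_mono[OF fc hB]) auto
        then show ?thesis using f0[of z] cutoff_nonneg[of "\<rho> n * (1 + (norm z)\<^sup>2)"] by (simp add: abs_mult)
      qed
    qed
  qed measurable
  moreover have "(\<integral>z. ?f z *\<^sub>R h x0 \<partial>lborel) = mollifier_mass TYPE('a) *\<^sub>R h x0"
    unfolding mollifier_mass_def by (rule integral_scaleR_left) (rule mollifier_limit_integrable)
  ultimately show ?thesis by (simp only: mollifier_convolution_rescale[OF \<rho>(1)])
qed

section \<open>Bootstrapping a Kato class bound\<close>

text \<open>Of the two distances \<open>|y - x|\<close> and \<open>|z - y|\<close> the larger is at least half of \<open>|z - x|\<close>, so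
  the smaller of the two weights is controlled by the weight at \<open>z - x\<close>. Moving all but the power
  \<open>d\<close> of it there lowers the first exponent from \<open>a\<close> to \<open>a - d\<close>, while the other weight absorbs
  the rest.\<close>
lemma singularity_three_points:
  fixes x y z :: "'a::euclidean_space"
  assumes zx: "z \<noteq> x" and a: "0 \<le> a" "a \<le> a0" and d: "d > 0"
  shows "singularity (y - x) powr a * singularity (z - y) powr a0 \<le>
    2 powr a0 * singularity (z - x) powr (max 0 (a - d)) *
      (singularity (y - x) powr (a0 + d) + singularity (z - y) powr (a0 + d))"
proof -
  define A B Z e where "A = singularity (y - x)" and "B = singularity (z - y)" and "Z = singularity (z - x)" and "e = max 0 (a - d)"
  have ge: "A \<ge> 1" "B \<ge> 1" "Z \<ge> 1" by (auto simp: A_def B_def Z_def singularity_ge_1)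
  have e: "0 \<le> e" "e \<le> a" "e \<le> a0" "a - e \<le> d" using a d by (auto simp: e_def)
  have min: "min A B \<le> 2 * Z"
  proof (cases "min A B = 1")
    case True
    then show ?thesis using ge by simp
  next
    case False
    then have AB: "A > 1" "B > 1" using ge by (auto simp: min_def split: if_splits)
    then have A: "A = 1 / norm (y - x)" and B: "B = 1 / norm (z - y)"
      by (auto simp: A_def B_def singularity_def max_def split: if_splits)
    have n0: "norm (y - x) > 0" "norm (z - y) > 0" using AB A B by auto
    have n: "norm (z - x) > 0" using zx by simp
    define M where "M = max (norm (y - x)) (norm (z - y))"
    have tri: "norm (z - x) \<le> norm (z - y) + norm (y - x)"
      using norm_triangle_ineq[of "z - y" "y - x"] by simp
    have M: "M > 0" "norm (z - x) \<le> 2 * M"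
      unfolding M_def using n0 tri by linarith+
    have "min A B \<le> 1 / M" unfolding A B M_def using n0 by (auto simp: min_def max_def field_simps)
    also have "\<dots> \<le> 2 * (1 / norm (z - x))" proof -
      have "0 < 2 * M * norm (z - x)" by (rule mult_pos_pos) (use M(1) n in auto)
      then have "2 / (2 * M) \<le> 2 / norm (z - x)" by (intro divide_left_mono M(2)) auto
      then show ?thesis by simp
    qed
    also have "\<dots> \<le> 2 * Z" by (simp add: Z_def singularity_def)
    finally show ?thesis .
  qed
  have two: "(2 * Z) powr e \<le> 2 powr a0 * Z powr e"
    using e ge by (simp add: powr_mult mult_right_mono)
  have "A powr a * B powr a0 \<le> 2 powr a0 * Z powr e * (A powr (a0 + d) + B powr (a0 + d))"
  proof (cases "A \<le> B")
    case True
    have "A powr a = A powr e * A powr (a - e)" by (simp add: powr_add[symmetric])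
    also have "\<dots> \<le> (2 * Z) powr e * B powr d"
    proof (rule mult_mono)
      show "A powr e \<le> (2 * Z) powr e" using min True ge e by (intro powr_mono2) auto
      have "A powr (a - e) \<le> B powr (a - e)" using True ge e by (intro powr_mono2) auto
      also have "\<dots> \<le> B powr d" using ge e by (intro powr_mono) auto
      finally show "A powr (a - e) \<le> B powr d" .
    qed auto
    finally have "A powr a * B powr a0 \<le> ((2 * Z) powr e * B powr d) * B powr a0" by (rule mult_right_mono) simp
    also have "\<dots> = (2 * Z) powr e * B powr (a0 + d)" by (simp add: powr_add)
    also have "\<dots> \<le> (2 powr a0 * Z powr e) * (A powr (a0 + d) + B powr (a0 + d))"
      using two by (intro mult_mono) auto
    finally show ?thesis .
  next
    case False
    have "B powr a0 = B powr e * B powr (a0 - e)" by (simp add: powr_add[symmetric])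
    also have "\<dots> \<le> (2 * Z) powr e * A powr (a0 - e)"
      using min False ge e by (intro mult_mono powr_mono2) auto
    finally have "A powr a * B powr a0 \<le> A powr a * ((2 * Z) powr e * A powr (a0 - e))" by (rule mult_left_mono) simp
    also have "\<dots> = (2 * Z) powr e * A powr (a0 + (a - e))" by (simp add: powr_add[symmetric] algebra_simps)
    also have "\<dots> \<le> (2 * Z) powr e * A powr (a0 + d)"
      using ge e by (intro mult_left_mono powr_mono) auto
    also have "\<dots> \<le> (2 powr a0 * Z powr e) * (A powr (a0 + d) + B powr (a0 + d))"
      using two by (intro mult_mono) auto
    finally show ?thesis .
  qed
  then show ?thesis by (simp only: A_def B_def Z_def e_def)
qed

text \<open>Inserting the pointwise bound for \<open>|w|\<close> into itself composes the kernel with the potential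
  \<open>1 + |w|^2\<close>. By the three point inequality and the Kato bound with the spare exponent \<open>d\<close>, the
  composed kernel is again a Riesz kernel whose exponent is smaller by \<open>d\<close>, on a larger ball. After
  finitely many steps the exponent is 0 and \<open>|w|\<close> is bounded by the integral of \<open>|w| + |w|^3\<close> over a
  ball.\<close>
lemma kato_iteration:
  fixes w :: "'a::euclidean_space \<Rightarrow> complex"
  assumes wm[measurable]: "w \<in> borel_measurable borel"
    and F: "\<And>R. (\<integral>\<^sup>+y. ennreal (norm (w y)) * ennreal (1 + (norm (w y))\<^sup>2) * indicator (cball 0 R) y \<partial>lborel) < \<infinity>"
    and a0: "a0 \<ge> 0" and d: "d > 0"
    and K: "\<And>r. \<exists>K\<ge>0. \<forall>x. (\<integral>\<^sup>+y. ennreal (1 + (norm (w y))\<^sup>2) * ennreal (singularity (y - x) powr (a0 + d)) * indicator (cball x r) y \<partial>lborel) \<le> ennreal K"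
    and C: "C0 \<ge> 0" "AE x in lborel. ennreal (norm (w x)) \<le>
       ennreal C0 * (\<integral>\<^sup>+y. ennreal (singularity (y - x) powr a0) * (ennreal (norm (w y)) * ennreal (1 + (norm (w y))\<^sup>2)) * indicator (cball x 2) y \<partial>lborel)"
  shows "\<exists>B\<ge>0. AE x in lborel. norm x \<le> R \<longrightarrow> norm (w x) \<le> B"
proof -
  define V where "V y = ennreal (1 + (norm (w y))\<^sup>2)" for y
  define W where "W y = ennreal (norm (w y))" for y
  define S where "S a z = ennreal (singularity z powr a)" for a and z :: 'a
  have [measurable]: "V \<in> borel_measurable borel" "W \<in> borel_measurable borel" "\<And>a. S a \<in> borel_measurable borel"
    unfolding V_def W_def S_def by measurable
  have F': "(\<integral>\<^sup>+y. W y * V y * indicator (cball 0 R) y \<partial>lborel) < \<infinity>" for R using F by (simp add: V_def W_def)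
  have K': "\<exists>K\<ge>0. \<forall>x. (\<integral>\<^sup>+y. V y * S (a0 + d) (y - x) * indicator (cball x r) y \<partial>lborel) \<le> ennreal K" for r
    using K[of r] by (simp add: V_def S_def)
  have C': "AE x in lborel. W x \<le> ennreal C0 * (\<integral>\<^sup>+y. S a0 (y - x) * (W y * V y) * indicator (cball x 2) y \<partial>lborel)"
    using C(2) by (simp add: V_def W_def S_def)
  have P: "\<exists>C\<ge>0. \<exists>r. AE x in lborel. W x \<le> ennreal C * (\<integral>\<^sup>+y. S (max 0 (a0 - real j * d)) (y - x) * (W y * V y) * indicator (cball x r) y \<partial>lborel)" for j
  proof (induction j)
    case 0
    have a00: "max 0 (a0 - real 0 * d) = a0" using a0 by simp
    show ?case unfolding a00 by (intro exI[of _ C0] conjI exI[of _ 2] C(1) C')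
  next
    case (Suc j)
    define a where "a = max 0 (a0 - real j * d)"
    define e where "e = max 0 (a - d)"
    have a: "0 \<le> a" "a \<le> a0" using a0 d by (auto simp: a_def)
    have e_eq: "max 0 (a0 - real (Suc j) * d) = e"
    proof -
      have Sj: "real (Suc j) * d = real j * d + d" by (simp add: algebra_simps)
      have "max 0 (a0 - (q + d)) = max 0 (max 0 (a0 - q) - d)" for q using d by linarith
      then show ?thesis unfolding e_def a_def Sj .
    qed
    from Suc.IH obtain C r where C: "C \<ge> 0" and IH: "AE x in lborel. W x \<le> ennreal C * (\<integral>\<^sup>+y. S a (y - x) * (W y * V y) * indicator (cball x r) y \<partial>lborel)"
      unfolding a_def by blast
    obtain Kr K2 where Kr: "Kr \<ge> 0" "\<And>x. (\<integral>\<^sup>+y. V y * S (a0 + d) (y - x) * indicator (cball x r) y \<partial>lborel) \<le> ennreal Kr"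
      and K2: "K2 \<ge> 0" "\<And>x. (\<integral>\<^sup>+y. V y * S (a0 + d) (y - x) * indicator (cball x 2) y \<partial>lborel) \<le> ennreal K2"
      using K'[of r] K'[of 2] by blast
    define D where "D = C0 * (2 powr a0 * (Kr + K2))"
    have D: "D \<ge> 0" using \<open>C0 \<ge> 0\<close> Kr(1) K2(1) by (simp add: D_def)
    have step: "(\<integral>\<^sup>+y. S a (y - x) * (W y * V y) * indicator (cball x r) y \<partial>lborel) \<le>
       ennreal D * (\<integral>\<^sup>+z. S e (z - x) * (W z * V z) * indicator (cball x (r + 2)) z \<partial>lborel)" for x
    proof -
      let ?g = "\<lambda>y z. S a (y - x) * V y * indicator (cball x r) y * (ennreal C0 * (S a0 (z - y) * (W z * V z) * indicator (cball y 2) z))"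
      have "(\<integral>\<^sup>+y. S a (y - x) * (W y * V y) * indicator (cball x r) y \<partial>lborel) \<le>
        (\<integral>\<^sup>+y. S a (y - x) * V y * indicator (cball x r) y * (ennreal C0 * (\<integral>\<^sup>+z. S a0 (z - y) * (W z * V z) * indicator (cball y 2) z \<partial>lborel)) \<partial>lborel)"
      proof (rule nn_integral_mono_AE)
        show "AE y in lborel. S a (y - x) * (W y * V y) * indicator (cball x r) y \<le>
          S a (y - x) * V y * indicator (cball x r) y * (ennreal C0 * (\<integral>\<^sup>+z. S a0 (z - y) * (W z * V z) * indicator (cball y 2) z \<partial>lborel))"
          using C'
        proof eventually_elim
          fix y assume "W y \<le> ennreal C0 * (\<integral>\<^sup>+z. S a0 (z - y) * (W z * V z) * indicator (cball y 2) z \<partial>lborel)"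
          then have "(S a (y - x) * V y * indicator (cball x r) y) * W y \<le> (S a (y - x) * V y * indicator (cball x r) y) *
              (ennreal C0 * (\<integral>\<^sup>+z. S a0 (z - y) * (W z * V z) * indicator (cball y 2) z \<partial>lborel))"
            by (rule mult_left_mono) simp
          then show "S a (y - x) * (W y * V y) * indicator (cball x r) y \<le>
            S a (y - x) * V y * indicator (cball x r) y * (ennreal C0 * (\<integral>\<^sup>+z. S a0 (z - y) * (W z * V z) * indicator (cball y 2) z \<partial>lborel))"
            by (simp only: mult_ac)
        qed
      qed
      also have "\<dots> = (\<integral>\<^sup>+y. (\<integral>\<^sup>+z. ?g y z \<partial>lborel) \<partial>lborel)"
      proof -
        have "A * (ennreal C0 * (\<integral>\<^sup>+z. G z \<partial>lborel)) = (\<integral>\<^sup>+z. A * (ennreal C0 * G z) \<partial>lborel)"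
          if [measurable]: "G \<in> borel_measurable lborel" for A and G :: "'a \<Rightarrow> ennreal"
        proof -
          have "(\<integral>\<^sup>+z. A * (ennreal C0 * G z) \<partial>lborel) = A * (\<integral>\<^sup>+z. ennreal C0 * G z \<partial>lborel)"
            by (rule nn_integral_cmult) measurable
          also have "(\<integral>\<^sup>+z. ennreal C0 * G z \<partial>lborel) = ennreal C0 * (\<integral>\<^sup>+z. G z \<partial>lborel)"
            by (rule nn_integral_cmult) measurable
          finally show ?thesis by (rule sym)
        qed
        then show ?thesis by (rule nn_integral_cong) measurable
      qed
      also have "\<dots> = (\<integral>\<^sup>+z. (\<integral>\<^sup>+y. ?g y z \<partial>lborel) \<partial>lborel)"
      proof (rule lborel_pair.Fubini')
        have "(\<lambda>(z, y). ?g y z) = (\<lambda>p. S a (snd p - x) * V (snd p) * indicator (cball x r) (snd p) *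
            (ennreal C0 * (S a0 (fst p - snd p) * (W (fst p) * V (fst p)) * (if dist (snd p) (fst p) \<le> 2 then 1 else 0))))"
          by (auto simp: fun_eq_iff indicator_def)
        also have "\<dots> \<in> borel_measurable (lborel \<Otimes>\<^sub>M lborel)" by measurable
        finally show "(\<lambda>(z, y). ?g y z) \<in> borel_measurable (lborel \<Otimes>\<^sub>M lborel)" .
      qed
      also have "\<dots> \<le> (\<integral>\<^sup>+z. ennreal D * (S e (z - x) * (W z * V z) * indicator (cball x (r + 2)) z) \<partial>lborel)"
      proof (rule nn_integral_mono_AE)
        have "AE z in lborel. z \<noteq> x" by (rule AE_lborel_singleton)
        then show "AE z in lborel. (\<integral>\<^sup>+y. ?g y z \<partial>lborel) \<le> ennreal D * (S e (z - x) * (W z * V z) * indicator (cball x (r + 2)) z)"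
        proof eventually_elim
          fix z assume zx: "z \<noteq> x"
          let ?c = "ennreal (C0 * 2 powr a0) * (S e (z - x) * (W z * V z) * indicator (cball x (r + 2)) z)"
          have "(\<integral>\<^sup>+y. ?g y z \<partial>lborel) \<le> (\<integral>\<^sup>+y. ?c * (V y * S (a0 + d) (y - x) * indicator (cball x r) y + V y * S (a0 + d) (y - z) * indicator (cball z 2) y) \<partial>lborel)"
          proof (rule nn_integral_mono)
            fix y
            show "?g y z \<le> ?c * (V y * S (a0 + d) (y - x) * indicator (cball x r) y + V y * S (a0 + d) (y - z) * indicator (cball z 2) y)"
            proof (cases "y \<in> cball x r \<and> z \<in> cball y 2")
              case False
              then have "indicator (cball x r) y * indicator (cball y 2) z = (0 :: ennreal)" by (auto simp: indicator_def)
              then have g0: "?g y z = 0" by (auto simp: indicator_def)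
              show ?thesis unfolding g0 by (rule zero_le)
            next
              case True
              then have "dist x z \<le> r + 2" using dist_triangle[of x z y] by simp
              then have ind: "indicator (cball x r) y = (1::ennreal)" "indicator (cball y 2) z = (1::ennreal)"
                "indicator (cball x (r + 2)) z = (1::ennreal)" "indicator (cball z 2) y = (1::ennreal)"
                using True by (auto simp: dist_commute)
              have "S a (y - x) * S a0 (z - y) = ennreal (singularity (y - x) powr a * singularity (z - y) powr a0)"
                by (simp add: S_def ennreal_mult)
              also have "\<dots> \<le> ennreal (2 powr a0 * singularity (z - x) powr e * (singularity (y - x) powr (a0 + d) + singularity (z - y) powr (a0 + d)))"
                unfolding e_def by (intro ennreal_leI singularity_three_points zx a d)
              also have "\<dots> = ennreal (2 powr a0) * S e (z - x) * (S (a0 + d) (y - x) + S (a0 + d) (y - z))"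
                by (simp add: S_def ennreal_mult singularity_commute[of z y])
              finally have "(S a (y - x) * S a0 (z - y)) * (V y * ennreal C0 * (W z * V z)) \<le>
                (ennreal (2 powr a0) * S e (z - x) * (S (a0 + d) (y - x) + S (a0 + d) (y - z))) * (V y * ennreal C0 * (W z * V z))"
                by (rule mult_right_mono) simp
              also have "\<dots> = ?c * (V y * S (a0 + d) (y - x) * indicator (cball x r) y + V y * S (a0 + d) (y - z) * indicator (cball z 2) y)"
                using \<open>C0 \<ge> 0\<close> by (simp only: ind mult_1_left mult_1_right distrib_left distrib_right ennreal_mult[OF \<open>C0 \<ge> 0\<close> powr_ge_zero] mult_ac)
              finally show ?thesis by (simp only: ind mult_1_left mult_1_right mult_ac)
            qed
          qed
          also have "\<dots> = ?c * ((\<integral>\<^sup>+y. V y * S (a0 + d) (y - x) * indicator (cball x r) y \<partial>lborel) + (\<integral>\<^sup>+y. V y * S (a0 + d) (y - z) * indicator (cball z 2) y \<partial>lborel))"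
            by (subst nn_integral_cmult, measurable, subst nn_integral_add, measurable)
          also have "\<dots> \<le> ?c * (ennreal Kr + ennreal K2)"
            by (intro mult_left_mono add_mono Kr K2) auto
          also have "\<dots> = ennreal D * (S e (z - x) * (W z * V z) * indicator (cball x (r + 2)) z)"
          proof -
            have "ennreal D = ennreal (C0 * 2 powr a0) * (ennreal Kr + ennreal K2)"
              using \<open>C0 \<ge> 0\<close> Kr(1) K2(1) unfolding D_def mult.assoc[symmetric]
              by (subst ennreal_mult) (auto simp: ennreal_plus)
            then show ?thesis by (simp only: mult_ac)
          qed
          finally show "(\<integral>\<^sup>+y. ?g y z \<partial>lborel) \<le> ennreal D * (S e (z - x) * (W z * V z) * indicator (cball x (r + 2)) z)" .
        qed
      qed
      also have "\<dots> = ennreal D * (\<integral>\<^sup>+z. S e (z - x) * (W z * V z) * indicator (cball x (r + 2)) z \<partial>lborel)"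
        by (rule nn_integral_cmult) measurable
      finally show ?thesis .
    qed
    have "AE x in lborel. W x \<le> ennreal (C * D) * (\<integral>\<^sup>+z. S e (z - x) * (W z * V z) * indicator (cball x (r + 2)) z \<partial>lborel)"
      using IH
    proof eventually_elim
      fix x assume "W x \<le> ennreal C * (\<integral>\<^sup>+y. S a (y - x) * (W y * V y) * indicator (cball x r) y \<partial>lborel)"
      also have "\<dots> \<le> ennreal C * (ennreal D * (\<integral>\<^sup>+z. S e (z - x) * (W z * V z) * indicator (cball x (r + 2)) z \<partial>lborel))"
        by (rule mult_left_mono[OF step]) simp
      finally show "W x \<le> ennreal (C * D) * (\<integral>\<^sup>+z. S e (z - x) * (W z * V z) * indicator (cball x (r + 2)) z \<partial>lborel)"
        using C D by (simp add: ennreal_mult mult.assoc)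
    qed
    then show ?case unfolding e_eq using C D by (intro exI[of _ "C * D"] conjI exI[of _ "r + 2"]) auto
  qed
  obtain j :: nat where j: "a0 \<le> real j * d" using reals_Archimedean3[OF d] less_imp_le by metis
  then have j0: "max 0 (a0 - real j * d) = 0" by simp
  have S0: "S 0 z = 1" for z using singularity_pos[of z] by (simp add: S_def)
  from P[of j] obtain C r where C: "C \<ge> 0" and Wb: "AE x in lborel. W x \<le> ennreal C * (\<integral>\<^sup>+y. W y * V y * indicator (cball x r) y \<partial>lborel)"
    unfolding j0 by (auto simp: S0)
  define I where "I = ennreal C * (\<integral>\<^sup>+y. W y * V y * indicator (cball 0 (R + r)) y \<partial>lborel)"
  have "I < \<infinity>" unfolding I_def using F'[of "R + r"] by (simp add: ennreal_mult_less_top)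
  have "AE x in lborel. norm x \<le> R \<longrightarrow> norm (w x) \<le> enn2real I"
    using Wb
  proof eventually_elim
    fix x assume Wx: "W x \<le> ennreal C * (\<integral>\<^sup>+y. W y * V y * indicator (cball x r) y \<partial>lborel)"
    show "norm x \<le> R \<longrightarrow> norm (w x) \<le> enn2real I"
    proof
      assume x: "norm x \<le> R"
      have sub: "cball x r \<subseteq> cball 0 (R + r)"
      proof
        fix y assume "y \<in> cball x r"
        then show "y \<in> cball 0 (R + r)"
          using x norm_triangle_ineq[of x "y - x"] by (simp add: dist_norm norm_minus_commute)
      qed
      have "W x \<le> I"
        unfolding I_def
        by (rule order_trans[OF Wx], intro mult_left_mono nn_integral_mono) (use sub in \<open>auto simp: indicator_def\<close>)
      also have "I = ennreal (enn2real I)" using \<open>I < \<infinity>\<close> by simp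
      finally show "norm (w x) \<le> enn2real I"
        unfolding W_def by (subst (asm) ennreal_le_iff) auto
    qed
  qed
  then show ?thesis by (intro exI[of _ "enn2real I"]) simp
qed

section \<open>The parametrix representation\<close>

lemma convolution_integrable_product:
  fixes a b :: "'a::euclidean_space \<Rightarrow> complex" and k :: "'a \<Rightarrow> real"
  assumes [measurable]: "a \<in> borel_measurable borel" and A: "\<And>x. norm (a x) \<le> A"
    and k: "integrable lborel k" and b: "integrable lborel b"
  shows "integrable (lborel \<Otimes>\<^sub>M lborel) (\<lambda>(y, x). a x * complex_of_real (k (y - x)) * b y)"
proof (rule lborel_pair.Fubini_integrable)
  have [measurable]: "k \<in> borel_measurable borel" "b \<in> borel_measurable borel" using k b by auto
  show [measurable]: "(\<lambda>(y, x). a x * complex_of_real (k (y - x)) * b y) \<in> borel_measurable (lborel \<Otimes>\<^sub>M lborel)"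
    unfolding case_prod_unfold by measurable
  have "A \<ge> 0" using A[of 0] norm_ge_zero order_trans by blast
  have ks: "integrable lborel (\<lambda>x. norm (k (y - x)))" "(\<integral>x. norm (k (y - x)) \<partial>lborel) = (\<integral>z. norm (k z) \<partial>lborel)" for y
    using integral_shift(3,4)[of "\<lambda>z. norm (k z)" y] k by simp_all
  have int: "integrable lborel (\<lambda>x. a x * complex_of_real (k (y - x)) * b y)" for y
  proof (rule Bochner_Integration.integrable_bound[of _ "\<lambda>x. A * norm (b y) * norm (k (y - x))"])
    show "integrable lborel (\<lambda>x. A * norm (b y) * norm (k (y - x)))" using ks by simp
    have "norm (a x) * (norm (k (y - x)) * norm (b y)) \<le> A * (norm (k (y - x)) * norm (b y))" for x
      by (intro mult_right_mono A) auto
    then show "AE x in lborel. norm (a x * complex_of_real (k (y - x)) * b y) \<le> norm (A * norm (b y) * norm (k (y - x)))"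
      using \<open>A \<ge> 0\<close> by (auto simp: norm_mult mult_ac)
  qed measurable
  then show "AE y in lborel. integrable lborel (\<lambda>x. case (y, x) of (y, x) \<Rightarrow> a x * complex_of_real (k (y - x)) * b y)"
    by simp
  have bnd: "(\<integral>x. norm (a x * complex_of_real (k (y - x)) * b y) \<partial>lborel) \<le> A * (\<integral>z. norm (k z) \<partial>lborel) * norm (b y)" for y
  proof -
    have "(\<integral>x. norm (a x * complex_of_real (k (y - x)) * b y) \<partial>lborel) \<le> (\<integral>x. A * norm (b y) * norm (k (y - x)) \<partial>lborel)"
    proof (rule integral_mono)
      show "integrable lborel (\<lambda>x. norm (a x * complex_of_real (k (y - x)) * b y))" by (intro integrable_norm int)
      show "integrable lborel (\<lambda>x. A * norm (b y) * norm (k (y - x)))" using ks by simp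
      fix x
      have "norm (a x) * (norm (k (y - x)) * norm (b y)) \<le> A * (norm (k (y - x)) * norm (b y))"
        by (intro mult_right_mono A) auto
      then show "norm (a x * complex_of_real (k (y - x)) * b y) \<le> A * norm (b y) * norm (k (y - x))"
        by (simp add: norm_mult mult_ac)
    qed
    also have "\<dots> = A * (\<integral>z. norm (k z) \<partial>lborel) * norm (b y)" using ks(2) by simp
    finally show ?thesis .
  qed
  show "integrable lborel (\<lambda>y. \<integral>x. norm (case (y, x) of (y, x) \<Rightarrow> a x * complex_of_real (k (y - x)) * b y) \<partial>lborel)"
  proof (rule Bochner_Integration.integrable_bound[of _ "\<lambda>y. A * (\<integral>z. norm (k z) \<partial>lborel) * norm (b y)"])
    show "integrable lborel (\<lambda>y. A * (\<integral>z. norm (k z) \<partial>lborel) * norm (b y))" using b by simp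
    show "AE y in lborel. norm (\<integral>x. norm (case (y, x) of (y, x) \<Rightarrow> a x * complex_of_real (k (y - x)) * b y) \<partial>lborel)
        \<le> norm (A * (\<integral>z. norm (k z) \<partial>lborel) * norm (b y))"
    proof (rule AE_I2)
      fix y
      have "0 \<le> (\<integral>x. norm (a x * complex_of_real (k (y - x)) * b y) \<partial>lborel)" by simp
      with bnd[of y] show "norm (\<integral>x. norm (case (y, x) of (y, x) \<Rightarrow> a x * complex_of_real (k (y - x)) * b y) \<partial>lborel)
        \<le> norm (A * (\<integral>z. norm (k z) \<partial>lborel) * norm (b y))" by simp
    qed
  qed measurable
qed

lemma convolution_swap:
  fixes a b :: "'a::euclidean_space \<Rightarrow> complex" and k :: "'a \<Rightarrow> real"
  assumes "a \<in> borel_measurable borel" "\<And>x. norm (a x) \<le> A" "integrable lborel k" "integrable lborel b"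
  shows "(\<integral>x. a x * (\<integral>y. complex_of_real (k (y - x)) * b y \<partial>lborel) \<partial>lborel) =
      (\<integral>y. (\<integral>x. a x * complex_of_real (k (y - x)) \<partial>lborel) * b y \<partial>lborel)"
    and "integrable lborel (\<lambda>x. a x * (\<integral>y. complex_of_real (k (y - x)) * b y \<partial>lborel))"
proof -
  note int = convolution_integrable_product[OF assms]
  have eq: "(\<integral>y. a x * complex_of_real (k (y - x)) * b y \<partial>lborel) = a x * (\<integral>y. complex_of_real (k (y - x)) * b y \<partial>lborel)" for x
    by (simp add: mult.assoc)
  show "integrable lborel (\<lambda>x. a x * (\<integral>y. complex_of_real (k (y - x)) * b y \<partial>lborel))"
    using lborel_pair.integrable_snd[OF int] unfolding eq .
  have "(\<integral>x. (\<integral>y. a x * complex_of_real (k (y - x)) * b y \<partial>lborel) \<partial>lborel) =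
     (\<integral>y. (\<integral>x. a x * complex_of_real (k (y - x)) * b y \<partial>lborel) \<partial>lborel)"
    by (rule lborel_pair.Fubini_integral[OF int])
  then show "(\<integral>x. a x * (\<integral>y. complex_of_real (k (y - x)) * b y \<partial>lborel) \<partial>lborel) =
      (\<integral>y. (\<integral>x. a x * complex_of_real (k (y - x)) \<partial>lborel) * b y \<partial>lborel)"
    unfolding eq by simp
qed

lemma convolution_localize:
  fixes f :: "'a::euclidean_space \<Rightarrow> complex"
  assumes k: "\<And>z::'a. norm z > 2 \<Longrightarrow> k z = (0::real)" and x: "norm x \<le> R"
  shows "(\<integral>y. complex_of_real (k (y - x)) * f y \<partial>lborel) =
     (\<integral>y. complex_of_real (k (y - x)) * (indicator (cball 0 (R + 2)) y *\<^sub>R f y) \<partial>lborel)"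
proof (rule Bochner_Integration.integral_cong[OF refl])
  fix y
  show "complex_of_real (k (y - x)) * f y = complex_of_real (k (y - x)) * (indicator (cball 0 (R + 2)) y *\<^sub>R f y)"
  proof (cases "norm y \<le> R + 2")
    case False
    then have "norm (y - x) > 2" using x norm_triangle_ineq2[of y x] by linarith
    then show ?thesis using k by simp
  qed simp
qed

text \<open>After the exchange of integrals the kernel acts on the bounded function \<open>\<psi>\<close>, and dominated
  convergence applies although \<open>f\<close> is only integrable on balls.\<close>
lemma convolution_kernel_limit:
  fixes f \<psi> :: "'a::euclidean_space \<Rightarrow> complex" and kn :: "nat \<Rightarrow> 'a \<Rightarrow> real"
  assumes \<psi>[measurable]: "\<psi> \<in> borel_measurable borel" and A: "\<And>x. norm (\<psi> x) \<le> A" and R: "\<And>x. norm x > R \<Longrightarrow> \<psi> x = 0"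
    and f: "integrable lborel (\<lambda>x. indicator (cball 0 (R + 2)) x *\<^sub>R f x)"
    and km[measurable]: "\<And>n. kn n \<in> borel_measurable borel" "k \<in> borel_measurable borel"
    and G: "integrable lborel G" "\<And>n z. z \<noteq> 0 \<Longrightarrow> \<bar>kn n z\<bar> \<le> G z"
    and lim: "\<And>z. z \<noteq> 0 \<Longrightarrow> (\<lambda>n. kn n z) \<longlonglongrightarrow> k z"
    and supp: "\<And>n z. norm z > 2 \<Longrightarrow> kn n z = 0"
  shows "(\<lambda>n. \<integral>x. \<psi> x * (\<integral>y. complex_of_real (kn n (y - x)) * f y \<partial>lborel) \<partial>lborel) \<longlonglongrightarrow>
    (\<integral>x. \<psi> x * (\<integral>y. complex_of_real (k (y - x)) * f y \<partial>lborel) \<partial>lborel)"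
proof -
  let ?f = "\<lambda>y. indicator (cball 0 (R + 2)) y *\<^sub>R f y"
  have [measurable]: "?f \<in> borel_measurable borel" using borel_measurable_integrable[OF f] by simp
  have "A \<ge> 0" using A[of 0] norm_ge_zero order_trans by blast
  have nz: "AE z in lborel. z \<noteq> (0::'a)" by (rule AE_lborel_singleton)
  have kG: "\<bar>k z\<bar> \<le> G z" if "z \<noteq> 0" for z
    by (rule LIMSEQ_le_const2[OF tendsto_rabs[OF lim[OF that]]]) (use G(2) that in auto)
  have ksupp: "k z = 0" if "norm z > 2" for z
  proof -
    have "z \<noteq> 0" using that by auto
    then show ?thesis using LIMSEQ_unique[OF lim[of z]] supp[OF that] by auto
  qed
  have kni: "integrable lborel (kn n)" for n
    by (rule Bochner_Integration.integrable_bound[OF G(1)]) (use nz G(2) in \<open>auto elim!: eventually_mono intro: order_trans[OF _ abs_ge_self]\<close>)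
  have ki: "integrable lborel k"
    by (rule Bochner_Integration.integrable_bound[OF G(1)]) (use nz kG in \<open>auto elim!: eventually_mono intro: order_trans[OF _ abs_ge_self]\<close>)
  have swap: "(\<integral>x. \<psi> x * (\<integral>y. complex_of_real (q (y - x)) * f y \<partial>lborel) \<partial>lborel) = (\<integral>y. (\<integral>z. \<psi> (y - z) * complex_of_real (q z) \<partial>lborel) * ?f y \<partial>lborel)"
    if q: "integrable lborel q" "\<And>z. norm z > 2 \<Longrightarrow> q z = 0" for q :: "'a \<Rightarrow> real"
  proof -
    have "(\<integral>x. \<psi> x * (\<integral>y. complex_of_real (q (y - x)) * f y \<partial>lborel) \<partial>lborel) = (\<integral>x. \<psi> x * (\<integral>y. complex_of_real (q (y - x)) * ?f y \<partial>lborel) \<partial>lborel)"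
    proof (rule Bochner_Integration.integral_cong[OF refl])
      fix x
      show "\<psi> x * (\<integral>y. complex_of_real (q (y - x)) * f y \<partial>lborel) = \<psi> x * (\<integral>y. complex_of_real (q (y - x)) * ?f y \<partial>lborel)"
        using convolution_localize[where k = q and x = x and R = R and f = f, OF q(2)] R[of x] by (cases "norm x \<le> R") auto
    qed
    also have "\<dots> = (\<integral>y. (\<integral>x. \<psi> x * complex_of_real (q (y - x)) \<partial>lborel) * ?f y \<partial>lborel)"
      by (rule convolution_swap(1)[OF \<psi> A q(1) f])
    also have "(\<lambda>y. \<integral>x. \<psi> x * complex_of_real (q (y - x)) \<partial>lborel) = (\<lambda>y. \<integral>z. \<psi> (y - z) * complex_of_real (q z) \<partial>lborel)"
      using integral_shift(3)[of "\<lambda>z. \<psi> (y - z) * complex_of_real (q z)" y for y] by simp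
    finally show ?thesis .
  qed
  have bnd: "norm (\<psi> (y - z) * complex_of_real (kn n z)) \<le> A * G z" if "z \<noteq> 0" for y z n
    unfolding norm_mult using G(2)[OF that, of n] by (intro mult_mono A) (auto simp: \<open>A \<ge> 0\<close>)
  have Jlim: "(\<lambda>n. \<integral>z. \<psi> (y - z) * complex_of_real (kn n z) \<partial>lborel) \<longlonglongrightarrow> (\<integral>z. \<psi> (y - z) * complex_of_real (k z) \<partial>lborel)" for y
  proof (rule integral_dominated_convergence[where w = "\<lambda>z. A * G z"])
    show "integrable lborel (\<lambda>z. A * G z)" using G(1) by simp
    show "AE z in lborel. (\<lambda>n. \<psi> (y - z) * complex_of_real (kn n z)) \<longlonglongrightarrow> \<psi> (y - z) * complex_of_real (k z)"
      using nz by eventually_elim (intro tendsto_intros lim)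
    show "AE z in lborel. norm (\<psi> (y - z) * complex_of_real (kn n z)) \<le> A * G z" for n
      using nz by eventually_elim (rule bnd)
  qed measurable
  have Jbnd: "norm (\<integral>z. \<psi> (y - z) * complex_of_real (kn n z) \<partial>lborel) \<le> A * (\<integral>z. G z \<partial>lborel)" for y n
  proof -
    have "norm (\<integral>z. \<psi> (y - z) * complex_of_real (kn n z) \<partial>lborel) \<le> (\<integral>z. norm (\<psi> (y - z) * complex_of_real (kn n z)) \<partial>lborel)"
      by (rule integral_norm_bound)
    also have "\<dots> \<le> (\<integral>z. A * G z \<partial>lborel)"
    proof (rule integral_mono_AE)
      show "integrable lborel (\<lambda>z. A * G z)" using G(1) by simp
      show "integrable lborel (\<lambda>z. norm (\<psi> (y - z) * complex_of_real (kn n z)))"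
        by (rule Bochner_Integration.integrable_bound[of _ "\<lambda>z. A * kn n z"])
           (use kni A \<open>A \<ge> 0\<close> in \<open>auto simp: norm_mult abs_mult intro!: mult_right_mono\<close>)
      show "AE z in lborel. norm (\<psi> (y - z) * complex_of_real (kn n z)) \<le> A * G z"
        using nz by eventually_elim (rule bnd)
    qed
    finally have "norm (\<integral>z. \<psi> (y - z) * complex_of_real (kn n z) \<partial>lborel) \<le> (\<integral>z. A * G z \<partial>lborel)" .
    then show ?thesis by simp
  qed
  have "(\<lambda>n. \<integral>y. (\<integral>z. \<psi> (y - z) * complex_of_real (kn n z) \<partial>lborel) * ?f y \<partial>lborel) \<longlonglongrightarrow>
     (\<integral>y. (\<integral>z. \<psi> (y - z) * complex_of_real (k z) \<partial>lborel) * ?f y \<partial>lborel)"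
  proof (rule integral_dominated_convergence[where w = "\<lambda>y. (A * (\<integral>z. G z \<partial>lborel)) * norm (?f y)"])
    show "integrable lborel (\<lambda>y. (A * (\<integral>z. G z \<partial>lborel)) * norm (?f y))"
      using integrable_norm[OF f] by (intro integrable_mult_right)
    show "AE y in lborel. (\<lambda>n. (\<integral>z. \<psi> (y - z) * complex_of_real (kn n z) \<partial>lborel) * ?f y) \<longlonglongrightarrow>
      (\<integral>z. \<psi> (y - z) * complex_of_real (k z) \<partial>lborel) * ?f y"
      by (intro AE_I2 tendsto_mult Jlim tendsto_const)
    show "AE y in lborel. norm ((\<integral>z. \<psi> (y - z) * complex_of_real (kn n z) \<partial>lborel) * ?f y) \<le> (A * (\<integral>z. G z \<partial>lborel)) * norm (?f y)" for n
      unfolding norm_mult by (intro AE_I2 mult_right_mono Jbnd) auto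
  qed measurable
  moreover have "(\<integral>x. \<psi> x * (\<integral>y. complex_of_real (kn n (y - x)) * f y \<partial>lborel) \<partial>lborel) =
      (\<integral>y. (\<integral>z. \<psi> (y - z) * complex_of_real (kn n z) \<partial>lborel) * ?f y \<partial>lborel)" for n
    by (rule swap[OF kni supp])
  moreover have "(\<integral>x. \<psi> x * (\<integral>y. complex_of_real (k (y - x)) * f y \<partial>lborel) \<partial>lborel) =
      (\<integral>y. (\<integral>z. \<psi> (y - z) * complex_of_real (k z) \<partial>lborel) * ?f y \<partial>lborel)"
    by (rule swap[OF ki ksupp])
  ultimately show ?thesis by (simp only:)
qed

lemma mollifier_minus: "mollifier \<rho> (x - y) = mollifier \<rho> (y - x)"
  by (simp add: mollifier_def norm_minus_commute)

lemma continuous_compact_support_kernel: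
  fixes k :: "'a::euclidean_space \<Rightarrow> real"
  assumes k: "continuous_on UNIV k" "\<And>z. norm z > 2 \<Longrightarrow> k z = 0"
  shows "integrable lborel k" "\<exists>B\<ge>0. \<forall>z. \<bar>k z\<bar> \<le> B"
proof -
  have "compact (k ` cball 0 2)" by (intro compact_continuous_image continuous_on_subset[OF k(1)]) auto
  then obtain B where B: "\<And>z. norm z \<le> 2 \<Longrightarrow> \<bar>k z\<bar> \<le> B"
    using compact_imp_bounded bounded_iff by (metis imageI mem_cball_0 real_norm_def)
  have "B \<ge> 0" using B[of 0] by simp
  have B': "\<bar>k z\<bar> \<le> B" for z using B[of z] k(2)[of z] \<open>B \<ge> 0\<close> by (cases "norm z \<le> 2") auto
  show "integrable lborel k"
    by (rule integrable_bounded_support[of _ B 2]) (use B' k in \<open>auto intro: borel_measurable_continuous_onI\<close>)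
  show "\<exists>B\<ge>0. \<forall>z. \<bar>k z\<bar> \<le> B" using B' \<open>B \<ge> 0\<close> by blast
qed

lemma mollifier_convolution_bound:
  fixes h :: "'a::euclidean_space \<Rightarrow> 'b::{banach, second_countable_topology}"
  assumes \<rho>: "\<rho> > 0" and [measurable]: "h \<in> borel_measurable borel" and A: "\<And>y. norm (h y) \<le> A"
  shows "norm (\<integral>y. mollifier \<rho> (y - x) *\<^sub>R h y \<partial>lborel) \<le> mollifier_mass TYPE('a) * A"
proof -
  let ?f = "\<lambda>z::'a. 2 * real DIM('a) * (1 + (norm z)\<^sup>2) powr (- (halfdim TYPE('a) + 1))"
  let ?g = "\<lambda>z. (?f z * cutoff (\<rho> * (1 + (norm z)\<^sup>2))) *\<^sub>R h (x + sqrt \<rho> *\<^sub>R z)"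
  have f0: "?f z \<ge> 0" for z by simp
  have [measurable]: "cutoff \<in> borel_measurable borel" by (rule borel_measurable_continuous_onI[OF continuous_on_cutoff])
  have b: "norm (?g z) \<le> ?f z * A" for z
  proof -
    have "?f z * cutoff (\<rho> * (1 + (norm z)\<^sup>2)) \<le> ?f z" using cutoff_le_1 f0 by (intro mult_left_le) auto
    from mult_mono[OF this A] show ?thesis using cutoff_nonneg[of "\<rho> * (1 + (norm z)\<^sup>2)"] by (simp add: abs_mult)
  qed
  have fA: "integrable lborel (\<lambda>z. ?f z * A)" by (intro integrable_mult_left mollifier_limit_integrable)
  have "norm (\<integral>z. ?g z \<partial>lborel) \<le> (\<integral>z. norm (?g z) \<partial>lborel)" by (rule integral_norm_bound)
  also have "\<dots> \<le> (\<integral>z. ?f z * A \<partial>lborel)"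
  proof (rule integral_mono[OF _ fA b])
    show "integrable lborel (\<lambda>z. norm (?g z))"
    proof (rule Bochner_Integration.integrable_bound[OF fA])
      show "AE z in lborel. norm (norm (?g z)) \<le> norm (?f z * A)"
      proof (rule AE_I2)
        fix z
        have "norm (?g z) \<le> \<bar>?f z * A\<bar>" by (rule order_trans[OF b abs_ge_self])
        then show "norm (norm (?g z)) \<le> norm (?f z * A)" by (simp only: real_norm_def abs_norm_cancel)
      qed
    qed measurable
  qed
  also have "\<dots> = mollifier_mass TYPE('a) * A"
    unfolding mollifier_mass_def by (rule integral_mult_left_zero)
  finally show ?thesis by (simp only: mollifier_convolution_rescale[OF \<rho>])
qed

lemma mollifier_pairing_limit:
  fixes f \<psi> :: "'a::euclidean_space \<Rightarrow> complex"
  assumes \<psi>: "continuous_on UNIV \<psi>" and A: "\<And>x. norm (\<psi> x) \<le> A" and R: "\<And>x. norm x > R \<Longrightarrow> \<psi> x = 0"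
    and f: "integrable lborel (\<lambda>x. indicator (cball 0 (R + 2)) x *\<^sub>R f x)"
    and \<rho>: "\<And>n. \<rho> n > 0" "\<rho> \<longlonglongrightarrow> 0"
  shows "(\<lambda>n. \<integral>x. \<psi> x * (\<integral>y. complex_of_real (mollifier (\<rho> n) (y - x)) * f y \<partial>lborel) \<partial>lborel) \<longlonglongrightarrow>
    (\<integral>x. \<psi> x * (mollifier_mass TYPE('a) *\<^sub>R f x) \<partial>lborel)"
proof -
  let ?f = "\<lambda>y. indicator (cball 0 (R + 2)) y *\<^sub>R f y"
  have \<psi>m[measurable]: "\<psi> \<in> borel_measurable borel" by (rule borel_measurable_continuous_onI[OF \<psi>])
  have [measurable]: "?f \<in> borel_measurable borel" using borel_measurable_integrable[OF f] by simp
  have mi: "integrable lborel (mollifier (\<rho> n) :: 'a \<Rightarrow> real)" for n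
    by (rule continuous_compact_support_kernel(1)[OF mollifier_continuous[OF \<rho>(1)]]) (simp add: kernels_support less_imp_le[OF \<rho>(1)])
  have [measurable]: "(mollifier (\<rho> n) :: 'a \<Rightarrow> real) \<in> borel_measurable borel" for n using mi[of n] by auto
  let ?J = "\<lambda>n y. \<integral>x. mollifier (\<rho> n) (x - y) *\<^sub>R \<psi> x \<partial>lborel"
  have [measurable]: "?J n \<in> borel_measurable borel" for n by measurable
  have swap: "(\<integral>x. \<psi> x * (\<integral>y. complex_of_real (mollifier (\<rho> n) (y - x)) * f y \<partial>lborel) \<partial>lborel) = (\<integral>y. ?J n y * ?f y \<partial>lborel)" for n
  proof -
    have supp: "mollifier (\<rho> n) z = 0" if "norm z > 2" for z :: 'a
      using kernels_support(2)[OF that less_imp_le[OF \<rho>(1)]] .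
    have "(\<integral>x. \<psi> x * (\<integral>y. complex_of_real (mollifier (\<rho> n) (y - x)) * f y \<partial>lborel) \<partial>lborel) = (\<integral>x. \<psi> x * (\<integral>y. complex_of_real (mollifier (\<rho> n) (y - x)) * ?f y \<partial>lborel) \<partial>lborel)"
    proof (rule Bochner_Integration.integral_cong[OF refl])
      fix x
      show "\<psi> x * (\<integral>y. complex_of_real (mollifier (\<rho> n) (y - x)) * f y \<partial>lborel) = \<psi> x * (\<integral>y. complex_of_real (mollifier (\<rho> n) (y - x)) * ?f y \<partial>lborel)"
        using convolution_localize[where k = "mollifier (\<rho> n)" and x = x and R = R and f = f, OF supp] R[of x] by (cases "norm x \<le> R") auto
    qed
    also have "\<dots> = (\<integral>y. (\<integral>x. \<psi> x * complex_of_real (mollifier (\<rho> n) (y - x)) \<partial>lborel) * ?f y \<partial>lborel)"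
      by (rule convolution_swap(1)[OF \<psi>m A mi f])
    also have "(\<lambda>y. \<integral>x. \<psi> x * complex_of_real (mollifier (\<rho> n) (y - x)) \<partial>lborel) = ?J n"
      by (simp add: mollifier_minus scaleR_conv_of_real mult.commute)
    finally show ?thesis .
  qed
  have "(\<lambda>n. \<integral>y. ?J n y * ?f y \<partial>lborel) \<longlonglongrightarrow> (\<integral>y. (mollifier_mass TYPE('a) *\<^sub>R \<psi> y) * ?f y \<partial>lborel)"
  proof (rule integral_dominated_convergence[where w = "\<lambda>y. (mollifier_mass TYPE('a) * A) * norm (?f y)"])
    show "integrable lborel (\<lambda>y. (mollifier_mass TYPE('a) * A) * norm (?f y))"
      using integrable_norm[OF f] by (intro integrable_mult_right)
    show "AE y in lborel. (\<lambda>n. ?J n y * ?f y) \<longlonglongrightarrow> (mollifier_mass TYPE('a) *\<^sub>R \<psi> y) * ?f y"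
      by (intro AE_I2 tendsto_mult tendsto_const mollifier_convolution_tendsto[OF \<psi> \<rho>])
    show "AE y in lborel. norm (?J n y * ?f y) \<le> (mollifier_mass TYPE('a) * A) * norm (?f y)" for n
      unfolding norm_mult by (intro AE_I2 mult_right_mono mollifier_convolution_bound \<rho> A) auto
  qed measurable
  also have "(\<lambda>y. (mollifier_mass TYPE('a) *\<^sub>R \<psi> y) * ?f y) = (\<lambda>x. \<psi> x * (mollifier_mass TYPE('a) *\<^sub>R f x))"
  proof
    fix y
    show "(mollifier_mass TYPE('a) *\<^sub>R \<psi> y) * ?f y = \<psi> y * (mollifier_mass TYPE('a) *\<^sub>R f y)"
      using R[of y] by (cases "norm y \<le> R + 2") auto
  qed
  finally show ?thesis unfolding swap .
qed

lemma locally_integrable_cball: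
  assumes "locally_integrable f"
  shows "integrable lborel (\<lambda>x. indicator (cball 0 R) x *\<^sub>R f x)"
  using assms unfolding locally_integrable_def set_integrable_def by auto

text \<open>The three integrals of the weak formulation in the form in which they are used, as one identity
  between integrals of \<open>w\<close> against explicit kernels.\<close>
lemma weak_equation:
  fixes w \<phi> :: "'a::euclidean_space \<Rightarrow> complex"
  assumes sol: "distributional_solution lam w" and \<phi>: "test_function \<phi>"
    and m: "\<phi> \<in> borel_measurable borel" and B: "\<And>x. norm (\<phi> x) \<le> B" and R: "\<And>x. norm x > R \<Longrightarrow> \<phi> x = 0"
  shows "(\<integral>x. w x * laplacian \<phi> x \<partial>lborel) = (\<integral>x. \<phi> x * (w x - lam * w x ^ 3) \<partial>lborel)"
proof -
  have w: "locally_integrable w" "locally_integrable (\<lambda>x. w x ^ 3)"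
    using sol by (auto simp: distributional_solution_def)
  have i: "integrable lborel (\<lambda>x. \<phi> x * w x)" "integrable lborel (\<lambda>x. \<phi> x * w x ^ 3)"
    by (rule locally_integrable_mult_bounded[OF locally_integrable_cball[OF w(1), of R] m B R];
        simp)
       (rule locally_integrable_mult_bounded[OF locally_integrable_cball[OF w(2), of R] m B R]; simp)
  have "(\<integral>x. \<phi> x * (w x - lam * w x ^ 3) \<partial>lborel) = (\<integral>x. \<phi> x * w x - lam * (\<phi> x * w x ^ 3) \<partial>lborel)"
    by (intro Bochner_Integration.integral_cong refl) (simp add: algebra_simps)
  also have "\<dots> = (\<integral>x. \<phi> x * w x \<partial>lborel) - lam * (\<integral>x. \<phi> x * w x ^ 3 \<partial>lborel)"
    using i by simp
  also have "\<dots> = (\<integral>x. w x * laplacian \<phi> x \<partial>lborel)"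
    using sol \<phi> unfolding distributional_solution_def by (simp add: mult.commute algebra_simps)
  finally show ?thesis by simp
qed

text \<open>The weak equation is tested with the regularised Newtonian kernel at \<open>x\<close>, whose Laplacian is
  an approximate identity plus a bounded kernel. As \<open>\<rho>\<close> tends to 0 the approximate identity
  reproduces \<open>w\<close> up to its mass. The limit is taken after pairing with a continuous function
  of \<open>x\<close>, since \<open>w\<close> has no pointwise values yet.\<close>
lemma parametrix_representation:
  fixes w :: "'a::euclidean_space \<Rightarrow> complex"
  assumes sol: "distributional_solution lam w" and wm[measurable]: "w \<in> borel_measurable borel"
  shows "AE x in lborel. mollifier_mass TYPE('a) *\<^sub>R w x =
     (\<integral>y. complex_of_real (newton_kernel 0 (y - x)) * (w y - lam * w y ^ 3) \<partial>lborel) -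
     (\<integral>y. complex_of_real (remainder_kernel 0 (y - x)) * w y \<partial>lborel)"
proof -
  let ?F = "\<lambda>y. w y - lam * w y ^ 3" and ?c = "mollifier_mass TYPE('a)"
  have w: "locally_integrable w" "locally_integrable (\<lambda>x. w x ^ 3)"
    using sol by (auto simp: distributional_solution_def)
  have wi: "integrable lborel (\<lambda>x. indicator (cball 0 R) x *\<^sub>R w x)" for R by (rule locally_integrable_cball[OF w(1)])
  have Fi: "integrable lborel (\<lambda>x. indicator (cball 0 R) x *\<^sub>R ?F x)" for R
  proof -
    have "integrable lborel (\<lambda>x. indicator (cball 0 R) x *\<^sub>R w x - lam * (indicator (cball 0 R) x *\<^sub>R w x ^ 3))"
      by (intro Bochner_Integration.integrable_diff integrable_mult_right locally_integrable_cball w)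
    also have "(\<lambda>x. indicator (cball 0 R) x *\<^sub>R w x - lam * (indicator (cball 0 R) x *\<^sub>R w x ^ 3)) = (\<lambda>x. indicator (cball 0 R) x *\<^sub>R ?F x)"
      by (simp add: algebra_simps)
    finally show ?thesis .
  qed
  have m0[measurable]: "(newton_kernel 0 :: 'a \<Rightarrow> real) \<in> borel_measurable borel" "(remainder_kernel 0 :: 'a \<Rightarrow> real) \<in> borel_measurable borel"
    by (auto intro: kernels_measurable)
  obtain L where L: "L > 0" "\<And>\<rho> z::'a. 0 \<le> \<rho> \<Longrightarrow> \<bar>remainder_kernel \<rho> z\<bar> \<le> L" using remainder_kernel_bounded by blast
  have ri: "integrable lborel (remainder_kernel 0 :: 'a \<Rightarrow> real)"
    by (rule integrable_bounded_support[of _ L 2]) (use L in \<open>auto simp: kernels_support\<close>)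
  let ?h = "\<lambda>x. ?c *\<^sub>R w x - ((\<integral>y. complex_of_real (newton_kernel 0 (y - x)) * ?F y \<partial>lborel) -
     (\<integral>y. complex_of_real (remainder_kernel 0 (y - x)) * w y \<partial>lborel))"
  have loc: "integrable lborel (\<lambda>x. indicator (cball 0 R) x *\<^sub>R (\<integral>y. complex_of_real (k (y - x)) * f y \<partial>lborel))"
    if k: "integrable lborel k" "\<And>z. norm z > 2 \<Longrightarrow> k z = 0" and f: "integrable lborel (\<lambda>x. indicator (cball 0 (R + 2)) x *\<^sub>R f x)"
    for k :: "'a \<Rightarrow> real" and f R
  proof -
    have "integrable lborel (\<lambda>x. indicator (cball 0 R) x * (\<integral>y. complex_of_real (k (y - x)) * (indicator (cball 0 (R + 2)) y *\<^sub>R f y) \<partial>lborel))"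
      by (rule convolution_swap(2)[of _ 1]) (use k(1) f in \<open>auto simp: indicator_def\<close>)
    also have "(\<lambda>x. indicator (cball 0 R) x * (\<integral>y. complex_of_real (k (y - x)) * (indicator (cball 0 (R + 2)) y *\<^sub>R f y) \<partial>lborel)) =
       (\<lambda>x. indicator (cball 0 R) x *\<^sub>R (\<integral>y. complex_of_real (k (y - x)) * f y \<partial>lborel))"
    proof
      fix x
      show "indicator (cball 0 R) x * (\<integral>y. complex_of_real (k (y - x)) * (indicator (cball 0 (R + 2)) y *\<^sub>R f y) \<partial>lborel) =
         indicator (cball 0 R) x *\<^sub>R (\<integral>y. complex_of_real (k (y - x)) * f y \<partial>lborel)"
        using convolution_localize[where k = k and x = x and R = R and f = f, OF k(2)]
        by (cases "norm x \<le> R") auto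
    qed
    finally show ?thesis .
  qed
  have "AE x in lborel. ?h x = 0"
  proof (rule integral_continuous_test_zero_imp_AE_zero)
    show "?h \<in> borel_measurable borel" by measurable
  next
    fix R
    have "integrable lborel (\<lambda>x. ?c *\<^sub>R (indicator (cball 0 R) x *\<^sub>R w x) - (indicator (cball 0 R) x *\<^sub>R (\<integral>y. complex_of_real (newton_kernel 0 (y - x)) * ?F y \<partial>lborel) -
     indicator (cball 0 R) x *\<^sub>R (\<integral>y. complex_of_real (remainder_kernel 0 (y - x)) * w y \<partial>lborel)))"
      by (intro Bochner_Integration.integrable_diff integrable_scaleR_right wi loc newton_kernel_integrable ri Fi) (auto simp: kernels_support)
    then show "integrable lborel (\<lambda>x. indicator (cball 0 R) x *\<^sub>R ?h x)"
      by (simp add: scaleR_diff_right mult.commute)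
  next
    fix \<psi> :: "'a \<Rightarrow> complex" and R
    assume \<psi>: "continuous_on UNIV \<psi>" "\<And>x. norm x > R \<Longrightarrow> \<psi> x = 0"
    have \<psi>m[measurable]: "\<psi> \<in> borel_measurable borel" by (rule borel_measurable_continuous_onI[OF \<psi>(1)])
    have "compact (\<psi> ` cball 0 R)" by (intro compact_continuous_image continuous_on_subset[OF \<psi>(1)]) auto
    then obtain A' where A': "\<And>x. norm x \<le> R \<Longrightarrow> norm (\<psi> x) \<le> A'"
      using compact_imp_bounded bounded_iff by (metis imageI mem_cball_0)
    define A where "A = \<bar>A'\<bar>"
    have A: "norm (\<psi> x) \<le> A" for x
      using A'[of x] \<psi>(2)[of x] by (cases "norm x \<le> R") (auto simp: A_def)
    have gi: "integrable lborel (\<lambda>x. \<psi> x * (\<integral>y. complex_of_real (k (y - x)) * f y \<partial>lborel))"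
      if k: "integrable lborel k" "\<And>z. norm z > 2 \<Longrightarrow> k z = 0" and f: "integrable lborel (\<lambda>x. indicator (cball 0 (R + 2)) x *\<^sub>R f x)"
      for k :: "'a \<Rightarrow> real" and f
      by (rule locally_integrable_mult_bounded[OF loc[OF k f] \<psi>m A \<psi>(2)])
    have wpi: "integrable lborel (\<lambda>x. \<psi> x * (?c *\<^sub>R w x))"
    proof -
      have "integrable lborel (\<lambda>x. indicator (cball 0 R) x *\<^sub>R (?c *\<^sub>R w x))"
        using integrable_scaleR_right[OF wi[of R], of ?c] by (simp add: mult.commute)
      then show ?thesis by (rule locally_integrable_mult_bounded[OF _ \<psi>m A \<psi>(2)])
    qed
    define \<rho> where "\<rho> n = inverse (real (Suc n))" for n
    have \<rho>: "\<And>n. \<rho> n > 0" "\<rho> \<longlonglongrightarrow> 0" unfolding \<rho>_def using LIMSEQ_inverse_real_of_nat by auto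
    have \<rho>0: "\<And>n. 0 \<le> \<rho> n" using \<rho>(1) less_imp_le by blast
    have km[measurable]: "(newton_kernel (\<rho> n) :: 'a \<Rightarrow> real) \<in> borel_measurable borel" "(remainder_kernel (\<rho> n) :: 'a \<Rightarrow> real) \<in> borel_measurable borel"
      "(mollifier (\<rho> n) :: 'a \<Rightarrow> real) \<in> borel_measurable borel" for n
      using \<rho>0 by (auto intro: kernels_measurable)
    have mi: "integrable lborel (mollifier (\<rho> n) :: 'a \<Rightarrow> real)" for n
      by (rule continuous_compact_support_kernel(1)[OF mollifier_continuous[OF \<rho>(1)]]) (simp add: kernels_support \<rho>0)
    have rni: "integrable lborel (remainder_kernel (\<rho> n) :: 'a \<Rightarrow> real)" for n
      by (rule integrable_bounded_support[of _ L 2]) (use L \<rho>0 km in \<open>auto simp: kernels_support\<close>)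
    have eq: "(\<integral>y. complex_of_real (mollifier (\<rho> n) (y - x)) * w y \<partial>lborel) + (\<integral>y. complex_of_real (remainder_kernel (\<rho> n) (y - x)) * w y \<partial>lborel) =
       (\<integral>y. complex_of_real (newton_kernel (\<rho> n) (y - x)) * ?F y \<partial>lborel)" for x n
    proof -
      obtain B where B: "B \<ge> 0" "\<And>z::'a. \<bar>newton_kernel (\<rho> n) z\<bar> \<le> B"
        using continuous_compact_support_kernel(2)[OF newton_kernel_continuous[OF \<rho>(1)], of n] kernels_support(1)[OF _ \<rho>0] by blast
      have far: "norm (y - x) > 2" if "norm y > norm x + 2" for y using that norm_triangle_ineq2[of y x] by linarith
      have "(\<integral>y. w y * laplacian (\<lambda>y. complex_of_real (newton_kernel (\<rho> n) (y - x))) y \<partial>lborel) =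
        (\<integral>y. complex_of_real (newton_kernel (\<rho> n) (y - x)) * ?F y \<partial>lborel)"
        by (rule weak_equation[OF sol newton_kernel_test_function[OF \<rho>(1)], where B = B and R = "norm x + 2"])
           (use B far in \<open>auto simp: kernels_support \<rho>0\<close>)
      also have "(\<lambda>y. w y * laplacian (\<lambda>y. complex_of_real (newton_kernel (\<rho> n) (y - x))) y) =
        (\<lambda>y. complex_of_real (mollifier (\<rho> n) (y - x)) * w y + complex_of_real (remainder_kernel (\<rho> n) (y - x)) * w y)"
        by (simp add: laplacian_newton_kernel[OF \<rho>(1)] algebra_simps)
      also have "(\<integral>y. complex_of_real (mollifier (\<rho> n) (y - x)) * w y + complex_of_real (remainder_kernel (\<rho> n) (y - x)) * w y \<partial>lborel) =
         (\<integral>y. complex_of_real (mollifier (\<rho> n) (y - x)) * w y \<partial>lborel) + (\<integral>y. complex_of_real (remainder_kernel (\<rho> n) (y - x)) * w y \<partial>lborel)"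
      proof (rule Bochner_Integration.integral_add)
        obtain B' where B': "B' \<ge> 0" "\<And>z::'a. \<bar>mollifier (\<rho> n) z\<bar> \<le> B'"
          using continuous_compact_support_kernel(2)[OF mollifier_continuous[OF \<rho>(1)], of n] kernels_support(2)[OF _ \<rho>0] by blast
        show "integrable lborel (\<lambda>y. complex_of_real (mollifier (\<rho> n) (y - x)) * w y)"
          by (rule locally_integrable_mult_bounded[OF wi[of "norm x + 2"], where B = B']) (use B' far in \<open>auto simp: kernels_support \<rho>0\<close>)
        show "integrable lborel (\<lambda>y. complex_of_real (remainder_kernel (\<rho> n) (y - x)) * w y)"
          by (rule locally_integrable_mult_bounded[OF wi[of "norm x + 2"], where B = L]) (use L far \<rho>0 in \<open>auto simp: kernels_support\<close>)
      qed
      finally show ?thesis .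
    qed
    let ?M = "\<lambda>n. \<integral>x. \<psi> x * (\<integral>y. complex_of_real (mollifier (\<rho> n) (y - x)) * w y \<partial>lborel) \<partial>lborel"
    let ?Rn = "\<lambda>n. \<integral>x. \<psi> x * (\<integral>y. complex_of_real (remainder_kernel (\<rho> n) (y - x)) * w y \<partial>lborel) \<partial>lborel"
    let ?Nn = "\<lambda>n. \<integral>x. \<psi> x * (\<integral>y. complex_of_real (newton_kernel (\<rho> n) (y - x)) * ?F y \<partial>lborel) \<partial>lborel"
    have eqn: "?M n + ?Rn n = ?Nn n" for n
    proof -
      have "?M n + ?Rn n = (\<integral>x. \<psi> x * (\<integral>y. complex_of_real (mollifier (\<rho> n) (y - x)) * w y \<partial>lborel) + \<psi> x * (\<integral>y. complex_of_real (remainder_kernel (\<rho> n) (y - x)) * w y \<partial>lborel) \<partial>lborel)"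
        by (intro Bochner_Integration.integral_add[symmetric] gi wi mi rni) (auto simp: kernels_support \<rho>0)
      also have "\<dots> = ?Nn n" unfolding distrib_left[symmetric] eq ..
      finally show ?thesis .
    qed
    have limM: "?M \<longlonglongrightarrow> (\<integral>x. \<psi> x * (?c *\<^sub>R w x) \<partial>lborel)"
      by (rule mollifier_pairing_limit[OF \<psi>(1) A \<psi>(2) wi \<rho>])
    have limR: "?Rn \<longlonglongrightarrow> (\<integral>x. \<psi> x * (\<integral>y. complex_of_real (remainder_kernel 0 (y - x)) * w y \<partial>lborel) \<partial>lborel)"
    proof (rule convolution_kernel_limit[OF \<psi>m A \<psi>(2) wi km(2) m0(2), where G = "\<lambda>z. L * indicator (cball 0 2) z"])
      show "integrable lborel (\<lambda>z::'a. L * indicator (cball 0 2) z)"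
        by (rule integrable_bounded_support[of _ L 2]) (use L in \<open>auto simp: indicator_def\<close>)
      show "\<bar>remainder_kernel (\<rho> n) z\<bar> \<le> L * indicator (cball 0 2) z" for n and z :: 'a
        using L(2)[OF \<rho>0] kernels_support(3)[OF _ \<rho>0, of z] by (cases "norm z \<le> 2") auto
    qed (use remainder_kernel_tendsto[OF _ tendsto_const \<rho>(2) \<rho>0] in \<open>auto simp: kernels_support \<rho>0\<close>)
    have limN: "?Nn \<longlonglongrightarrow> (\<integral>x. \<psi> x * (\<integral>y. complex_of_real (newton_kernel 0 (y - x)) * ?F y \<partial>lborel) \<partial>lborel)"
      by (rule convolution_kernel_limit[OF \<psi>m A \<psi>(2) Fi km(1) m0(1) integrable_abs[OF newton_kernel_integrable]])
         (use newton_kernel_mono[OF _ \<rho>0] newton_kernel_tendsto[OF _ \<rho>(2)] in \<open>auto simp: kernels_support \<rho>0\<close>)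
    have E1: "(\<integral>x. \<psi> x * (?c *\<^sub>R w x) \<partial>lborel) + (\<integral>x. \<psi> x * (\<integral>y. complex_of_real (remainder_kernel 0 (y - x)) * w y \<partial>lborel) \<partial>lborel) =
      (\<integral>x. \<psi> x * (\<integral>y. complex_of_real (newton_kernel 0 (y - x)) * ?F y \<partial>lborel) \<partial>lborel)"
      using tendsto_add[OF limM limR] limN unfolding eqn by (rule LIMSEQ_unique)
    have "(\<integral>x. \<psi> x * ?h x \<partial>lborel) = (\<integral>x. \<psi> x * (?c *\<^sub>R w x) - (\<psi> x * (\<integral>y. complex_of_real (newton_kernel 0 (y - x)) * ?F y \<partial>lborel) -
       \<psi> x * (\<integral>y. complex_of_real (remainder_kernel 0 (y - x)) * w y \<partial>lborel)) \<partial>lborel)"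
      by (simp only: right_diff_distrib)
    also have "\<dots> = (\<integral>x. \<psi> x * (?c *\<^sub>R w x) \<partial>lborel) - ((\<integral>x. \<psi> x * (\<integral>y. complex_of_real (newton_kernel 0 (y - x)) * ?F y \<partial>lborel) \<partial>lborel) -
       (\<integral>x. \<psi> x * (\<integral>y. complex_of_real (remainder_kernel 0 (y - x)) * w y \<partial>lborel) \<partial>lborel))"
    proof -
      note i1 = gi[OF newton_kernel_integrable _ Fi] and i2 = gi[OF ri _ wi]
      have i1': "integrable lborel (\<lambda>x. \<psi> x * (\<integral>y. complex_of_real (newton_kernel 0 (y - x)) * ?F y \<partial>lborel))"
        by (rule i1) (simp add: kernels_support)
      have i2': "integrable lborel (\<lambda>x. \<psi> x * (\<integral>y. complex_of_real (remainder_kernel 0 (y - x)) * w y \<partial>lborel))"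
        by (rule i2) (simp add: kernels_support)
      show ?thesis
        by (simp only: Bochner_Integration.integral_diff[OF wpi Bochner_Integration.integrable_diff[OF i1' i2']]
              Bochner_Integration.integral_diff[OF i1' i2'])
    qed
    also have "\<dots> = 0"
    proof -
      have "p + r = n \<Longrightarrow> p - (n - r) = 0" for p r n :: complex by auto
      from this[OF E1] show ?thesis .
    qed
    finally show "(\<integral>x. \<psi> x * ?h x \<partial>lborel) = 0" .
  qed
  then show ?thesis by eventually_elim simp
qed

section \<open>Continuity of the solution\<close>

lemma convolution_continuous_kernel:
  fixes f :: "'a::euclidean_space \<Rightarrow> complex" and k :: "'a \<Rightarrow> real"
  assumes k: "continuous_on UNIV k" "\<And>z. norm z > 2 \<Longrightarrow> k z = 0"
    and f: "\<And>R. integrable lborel (\<lambda>y. indicator (cball 0 R) y *\<^sub>R f y)"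
  shows "continuous_on S (\<lambda>x. \<integral>y. complex_of_real (k (y - x)) * f y \<partial>lborel)"
  unfolding continuous_on_sequentially
proof (intro allI ballI impI, elim conjE)
  fix x :: "nat \<Rightarrow> 'a" and a assume x: "x \<longlonglongrightarrow> a"
  obtain K where K: "\<And>n. norm (x n) \<le> K" using convergent_imp_Bseq[OF convergentI[OF x]] by (auto simp: Bseq_def)
  have aK: "norm a \<le> K" by (rule LIMSEQ_le_const2[OF tendsto_norm[OF x]]) (use K in auto)
  let ?f = "\<lambda>y. indicator (cball 0 (K + 2)) y *\<^sub>R f y"
  have [measurable]: "?f \<in> borel_measurable borel" "k \<in> borel_measurable borel"
    using borel_measurable_integrable[OF f] borel_measurable_continuous_onI[OF k(1)] by auto
  obtain B where B: "B \<ge> 0" "\<And>z. \<bar>k z\<bar> \<le> B" using continuous_compact_support_kernel(2)[OF k] by blast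
  have "(\<lambda>n. \<integral>y. complex_of_real (k (y - x n)) * ?f y \<partial>lborel) \<longlonglongrightarrow> (\<integral>y. complex_of_real (k (y - a)) * ?f y \<partial>lborel)"
  proof (rule integral_dominated_convergence[where w = "\<lambda>y. B * norm (?f y)"])
    show "integrable lborel (\<lambda>y. B * norm (?f y))" using integrable_norm[OF f] by (intro integrable_mult_right)
    have "(\<lambda>n. k (y - x n)) \<longlonglongrightarrow> k (y - a)" for y
      by (rule continuous_on_tendsto_compose[OF k(1)], intro tendsto_intros x) auto
    then show "AE y in lborel. (\<lambda>n. complex_of_real (k (y - x n)) * ?f y) \<longlonglongrightarrow> complex_of_real (k (y - a)) * ?f y"
      by (intro AE_I2 tendsto_mult tendsto_of_real tendsto_const)
    show "AE y in lborel. norm (complex_of_real (k (y - x n)) * ?f y) \<le> B * norm (?f y)" for n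
      unfolding norm_mult using B by (intro AE_I2 mult_right_mono) auto
  qed measurable
  moreover have "(\<integral>y. complex_of_real (k (y - x n)) * f y \<partial>lborel) = (\<integral>y. complex_of_real (k (y - x n)) * ?f y \<partial>lborel)" for n
    by (rule convolution_localize[OF k(2) K])
  moreover have "(\<integral>y. complex_of_real (k (y - a)) * f y \<partial>lborel) = (\<integral>y. complex_of_real (k (y - a)) * ?f y \<partial>lborel)"
    by (rule convolution_localize[OF k(2) aK])
  ultimately show "((\<lambda>x. \<integral>y. complex_of_real (k (y - x)) * f y \<partial>lborel) \<circ> x) \<longlonglongrightarrow> (\<integral>y. complex_of_real (k (y - a)) * f y \<partial>lborel)"
    by (simp only: o_def)
qed

lemma locally_bounded_imp_locally_integrable:
  fixes f :: "'a::euclidean_space \<Rightarrow> complex"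
  assumes [measurable]: "f \<in> borel_measurable borel"
    and f: "\<And>R. \<exists>B\<ge>0. AE y in lborel. norm y \<le> R \<longrightarrow> norm (f y) \<le> B"
  shows "integrable lborel (\<lambda>y. indicator (cball 0 R) y *\<^sub>R f y)"
proof -
  obtain B where B: "B \<ge> 0" "AE y in lborel. norm y \<le> R \<longrightarrow> norm (f y) \<le> B" using f[of R] by blast
  show ?thesis
    by (intro integrableI_bounded_set_indicator[where B = B] emeasure_bounded_finite)
       (use B in \<open>auto elim!: eventually_mono\<close>)
qed

text \<open>The kernel has an integrable singularity; convolutions with continuous approximations
  of it in mean converge locally uniformly.\<close>
lemma convolution_continuous_bounded:
  fixes f :: "'a::euclidean_space \<Rightarrow> complex" and k :: "'a \<Rightarrow> real"
  assumes fm[measurable]: "f \<in> borel_measurable borel"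
    and f: "\<And>R. \<exists>B\<ge>0. AE y in lborel. norm y \<le> R \<longrightarrow> norm (f y) \<le> B"
    and k: "integrable lborel k" "\<And>z. norm z > 2 \<Longrightarrow> k z = 0"
    and kn: "\<And>n. continuous_on UNIV (kn n)" "\<And>n z. norm z > 2 \<Longrightarrow> kn n z = 0"
    and lim: "(\<lambda>n. \<integral>z. \<bar>kn n z - k z\<bar> \<partial>lborel) \<longlonglongrightarrow> 0"
  shows "continuous_on UNIV (\<lambda>x. \<integral>y. complex_of_real (k (y - x)) * f y \<partial>lborel)"
proof -
  have fi: "integrable lborel (\<lambda>y. indicator (cball 0 R) y *\<^sub>R f y)" for R
    by (rule locally_bounded_imp_locally_integrable[OF fm f])
  have kni: "integrable lborel (kn n)" for n by (rule continuous_compact_support_kernel(1)[OF kn])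
  have [measurable]: "k \<in> borel_measurable borel" "\<And>n. kn n \<in> borel_measurable borel" using k(1) kni by auto
  have "continuous_on (ball 0 R) (\<lambda>x. \<integral>y. complex_of_real (k (y - x)) * f y \<partial>lborel)" for R
  proof (rule uniform_limit_theorem)
    show "\<forall>\<^sub>F n in sequentially. continuous_on (ball 0 R) (\<lambda>x. \<integral>y. complex_of_real (kn n (y - x)) * f y \<partial>lborel)"
      by (intro always_eventually allI convolution_continuous_kernel kn fi)
    obtain B where B: "B \<ge> 0" "AE y in lborel. norm y \<le> R + 2 \<longrightarrow> norm (f y) \<le> B" using f[of "R + 2"] by blast
    have bnd: "dist (\<integral>y. complex_of_real (kn n (y - x)) * f y \<partial>lborel) (\<integral>y. complex_of_real (k (y - x)) * f y \<partial>lborel) \<le>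
       B * (\<integral>z. \<bar>kn n z - k z\<bar> \<partial>lborel)" if x: "x \<in> ball 0 R" for x n
    proof -
      have xR: "norm x \<le> R" using x by simp
      let ?f = "\<lambda>y. indicator (cball 0 (R + 2)) y *\<^sub>R f y"
      have fB: "AE y in lborel. norm (?f y) \<le> B" using B(2) by eventually_elim (use B(1) in \<open>auto simp: indicator_def\<close>)
      have int: "integrable lborel (\<lambda>y. complex_of_real (q (y - x)) * ?f y)" if q: "integrable lborel q" for q :: "'a \<Rightarrow> real"
      proof (rule Bochner_Integration.integrable_bound[of _ "\<lambda>y. B * norm (q (y - x))"])
        show "integrable lborel (\<lambda>y. B * norm (q (y - x)))" using integral_shift(2)[of "\<lambda>z. norm (q z)" x] q by simp
        have [measurable]: "q \<in> borel_measurable borel" using q by auto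
        show "(\<lambda>y. complex_of_real (q (y - x)) * ?f y) \<in> borel_measurable lborel" by measurable
        show "AE y in lborel. norm (complex_of_real (q (y - x)) * ?f y) \<le> norm (B * norm (q (y - x)))"
          using fB
        proof eventually_elim
          fix y assume "norm (?f y) \<le> B"
          then have "\<bar>q (y - x)\<bar> * norm (?f y) \<le> \<bar>q (y - x)\<bar> * B" by (rule mult_left_mono) simp
          also have "\<dots> = norm (B * norm (q (y - x)))" using B(1) by (simp add: abs_mult)
          finally show "norm (complex_of_real (q (y - x)) * ?f y) \<le> norm (B * norm (q (y - x)))"
            by (simp only: norm_mult norm_of_real)
        qed
      qed
      have "(\<integral>y. complex_of_real (kn n (y - x)) * f y \<partial>lborel) - (\<integral>y. complex_of_real (k (y - x)) * f y \<partial>lborel) =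
         (\<integral>y. complex_of_real (kn n (y - x)) * ?f y \<partial>lborel) - (\<integral>y. complex_of_real (k (y - x)) * ?f y \<partial>lborel)"
        using convolution_localize[where k = "kn n" and x = x and R = R and f = f, OF kn(2) xR]
          convolution_localize[where k = k and x = x and R = R and f = f, OF k(2) xR] by simp
      also have "\<dots> = (\<integral>y. complex_of_real (kn n (y - x) - k (y - x)) * ?f y \<partial>lborel)"
        by (subst Bochner_Integration.integral_diff[symmetric, OF int[OF kni] int[OF k(1)]]) (simp add: algebra_simps)
      finally have "dist (\<integral>y. complex_of_real (kn n (y - x)) * f y \<partial>lborel) (\<integral>y. complex_of_real (k (y - x)) * f y \<partial>lborel) =
          norm (\<integral>y. complex_of_real (kn n (y - x) - k (y - x)) * ?f y \<partial>lborel)"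
        unfolding dist_norm by simp
      also have "\<dots> \<le> (\<integral>y. norm (complex_of_real (kn n (y - x) - k (y - x)) * ?f y) \<partial>lborel)" by (rule integral_norm_bound)
      also have "\<dots> \<le> (\<integral>y. B * \<bar>kn n (y - x) - k (y - x)\<bar> \<partial>lborel)"
      proof (rule integral_mono_AE)
        have i: "integrable lborel (\<lambda>z. kn n z - k z)" using kni k(1) by simp
        show "integrable lborel (\<lambda>y. norm (complex_of_real (kn n (y - x) - k (y - x)) * ?f y))"
          by (intro integrable_norm int[OF i])
        show "integrable lborel (\<lambda>y. B * \<bar>kn n (y - x) - k (y - x)\<bar>)"
          using integral_shift(2)[of "\<lambda>z. \<bar>kn n z - k z\<bar>" x] integrable_abs[OF i] by simp
        show "AE y in lborel. norm (complex_of_real (kn n (y - x) - k (y - x)) * ?f y) \<le> B * \<bar>kn n (y - x) - k (y - x)\<bar>"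
          using fB
        proof eventually_elim
          fix y assume "norm (?f y) \<le> B"
          then have "\<bar>kn n (y - x) - k (y - x)\<bar> * norm (?f y) \<le> \<bar>kn n (y - x) - k (y - x)\<bar> * B" by (rule mult_left_mono) simp
          then show "norm (complex_of_real (kn n (y - x) - k (y - x)) * ?f y) \<le> B * \<bar>kn n (y - x) - k (y - x)\<bar>"
            by (simp only: norm_mult norm_of_real mult.commute)
        qed
      qed
      also have "\<dots> = B * (\<integral>z. \<bar>kn n z - k z\<bar> \<partial>lborel)" using integral_shift(1)[of "\<lambda>z. \<bar>kn n z - k z\<bar>" x] by simp
      finally show ?thesis .
    qed
    show "uniform_limit (ball 0 R) (\<lambda>n x. \<integral>y. complex_of_real (kn n (y - x)) * f y \<partial>lborel) (\<lambda>x. \<integral>y. complex_of_real (k (y - x)) * f y \<partial>lborel) sequentially"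
    proof (rule uniform_limitI)
      fix e :: real assume "e > 0"
      have "(\<lambda>n. B * (\<integral>z. \<bar>kn n z - k z\<bar> \<partial>lborel)) \<longlonglongrightarrow> B * 0" by (intro tendsto_intros lim)
      then have "\<forall>\<^sub>F n in sequentially. B * (\<integral>z. \<bar>kn n z - k z\<bar> \<partial>lborel) < e"
        using \<open>e > 0\<close> order_tendstoD(2) by fastforce
      then show "\<forall>\<^sub>F n in sequentially. \<forall>x\<in>ball 0 R. dist (\<integral>y. complex_of_real (kn n (y - x)) * f y \<partial>lborel) (\<integral>y. complex_of_real (k (y - x)) * f y \<partial>lborel) < e"
        by eventually_elim (use bnd le_less_trans in blast)
    qed
  qed simp
  then have "continuous_on (\<Union>n::nat. ball 0 (real n)) (\<lambda>x. \<integral>y. complex_of_real (k (y - x)) * f y \<partial>lborel)"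
    by (intro continuous_on_open_UN) auto
  moreover have "(\<Union>n::nat. ball 0 (real n)) = (UNIV :: 'a set)"
    using reals_Archimedean2 by auto
  ultimately show ?thesis by simp
qed

text \<open>Beyond distance 1 the weight is 1, so large balls cost the total mass of \<open>|w|^2\<close>.\<close>
lemma kato_bound_large_balls:
  fixes w :: "'a::euclidean_space \<Rightarrow> complex"
  assumes wm[measurable]: "w \<in> borel_measurable borel" and w2: "integrable lborel (\<lambda>x. (norm (w x))\<^sup>2)"
    and a: "0 \<le> a" "a < real DIM('a)"
    and K: "K \<ge> 0" "\<And>x. (\<integral>\<^sup>+y. ennreal ((norm (w y))\<^sup>2 * singularity (y - x) powr a) * indicator (cball x 1) y \<partial>lborel) \<le> ennreal K"
  shows "\<exists>K\<ge>0. \<forall>x. (\<integral>\<^sup>+y. ennreal (1 + (norm (w y))\<^sup>2) * ennreal (singularity (y - x) powr a) * indicator (cball x r) y \<partial>lborel) \<le> ennreal K"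
proof -
  obtain M where M: "\<And>x y::'a. (\<integral>\<^sup>+z. ennreal (singularity (z - y) powr a) * indicator (cball x r) z \<partial>lborel) \<le> ennreal M" "M \<ge> 0"
    using singularity_integral_cball_bound[OF a] by blast
  define W where "W = (\<integral>x. (norm (w x))\<^sup>2 \<partial>lborel)"
  have W: "W \<ge> 0" "(\<integral>\<^sup>+x. ennreal ((norm (w x))\<^sup>2) \<partial>lborel) = ennreal W"
    unfolding W_def by (auto intro: nn_integral_eq_integral[OF w2])
  have "(\<integral>\<^sup>+y. ennreal (1 + (norm (w y))\<^sup>2) * ennreal (singularity (y - x) powr a) * indicator (cball x r) y \<partial>lborel) \<le> ennreal (M + (K + W))" for x
  proof -
    have "(\<integral>\<^sup>+y. ennreal (1 + (norm (w y))\<^sup>2) * ennreal (singularity (y - x) powr a) * indicator (cball x r) y \<partial>lborel) \<le>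
      (\<integral>\<^sup>+y. ennreal (singularity (y - x) powr a) * indicator (cball x r) y + (ennreal ((norm (w y))\<^sup>2 * singularity (y - x) powr a) * indicator (cball x 1) y + ennreal ((norm (w y))\<^sup>2)) \<partial>lborel)"
    proof (rule nn_integral_mono)
      fix y
      let ?s = "singularity (y - x) powr a"
      show "ennreal (1 + (norm (w y))\<^sup>2) * ennreal ?s * indicator (cball x r) y \<le>
         ennreal ?s * indicator (cball x r) y + (ennreal ((norm (w y))\<^sup>2 * ?s) * indicator (cball x 1) y + ennreal ((norm (w y))\<^sup>2))"
      proof (cases "y \<in> cball x r")
        case True
        have "ennreal (1 + (norm (w y))\<^sup>2) * ennreal ?s = ennreal ?s + ennreal ((norm (w y))\<^sup>2 * ?s)"
          by (simp add: ennreal_mult[symmetric] ennreal_plus[symmetric] algebra_simps del: ennreal_plus)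
        moreover have "ennreal ((norm (w y))\<^sup>2 * ?s) \<le> ennreal ((norm (w y))\<^sup>2 * ?s) * indicator (cball x 1) y + ennreal ((norm (w y))\<^sup>2)"
        proof (cases "y \<in> cball x 1")
          case False
          then have "1 / norm (y - x) \<le> 1" by (simp add: divide_le_eq_1 dist_norm norm_minus_commute)
          then have "singularity (y - x) = 1" by (simp add: singularity_def)
          then show ?thesis by simp
        qed simp
        ultimately show ?thesis using True by (simp add: add_left_mono)
      qed simp
    qed
    also have "\<dots> = (\<integral>\<^sup>+y. ennreal (singularity (y - x) powr a) * indicator (cball x r) y \<partial>lborel) +
       ((\<integral>\<^sup>+y. ennreal ((norm (w y))\<^sup>2 * singularity (y - x) powr a) * indicator (cball x 1) y \<partial>lborel) + (\<integral>\<^sup>+y. ennreal ((norm (w y))\<^sup>2) \<partial>lborel))"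
      by (simp add: nn_integral_add)
    also have "\<dots> \<le> ennreal M + (ennreal K + ennreal W)"
      unfolding W(2) by (intro add_mono M K order_refl)
    also have "\<dots> = ennreal (M + (K + W))" using M K W by simp
    finally show ?thesis .
  qed
  then show ?thesis using M(2) K(1) W(1) by (intro exI[of _ "M + (K + W)"]) auto
qed

text \<open>The Kato bound, the parametrix and the iteration give local boundedness; then the right-hand side
  of the parametrix representation is continuous in \<open>x\<close> and provides the continuous representative.
  The Kato bound itself is passed on: it controls Newtonian potentials of \<open>|w|^2\<close> uniformly in
  space, whereas the bounds from the iteration are local.\<close>
lemma continuous_solution:
  fixes w :: "'a::euclidean_space \<Rightarrow> complex"
  assumes d: "DIM('a) \<ge> 2" and s: "s > real DIM('a) / 2 - 1" and w: "w \<in> sobolev_H s"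
    and sol: "distributional_solution lam w"
  obtains u a e K where "continuous_on UNIV u" "AE x in lborel. u x = w x"
    "a > real DIM('a) - 2" "a > 0" "e > 0" "K \<ge> 0"
    "\<And>x. (\<integral>\<^sup>+y. ennreal ((norm (w y))\<^sup>2 * singularity (y - x) powr (a + e)) * indicator (cball x 1) y \<partial>lborel) \<le> ennreal K"
proof -
  have d2: "real DIM('a) \<ge> 2" using d by simp
  have s0: "s > 0" using s d2 by simp
  from w have w0: "w \<in> weighted_L2 0" by (simp add: sobolev_H_def)
  note wm[measurable] = weighted_L2_0(1)[OF w0]
  \<comment> \<open>The midpoint between d/2 - s and 1, raised to 1/2 if it is smaller, satisfies b < 1 and
    s + b > d/2.\<close>
  define b where "b = max (1 / 2) ((1 + (real DIM('a) / 2 - s)) / 2)"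
  have b: "0 \<le> b" "b < 1" "s + b - real DIM('a) / 2 > 0"
    using s d2 unfolding b_def by (auto simp: max_def field_simps)
  have b2: "2 * b < real DIM('a)" using b d2 by linarith
  obtain C where C: "C \<ge> 0" "\<And>\<psi> B R. \<psi> \<in> borel_measurable borel \<Longrightarrow> (\<And>x. norm (\<psi> x) \<le> B) \<Longrightarrow> (\<And>x. norm x > R \<Longrightarrow> \<psi> x = 0) \<Longrightarrow>
      ennreal ((norm (\<integral>x. \<psi> x * w x \<partial>lborel))\<^sup>2) \<le> ennreal C * riesz_energy (2 * b) \<psi>"
    using sobolev_pairing_bound[OF w s0 b(1) less_imp_le[OF b(2)] b2 b(3)] by blast
  \<comment> \<open>The gap 1 - b is shared: a exceeds d - 2 by e, which also covers the logarithm in dimension 2,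
    the iteration gets another e, and a + e + 2 b = d - 1 + b stays below d.\<close>
  define e where "e = (1 - b) / 2"
  define a where "a = real DIM('a) - 2 + e"
  have e: "e > 0" using b by (simp add: e_def)
  have a: "a > real DIM('a) - 2" "a > 0" using e d2 by (auto simp: a_def)
  have ae: "0 \<le> a + e" "a + e + 2 * b < real DIM('a)" using a e b by (auto simp: a_def e_def field_simps)
  obtain K where K: "K \<ge> 0"
    "\<And>x. (\<integral>\<^sup>+y. ennreal ((norm (w y))\<^sup>2 * singularity (y - x) powr (a + e)) * indicator (cball x 1) y \<partial>lborel) \<le> ennreal K"
  proof -
    have "\<exists>K\<ge>0. \<forall>x. (\<integral>\<^sup>+y. ennreal ((norm (w y))\<^sup>2 * singularity (y - x) powr (a + e)) * indicator (cball x 1) y \<partial>lborel) \<le> ennreal K"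
    proof (rule kato_bound[OF wm C(1), where p = "2 * b" and a = "a + e"])
      fix \<psi> :: "'a \<Rightarrow> complex" and B R
      assume "\<psi> \<in> borel_measurable borel" "\<And>x. norm (\<psi> x) \<le> B" "\<And>x. norm x > R \<Longrightarrow> \<psi> x = 0"
      then show "ennreal ((norm (\<integral>x. \<psi> x * w x \<partial>lborel))\<^sup>2) \<le> ennreal C * riesz_energy (2 * b) \<psi>" by (rule C(2))
    qed (use b ae in auto)
    then show ?thesis using that by blast
  qed
  have large: "\<exists>K\<ge>0. \<forall>x. (\<integral>\<^sup>+y. ennreal (1 + (norm (w y))\<^sup>2) * ennreal (singularity (y - x) powr (a + e)) * indicator (cball x r) y \<partial>lborel) \<le> ennreal K" for r
    by (rule kato_bound_large_balls[OF wm weighted_L2_0(2)[OF w0] ae(1) _ K]) (use ae b in linarith)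
  let ?c = "mollifier_mass TYPE('a)" and ?F = "\<lambda>y. w y - lam * w y ^ 3"
  have c: "?c > 0" by (rule mollifier_mass_pos)
  note rep = parametrix_representation[OF sol wm]
  obtain L where L: "L > 0" "\<And>\<rho> z::'a. 0 \<le> \<rho> \<Longrightarrow> \<bar>remainder_kernel \<rho> z\<bar> \<le> L" using remainder_kernel_bounded by blast
  obtain N where N: "N > 0" "\<And>z::'a. z \<noteq> 0 \<Longrightarrow> \<bar>newton_kernel 0 z\<bar> \<le> N * singularity z powr a"
    using newton_kernel_le_singularity[OF a(2,1)] by blast
  have m0[measurable]: "(newton_kernel 0 :: 'a \<Rightarrow> real) \<in> borel_measurable borel" "(remainder_kernel 0 :: 'a \<Rightarrow> real) \<in> borel_measurable borel"
    by (auto intro: kernels_measurable)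
  define C0 where "C0 = (N * (1 + norm lam) + L) / ?c"
  have C0: "C0 \<ge> 0" using N L c by (simp add: C0_def)
  let ?P = "\<lambda>y. ennreal (norm (w y)) * ennreal (1 + (norm (w y))\<^sup>2)"
  have pw: "AE x in lborel. ennreal (norm (w x)) \<le> ennreal C0 * (\<integral>\<^sup>+y. ennreal (singularity (y - x) powr a) * ?P y * indicator (cball x 2) y \<partial>lborel)"
    using rep
  proof eventually_elim
    fix x
    assume eq: "?c *\<^sub>R w x = (\<integral>y. complex_of_real (newton_kernel 0 (y - x)) * ?F y \<partial>lborel) - (\<integral>y. complex_of_real (remainder_kernel 0 (y - x)) * w y \<partial>lborel)"
    let ?S = "\<lambda>y. singularity (y - x) powr a"
    have "ennreal (norm (?c *\<^sub>R w x)) \<le> ennreal (norm (\<integral>y. complex_of_real (newton_kernel 0 (y - x)) * ?F y \<partial>lborel) + norm (\<integral>y. complex_of_real (remainder_kernel 0 (y - x)) * w y \<partial>lborel))"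
      unfolding eq by (intro ennreal_leI norm_triangle_ineq4)
    also have "\<dots> = ennreal (norm (\<integral>y. complex_of_real (newton_kernel 0 (y - x)) * ?F y \<partial>lborel)) + ennreal (norm (\<integral>y. complex_of_real (remainder_kernel 0 (y - x)) * w y \<partial>lborel))"
      by simp
    also have "\<dots> \<le> (\<integral>\<^sup>+y. norm (complex_of_real (newton_kernel 0 (y - x)) * ?F y) \<partial>lborel) + (\<integral>\<^sup>+y. norm (complex_of_real (remainder_kernel 0 (y - x)) * w y) \<partial>lborel)"
      by (intro add_mono integral_norm_bound_nn)
    also have "\<dots> = (\<integral>\<^sup>+y. ennreal (norm (complex_of_real (newton_kernel 0 (y - x)) * ?F y)) + ennreal (norm (complex_of_real (remainder_kernel 0 (y - x)) * w y)) \<partial>lborel)"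
      by (rule nn_integral_add[symmetric]) measurable
    also have "\<dots> \<le> (\<integral>\<^sup>+y. ennreal (N * (1 + norm lam) + L) * (ennreal (?S y) * ?P y * indicator (cball x 2) y) \<partial>lborel)"
    proof (rule nn_integral_mono_AE)
      have "AE y in lborel. y \<noteq> x" by (rule AE_lborel_singleton)
      then show "AE y in lborel. ennreal (norm (complex_of_real (newton_kernel 0 (y - x)) * ?F y)) + ennreal (norm (complex_of_real (remainder_kernel 0 (y - x)) * w y))
         \<le> ennreal (N * (1 + norm lam) + L) * (ennreal (?S y) * ?P y * indicator (cball x 2) y)"
      proof eventually_elim
        fix y assume yx: "y \<noteq> x"
        show "ennreal (norm (complex_of_real (newton_kernel 0 (y - x)) * ?F y)) + ennreal (norm (complex_of_real (remainder_kernel 0 (y - x)) * w y))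
         \<le> ennreal (N * (1 + norm lam) + L) * (ennreal (?S y) * ?P y * indicator (cball x 2) y)"
        proof (cases "y \<in> cball x 2")
          case False
          then have "norm (y - x) > 2" by (simp add: dist_norm norm_minus_commute)
          then show ?thesis using kernels_support(1,3)[of "y - x" 0] by simp
        next
          case True
          have S1: "?S y \<ge> 1" using a singularity_ge_1[of "y - x"] by (simp add: ge_one_powr_ge_zero)
          have F: "norm (?F y) \<le> (1 + norm lam) * (norm (w y) * (1 + (norm (w y))\<^sup>2))"
          proof -
            have "norm (?F y) \<le> norm (w y) + norm lam * norm (w y) ^ 3"
              using norm_triangle_ineq4[of "w y" "lam * w y ^ 3"] by (simp add: norm_mult norm_power)
            also have "\<dots> \<le> (1 + norm lam) * (norm (w y) * (1 + (norm (w y))\<^sup>2))"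
              by (simp add: algebra_simps power2_eq_square power3_eq_cube)
            finally show ?thesis .
          qed
          have 1: "norm (complex_of_real (newton_kernel 0 (y - x)) * ?F y) \<le> (N * ?S y) * ((1 + norm lam) * (norm (w y) * (1 + (norm (w y))\<^sup>2)))"
            unfolding norm_mult using N yx by (intro mult_mono F) auto
          have 2: "norm (complex_of_real (remainder_kernel 0 (y - x)) * w y) \<le> (L * ?S y) * (norm (w y) * (1 + (norm (w y))\<^sup>2))"
          proof -
            have "L \<le> L * ?S y" using S1 L by simp
            then have "\<bar>remainder_kernel 0 (y - x)\<bar> \<le> L * ?S y" using L(2)[of 0 "y - x"] by linarith
            moreover have "norm (w y) \<le> norm (w y) * (1 + (norm (w y))\<^sup>2)" by (simp add: distrib_left)
            ultimately show ?thesis unfolding norm_mult using L by (intro mult_mono) auto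
          qed
          have "norm (complex_of_real (newton_kernel 0 (y - x)) * ?F y) + norm (complex_of_real (remainder_kernel 0 (y - x)) * w y) \<le>
             (N * (1 + norm lam) + L) * (?S y * (norm (w y) * (1 + (norm (w y))\<^sup>2)))"
            using add_mono[OF 1 2] by (simp add: algebra_simps)
          then have "ennreal (norm (complex_of_real (newton_kernel 0 (y - x)) * ?F y) + norm (complex_of_real (remainder_kernel 0 (y - x)) * w y)) \<le>
             ennreal ((N * (1 + norm lam) + L) * (?S y * (norm (w y) * (1 + (norm (w y))\<^sup>2))))"
            by (rule ennreal_leI)
          also have "\<dots> = ennreal (N * (1 + norm lam) + L) * (ennreal (?S y) * ?P y * indicator (cball x 2) y)"
            using True N L by (simp add: ennreal_mult)
          finally show ?thesis by simp
        qed
      qed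
    qed
    also have "\<dots> = ennreal (N * (1 + norm lam) + L) * (\<integral>\<^sup>+y. ennreal (?S y) * ?P y * indicator (cball x 2) y \<partial>lborel)"
      by (rule nn_integral_cmult) measurable
    finally have "ennreal (1 / ?c) * ennreal (norm (?c *\<^sub>R w x)) \<le> ennreal (1 / ?c) * (ennreal (N * (1 + norm lam) + L) * (\<integral>\<^sup>+y. ennreal (?S y) * ?P y * indicator (cball x 2) y \<partial>lborel))"
      by (rule mult_left_mono) simp
    also have "\<dots> = ennreal C0 * (\<integral>\<^sup>+y. ennreal (?S y) * ?P y * indicator (cball x 2) y \<partial>lborel)"
    proof -
      have "ennreal (1 / ?c) * ennreal (N * (1 + norm lam) + L) = ennreal C0"
        using c by (subst ennreal_mult'[symmetric]) (auto simp: C0_def)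
      then show ?thesis by (simp only: mult.assoc[symmetric])
    qed
    also have "ennreal (1 / ?c) * ennreal (norm (?c *\<^sub>R w x)) = ennreal (norm (w x))"
      using c by (simp add: ennreal_mult'[symmetric])
    finally show "ennreal (norm (w x)) \<le> ennreal C0 * (\<integral>\<^sup>+y. ennreal (?S y) * ?P y * indicator (cball x 2) y \<partial>lborel)" .
  qed
  have Ffin: "(\<integral>\<^sup>+y. ennreal (norm (w y)) * ennreal (1 + (norm (w y))\<^sup>2) * indicator (cball 0 R) y \<partial>lborel) < \<infinity>" for R
  proof -
    have w3: "locally_integrable w" "locally_integrable (\<lambda>x. w x ^ 3)" using sol by (auto simp: distributional_solution_def)
    have "integrable lborel (\<lambda>y. norm (indicator (cball 0 R) y *\<^sub>R w y) + norm (indicator (cball 0 R) y *\<^sub>R w y ^ 3))"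
      by (intro Bochner_Integration.integrable_add integrable_norm locally_integrable_cball w3)
    then have "(\<integral>\<^sup>+y. ennreal (norm (norm (indicator (cball 0 R) y *\<^sub>R w y) + norm (indicator (cball 0 R) y *\<^sub>R w y ^ 3))) \<partial>lborel) < \<infinity>"
      by (simp only: integrable_iff_bounded)
    also have "(\<integral>\<^sup>+y. ennreal (norm (norm (indicator (cball 0 R) y *\<^sub>R w y) + norm (indicator (cball 0 R) y *\<^sub>R w y ^ 3))) \<partial>lborel) =
      (\<integral>\<^sup>+y. ennreal (norm (w y)) * ennreal (1 + (norm (w y))\<^sup>2) * indicator (cball 0 R) y \<partial>lborel)"
    proof (rule nn_integral_cong)
      fix y :: 'a
      have "norm (w y) * (1 + (norm (w y))\<^sup>2) = norm (w y) + norm (w y ^ 3)"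
        by (simp add: norm_mult power2_eq_square power3_eq_cube algebra_simps)
      then have "ennreal (norm (w y)) * ennreal (1 + (norm (w y))\<^sup>2) = ennreal (norm (w y) + norm (w y ^ 3))"
        by (simp only: ennreal_mult'[OF norm_ge_zero, symmetric])
      then show "ennreal (norm (norm (indicator (cball 0 R) y *\<^sub>R w y) + norm (indicator (cball 0 R) y *\<^sub>R w y ^ 3))) =
         ennreal (norm (w y)) * ennreal (1 + (norm (w y))\<^sup>2) * indicator (cball 0 R) y"
        by (cases "norm y \<le> R") (simp_all add: del: ennreal_plus)
    qed
    finally show ?thesis .
  qed
  have wb: "\<exists>B\<ge>0. AE x in lborel. norm x \<le> R \<longrightarrow> norm (w x) \<le> B" for R
    by (rule kato_iteration[OF wm Ffin less_imp_le[OF a(2)] e large C0 pw])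
  have Fb: "\<exists>B\<ge>0. AE x in lborel. norm x \<le> R \<longrightarrow> norm (?F x) \<le> B" for R
  proof -
    obtain B where B: "B \<ge> 0" "AE x in lborel. norm x \<le> R \<longrightarrow> norm (w x) \<le> B" using wb by blast
    have "AE x in lborel. norm x \<le> R \<longrightarrow> norm (?F x) \<le> B + norm lam * B ^ 3"
      using B(2)
    proof eventually_elim
      fix x assume x: "norm x \<le> R \<longrightarrow> norm (w x) \<le> B"
      show "norm x \<le> R \<longrightarrow> norm (?F x) \<le> B + norm lam * B ^ 3"
      proof
        assume "norm x \<le> R"
        then have wB: "norm (w x) \<le> B" using x by blast
        have "norm (?F x) \<le> norm (w x) + norm lam * norm (w x) ^ 3"
          using norm_triangle_ineq4[of "w x" "lam * w x ^ 3"] by (simp add: norm_mult norm_power)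
        also have "\<dots> \<le> B + norm lam * B ^ 3" by (intro add_mono mult_left_mono power_mono wB) auto
        finally show "norm (?F x) \<le> B + norm lam * B ^ 3" .
      qed
    qed
    then show ?thesis using B(1) by (intro exI[of _ "B + norm lam * B ^ 3"]) auto
  qed
  have Fm: "?F \<in> borel_measurable borel" by measurable
  define \<rho> where "\<rho> n = inverse (real (Suc n))" for n
  have \<rho>: "\<And>n. \<rho> n > 0" "\<rho> \<longlonglongrightarrow> 0" unfolding \<rho>_def using LIMSEQ_inverse_real_of_nat by auto
  have \<rho>0: "\<And>n. 0 \<le> \<rho> n" using \<rho>(1) less_imp_le by blast
  have km[measurable]: "(newton_kernel (\<rho> n) :: 'a \<Rightarrow> real) \<in> borel_measurable borel" for n
    using \<rho>0 by (auto intro: kernels_measurable)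
  have cN: "continuous_on UNIV (\<lambda>x. \<integral>y. complex_of_real (newton_kernel 0 (y - x)) * ?F y \<partial>lborel)"
  proof (rule convolution_continuous_bounded[OF Fm Fb newton_kernel_integrable, of "\<lambda>n. newton_kernel (\<rho> n)"])
    show "(\<lambda>n. \<integral>z. \<bar>newton_kernel (\<rho> n) z - newton_kernel 0 (z::'a)\<bar> \<partial>lborel) \<longlonglongrightarrow> 0"
    proof -
      have nz: "AE z in lborel. z \<noteq> (0::'a)" by (rule AE_lborel_singleton)
      have "(\<lambda>n. \<integral>z. \<bar>newton_kernel (\<rho> n) z - newton_kernel 0 (z::'a)\<bar> \<partial>lborel) \<longlonglongrightarrow> (\<integral>z. 0 \<partial>(lborel :: 'a measure))"
      proof (rule integral_dominated_convergence[where w = "\<lambda>z. 2 * \<bar>newton_kernel 0 z\<bar>"])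
        show "integrable lborel (\<lambda>z::'a. 2 * \<bar>newton_kernel 0 z\<bar>)" using integrable_abs[OF newton_kernel_integrable] by simp
        show "AE z in lborel. (\<lambda>n. \<bar>newton_kernel (\<rho> n) z - newton_kernel 0 (z::'a)\<bar>) \<longlonglongrightarrow> 0"
          using nz
        proof eventually_elim
          fix z :: 'a assume "z \<noteq> 0"
          from newton_kernel_tendsto[OF this \<rho>(2)] show "(\<lambda>n. \<bar>newton_kernel (\<rho> n) z - newton_kernel 0 z\<bar>) \<longlonglongrightarrow> 0"
            by (intro tendsto_rabs_zero) (simp add: LIM_zero)
        qed
        show "AE z in lborel. norm \<bar>newton_kernel (\<rho> n) z - newton_kernel 0 (z::'a)\<bar> \<le> 2 * \<bar>newton_kernel 0 z\<bar>" for n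
          using nz
        proof eventually_elim
          fix z :: 'a assume "z \<noteq> 0"
          from newton_kernel_mono[OF this \<rho>0[of n]] show "norm \<bar>newton_kernel (\<rho> n) z - newton_kernel 0 z\<bar> \<le> 2 * \<bar>newton_kernel 0 z\<bar>" by simp
        qed
      qed measurable
      then show ?thesis by simp
    qed
  qed (use \<rho> \<rho>0 newton_kernel_continuous in \<open>auto simp: kernels_support\<close>)
  have r0: "continuous_on UNIV (remainder_kernel 0 :: 'a \<Rightarrow> real)"
    unfolding continuous_on_sequentially
  proof (intro allI ballI impI, elim conjE)
    fix z' :: "nat \<Rightarrow> 'a" and z assume z: "z' \<longlonglongrightarrow> z"
    show "(remainder_kernel 0 \<circ> z') \<longlonglongrightarrow> remainder_kernel 0 z"
    proof (cases "z = 0")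
      case False
      show ?thesis unfolding o_def by (rule remainder_kernel_tendsto[OF False z tendsto_const]) simp
    next
      case True
      have "\<forall>\<^sub>F n in sequentially. norm (z' n) < 1 / 2"
        using order_tendstoD(2)[OF tendsto_norm[OF z], of "1 / 2"] True by simp
      then have "\<forall>\<^sub>F n in sequentially. remainder_kernel 0 (z' n) = 0"
        by eventually_elim (simp add: remainder_kernel_near_0)
      then show ?thesis unfolding o_def True using tendsto_eventually by (simp add: remainder_kernel_near_0)
    qed
  qed
  have cR: "continuous_on UNIV (\<lambda>x. \<integral>y. complex_of_real (remainder_kernel 0 (y - x)) * w y \<partial>lborel)"
    by (rule convolution_continuous_kernel[OF r0])
       (auto simp: kernels_support intro: locally_bounded_imp_locally_integrable[OF wm wb])
  define u where "u x = (1 / ?c) *\<^sub>R ((\<integral>y. complex_of_real (newton_kernel 0 (y - x)) * ?F y \<partial>lborel) - (\<integral>y. complex_of_real (remainder_kernel 0 (y - x)) * w y \<partial>lborel))" for x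
  show ?thesis
  proof (rule that[of u a e K])
    show "continuous_on UNIV u" unfolding u_def by (intro continuous_intros cN cR)
    show "AE x in lborel. u x = w x" 
      using rep
    proof eventually_elim
      fix x
      assume eq: "?c *\<^sub>R w x = (\<integral>y. complex_of_real (newton_kernel 0 (y - x)) * ?F y \<partial>lborel) - (\<integral>y. complex_of_real (remainder_kernel 0 (y - x)) * w y \<partial>lborel)"
      show "u x = w x" unfolding u_def eq[symmetric] using c by simp
    qed
  qed (use a e K in auto)
qed

section \<open>Derivatives of convolutions with radial kernels\<close>

text \<open>The correlation of \<open>k\<close> and \<open>h\<close>, which for the even kernels below is their convolution; in this
  form the argument of the kernel is the one of test functions centred at \<open>x\<close>.\<close>
definition conv :: "('a::euclidean_space \<Rightarrow> real) \<Rightarrow> ('a \<Rightarrow> real) \<Rightarrow> 'a \<Rightarrow> real" where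
  "conv k h x = (\<integral>y. k (y - x) * h y \<partial>lborel)"

lemma continuous_locally_integrable:
  fixes h :: "'a::euclidean_space \<Rightarrow> 'b::{banach, second_countable_topology}"
  assumes "continuous_on UNIV h"
  shows "integrable lborel (\<lambda>y. indicator (cball 0 R) y *\<^sub>R h y)"
proof -
  have "compact (h ` cball 0 R)" by (intro compact_continuous_image continuous_on_subset[OF assms]) auto
  then obtain B where "\<And>y. norm y \<le> R \<Longrightarrow> norm (h y) \<le> B"
    using compact_imp_bounded bounded_iff by (metis imageI mem_cball_0)
  then show ?thesis
    by (intro integrableI_bounded_set_indicator[where B = B] emeasure_bounded_finite)
       (use borel_measurable_continuous_onI[OF assms] in auto)
qed

lemma conv_integrable:
  fixes h :: "'a::euclidean_space \<Rightarrow> 'b::{banach, second_countable_topology}"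
  assumes h: "continuous_on UNIV h" and k: "continuous_on UNIV k" "\<And>z. norm z > 2 \<Longrightarrow> k z = 0"
  shows "integrable lborel (\<lambda>y. k (y - x) *\<^sub>R h y)"
proof -
  obtain B where B: "B \<ge> 0" "\<And>z. \<bar>k z\<bar> \<le> B" using continuous_compact_support_kernel(2)[OF k] by blast
  have [measurable]: "k \<in> borel_measurable borel" "h \<in> borel_measurable borel"
    using k(1) h by (auto intro: borel_measurable_continuous_onI)
  show ?thesis
  proof (rule Bochner_Integration.integrable_bound[of _ "\<lambda>y. B *\<^sub>R (indicator (cball 0 (norm x + 2)) y *\<^sub>R h y)"])
    show "integrable lborel (\<lambda>y. B *\<^sub>R (indicator (cball 0 (norm x + 2)) y *\<^sub>R h y))"
      by (intro integrable_scaleR_right continuous_locally_integrable h)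
    show "AE y in lborel. norm (k (y - x) *\<^sub>R h y) \<le> norm (B *\<^sub>R (indicator (cball 0 (norm x + 2)) y *\<^sub>R h y))"
    proof (rule AE_I2)
      fix y
      show "norm (k (y - x) *\<^sub>R h y) \<le> norm (B *\<^sub>R (indicator (cball 0 (norm x + 2)) y *\<^sub>R h y))"
      proof (cases "norm y \<le> norm x + 2")
        case True
        then show ?thesis using B by (simp add: mult_right_mono)
      next
        case False
        then have "norm (y - x) > 2" using norm_triangle_ineq2[of y x] by linarith
        then show ?thesis using k(2) by simp
      qed
    qed
  qed measurable
qed

lemma conv_continuous:
  assumes "continuous_on UNIV h" "continuous_on UNIV k" "\<And>z. norm z > 2 \<Longrightarrow> k z = 0"
  shows "continuous_on S (conv k h)"
proof -
  have "continuous_on S (\<lambda>x. \<integral>y. complex_of_real (k (y - x)) * complex_of_real (h y) \<partial>lborel)"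
    by (rule convolution_continuous_kernel[OF assms(2,3)])
       (auto intro!: continuous_locally_integrable continuous_intros assms)
  then have "continuous_on S (\<lambda>x. Re (\<integral>y. complex_of_real (k (y - x)) * complex_of_real (h y) \<partial>lborel))"
    by (rule continuous_on_Re)
  then show ?thesis by (simp add: conv_def[abs_def] of_real_mult[symmetric] del: of_real_mult)
qed

text \<open>The derivative falls on the kernel alone. The sign appears because the kernel is evaluated at
  \<open>y - x\<close>.\<close>
lemma conv_line_derivative:
  fixes h k k' :: "'a::euclidean_space \<Rightarrow> real"
  assumes h: "continuous_on UNIV h" and k: "continuous_on UNIV k" "\<And>z. norm z > 2 \<Longrightarrow> k z = 0"
    and k': "continuous_on UNIV k'" "\<And>z. norm z > 2 \<Longrightarrow> k' z = 0"
    and der: "\<And>z. ((\<lambda>t. k (z + t *\<^sub>R v)) has_real_derivative k' z) (at 0)"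
  shows "((\<lambda>t. conv k h (x + t *\<^sub>R v)) has_real_derivative - conv k' h x) (at 0)"
proof -
  obtain B where B: "B \<ge> 0" "\<And>z. \<bar>k' z\<bar> \<le> B" using continuous_compact_support_kernel(2)[OF k'] by blast
  have [measurable]: "k \<in> borel_measurable borel" "h \<in> borel_measurable borel" "k' \<in> borel_measurable borel"
    using k(1) h k'(1) by (auto intro: borel_measurable_continuous_onI)
  have der': "((\<lambda>t. k (z + t *\<^sub>R v)) has_real_derivative k' (z + s *\<^sub>R v)) (at s)" for z s
  proof -
    have "((\<lambda>t. k ((z + s *\<^sub>R v) + t *\<^sub>R v)) has_real_derivative k' (z + s *\<^sub>R v)) (at 0)" by (rule der)
    then have "((\<lambda>t. k (z + (t + s) *\<^sub>R v)) has_real_derivative k' (z + s *\<^sub>R v)) (at 0)"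
      by (simp add: algebra_simps)
    then show ?thesis using DERIV_shift[of "\<lambda>t. k (z + t *\<^sub>R v)" "k' (z + s *\<^sub>R v)" 0 s] by simp
  qed
  have lip: "\<bar>k (z + s *\<^sub>R v) - k z\<bar> \<le> B * \<bar>s\<bar>" for z s
    using field_differentiable_bound[of UNIV "\<lambda>t. k (z + t *\<^sub>R v)" "\<lambda>s. k' (z + s *\<^sub>R v)" B s 0] der' B(2) by simp
  show ?thesis
    unfolding has_field_derivative_iff tendsto_at_iff_sequentially
  proof (intro allI impI)
    fix t :: "nat \<Rightarrow> real" assume t: "\<forall>i. t i \<in> UNIV - {0}" "t \<longlonglongrightarrow> 0"
    then have t0: "t n \<noteq> 0" for n by auto
    obtain K where K: "\<And>n. norm (t n) \<le> K" using convergent_imp_Bseq[OF convergentI[OF t(2)]] by (auto simp: Bseq_def)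
    let ?R = "norm x + K * norm v + 2"
    let ?w = "\<lambda>y. B * norm (indicator (cball 0 ?R) y *\<^sub>R h y)"
    have "(\<lambda>n. \<integral>y. (k (y - (x + t n *\<^sub>R v)) - k (y - x)) / t n * h y \<partial>lborel) \<longlonglongrightarrow> (\<integral>y. (- k' (y - x)) * h y \<partial>lborel)"
    proof (rule integral_dominated_convergence[where w = ?w])
      show "integrable lborel ?w" by (intro integrable_mult_right integrable_norm continuous_locally_integrable h)
      have "(\<lambda>n. (k ((y - x) + (- t n) *\<^sub>R v) - k (y - x)) / (- t n)) \<longlonglongrightarrow> k' (y - x)" for y
      proof -
        have "((\<lambda>s. (k ((y - x) + s *\<^sub>R v) - k (y - x)) / s) \<longlongrightarrow> k' (y - x)) (at 0)"
          using der[of "y - x"] by (simp add: has_field_derivative_iff)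
        then have *: "(\<forall>i. X i \<in> UNIV - {0}) \<longrightarrow> X \<longlonglongrightarrow> 0 \<longrightarrow> ((\<lambda>s. (k ((y - x) + s *\<^sub>R v) - k (y - x)) / s) \<circ> X) \<longlonglongrightarrow> k' (y - x)" for X
          unfolding tendsto_at_iff_sequentially by blast
        have n: "\<forall>i. - t i \<in> UNIV - {0}" "(\<lambda>n. - t n) \<longlonglongrightarrow> 0" using t0 tendsto_minus[OF t(2)] by auto
        show ?thesis using *[of "\<lambda>n. - t n", THEN mp, THEN mp, OF n] unfolding o_def .
      qed
      then have "(\<lambda>n. - ((k ((y - x) + (- t n) *\<^sub>R v) - k (y - x)) / (- t n))) \<longlonglongrightarrow> - k' (y - x)" for y
        by (intro tendsto_minus)
      then have "(\<lambda>n. (k (y - (x + t n *\<^sub>R v)) - k (y - x)) / t n) \<longlonglongrightarrow> - k' (y - x)" for y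
        by (simp add: algebra_simps)
      then show "AE y in lborel. (\<lambda>n. (k (y - (x + t n *\<^sub>R v)) - k (y - x)) / t n * h y) \<longlonglongrightarrow> (- k' (y - x)) * h y"
        by (intro AE_I2 tendsto_mult tendsto_const)
      show "AE y in lborel. norm ((k (y - (x + t n *\<^sub>R v)) - k (y - x)) / t n * h y) \<le> ?w y" for n
      proof (rule AE_I2)
        fix y
        show "norm ((k (y - (x + t n *\<^sub>R v)) - k (y - x)) / t n * h y) \<le> ?w y"
        proof (cases "norm y \<le> ?R")
          case True
          have "\<bar>k (y - (x + t n *\<^sub>R v)) - k (y - x)\<bar> \<le> B * \<bar>t n\<bar>"
            using lip[of "y - x" "- t n"] by (simp add: algebra_simps)
          then have "\<bar>k (y - (x + t n *\<^sub>R v)) - k (y - x)\<bar> / \<bar>t n\<bar> \<le> B" using t0[of n] by (simp add: divide_le_eq)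
          then have "\<bar>k (y - (x + t n *\<^sub>R v)) - k (y - x)\<bar> / \<bar>t n\<bar> * \<bar>h y\<bar> \<le> B * \<bar>h y\<bar>" by (rule mult_right_mono) simp
          then show ?thesis using True by (simp add: abs_mult)
        next
          case False
          have "norm (t n *\<^sub>R v) \<le> K * norm v" using K[of n] by (simp add: mult_right_mono)
          moreover have "0 \<le> norm (t n *\<^sub>R v)" by simp
          moreover have "norm (y - (x + t n *\<^sub>R v)) \<ge> norm y - norm (x + t n *\<^sub>R v)" by (rule norm_triangle_ineq2)
          moreover have "norm (x + t n *\<^sub>R v) \<le> norm x + norm (t n *\<^sub>R v)" by (rule norm_triangle_ineq)
          moreover have "norm (y - x) \<ge> norm y - norm x" by (rule norm_triangle_ineq2)
          ultimately have "norm (y - (x + t n *\<^sub>R v)) > 2" "norm (y - x) > 2" using False by linarith+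
          then show ?thesis using k(2) False by simp
        qed
      qed
    qed measurable
    moreover have "(\<integral>y. (k (y - (x + t n *\<^sub>R v)) - k (y - x)) / t n * h y \<partial>lborel) =
       (conv k h (x + t n *\<^sub>R v) - conv k h (x + 0 *\<^sub>R v)) / (t n - 0)" for n
    proof -
      have "(\<integral>y. (k (y - (x + t n *\<^sub>R v)) - k (y - x)) / t n * h y \<partial>lborel) =
        (\<integral>y. (k (y - (x + t n *\<^sub>R v)) *\<^sub>R h y - k (y - x) *\<^sub>R h y) / t n \<partial>lborel)"
        by (intro Bochner_Integration.integral_cong refl) (simp add: diff_divide_distrib left_diff_distrib)
      also have "\<dots> = ((\<integral>y. k (y - (x + t n *\<^sub>R v)) *\<^sub>R h y \<partial>lborel) - (\<integral>y. k (y - x) *\<^sub>R h y \<partial>lborel)) / t n"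
        unfolding integral_divide_zero by (subst Bochner_Integration.integral_diff) (auto intro!: conv_integrable h k simp del: real_scaleR_def)
      finally show ?thesis by (simp add: conv_def)
    qed
    moreover have "(\<integral>y. (- k' (y - x)) * h y \<partial>lborel) = - conv k' h x" by (simp add: conv_def)
    ultimately show "((\<lambda>y. (conv k h (x + y *\<^sub>R v) - conv k h (x + 0 *\<^sub>R v)) / (y - 0)) \<circ> t) \<longlonglongrightarrow> - conv k' h x"
      by (simp only: o_def)
  qed
qed

lemma profile_two_derivatives:
  assumes f: "f \<in> profiles m" "\<And>t. t \<ge> 2 \<Longrightarrow> f t = 0"
  obtains f1 f2 where "\<And>t. t > 0 \<Longrightarrow> (f has_real_derivative f1 t) (at t)" "\<And>t. t > 0 \<Longrightarrow> (f1 has_real_derivative f2 t) (at t)"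
    "continuous_on {0<..} f" "continuous_on {0<..} f1" "continuous_on {0<..} f2"
    "\<And>t. t > 2 \<Longrightarrow> f1 t = 0" "\<And>t. t > 2 \<Longrightarrow> f2 t = 0"
proof -
  obtain f1 where f1: "f1 \<in> profiles m" "\<And>t. t > 0 \<Longrightarrow> (f has_real_derivative f1 t) (at t)" using profiles_deriv[OF f(1)] by blast
  obtain f2 where f2: "f2 \<in> profiles m" "\<And>t. t > 0 \<Longrightarrow> (f1 has_real_derivative f2 t) (at t)" using profiles_deriv[OF f1(1)] by blast
  have z: "g' t = 0" if g: "\<And>t. t > 0 \<Longrightarrow> (g has_real_derivative g' t) (at t)" "\<And>t. t > 2 \<Longrightarrow> g t = 0" and t: "t > 2" for g g' :: "real \<Rightarrow> real" and t
  proof -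
    have "(g has_real_derivative 0) (at t)"
      using t by (intro has_field_derivative_transform_within_open[of "\<lambda>_. 0" 0 t "{2<..}" g]) (auto simp: g)
    then show ?thesis using DERIV_unique g(1)[of t] t by force
  qed
  have z1: "f1 t = 0" if "t > 2" for t by (rule z[OF f1(2) _ that]) (use f(2) in auto)
  have z2: "f2 t = 0" if "t > 2" for t by (rule z[OF f2(2) z1 that]) auto
  show ?thesis
    by (rule that[OF f1(2) f2(2) _ _ _ z1 z2]) (auto intro: profile_continuous_on f f1 f2)
qed

text \<open>Derivatives along lines in coordinate directions suffice for maxima and for integration by parts,
  so kernels carry explicit directional derivatives instead of total ones.\<close>
locale radial_kernel =
  fixes f f1 f2 :: "real \<Rightarrow> real" and \<rho> :: real
  assumes \<rho>: "\<rho> > 0"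
    and f_deriv: "\<And>t. t > 0 \<Longrightarrow> (f has_real_derivative f1 t) (at t)" and f1_deriv: "\<And>t. t > 0 \<Longrightarrow> (f1 has_real_derivative f2 t) (at t)"
    and f_cont: "continuous_on {0<..} f" and f1_cont: "continuous_on {0<..} f1" and f2_cont: "continuous_on {0<..} f2"
    and f_supp: "\<And>t. t > 2 \<Longrightarrow> f t = 0" and f1_supp: "\<And>t. t > 2 \<Longrightarrow> f1 t = 0" and f2_supp: "\<And>t. t > 2 \<Longrightarrow> f2 t = 0"
begin

definition ker :: "'a::euclidean_space \<Rightarrow> real" where "ker z = f ((norm z)\<^sup>2 + \<rho>)"
definition ker1 :: "'a::euclidean_space \<Rightarrow> 'a \<Rightarrow> real" where "ker1 v z = 2 * (z \<bullet> v) * f1 ((norm z)\<^sup>2 + \<rho>)"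
definition ker2 :: "'a::euclidean_space \<Rightarrow> 'a \<Rightarrow> 'a \<Rightarrow> real" where
  "ker2 v w z = 2 * (v \<bullet> w) * f1 ((norm z)\<^sup>2 + \<rho>) + 4 * (z \<bullet> v) * (z \<bullet> w) * f2 ((norm z)\<^sup>2 + \<rho>)"

lemma pos: "(norm (z::'a::euclidean_space))\<^sup>2 + \<rho> > 0" using \<rho> by (simp add: add_nonneg_pos)

lemma comp_cont: "continuous_on {0<..} g \<Longrightarrow> continuous_on UNIV (\<lambda>z::'a::euclidean_space. g ((norm z)\<^sup>2 + \<rho>))"
  by (rule continuous_on_compose2[of "{0<..}" g]) (auto intro!: continuous_intros pos)

lemma ker_cont: "continuous_on UNIV (ker :: 'a::euclidean_space \<Rightarrow> real)"
  "continuous_on UNIV (ker1 v :: 'a::euclidean_space \<Rightarrow> real)" "continuous_on UNIV (ker2 v w :: 'a \<Rightarrow> real)"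
  unfolding ker_def[abs_def] ker1_def[abs_def] ker2_def[abs_def]
  by (intro continuous_intros comp_cont f_cont f1_cont f2_cont)+

lemma ker_supp: "norm z > 2 \<Longrightarrow> ker z = 0" "norm z > 2 \<Longrightarrow> ker1 v z = 0" "norm z > 2 \<Longrightarrow> ker2 v w z = 0"
  using norm_gt_2_imp[of z \<rho>] \<rho> by (auto simp: ker_def ker1_def ker2_def f_supp f1_supp f2_supp)

lemma line_deriv:
  fixes z v :: "'a::euclidean_space"
  assumes "\<And>t. t > 0 \<Longrightarrow> (g has_real_derivative g' t) (at t)"
  shows "((\<lambda>t. g ((norm (z + t *\<^sub>R v))\<^sup>2 + \<rho>)) has_real_derivative 2 * (z \<bullet> v) * g' ((norm z)\<^sup>2 + \<rho>)) (at 0)"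
proof -
  have 1: "((\<lambda>t. (norm (z + t *\<^sub>R v))\<^sup>2 + \<rho>) has_real_derivative 2 * (z \<bullet> v)) (at 0)"
    unfolding power2_norm_eq_inner by (auto intro!: derivative_eq_intros simp: inner_add_left inner_add_right inner_commute)
  have "(g has_real_derivative g' ((norm z)\<^sup>2 + \<rho>)) (at ((norm (z + 0 *\<^sub>R v))\<^sup>2 + \<rho>))" using assms[OF pos[of z]] by simp
  from DERIV_chain2[OF this 1] show ?thesis by (simp add: mult.commute)
qed

lemma ker_deriv: "((\<lambda>t. ker (z + t *\<^sub>R v)) has_real_derivative ker1 v z) (at 0)"
  unfolding ker_def ker1_def by (rule line_deriv[OF f_deriv])

lemma ker1_deriv: "((\<lambda>t. ker1 v (z + t *\<^sub>R w)) has_real_derivative ker2 v w z) (at 0)"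
proof -
  have 1: "((\<lambda>t. 2 * ((z + t *\<^sub>R w) \<bullet> v)) has_real_derivative 2 * (v \<bullet> w)) (at 0)"
  proof -
    have "(\<lambda>t. 2 * ((z + t *\<^sub>R w) \<bullet> v)) = (\<lambda>t. 2 * (z \<bullet> v + t * (v \<bullet> w)))"
      by (simp add: inner_add_left distrib_left inner_commute[of w v] fun_eq_iff)
    then show ?thesis by (auto intro!: derivative_eq_intros)
  qed
  from DERIV_mult[OF 1 line_deriv[OF f1_deriv, of z w]] show ?thesis
    unfolding ker1_def ker2_def by (simp add: algebra_simps)
qed

lemma conv_deriv1:
  assumes "continuous_on UNIV h"
  shows "((\<lambda>t. conv ker h (x + t *\<^sub>R v)) has_real_derivative - conv (ker1 v) h x) (at 0)"
  by (rule conv_line_derivative[OF assms ker_cont(1) ker_supp(1) ker_cont(2) ker_supp(2) ker_deriv])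

lemma conv_deriv2:
  assumes "continuous_on UNIV h"
  shows "((\<lambda>t. - conv (ker1 v) h (x + t *\<^sub>R w)) has_real_derivative conv (ker2 v w) h x) (at 0)"
  using DERIV_minus[OF conv_line_derivative[OF assms ker_cont(2) ker_supp(2) ker_cont(3) ker_supp(3) ker1_deriv]] by simp

lemma ker2_sum:
  fixes z :: "'a::euclidean_space"
  shows "(\<Sum>b\<in>Basis. ker2 b b z) = 2 * real DIM('a) * f1 ((norm z)\<^sup>2 + \<rho>) + 4 * (norm z)\<^sup>2 * f2 ((norm z)\<^sup>2 + \<rho>)"
proof -
  have "(norm z)\<^sup>2 = (\<Sum>b\<in>Basis. (z \<bullet> b)\<^sup>2)"
    unfolding power2_norm_eq_inner by (subst euclidean_inner) (simp add: power2_eq_square)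
  then show ?thesis
    by (simp add: ker2_def sum.distrib sum_distrib_left sum_distrib_right power2_eq_square mult.assoc)
qed

lemma conv_laplacian:
  fixes h :: "'a::euclidean_space \<Rightarrow> real"
  assumes h: "continuous_on UNIV h"
  shows "(\<Sum>b\<in>Basis. conv (ker2 b b) h x) = (\<integral>y. (2 * real DIM('a) * f1 ((norm (y - x))\<^sup>2 + \<rho>) + 4 * (norm (y - x))\<^sup>2 * f2 ((norm (y - x))\<^sup>2 + \<rho>)) * h y \<partial>lborel)"
proof -
  have "(\<Sum>b\<in>Basis. conv (ker2 b b) h x) = (\<integral>y. (\<Sum>b\<in>Basis. ker2 b b (y - x) * h y) \<partial>lborel)"
    unfolding conv_def
    using conv_integrable[OF h ker_cont(3) ker_supp(3)] by (subst Bochner_Integration.integral_sum) auto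
  then show ?thesis by (simp only: sum_distrib_right[symmetric] ker2_sum)
qed

end

lemma second_derivative_at_max:
  fixes \<phi> :: "real \<Rightarrow> real"
  assumes "r > 0" and d1: "\<And>t. \<bar>t\<bar> < r \<Longrightarrow> (\<phi> has_real_derivative \<phi>1 t) (at t)"
    and d2: "(\<phi>1 has_real_derivative D) (at 0)" and max: "\<And>t. \<bar>t\<bar> < r \<Longrightarrow> \<phi> t \<le> \<phi> 0"
  shows "D \<le> 0"
proof (rule ccontr)
  assume "\<not> D \<le> 0"
  then have "D > 0" by simp
  have "\<phi>1 0 = 0"
    by (rule DERIV_local_max[OF d1[of 0] \<open>r > 0\<close>]) (use max \<open>r > 0\<close> in auto)
  obtain d where d: "d > 0" "\<And>h. h > 0 \<Longrightarrow> h < d \<Longrightarrow> \<phi>1 0 < \<phi>1 (0 + h)"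
    using DERIV_pos_inc_right[OF d2 \<open>D > 0\<close>] by auto
  define s where "s = min d r / 2"
  have s: "0 < s" "s < d" "s < r" using d \<open>r > 0\<close> by (auto simp: s_def min_def)
  have "\<phi> 0 < \<phi> s"
  proof (rule DERIV_pos_imp_increasing_open[OF s(1)])
    fix t assume "0 < t" "t < s"
    then show "\<exists>y. (\<phi> has_real_derivative y) (at t) \<and> y > 0"
      using d1[of t] d(2)[of t] s \<open>\<phi>1 0 = 0\<close> by (intro exI[of _ "\<phi>1 t"]) auto
  next
    show "continuous_on {0..s} \<phi>"
    proof (intro continuous_at_imp_continuous_on ballI)
      fix t assume "t \<in> {0..s}"
      then show "isCont \<phi> t" using s by (intro DERIV_isCont[OF d1]) auto
    qed
  qed
  then show False using max[of s] s by auto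
qed

section \<open>The maximum principle on spherical shells\<close>

lemma conv_tendsto_mollifier:
  fixes h :: "'a::euclidean_space \<Rightarrow> real"
  assumes "continuous_on UNIV h" "\<And>n. 0 < \<rho> n" "\<rho> \<longlonglongrightarrow> 0" "x \<longlonglongrightarrow> x0"
  shows "(\<lambda>n. conv (mollifier (\<rho> n)) h (x n)) \<longlonglongrightarrow> mollifier_mass TYPE('a) * h x0"
  using mollifier_convolution_tendsto[OF assms] by (simp add: conv_def)

text \<open>The Laplacian of the mollified solution, computed on the mollifier. In this way the equation
  holds pointwise although \<open>u\<close> itself is merely continuous.\<close>
lemma mollified_equation:
  fixes u :: "'a::euclidean_space \<Rightarrow> complex"
  assumes u: "continuous_on UNIV u" and ae: "AE x in lborel. u x = w x" and wm[measurable]: "w \<in> borel_measurable borel"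
    and sol: "distributional_solution lam w" and \<rho>: "\<rho> > 0"
    and f1: "\<And>t. t > 0 \<Longrightarrow> (mollifier_profile (halfdim TYPE('a)) \<rho> has_real_derivative f1 t) (at t)"
    and f2: "\<And>t. t > 0 \<Longrightarrow> (f1 has_real_derivative f2 t) (at t)"
  shows "(\<integral>y. (2 * real DIM('a) * f1 ((norm (y - x))\<^sup>2 + \<rho>) + 4 * (norm (y - x))\<^sup>2 * f2 ((norm (y - x))\<^sup>2 + \<rho>)) *\<^sub>R u y \<partial>lborel) =
    (\<integral>y. mollifier \<rho> (y - x) *\<^sub>R (u y - lam * u y ^ 3) \<partial>lborel)"
proof -
  have um[measurable]: "u \<in> borel_measurable borel" by (rule borel_measurable_continuous_onI[OF u])
  have \<rho>0: "0 \<le> \<rho>" using \<rho> by simp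
  have mm[measurable]: "(mollifier \<rho> :: 'a \<Rightarrow> real) \<in> borel_measurable borel" using \<rho>0 by (rule kernels_measurable)
  obtain B where B: "B \<ge> 0" "\<And>z::'a. \<bar>mollifier \<rho> z\<bar> \<le> B"
    using continuous_compact_support_kernel(2)[OF mollifier_continuous[OF \<rho>]] kernels_support(2)[OF _ \<rho>0] by blast
  have far: "norm (y - x) > 2" if "norm y > norm x + 2" for y using that norm_triangle_ineq2[of y x] by linarith
  have lap: "laplacian (\<lambda>y. complex_of_real (mollifier \<rho> (y - x))) y = complex_of_real (2 * real DIM('a) * f1 ((norm (y - x))\<^sup>2 + \<rho>) + 4 * (norm (y - x))\<^sup>2 * f2 ((norm (y - x))\<^sup>2 + \<rho>))" for y
    unfolding mollifier_def by (rule radial_laplacian[OF \<rho> f1 f2])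
  have "continuous_on {0<..} f1" "continuous_on {0<..} f2"
  proof -
    obtain g1 g2 where g: "\<And>t. t > 0 \<Longrightarrow> (mollifier_profile (halfdim TYPE('a)) \<rho> has_real_derivative g1 t) (at t)" "\<And>t. t > 0 \<Longrightarrow> (g1 has_real_derivative g2 t) (at t)"
      "continuous_on {0<..} g1" "continuous_on {0<..} g2"
      using profile_two_derivatives[OF mollifier_profile_in_profiles mollifier_profile_eq_0] by metis
    \<comment> \<open>Derivatives are unique, so f1 and f2 inherit the continuity of derivatives inside the algebra
      of profiles.\<close>
    have e1: "f1 t = g1 t" if "t > 0" for t using DERIV_unique[OF f1 g(1)] that by blast
    have e2: "f2 t = g2 t" if "t > 0" for t
    proof -
      have "(g1 has_real_derivative f2 t) (at t)"
        by (rule has_field_derivative_transform_within_open[OF f2[OF that], of "{0<..}"]) (use that e1 in auto)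
      then show ?thesis using DERIV_unique g(2)[OF that] by blast
    qed
    show "continuous_on {0<..} f1" using g(3) continuous_on_cong[of "{0<..}" "{0<..}" f1 g1] e1 by simp
    show "continuous_on {0<..} f2" using g(4) continuous_on_cong[of "{0<..}" "{0<..}" f2 g2] e2 by simp
  qed
  then have lm[measurable]: "(\<lambda>y. 2 * real DIM('a) * f1 ((norm (y - x))\<^sup>2 + \<rho>) + 4 * (norm (y - x))\<^sup>2 * f2 ((norm (y - x))\<^sup>2 + \<rho>)) \<in> borel_measurable borel"
  proof -
    assume c: "continuous_on {0<..} f1" "continuous_on {0<..} f2"
    have "continuous_on UNIV (\<lambda>y. 2 * real DIM('a) * f1 ((norm (y - x))\<^sup>2 + \<rho>) + 4 * (norm (y - x))\<^sup>2 * f2 ((norm (y - x))\<^sup>2 + \<rho>))"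
      using \<rho> by (intro continuous_intros continuous_on_compose2[OF c(1)] continuous_on_compose2[OF c(2)]) (auto simp: add_nonneg_pos)
    then show ?thesis by (rule borel_measurable_continuous_onI)
  qed
  have "(\<integral>y. (2 * real DIM('a) * f1 ((norm (y - x))\<^sup>2 + \<rho>) + 4 * (norm (y - x))\<^sup>2 * f2 ((norm (y - x))\<^sup>2 + \<rho>)) *\<^sub>R u y \<partial>lborel) =
     (\<integral>y. w y * laplacian (\<lambda>y. complex_of_real (mollifier \<rho> (y - x))) y \<partial>lborel)"
    unfolding lap by (rule integral_cong_AE) (measurable, use ae in \<open>auto simp: scaleR_conv_of_real mult.commute elim!: eventually_mono\<close>)
  also have "\<dots> = (\<integral>y. complex_of_real (mollifier \<rho> (y - x)) * (w y - lam * w y ^ 3) \<partial>lborel)"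
    by (rule weak_equation[OF sol mollifier_test_function[OF \<rho>], where B = B and R = "norm x + 2"])
       (use B far in \<open>auto simp: kernels_support \<rho>0\<close>)
  also have "\<dots> = (\<integral>y. mollifier \<rho> (y - x) *\<^sub>R (u y - lam * u y ^ 3) \<partial>lborel)"
    by (rule integral_cong_AE) (measurable, use ae in \<open>auto simp: scaleR_conv_of_real elim!: eventually_mono\<close>)
  finally show ?thesis .
qed

lemma conv_Re:
  fixes h :: "'a::euclidean_space \<Rightarrow> complex"
  assumes "continuous_on UNIV h" "continuous_on UNIV k" "\<And>z. norm z > 2 \<Longrightarrow> k z = 0"
  shows "conv k (\<lambda>y. Re (e * h y)) x = Re (e * (\<integral>y. k (y - x) *\<^sub>R h y \<partial>lborel))"
proof -
  have int: "integrable lborel (\<lambda>y. e * (k (y - x) *\<^sub>R h y))" by (intro integrable_mult_right conv_integrable assms)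
  have "Re (e * (\<integral>y. k (y - x) *\<^sub>R h y \<partial>lborel)) = Re (\<integral>y. e * (k (y - x) *\<^sub>R h y) \<partial>lborel)"
    by (simp only: integral_mult_right_zero)
  also have "\<dots> = (\<integral>y. Re (e * (k (y - x) *\<^sub>R h y)) \<partial>lborel)" by (rule integral_Re[OF int, symmetric])
  also have "(\<lambda>y. Re (e * (k (y - x) *\<^sub>R h y))) = (\<lambda>y. k (y - x) * Re (e * h y))" by (simp add: fun_eq_iff right_diff_distrib)
  finally show ?thesis by (simp add: conv_def)
qed

text \<open>At an interior maximum the Laplacian is not positive. The function consists of a mollified real
  component of \<open>u\<close>, whose Laplacian is known from the equation, and of a mollified Newtonian potential
  of \<open>q\<close>, whose Laplacian is approximately \<open>q\<close>.\<close>
lemma interior_max_inequality: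
  fixes u :: "'a::euclidean_space \<Rightarrow> complex" and q :: "'a \<Rightarrow> real"
  assumes u: "continuous_on UNIV u" and ae: "AE x in lborel. u x = w x" and wm: "w \<in> borel_measurable borel"
    and sol: "distributional_solution lam w" and \<rho>: "\<rho> > 0" and q: "continuous_on UNIV q" and r: "r > 0"
    and max: "\<And>x. dist x x0 < r \<Longrightarrow>
       Re (e * (\<integral>y. mollifier \<rho> (y - x) *\<^sub>R u y \<partial>lborel)) + m * conv (newton_kernel \<rho>) q x \<le>
       Re (e * (\<integral>y. mollifier \<rho> (y - x0) *\<^sub>R u y \<partial>lborel)) + m * conv (newton_kernel \<rho>) q x0"
  shows "Re (e * (\<integral>y. mollifier \<rho> (y - x0) *\<^sub>R (u y - lam * u y ^ 3) \<partial>lborel)) + m * (conv (mollifier \<rho>) q x0 + conv (remainder_kernel \<rho>) q x0) \<le> 0"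
proof -
  obtain f1 f2 where f: "\<And>t. t > 0 \<Longrightarrow> (mollifier_profile (halfdim TYPE('a)) \<rho> has_real_derivative f1 t) (at t)" "\<And>t. t > 0 \<Longrightarrow> (f1 has_real_derivative f2 t) (at t)"
      "continuous_on {0<..} (mollifier_profile (halfdim TYPE('a)) \<rho>)" "continuous_on {0<..} f1" "continuous_on {0<..} f2" "\<And>t. t > 2 \<Longrightarrow> f1 t = 0" "\<And>t. t > 2 \<Longrightarrow> f2 t = 0"
    using profile_two_derivatives[OF mollifier_profile_in_profiles mollifier_profile_eq_0] by metis
  obtain g1 g2 where g: "\<And>t. t > 0 \<Longrightarrow> (newton_profile (halfdim TYPE('a)) has_real_derivative g1 t) (at t)" "\<And>t. t > 0 \<Longrightarrow> (g1 has_real_derivative g2 t) (at t)"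
      "continuous_on {0<..} (newton_profile (halfdim TYPE('a)))" "continuous_on {0<..} g1" "continuous_on {0<..} g2" "\<And>t. t > 2 \<Longrightarrow> g1 t = 0" "\<And>t. t > 2 \<Longrightarrow> g2 t = 0"
    using profile_two_derivatives[OF newton_profile_in_profiles newton_profile_eq_0] by metis
  interpret M: radial_kernel "mollifier_profile (halfdim TYPE('a)) \<rho>" f1 f2 \<rho>
    by unfold_locales (use \<rho> f mollifier_profile_eq_0 in auto)
  interpret N: radial_kernel "newton_profile (halfdim TYPE('a))" g1 g2 \<rho>
    by unfold_locales (use \<rho> g newton_profile_eq_0 in auto)
  have Mk: "(mollifier \<rho> :: 'a \<Rightarrow> real) = M.ker" by (simp add: fun_eq_iff mollifier_def M.ker_def)
  have Nk: "(newton_kernel \<rho> :: 'a \<Rightarrow> real) = N.ker" by (simp add: fun_eq_iff newton_kernel_def N.ker_def)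
  let ?h = "\<lambda>y. Re (e * u y)"
  have h: "continuous_on UNIV ?h" by (intro continuous_intros u)
  let ?D = "\<lambda>x. conv M.ker ?h x + m * conv N.ker q x"
  have cM: "conv M.ker ?h x = Re (e * (\<integral>y. mollifier \<rho> (y - x) *\<^sub>R u y \<partial>lborel))" for x
    unfolding Mk by (rule conv_Re[OF u M.ker_cont(1) M.ker_supp(1)])
  have max': "?D x \<le> ?D x0" if "dist x x0 < r" for x using max[OF that] unfolding cM Nk .
  let ?D1 = "\<lambda>v x. - conv (M.ker1 v) ?h x + m * - conv (N.ker1 v) q x"
  let ?D2 = "\<lambda>v x. conv (M.ker2 v v) ?h x + m * conv (N.ker2 v v) q x"
  have D1: "((\<lambda>t. ?D (x + t *\<^sub>R v)) has_real_derivative ?D1 v x) (at 0)" for x v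
    by (intro DERIV_add DERIV_cmult M.conv_deriv1 N.conv_deriv1 h q)
  have D2: "((\<lambda>t. ?D1 v (x + t *\<^sub>R v)) has_real_derivative ?D2 v x) (at 0)" for x v
    by (intro DERIV_add DERIV_cmult M.conv_deriv2 N.conv_deriv2 h q)
  have neg: "?D2 b x0 \<le> 0" if b: "b \<in> Basis" for b
  proof (rule second_derivative_at_max[OF r])
    fix t :: real assume t: "\<bar>t\<bar> < r"
    have "((\<lambda>s. ?D ((x0 + t *\<^sub>R b) + s *\<^sub>R b)) has_real_derivative ?D1 b (x0 + t *\<^sub>R b)) (at 0)" by (rule D1)
    then have "((\<lambda>s. ?D (x0 + (s + t) *\<^sub>R b)) has_real_derivative ?D1 b (x0 + t *\<^sub>R b)) (at 0)" by (simp add: algebra_simps)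
    then show "((\<lambda>t. ?D (x0 + t *\<^sub>R b)) has_real_derivative ?D1 b (x0 + t *\<^sub>R b)) (at t)"
      using DERIV_shift[of "\<lambda>t. ?D (x0 + t *\<^sub>R b)" "?D1 b (x0 + t *\<^sub>R b)" 0 t] by simp
    show "?D (x0 + t *\<^sub>R b) \<le> ?D (x0 + 0 *\<^sub>R b)"
      using max'[of "x0 + t *\<^sub>R b"] t b by (simp add: dist_norm)
  next
    show "((\<lambda>t. ?D1 b (x0 + t *\<^sub>R b)) has_real_derivative ?D2 b x0) (at 0)" by (rule D2)
  qed
  have "(\<Sum>b\<in>Basis. ?D2 b x0) \<le> 0" by (rule sum_nonpos) (rule neg)
  then have sum: "(\<Sum>b\<in>Basis. conv (M.ker2 b b) ?h x0) + m * (\<Sum>b\<in>Basis. conv (N.ker2 b b) q x0) \<le> 0"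
    by (simp add: sum.distrib sum_distrib_left)
  let ?l = "\<lambda>z::'a. 2 * real DIM('a) * f1 ((norm z)\<^sup>2 + \<rho>) + 4 * (norm z)\<^sup>2 * f2 ((norm z)\<^sup>2 + \<rho>)"
  have lc: "continuous_on UNIV ?l" by (intro continuous_intros M.comp_cont f)
  have ls: "?l z = 0" if "norm z > 2" for z using norm_gt_2_imp[OF that, of \<rho>] \<rho> f(6,7) by simp
  have S1: "(\<Sum>b\<in>Basis. conv (M.ker2 b b) ?h x0) = Re (e * (\<integral>y. mollifier \<rho> (y - x0) *\<^sub>R (u y - lam * u y ^ 3) \<partial>lborel))"
  proof -
    have "(\<Sum>b\<in>Basis. conv (M.ker2 b b) ?h x0) = conv ?l ?h x0"
      using M.conv_laplacian[OF h, of x0] by (simp only: conv_def)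
    also have "\<dots> = Re (e * (\<integral>y. ?l (y - x0) *\<^sub>R u y \<partial>lborel))" by (rule conv_Re[OF u lc ls])
    also have "(\<integral>y. ?l (y - x0) *\<^sub>R u y \<partial>lborel) = (\<integral>y. mollifier \<rho> (y - x0) *\<^sub>R (u y - lam * u y ^ 3) \<partial>lborel)"
      by (rule mollified_equation[OF u ae wm sol \<rho> f(1,2)])
    finally show ?thesis .
  qed
  have S2: "(\<Sum>b\<in>Basis. conv (N.ker2 b b) q x0) = conv (mollifier \<rho>) q x0 + conv (remainder_kernel \<rho>) q x0"
  proof -
    let ?n = "\<lambda>z::'a. 2 * real DIM('a) * g1 ((norm z)\<^sup>2 + \<rho>) + 4 * (norm z)\<^sup>2 * g2 ((norm z)\<^sup>2 + \<rho>)"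
    have nl: "?n z = mollifier \<rho> z + remainder_kernel \<rho> z" for z :: 'a
    proof -
      have "complex_of_real (?n (z - 0)) = laplacian (\<lambda>y. complex_of_real (newton_kernel \<rho> (y - 0))) z"
        unfolding newton_kernel_def by (rule radial_laplacian[OF \<rho> g(1,2), symmetric])
      also have "\<dots> = complex_of_real (mollifier \<rho> (z - 0) + remainder_kernel \<rho> (z - 0))"
        by (rule laplacian_newton_kernel[OF \<rho>])
      finally show ?thesis unfolding of_real_eq_iff by simp
    qed
    have nc: "continuous_on UNIV ?n" by (intro continuous_intros N.comp_cont g)
    have rc: "continuous_on UNIV (remainder_kernel \<rho> :: 'a \<Rightarrow> real)"
    proof -
      have "continuous_on UNIV (\<lambda>z::'a. ?n z - mollifier \<rho> z)" by (intro continuous_on_diff nc mollifier_continuous[OF \<rho>])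
      then show ?thesis unfolding nl by simp
    qed
    have supp: "mollifier \<rho> z = 0" "remainder_kernel \<rho> z = 0" if "norm z > 2" for z :: 'a
      using kernels_support[OF that] \<rho> by auto
    have "(\<Sum>b\<in>Basis. conv (N.ker2 b b) q x0) = (\<integral>y. mollifier \<rho> (y - x0) *\<^sub>R q y + remainder_kernel \<rho> (y - x0) *\<^sub>R q y \<partial>lborel)"
      unfolding N.conv_laplacian[OF q] nl by (simp add: distrib_right)
    also have "\<dots> = conv (mollifier \<rho>) q x0 + conv (remainder_kernel \<rho>) q x0"
      unfolding conv_def real_scaleR_def[symmetric]
      by (intro Bochner_Integration.integral_add conv_integrable q mollifier_continuous[OF \<rho>] rc supp)
    finally show ?thesis .
  qed
  show ?thesis using sum unfolding S1 S2 .
qed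

text \<open>A maximum principle in which the potential \<open>lam u^2\<close> need not be small pointwise. Let \<open>M\<close> be the
  maximum of \<open>|u|\<close> on the shell and \<open>V\<close> the Newtonian potential of \<open>|u|^2\<close>. Suppressing
  the mollification and normalising its mass to 1, at a maximum of \<open>|u| + m V\<close> with
  \<open>m = |lam| M\<close> the equation yields
  \<open>0 \<ge> |u| - |lam| |u|^3 + m (|u|^2 - \<epsilon>)\<close>, and the choice of \<open>m\<close> lets the potential absorb the cubic
  term, so \<open>|u| \<le> m \<epsilon>\<close> there. As \<open>|V| \<le> \<kappa>\<close>, this point carries \<open>|u| \<ge> M - 2 m \<kappa>\<close>. Smallness of \<open>\<kappa>\<close>
  and \<open>\<epsilon>\<close> contradicts \<open>M > 0\<close>; it also keeps the maximum away from the boundary spheres, where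
  \<open>u\<close> vanishes.\<close>
lemma shell_uniqueness:
  fixes u :: "'a::euclidean_space \<Rightarrow> complex"
  assumes u: "continuous_on UNIV u" and ae: "AE x in lborel. u x = w x" and wm: "w \<in> borel_measurable borel"
    and sol: "distributional_solution lam w"
    and bdry: "\<And>x. norm x = R1 \<or> norm x = R2 \<Longrightarrow> u x = 0"
    and \<kappa>: "\<And>\<rho> x. 0 < \<rho> \<Longrightarrow> \<rho> \<le> 1 \<Longrightarrow> R1 \<le> norm x \<Longrightarrow> \<bar>conv (newton_kernel \<rho>) (\<lambda>y. (norm (u y))\<^sup>2) x\<bar> \<le> \<kappa>"
    and \<epsilon>: "\<And>\<rho> x. 0 < \<rho> \<Longrightarrow> \<rho> \<le> 1 \<Longrightarrow> R1 \<le> norm x \<Longrightarrow> \<bar>conv (remainder_kernel \<rho>) (\<lambda>y. (norm (u y))\<^sup>2) x\<bar> \<le> \<epsilon>"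
    and small: "norm lam * (\<epsilon> + 2 * \<kappa>) < mollifier_mass TYPE('a)"
    and x: "R1 \<le> norm x" "norm x \<le> R2"
  shows "u x = 0"
proof -
  let ?A = "{x::'a. R1 \<le> norm x \<and> norm x \<le> R2}" and ?c = "mollifier_mass TYPE('a)"
  let ?q = "\<lambda>y. (norm (u y))\<^sup>2"
  have c: "?c > 0" by (rule mollifier_mass_pos)
  have q: "continuous_on UNIV ?q" by (intro continuous_intros u)
  have A: "compact ?A"
  proof -
    have "closed ?A" by (intro closed_Collect_conj closed_Collect_le continuous_intros)
    moreover have "bounded ?A" by (rule boundedI[of _ R2]) auto
    ultimately show ?thesis by (simp add: compact_eq_bounded_closed)
  qed
  have xA: "x \<in> ?A" using x by simp
  obtain xh where xh: "xh \<in> ?A" "\<And>y. y \<in> ?A \<Longrightarrow> norm (u y) \<le> norm (u xh)"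
    using continuous_attains_sup[OF A, of "\<lambda>y. norm (u y)"] xA by (auto intro!: continuous_intros continuous_on_subset[OF u])
  define M where "M = norm (u xh)"
  have MA: "norm (u y) \<le> M" if "y \<in> ?A" for y using xh(2)[OF that] by (simp add: M_def)
  have "M = 0"
  proof (rule ccontr)
    assume "M \<noteq> 0"
    then have M: "M > 0" by (simp add: M_def)
    define m where "m = norm lam * M"
    have m: "m \<ge> 0" using M by (simp add: m_def)
    define \<rho> where "\<rho> n = inverse (real (Suc n))" for n
    have \<rho>: "\<And>n. \<rho> n > 0" "\<rho> \<longlonglongrightarrow> 0" unfolding \<rho>_def using LIMSEQ_inverse_real_of_nat by auto
    have \<rho>1: "\<rho> n \<le> 1" for n by (simp add: \<rho>_def field_simps)
    define U where "U n x = (\<integral>y. mollifier (\<rho> n) (y - x) *\<^sub>R u y \<partial>lborel)" for n x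
    define V where "V n x = conv (newton_kernel (\<rho> n)) ?q x" for n x
    have Vb: "\<bar>V n y\<bar> \<le> \<kappa>" if "y \<in> ?A" for n y using \<kappa>[OF \<rho>(1) \<rho>1] that by (simp add: V_def)
    have supp: "mollifier (\<rho> n) z = 0" "newton_kernel (\<rho> n) z = 0" if "norm z > 2" for n and z :: 'a
      using kernels_support[OF that] less_imp_le[OF \<rho>(1)] by auto
    have Uc: "continuous_on UNIV (U n)" for n
    proof -
      have "U n = (\<lambda>x. \<integral>y. complex_of_real (mollifier (\<rho> n) (y - x)) * u y \<partial>lborel)"
        by (simp add: fun_eq_iff U_def scaleR_conv_of_real)
      then show ?thesis
        using convolution_continuous_kernel[OF mollifier_continuous[OF \<rho>(1)] supp(1) continuous_locally_integrable[OF u]] by simp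
    qed
    have Vc: "continuous_on UNIV (V n)" for n
      unfolding V_def[abs_def] by (rule conv_continuous[OF q newton_kernel_continuous[OF \<rho>(1)] supp(2)])
    have "\<exists>z\<in>?A. \<forall>y\<in>?A. norm (U n y) + m * V n y \<le> norm (U n z) + m * V n z" for n
    proof (rule continuous_attains_sup[OF A])
      show "continuous_on ?A (\<lambda>y. norm (U n y) + m * V n y)"
        by (intro continuous_intros continuous_on_subset[OF Uc] continuous_on_subset[OF Vc]) auto
    qed (use xA in blast)
    then obtain X where X: "\<And>n. X n \<in> ?A" "\<And>n y. y \<in> ?A \<Longrightarrow> norm (U n y) + m * V n y \<le> norm (U n (X n)) + m * V n (X n)"
      by metis
    obtain xs r where xs: "xs \<in> ?A" and r: "strict_mono r" and Xr: "(X \<circ> r) \<longlonglongrightarrow> xs"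
      using compact_imp_seq_compact[OF A] X(1) by (meson seq_compactE)
    have \<rho>r: "(\<lambda>n. \<rho> (r n)) \<longlonglongrightarrow> 0" using LIMSEQ_subseq_LIMSEQ[OF \<rho>(2) r] by (simp add: o_def)
    have Xr': "(\<lambda>n. X (r n)) \<longlonglongrightarrow> xs" using Xr by (simp add: o_def)
    have Ulim: "(\<lambda>n. U (r n) (X (r n))) \<longlonglongrightarrow> ?c *\<^sub>R u xs"
      unfolding U_def by (rule mollifier_convolution_tendsto[OF u \<rho>(1) \<rho>r Xr'])
    have Uhlim: "(\<lambda>n. U (r n) xh) \<longlonglongrightarrow> ?c *\<^sub>R u xh"
      unfolding U_def by (rule mollifier_convolution_tendsto[OF u \<rho>(1) \<rho>r tendsto_const])
    have "norm (U (r n) xh) - 2 * m * \<kappa> \<le> norm (U (r n) (X (r n)))" for n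
    proof -
      have "m * V (r n) (X (r n)) \<le> m * \<kappa>" "m * (- \<kappa>) \<le> m * V (r n) xh"
        using Vb[OF X(1), of "r n" "r n"] Vb[OF xh(1), of "r n"] m by (intro mult_left_mono; linarith)+
      then show ?thesis using X(2)[OF xh(1), of "r n"] by simp
    qed
    then have "norm (?c *\<^sub>R u xh) - 2 * m * \<kappa> \<le> norm (?c *\<^sub>R u xs)"
      using LIMSEQ_le[OF tendsto_diff[OF tendsto_norm[OF Uhlim] tendsto_const] tendsto_norm[OF Ulim]] by blast
    \<comment> \<open>The maximal value of |U| + m V is at least its value at xh, and the potential costs at most
      \<kappa> at each of the two points.\<close>
    then have low: "?c * M - 2 * m * \<kappa> \<le> ?c * norm (u xs)" using c by (simp add: M_def)
    have \<epsilon>0: "\<epsilon> \<ge> 0" using \<epsilon>[OF \<rho>(1) \<rho>1 x(1), of 0] by linarith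
    have "2 * m * \<kappa> < ?c * M"
    proof -
      have "norm lam * (2 * \<kappa>) \<le> norm lam * (\<epsilon> + 2 * \<kappa>)" using \<epsilon>0 by (intro mult_left_mono) auto
      then have "norm lam * (2 * \<kappa>) < ?c" using small by linarith
      then have "norm lam * (2 * \<kappa>) * M < ?c * M" using M by (rule mult_strict_right_mono)
      then show ?thesis by (simp add: m_def mult_ac)
    qed
    with low have "0 < ?c * norm (u xs)" by linarith
    \<comment> \<open>So the limit point is interior, and the phases converge.\<close>
    then have us: "u xs \<noteq> 0" using c by (auto simp: zero_less_mult_iff)
    then have "R1 < norm xs" "norm xs < R2" using bdry[of xs] xs by (auto simp: less_le)
    define s where "s = min (norm xs - R1) (R2 - norm xs) / 2"
    have s: "s > 0" "\<And>y z. dist z xs < s \<Longrightarrow> dist y z < s \<Longrightarrow> y \<in> ?A"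
    proof -
      show "s > 0" using \<open>R1 < norm xs\<close> \<open>norm xs < R2\<close> by (simp add: s_def)
      fix y z assume "dist z xs < s" "dist y z < s"
      then have "norm (y - xs) < 2 * s" using dist_triangle[of y xs z] by (simp add: dist_norm)
      moreover have "2 * s \<le> norm xs - R1" "2 * s \<le> R2 - norm xs" by (auto simp: s_def)
      moreover have "\<bar>norm y - norm xs\<bar> \<le> norm (y - xs)" by (rule norm_triangle_ineq3)
      ultimately show "y \<in> ?A" by (simp only: mem_Collect_eq) linarith
    qed
    let ?F = "\<lambda>y. u y - lam * u y ^ 3"
    have Fc: "continuous_on UNIV ?F" by (intro continuous_intros u)
    \<comment> \<open>The phase of the mollified solution at its maximum point turns the modulus into a real
      component, which is a linear expression in u and hence accessible to the equation.\<close>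
    let ?e = "\<lambda>n. cnj (sgn (U (r n) (X (r n))))"
    have near: "\<forall>\<^sub>F n in sequentially. dist (X (r n)) xs < s" using tendstoD[OF Xr' s(1)] .
    have ineq: "\<forall>\<^sub>F n in sequentially. Re (?e n * (\<integral>y. mollifier (\<rho> (r n)) (y - X (r n)) *\<^sub>R ?F y \<partial>lborel)) + m * conv (mollifier (\<rho> (r n))) ?q (X (r n)) \<le> m * \<epsilon>"
      using near
    proof eventually_elim
      fix n assume n: "dist (X (r n)) xs < s"
      let ?x = "X (r n)" and ?\<rho> = "\<rho> (r n)"
      have e1: "Re (?e n * U (r n) ?x) = norm (U (r n) ?x)"
        by (cases "U (r n) ?x = 0") (auto simp: sgn_eq complex_norm_square[symmetric] power2_eq_square mult.commute)
      have e2: "Re (?e n * z) \<le> norm z" for z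
      proof -
        have "Re (?e n * z) \<le> norm (?e n * z)" by (rule complex_Re_le_cmod)
        also have "\<dots> \<le> 1 * norm z" unfolding norm_mult by (intro mult_right_mono) (auto simp: norm_sgn)
        finally show ?thesis by simp
      qed
      have "Re (?e n * (\<integral>y. mollifier ?\<rho> (y - ?x) *\<^sub>R ?F y \<partial>lborel)) + m * (conv (mollifier ?\<rho>) ?q ?x + conv (remainder_kernel ?\<rho>) ?q ?x) \<le> 0"
      proof (rule interior_max_inequality[OF u ae wm sol \<rho>(1) q s(1)])
        fix y assume "dist y ?x < s"
        then have "y \<in> ?A" by (rule s(2)[OF n])
        then have "norm (U (r n) y) + m * V (r n) y \<le> norm (U (r n) ?x) + m * V (r n) ?x" by (rule X(2))
        then show "Re (?e n * (\<integral>y'. mollifier ?\<rho> (y' - y) *\<^sub>R u y' \<partial>lborel)) + m * conv (newton_kernel ?\<rho>) ?q y \<le>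
          Re (?e n * (\<integral>y'. mollifier ?\<rho> (y' - ?x) *\<^sub>R u y' \<partial>lborel)) + m * conv (newton_kernel ?\<rho>) ?q ?x"
          using e1 e2[of "U (r n) y"] unfolding U_def[symmetric] V_def[symmetric] by linarith
      qed
      moreover have "m * (- conv (remainder_kernel ?\<rho>) ?q ?x) \<le> m * \<epsilon>"
      proof (rule mult_left_mono[OF _ m])
        have "R1 \<le> norm ?x" using X(1)[of "r n"] by simp
        from \<epsilon>[OF \<rho>(1) \<rho>1 this, of "r n"] show "- conv (remainder_kernel ?\<rho>) ?q ?x \<le> \<epsilon>" by linarith
      qed
      ultimately show "Re (?e n * (\<integral>y. mollifier ?\<rho> (y - ?x) *\<^sub>R ?F y \<partial>lborel)) + m * conv (mollifier ?\<rho>) ?q ?x \<le> m * \<epsilon>"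
        by (simp add: algebra_simps)
    qed
    have elim: "?e \<longlonglongrightarrow> cnj (sgn (?c *\<^sub>R u xs))"
      using us c by (intro tendsto_cnj tendsto_sgn Ulim) auto
    have Flim: "(\<lambda>n. \<integral>y. mollifier (\<rho> (r n)) (y - X (r n)) *\<^sub>R ?F y \<partial>lborel) \<longlonglongrightarrow> ?c *\<^sub>R ?F xs"
      by (rule mollifier_convolution_tendsto[OF Fc \<rho>(1) \<rho>r Xr'])
    have qlim: "(\<lambda>n. conv (mollifier (\<rho> (r n))) ?q (X (r n))) \<longlonglongrightarrow> ?c * ?q xs"
      by (rule conv_tendsto_mollifier[OF q \<rho>(1) \<rho>r Xr'])
    have "Re (cnj (sgn (?c *\<^sub>R u xs)) * (?c *\<^sub>R ?F xs)) + m * (?c * ?q xs) \<le> m * \<epsilon>"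
      by (rule tendsto_upperbound[OF _ ineq]) (intro tendsto_intros elim Flim qlim, simp)
    moreover have "Re (cnj (sgn (?c *\<^sub>R u xs)) * (?c *\<^sub>R ?F xs)) \<ge> ?c * (norm (u xs) - norm lam * norm (u xs) ^ 3)"
    proof -
      let ?s = "cnj (sgn (u xs))"
      have sg: "sgn (?c *\<^sub>R u xs) = sgn (u xs)" using c by (simp add: sgn_scaleR)
      have 1: "Re (?s * u xs) = norm (u xs)"
        using us by (simp add: sgn_eq complex_norm_square[symmetric] power2_eq_square mult.commute)
      have "Re (?s * (lam * u xs ^ 3)) \<le> norm (?s * (lam * u xs ^ 3))" by (rule complex_Re_le_cmod)
      also have "\<dots> = norm lam * norm (u xs) ^ 3" using us by (simp add: norm_mult norm_power norm_sgn)
      finally have 2: "Re (?s * (lam * u xs ^ 3)) \<le> norm lam * norm (u xs) ^ 3" .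
      have "norm (u xs) - norm lam * norm (u xs) ^ 3 \<le> Re (?s * ?F xs)"
        using 1 2 by (simp add: right_diff_distrib)
      then have "?c * (norm (u xs) - norm lam * norm (u xs) ^ 3) \<le> ?c * Re (?s * ?F xs)"
        using c by (intro mult_left_mono) auto
      moreover have "Re (a * (k *\<^sub>R b)) = k * Re (a * b)" for a b :: complex and k by (simp add: algebra_simps)
      ultimately show ?thesis unfolding sg by simp
    qed
    ultimately have main: "?c * (norm (u xs) - norm lam * norm (u xs) ^ 3) + m * (?c * ?q xs) \<le> m * \<epsilon>" by linarith
    have "norm lam * norm (u xs) ^ 3 \<le> m * ?q xs"
    proof -
      have "norm (u xs) * (norm (u xs))\<^sup>2 \<le> M * (norm (u xs))\<^sup>2" by (intro mult_right_mono MA[OF xs]) auto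
      then have "norm lam * (norm (u xs) * (norm (u xs))\<^sup>2) \<le> norm lam * (M * (norm (u xs))\<^sup>2)" by (rule mult_left_mono) simp
      then show ?thesis by (simp add: m_def power2_eq_square power3_eq_cube mult_ac)
    qed
    then have "?c * (norm lam * norm (u xs) ^ 3) \<le> ?c * (m * ?q xs)" using c by (intro mult_left_mono) auto
    with main have "?c * norm (u xs) \<le> m * \<epsilon>" by (simp add: algebra_simps)
    with low have "?c * M \<le> M * (norm lam * (\<epsilon> + 2 * \<kappa>))" by (simp add: m_def algebra_simps)
    also have "\<dots> < M * ?c" using small M by (intro mult_strict_left_mono) auto
    finally show False by (simp add: mult.commute)
  qed
  then show ?thesis using MA[OF xA] by simp
qed

section \<open>A Carleman estimate and solutions of compact support\<close>

lemma continuous_compact_support_integrable: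
  fixes f :: "'a::euclidean_space \<Rightarrow> real"
  assumes "continuous_on UNIV f" "\<And>x. norm x > R \<Longrightarrow> f x = 0"
  shows "integrable lborel f"
proof -
  have "(\<lambda>y. indicator (cball 0 R) y *\<^sub>R f y) = f" using assms(2) by (auto simp: fun_eq_iff indicator_def)
  then show ?thesis using continuous_locally_integrable[OF assms(1), of R] by simp
qed

text \<open>The translates of \<open>g\<close> have a constant integral, and the derivative passes under the integral.\<close>
lemma integral_directional_derivative:
  fixes g g' :: "'a::euclidean_space \<Rightarrow> real"
  assumes g: "continuous_on UNIV g" "\<And>x. norm x > R \<Longrightarrow> g x = 0" and g': "continuous_on UNIV g'" "\<And>x. norm x > R \<Longrightarrow> g' x = 0"
    and R: "R > 0" and der: "\<And>x. ((\<lambda>t. g (x + t *\<^sub>R v)) has_real_derivative g' x) (at 0)"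
  shows "(\<integral>x. g' x \<partial>lborel) = 0"
proof -
  define \<sigma> where "\<sigma> = R / 2"
  have \<sigma>: "\<sigma> > 0" using R by (simp add: \<sigma>_def)
  let ?k = "\<lambda>z. g (\<sigma> *\<^sub>R z)" and ?k' = "\<lambda>z. \<sigma> * g' (\<sigma> *\<^sub>R z)"
  have far: "norm (\<sigma> *\<^sub>R z) > R" if "norm z > 2" for z :: 'a
    using that \<sigma> R by (simp add: \<sigma>_def field_simps)
  have d: "((\<lambda>t. conv ?k (\<lambda>_. 1) (0 + t *\<^sub>R v)) has_real_derivative - conv ?k' (\<lambda>_. 1) 0) (at 0)"
  proof (rule conv_line_derivative)
    show "continuous_on UNIV ?k" "continuous_on UNIV ?k'"
      by (auto intro!: continuous_intros continuous_on_compose2[OF g(1)] continuous_on_compose2[OF g'(1)])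
    show "((\<lambda>t. ?k (z + t *\<^sub>R v)) has_real_derivative ?k' z) (at 0)" for z
    proof -
      have 1: "((\<lambda>t. \<sigma> * t) has_real_derivative \<sigma>) (at 0)" by (auto intro!: derivative_eq_intros)
      have 2: "((\<lambda>t. g (\<sigma> *\<^sub>R z + t *\<^sub>R v)) has_real_derivative g' (\<sigma> *\<^sub>R z)) (at (\<sigma> * 0))" using der by simp
      from DERIV_chain2[OF 2 1] show ?thesis by (simp add: scaleR_add_right mult.commute)
    qed
  qed (use far g(2) g'(2) in auto)
  have "conv ?k (\<lambda>_. 1) x = (\<integral>z. ?k z \<partial>lborel)" for x
    unfolding conv_def using integral_shift(1)[of ?k x] by simp
  then have "((\<lambda>t. conv ?k (\<lambda>_. 1) (0 + t *\<^sub>R v)) has_real_derivative 0) (at 0)" by simp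
  with d have "conv ?k' (\<lambda>_. 1) 0 = 0" using DERIV_unique by fastforce
  then have "(\<integral>z. g' (\<sigma> *\<^sub>R z) \<partial>lborel) = 0" using \<sigma> by (simp add: conv_def)
  moreover have "(\<integral>x. g' x \<partial>lborel) = \<bar>\<sigma>\<bar> ^ DIM('a) *\<^sub>R (\<integral>z. g' (0 + \<sigma> *\<^sub>R z) \<partial>lborel)"
    by (rule integral_euclidean_affine) (use \<sigma> in simp)
  ultimately show ?thesis by simp
qed

text \<open>For \<open>v = exp (\<tau> x \<bullet> e) g\<close> the conjugated Laplacian is \<open>P - Q\<close> with the symmetric part
  \<open>P = \<Delta> + \<tau>^2\<close> and the antisymmetric part \<open>Q = 2 \<tau> \<partial>\<^sub>e\<close>. Both have constant coefficients, so they
  commute and the cross term integrates to 0, leaving the norm of \<open>Q v\<close> as a lower bound. Poincare's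
  inequality in the direction \<open>e\<close> then bounds \<open>v\<close>.\<close>
lemma carleman_conjugated:
  fixes v :: "'a::euclidean_space \<Rightarrow> real"
  assumes R: "R > 0" and e: "e \<in> Basis"
    and c: "continuous_on UNIV v" "\<And>b. continuous_on UNIV (v1 b)" "\<And>b c. continuous_on UNIV (v2 b c)"
    and z: "\<And>x. norm x > R \<Longrightarrow> v x = 0" "\<And>b x. norm x > R \<Longrightarrow> v1 b x = 0" "\<And>b c x. norm x > R \<Longrightarrow> v2 b c x = 0"
    and d: "\<And>b x. ((\<lambda>t. v (x + t *\<^sub>R b)) has_real_derivative v1 b x) (at 0)"
      "\<And>b c x. ((\<lambda>t. v1 b (x + t *\<^sub>R c)) has_real_derivative v2 b c x) (at 0)"
    and sym: "\<And>b c x. v2 b c x = v2 c b x"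
  shows "\<tau>\<^sup>2 / R\<^sup>2 * (\<integral>x. (v x)\<^sup>2 \<partial>lborel) \<le> (\<integral>x. ((\<Sum>b\<in>Basis. v2 b b x) + \<tau>\<^sup>2 * v x - 2 * \<tau> * v1 e x)\<^sup>2 \<partial>lborel)"
proof -
  let ?P = "\<lambda>x. (\<Sum>b\<in>Basis. v2 b b x) + \<tau>\<^sup>2 * v x" and ?Q = "\<lambda>x. 2 * \<tau> * v1 e x"
  note int = continuous_compact_support_integrable[where R = R]
  have i1: "(\<integral>x. v x * v1 e x \<partial>lborel) = 0"
  proof -
    have "(\<integral>x. v x * v1 e x + v1 e x * v x \<partial>lborel) = 0"
    proof (rule integral_directional_derivative[where g = "\<lambda>x. v x * v x" and R = R and v = e])
      show "((\<lambda>t. v (x + t *\<^sub>R e) * v (x + t *\<^sub>R e)) has_real_derivative v x * v1 e x + v1 e x * v x) (at 0)" for x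
        using DERIV_mult[OF d(1)[of x e] d(1)[of x e]] by (simp add: algebra_simps)
    qed (auto intro!: continuous_intros c R simp: z)
    then have "(\<integral>x. 2 * (v x * v1 e x) \<partial>lborel) = 0" by (simp add: mult.commute[of "v1 e _"] mult_2[symmetric])
    then show ?thesis by simp
  qed
  have i2: "(\<integral>x. v2 b b x * v1 e x \<partial>lborel) = 0" for b
  proof -
    have A: "(\<integral>x. v2 b b x * v1 e x + v1 b x * v2 e b x \<partial>lborel) = 0"
    proof (rule integral_directional_derivative[where g = "\<lambda>x. v1 b x * v1 e x" and R = R and v = b])
      show "((\<lambda>t. v1 b (x + t *\<^sub>R b) * v1 e (x + t *\<^sub>R b)) has_real_derivative v2 b b x * v1 e x + v1 b x * v2 e b x) (at 0)" for x
        using DERIV_mult[OF d(2)[of b x b] d(2)[of e x b]] by (simp add: algebra_simps)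
    qed (auto intro!: continuous_intros c R simp: z)
    have B: "(\<integral>x. v1 b x * v2 e b x \<partial>lborel) = 0"
    proof -
      have "(\<integral>x. v1 b x * v2 b e x + v2 b e x * v1 b x \<partial>lborel) = 0"
      proof (rule integral_directional_derivative[where g = "\<lambda>x. v1 b x * v1 b x" and R = R and v = e])
        show "((\<lambda>t. v1 b (x + t *\<^sub>R e) * v1 b (x + t *\<^sub>R e)) has_real_derivative v1 b x * v2 b e x + v2 b e x * v1 b x) (at 0)" for x
          using DERIV_mult[OF d(2)[of b x e] d(2)[of b x e]] by (simp add: algebra_simps)
      qed (auto intro!: continuous_intros c R simp: z)
      then have "(\<integral>x. 2 * (v1 b x * v2 e b x) \<partial>lborel) = 0"
        by (simp add: sym[of e b] mult.commute[of "v2 b e _"] mult_2[symmetric])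
      then show ?thesis by simp
    qed
    have "(\<integral>x. v2 b b x * v1 e x + v1 b x * v2 e b x \<partial>lborel) = (\<integral>x. v2 b b x * v1 e x \<partial>lborel) + (\<integral>x. v1 b x * v2 e b x \<partial>lborel)"
      by (intro Bochner_Integration.integral_add int continuous_intros c) (auto simp: z)
    with A B show ?thesis by simp
  qed
  have PQ: "(\<integral>x. ?P x * ?Q x \<partial>lborel) = 0"
  proof -
    have "(\<integral>x. ?P x * ?Q x \<partial>lborel) = (\<integral>x. (\<Sum>b\<in>Basis. 2 * \<tau> * (v2 b b x * v1 e x)) + 2 * \<tau> ^ 3 * (v x * v1 e x) \<partial>lborel)"
      by (intro Bochner_Integration.integral_cong refl)
         (simp add: algebra_simps sum_distrib_left sum_distrib_right power2_eq_square power3_eq_cube)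
    also have "\<dots> = (\<integral>x. (\<Sum>b\<in>Basis. 2 * \<tau> * (v2 b b x * v1 e x)) \<partial>lborel) + (\<integral>x. 2 * \<tau> ^ 3 * (v x * v1 e x) \<partial>lborel)"
      by (intro Bochner_Integration.integral_add int continuous_intros c) (auto simp: z)
    also have "(\<integral>x. (\<Sum>b\<in>Basis. 2 * \<tau> * (v2 b b x * v1 e x)) \<partial>lborel) = (\<Sum>b\<in>Basis. \<integral>x. 2 * \<tau> * (v2 b b x * v1 e x) \<partial>lborel)"
      by (intro Bochner_Integration.integral_sum int continuous_intros c) (auto simp: z)
    finally show ?thesis by (simp add: i1 i2)
  qed
  have exp: "(\<integral>x. (?P x - ?Q x)\<^sup>2 \<partial>lborel) = (\<integral>x. (?P x)\<^sup>2 \<partial>lborel) - 2 * (\<integral>x. ?P x * ?Q x \<partial>lborel) + (\<integral>x. (?Q x)\<^sup>2 \<partial>lborel)"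
  proof -
    have iP: "integrable lborel (\<lambda>x. (?P x)\<^sup>2)" by (intro int continuous_intros c) (auto simp: z)
    have iPQ: "integrable lborel (\<lambda>x. 2 * (?P x * ?Q x))" by (intro int continuous_intros c) (auto simp: z)
    have iQ: "integrable lborel (\<lambda>x. (?Q x)\<^sup>2)" by (intro int continuous_intros c) (auto simp: z)
    have "(\<integral>x. (?P x - ?Q x)\<^sup>2 \<partial>lborel) = (\<integral>x. (?P x)\<^sup>2 - 2 * (?P x * ?Q x) + (?Q x)\<^sup>2 \<partial>lborel)"
      by (intro Bochner_Integration.integral_cong refl) (simp only: power2_diff mult.assoc)
    also have "\<dots> = (\<integral>x. (?P x)\<^sup>2 \<partial>lborel) - (\<integral>x. 2 * (?P x * ?Q x) \<partial>lborel) + (\<integral>x. (?Q x)\<^sup>2 \<partial>lborel)"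
      by (simp only: Bochner_Integration.integral_add[OF Bochner_Integration.integrable_diff[OF iP iPQ] iQ] Bochner_Integration.integral_diff[OF iP iPQ])
    also have "(\<integral>x. 2 * (?P x * ?Q x) \<partial>lborel) = 2 * (\<integral>x. ?P x * ?Q x \<partial>lborel)" by (rule integral_mult_right_zero)
    finally show ?thesis .
  qed
  have "(\<integral>x. (?P x)\<^sup>2 \<partial>lborel) \<ge> 0" by simp
  then have lower: "(\<integral>x. (?Q x)\<^sup>2 \<partial>lborel) \<le> (\<integral>x. (?P x - ?Q x)\<^sup>2 \<partial>lborel)" unfolding exp PQ by simp
  have iv: "integrable lborel (\<lambda>x. (v x)\<^sup>2)" "integrable lborel (\<lambda>x. (v1 e x)\<^sup>2)"
    by (intro int continuous_intros c; simp add: z)+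
  have poincare: "(\<integral>x. (v x)\<^sup>2 \<partial>lborel) \<le> 4 * R\<^sup>2 * (\<integral>x. (v1 e x)\<^sup>2 \<partial>lborel)"
  proof -
    have ee: "e \<bullet> e = 1" using e by simp
    have "(\<integral>x. (v x)\<^sup>2 + 2 * (x \<bullet> e) * v x * v1 e x \<partial>lborel) = 0"
    proof (rule integral_directional_derivative[where g = "\<lambda>x. (x \<bullet> e) * (v x * v x)" and R = R and v = e])
      fix x
      have 1: "((\<lambda>t. (x + t *\<^sub>R e) \<bullet> e) has_real_derivative 1) (at 0)"
      proof -
        have "(\<lambda>t. (x + t *\<^sub>R e) \<bullet> e) = (\<lambda>t. x \<bullet> e + t)" by (simp add: inner_add_left ee fun_eq_iff)
        then show ?thesis by (auto intro!: derivative_eq_intros)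
      qed
      show "((\<lambda>t. ((x + t *\<^sub>R e) \<bullet> e) * (v (x + t *\<^sub>R e) * v (x + t *\<^sub>R e))) has_real_derivative (v x)\<^sup>2 + 2 * (x \<bullet> e) * v x * v1 e x) (at 0)"
        using DERIV_mult[OF 1 DERIV_mult[OF d(1)[of x e] d(1)[of x e]]] by (simp add: algebra_simps power2_eq_square)
    qed (auto intro!: continuous_intros c R simp: z)
    moreover have iw: "integrable lborel (\<lambda>x. 2 * (x \<bullet> e) * v x * v1 e x)" by (intro int continuous_intros c) (auto simp: z)
    ultimately have "(\<integral>x. (v x)\<^sup>2 \<partial>lborel) = (\<integral>x. - (2 * (x \<bullet> e) * v x * v1 e x) \<partial>lborel)"
      using iv by simp
    also have "\<dots> \<le> (\<integral>x. 1 / 2 * (v x)\<^sup>2 + 2 * R\<^sup>2 * (v1 e x)\<^sup>2 \<partial>lborel)"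
    proof (rule integral_mono)
      fix x
      show "- (2 * (x \<bullet> e) * v x * v1 e x) \<le> 1 / 2 * (v x)\<^sup>2 + 2 * R\<^sup>2 * (v1 e x)\<^sup>2"
      proof (cases "norm x \<le> R")
        case True
        have "\<bar>x \<bullet> e\<bar> \<le> R" using True Basis_le_norm[OF e, of x] by linarith
        then have "(x \<bullet> e)\<^sup>2 \<le> R\<^sup>2" by (simp add: abs_le_square_iff[symmetric] R less_imp_le)
        then have "(x \<bullet> e)\<^sup>2 * (v1 e x)\<^sup>2 \<le> R\<^sup>2 * (v1 e x)\<^sup>2" by (rule mult_right_mono) simp
        moreover have "0 \<le> (1 / 2 * v x + (x \<bullet> e) * v1 e x)\<^sup>2" by simp
        ultimately show ?thesis by (simp add: power2_sum power_mult_distrib power_divide algebra_simps)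
      next
        case False
        then show ?thesis by (simp add: z)
      qed
    qed (use iv iw in auto)
    also have "\<dots> = 1 / 2 * (\<integral>x. (v x)\<^sup>2 \<partial>lborel) + 2 * R\<^sup>2 * (\<integral>x. (v1 e x)\<^sup>2 \<partial>lborel)" using iv by simp
    finally show ?thesis by simp
  qed
  have "\<tau>\<^sup>2 / R\<^sup>2 * (\<integral>x. (v x)\<^sup>2 \<partial>lborel) \<le> \<tau>\<^sup>2 / R\<^sup>2 * (4 * R\<^sup>2 * (\<integral>x. (v1 e x)\<^sup>2 \<partial>lborel))"
    by (intro mult_left_mono poincare) auto
  also have "\<dots> = (\<integral>x. (?Q x)\<^sup>2 \<partial>lborel)" using R by (simp add: power_mult_distrib)
  finally show ?thesis using lower by linarith
qed

text \<open>The linear weight suffices for functions of compact support: the constant grows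
  with \<open>\<tau>\<close>, so it beats any bounded potential.\<close>
lemma carleman_estimate:
  fixes g :: "'a::euclidean_space \<Rightarrow> real"
  assumes R: "R > 0" and e: "e \<in> Basis"
    and c: "continuous_on UNIV g" "\<And>b. continuous_on UNIV (g1 b)" "\<And>b c. continuous_on UNIV (g2 b c)"
    and z: "\<And>x. norm x > R \<Longrightarrow> g x = 0" "\<And>b x. norm x > R \<Longrightarrow> g1 b x = 0" "\<And>b c x. norm x > R \<Longrightarrow> g2 b c x = 0"
    and d: "\<And>b x. ((\<lambda>t. g (x + t *\<^sub>R b)) has_real_derivative g1 b x) (at 0)"
      "\<And>b c x. ((\<lambda>t. g1 b (x + t *\<^sub>R c)) has_real_derivative g2 b c x) (at 0)"
    and sym: "\<And>b c x. g2 b c x = g2 c b x"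
  shows "\<tau>\<^sup>2 / R\<^sup>2 * (\<integral>x. exp (2 * \<tau> * (x \<bullet> e)) * (g x)\<^sup>2 \<partial>lborel) \<le>
    (\<integral>x. exp (2 * \<tau> * (x \<bullet> e)) * (\<Sum>b\<in>Basis. g2 b b x)\<^sup>2 \<partial>lborel)"
proof -
  let ?E = "\<lambda>x. exp (\<tau> * (x \<bullet> e))"
  let ?v = "\<lambda>x. ?E x * g x"
  let ?v1 = "\<lambda>b x. ?E x * (g1 b x + \<tau> * (b \<bullet> e) * g x)"
  let ?v2 = "\<lambda>b c x. ?E x * (g2 b c x + \<tau> * (b \<bullet> e) * g1 c x + \<tau> * (c \<bullet> e) * (g1 b x + \<tau> * (b \<bullet> e) * g x))"
  have E2: "(?E x)\<^sup>2 = exp (2 * \<tau> * (x \<bullet> e))" for x by (simp add: power2_eq_square exp_add[symmetric])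
  have dE: "((\<lambda>t. ?E (x + t *\<^sub>R b)) has_real_derivative \<tau> * (b \<bullet> e) * ?E x) (at 0)" for x b
  proof -
    have "(\<lambda>t. ?E (x + t *\<^sub>R b)) = (\<lambda>t. exp (\<tau> * (x \<bullet> e + t * (b \<bullet> e))))" by (simp add: inner_add_left fun_eq_iff)
    then show ?thesis by (auto intro!: derivative_eq_intros)
  qed
  have "\<tau>\<^sup>2 / R\<^sup>2 * (\<integral>x. (?v x)\<^sup>2 \<partial>lborel) \<le> (\<integral>x. ((\<Sum>b\<in>Basis. ?v2 b b x) + \<tau>\<^sup>2 * ?v x - 2 * \<tau> * ?v1 e x)\<^sup>2 \<partial>lborel)"
  proof (rule carleman_conjugated[OF R e, where v = ?v and ?v1.0 = ?v1 and ?v2.0 = ?v2])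
    show "continuous_on UNIV ?v" by (intro continuous_intros c)
    show "continuous_on UNIV (?v1 b)" for b by (intro continuous_intros c)
    show "continuous_on UNIV (?v2 b c)" for b c by (intro continuous_intros c)
    show "((\<lambda>t. ?v (x + t *\<^sub>R b)) has_real_derivative ?v1 b x) (at 0)" for b x
      using DERIV_mult[OF dE[of x b] d(1)[of x b]] by (simp add: algebra_simps)
    show "((\<lambda>t. ?v1 b (x + t *\<^sub>R c)) has_real_derivative ?v2 b c x) (at 0)" for b c x
      using DERIV_mult[OF dE[of x c] DERIV_add[OF d(2)[of b x c] DERIV_cmult[OF d(1)[of x c], of "\<tau> * (b \<bullet> e)"]]] by (simp add: algebra_simps)
    show "?v2 b c x = ?v2 c b x" for b c x by (simp add: sym[of b c] algebra_simps)
  qed (auto simp: z)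
  also have "(\<lambda>x. ((\<Sum>b\<in>Basis. ?v2 b b x) + \<tau>\<^sup>2 * ?v x - 2 * \<tau> * ?v1 e x)\<^sup>2) = (\<lambda>x. exp (2 * \<tau> * (x \<bullet> e)) * (\<Sum>b\<in>Basis. g2 b b x)\<^sup>2)"
  proof
    fix x
    have delta: "(\<Sum>b\<in>Basis. (b \<bullet> e) * f b) = f e" for f :: "'a \<Rightarrow> real"
    proof -
      have "(\<Sum>b\<in>Basis. (b \<bullet> e) * f b) = (\<Sum>b\<in>Basis. if b = e then f b else 0)"
        using e by (intro sum.cong refl) (auto simp: inner_Basis)
      then show ?thesis using e by simp
    qed
    have "(\<Sum>b\<in>Basis. ?v2 b b x) = ?E x * ((\<Sum>b\<in>Basis. g2 b b x) + (\<Sum>b\<in>Basis. (b \<bullet> e) * (2 * \<tau> * g1 b x)) + (\<Sum>b\<in>Basis. (b \<bullet> e) * ((b \<bullet> e) * (\<tau>\<^sup>2 * g x))))"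
      by (simp add: sum_distrib_left sum.distrib[symmetric] algebra_simps power2_eq_square)
    also have "\<dots> = ?E x * ((\<Sum>b\<in>Basis. g2 b b x) + 2 * \<tau> * g1 e x + \<tau>\<^sup>2 * g x)"
      unfolding delta using e by simp
    finally have "(\<Sum>b\<in>Basis. ?v2 b b x) + \<tau>\<^sup>2 * ?v x - 2 * \<tau> * ?v1 e x = ?E x * (\<Sum>b\<in>Basis. g2 b b x)"
      using e by (simp add: algebra_simps power2_eq_square)
    then show "((\<Sum>b\<in>Basis. ?v2 b b x) + \<tau>\<^sup>2 * ?v x - 2 * \<tau> * ?v1 e x)\<^sup>2 = exp (2 * \<tau> * (x \<bullet> e)) * (\<Sum>b\<in>Basis. g2 b b x)\<^sup>2"
      by (simp only: power_mult_distrib E2)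
  qed
  finally show ?thesis by (simp only: power_mult_distrib E2)
qed

lemma conv_support:
  assumes "\<And>z. norm z > 2 \<Longrightarrow> k z = 0" "\<And>y. norm y > R \<Longrightarrow> h y = 0" "norm x > R + 2"
  shows "conv k h x = 0"
proof -
  have 0: "k (y - x) * h y = 0" for y
  proof (cases "norm y > R")
    case False
    then have "norm (y - x) > 2"
      using assms(3) norm_triangle_ineq2[of x y] by (simp add: norm_minus_commute)
    then show ?thesis using assms(1) by simp
  qed (simp add: assms(2))
  show ?thesis unfolding conv_def 0 by simp
qed

text \<open>The Carleman estimate is applied to real components of the mollified solution, and the limit gives
  it for \<open>u\<close> with \<open>u - lam u^3\<close> in the role of the Laplacian. On the support \<open>u\<close> is bounded, so
  \<open>|u - lam u^3| \<le> K |u|\<close>, and a parameter \<open>\<tau>\<close> with \<open>\<tau> / L > K\<close> forces \<open>u = 0\<close>.\<close>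
lemma compact_support_uniqueness:
  fixes u :: "'a::euclidean_space \<Rightarrow> complex"
  assumes u: "continuous_on UNIV u" and ae: "AE x in lborel. u x = w x" and wm: "w \<in> borel_measurable borel"
    and sol: "distributional_solution lam w" and supp: "\<And>x. norm x > R \<Longrightarrow> u x = 0"
  shows "AE x in lborel. u x = 0"
proof -
  obtain e :: 'a where e: "e \<in> Basis" using nonempty_Basis by blast
  define L where "L = \<bar>R\<bar> + 3"
  have L: "L > 0" by (simp add: L_def)
  let ?F = "\<lambda>y. u y - lam * u y ^ 3" and ?c = "mollifier_mass TYPE('a)"
  have c: "?c > 0" by (rule mollifier_mass_pos)
  have Fc: "continuous_on UNIV ?F" by (intro continuous_intros u)
  have Fs: "norm x > R \<Longrightarrow> ?F x = 0" for x using supp by simp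
  define \<rho> where "\<rho> n = inverse (real (Suc n))" for n
  have \<rho>: "\<And>n. \<rho> n > 0" "\<rho> \<longlonglongrightarrow> 0" unfolding \<rho>_def using LIMSEQ_inverse_real_of_nat by auto
  have ms: "mollifier (\<rho> n) z = 0" if "norm z > 2" for n and z :: 'a
    using kernels_support[OF that] less_imp_le[OF \<rho>(1)] by auto
  have est: "\<tau>\<^sup>2 / L\<^sup>2 * (\<integral>x. exp (2 * \<tau> * (x \<bullet> e)) * (conv (mollifier (\<rho> n)) (\<lambda>y. Re (\<theta> * u y)) x)\<^sup>2 \<partial>lborel) \<le>
      (\<integral>x. exp (2 * \<tau> * (x \<bullet> e)) * (conv (mollifier (\<rho> n)) (\<lambda>y. Re (\<theta> * ?F y)) x)\<^sup>2 \<partial>lborel)" for n \<tau> \<theta>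
  proof -
    obtain f1 f2 where f: "\<And>t. t > 0 \<Longrightarrow> (mollifier_profile (halfdim TYPE('a)) (\<rho> n) has_real_derivative f1 t) (at t)" "\<And>t. t > 0 \<Longrightarrow> (f1 has_real_derivative f2 t) (at t)"
        "continuous_on {0<..} (mollifier_profile (halfdim TYPE('a)) (\<rho> n))" "continuous_on {0<..} f1" "continuous_on {0<..} f2" "\<And>t. t > 2 \<Longrightarrow> f1 t = 0" "\<And>t. t > 2 \<Longrightarrow> f2 t = 0"
      using profile_two_derivatives[OF mollifier_profile_in_profiles mollifier_profile_eq_0] by metis
    interpret M: radial_kernel "mollifier_profile (halfdim TYPE('a)) (\<rho> n)" f1 f2 "\<rho> n"
      by unfold_locales (use \<rho> f mollifier_profile_eq_0 in auto)
    have Mk: "(mollifier (\<rho> n) :: 'a \<Rightarrow> real) = M.ker" by (simp add: fun_eq_iff mollifier_def M.ker_def)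
    let ?h = "\<lambda>y. Re (\<theta> * u y)"
    have h: "continuous_on UNIV ?h" by (intro continuous_intros u)
    have hs: "norm y > R \<Longrightarrow> ?h y = 0" for y using supp by simp
    have far: "norm x > R + 2" if "norm x > L" for x :: 'a using that by (simp add: L_def)
    have "\<tau>\<^sup>2 / L\<^sup>2 * (\<integral>x. exp (2 * \<tau> * (x \<bullet> e)) * (conv M.ker ?h x)\<^sup>2 \<partial>lborel) \<le>
      (\<integral>x. exp (2 * \<tau> * (x \<bullet> e)) * (\<Sum>b\<in>Basis. conv (M.ker2 b b) ?h x)\<^sup>2 \<partial>lborel)"
    proof (rule carleman_estimate[OF L e, where ?g1.0 = "\<lambda>b x. - conv (M.ker1 b) ?h x" and ?g2.0 = "\<lambda>b c. conv (M.ker2 b c) ?h"])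
      show "continuous_on UNIV (conv M.ker ?h)" by (rule conv_continuous[OF h M.ker_cont(1) M.ker_supp(1)])
      show "continuous_on UNIV (\<lambda>x. - conv (M.ker1 b) ?h x)" for b
        by (intro continuous_on_minus conv_continuous[OF h M.ker_cont(2) M.ker_supp(2)])
      show "continuous_on UNIV (conv (M.ker2 b c) ?h)" for b c by (rule conv_continuous[OF h M.ker_cont(3) M.ker_supp(3)])
      show "conv M.ker ?h x = 0" if "norm x > L" for x by (rule conv_support[OF M.ker_supp(1) hs far[OF that]])
      show "- conv (M.ker1 b) ?h x = 0" if "norm x > L" for b x using conv_support[OF M.ker_supp(2) hs far[OF that]] by simp
      show "conv (M.ker2 b c) ?h x = 0" if "norm x > L" for b c x by (rule conv_support[OF M.ker_supp(3) hs far[OF that]])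
      show "((\<lambda>t. conv M.ker ?h (x + t *\<^sub>R b)) has_real_derivative - conv (M.ker1 b) ?h x) (at 0)" for b x by (rule M.conv_deriv1[OF h])
      show "((\<lambda>t. - conv (M.ker1 b) ?h (x + t *\<^sub>R c)) has_real_derivative conv (M.ker2 b c) ?h x) (at 0)" for b c x by (rule M.conv_deriv2[OF h])
      have "M.ker2 b c = M.ker2 c b" for b c :: 'a by (simp add: M.ker2_def inner_commute mult_ac fun_eq_iff)
      then show "conv (M.ker2 b c) ?h x = conv (M.ker2 c b) ?h x" for b c x by simp
    qed
    also have "(\<lambda>x. \<Sum>b\<in>Basis. conv (M.ker2 b b) ?h x) = conv (mollifier (\<rho> n)) (\<lambda>y. Re (\<theta> * ?F y))"
    proof
      fix x
      let ?l = "\<lambda>z::'a. 2 * real DIM('a) * f1 ((norm z)\<^sup>2 + \<rho> n) + 4 * (norm z)\<^sup>2 * f2 ((norm z)\<^sup>2 + \<rho> n)"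
      have lc: "continuous_on UNIV ?l" by (intro continuous_intros M.comp_cont f)
      have ls: "?l z = 0" if "norm z > 2" for z using norm_gt_2_imp[OF that, of "\<rho> n"] \<rho>(1)[of n] f(6,7) by simp
      have "(\<Sum>b\<in>Basis. conv (M.ker2 b b) ?h x) = conv ?l ?h x" using M.conv_laplacian[OF h, of x] by (simp only: conv_def)
      also have "\<dots> = Re (\<theta> * (\<integral>y. ?l (y - x) *\<^sub>R u y \<partial>lborel))" by (rule conv_Re[OF u lc ls])
      also have "(\<integral>y. ?l (y - x) *\<^sub>R u y \<partial>lborel) = (\<integral>y. mollifier (\<rho> n) (y - x) *\<^sub>R ?F y \<partial>lborel)"
        by (rule mollified_equation[OF u ae wm sol \<rho>(1) f(1,2)])
      also have "Re (\<theta> * (\<integral>y. mollifier (\<rho> n) (y - x) *\<^sub>R ?F y \<partial>lborel)) = conv (mollifier (\<rho> n)) (\<lambda>y. Re (\<theta> * ?F y)) x"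
        by (rule conv_Re[OF Fc mollifier_continuous[OF \<rho>(1)] ms, symmetric])
      finally show "(\<Sum>b\<in>Basis. conv (M.ker2 b b) ?h x) = conv (mollifier (\<rho> n)) (\<lambda>y. Re (\<theta> * ?F y)) x" .
    qed
    finally show ?thesis unfolding Mk .
  qed
  have lim: "(\<lambda>n. \<integral>x. exp (2 * \<tau> * (x \<bullet> e)) * (conv (mollifier (\<rho> n)) h x)\<^sup>2 \<partial>lborel) \<longlonglongrightarrow> (\<integral>x. exp (2 * \<tau> * (x \<bullet> e)) * (?c * h x)\<^sup>2 \<partial>lborel)"
    if h: "continuous_on UNIV h" and hs: "\<And>y. norm y > R \<Longrightarrow> h y = 0" for h :: "'a \<Rightarrow> real" and \<tau>
  proof -
    have [measurable]: "h \<in> borel_measurable borel" by (rule borel_measurable_continuous_onI[OF h])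
    have "compact (h ` cball 0 R)" by (intro compact_continuous_image continuous_on_subset[OF h]) auto
    then obtain B' where B': "\<And>x. norm x \<le> R \<Longrightarrow> norm (h x) \<le> B'"
      using compact_imp_bounded bounded_iff by (metis imageI mem_cball_0)
    define B where "B = \<bar>B'\<bar>"
    have B: "norm (h x) \<le> B" for x using B'[of x] hs[of x] by (cases "norm x \<le> R") (auto simp: B_def)
    have Ecs: "continuous_on UNIV (\<lambda>x. exp (2 * \<tau> * (x \<bullet> e)) * (?c * B)\<^sup>2)" by (intro continuous_intros)
    have [measurable]: "conv (mollifier (\<rho> n)) h \<in> borel_measurable borel" for n
      by (rule borel_measurable_continuous_onI[OF conv_continuous[OF h mollifier_continuous[OF \<rho>(1)] ms]])
    show ?thesis
    proof (rule integral_dominated_convergence[where w = "\<lambda>x. indicator (cball 0 (R + 2)) x *\<^sub>R (exp (2 * \<tau> * (x \<bullet> e)) * (?c * B)\<^sup>2)"])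
      show "integrable lborel (\<lambda>x. indicator (cball 0 (R + 2)) x *\<^sub>R (exp (2 * \<tau> * (x \<bullet> e)) * (?c * B)\<^sup>2))"
        by (rule continuous_locally_integrable[OF Ecs])
      show "AE x in lborel. (\<lambda>n. exp (2 * \<tau> * (x \<bullet> e)) * (conv (mollifier (\<rho> n)) h x)\<^sup>2) \<longlonglongrightarrow> exp (2 * \<tau> * (x \<bullet> e)) * (?c * h x)\<^sup>2"
        by (intro AE_I2 tendsto_mult tendsto_const tendsto_power conv_tendsto_mollifier[OF h \<rho>])
      show "AE x in lborel. norm (exp (2 * \<tau> * (x \<bullet> e)) * (conv (mollifier (\<rho> n)) h x)\<^sup>2) \<le> indicator (cball 0 (R + 2)) x *\<^sub>R (exp (2 * \<tau> * (x \<bullet> e)) * (?c * B)\<^sup>2)" for n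
      proof (rule AE_I2)
        fix x
        show "norm (exp (2 * \<tau> * (x \<bullet> e)) * (conv (mollifier (\<rho> n)) h x)\<^sup>2) \<le> indicator (cball 0 (R + 2)) x *\<^sub>R (exp (2 * \<tau> * (x \<bullet> e)) * (?c * B)\<^sup>2)"
        proof (cases "norm x \<le> R + 2")
          case True
          have "\<bar>conv (mollifier (\<rho> n)) h x\<bar> \<le> ?c * B"
            using mollifier_convolution_bound[OF \<rho>(1)[of n] _ B, where x = x] by (simp add: conv_def)
          then have "\<bar>conv (mollifier (\<rho> n)) h x\<bar>\<^sup>2 \<le> (?c * B)\<^sup>2" by (rule power_mono) simp
          then show ?thesis using True by (simp add: abs_mult)
        next
          case False
          then show ?thesis using conv_support[where k = "mollifier (\<rho> n)" and h = h and R = R and x = x, OF ms hs] by simp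
        qed
      qed
    qed measurable
  qed
  have est': "\<tau>\<^sup>2 / L\<^sup>2 * (\<integral>x. exp (2 * \<tau> * (x \<bullet> e)) * (?c * Re (\<theta> * u x))\<^sup>2 \<partial>lborel) \<le> (\<integral>x. exp (2 * \<tau> * (x \<bullet> e)) * (?c * Re (\<theta> * ?F x))\<^sup>2 \<partial>lborel)" for \<tau> \<theta>
  proof (rule LIMSEQ_le)
    show "(\<lambda>n. \<tau>\<^sup>2 / L\<^sup>2 * (\<integral>x. exp (2 * \<tau> * (x \<bullet> e)) * (conv (mollifier (\<rho> n)) (\<lambda>y. Re (\<theta> * u y)) x)\<^sup>2 \<partial>lborel)) \<longlonglongrightarrow> \<tau>\<^sup>2 / L\<^sup>2 * (\<integral>x. exp (2 * \<tau> * (x \<bullet> e)) * (?c * Re (\<theta> * u x))\<^sup>2 \<partial>lborel)"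
      by (intro tendsto_mult_left lim continuous_intros u) (simp add: supp)
    show "(\<lambda>n. \<integral>x. exp (2 * \<tau> * (x \<bullet> e)) * (conv (mollifier (\<rho> n)) (\<lambda>y. Re (\<theta> * ?F y)) x)\<^sup>2 \<partial>lborel) \<longlonglongrightarrow> (\<integral>x. exp (2 * \<tau> * (x \<bullet> e)) * (?c * Re (\<theta> * ?F x))\<^sup>2 \<partial>lborel)"
      by (intro lim continuous_intros u) (simp add: supp)
  qed (use est in blast)
  have csi: "integrable lborel f" if "continuous_on UNIV f" "\<And>x. norm x > R \<Longrightarrow> f x = 0" for f :: "'a \<Rightarrow> real"
    by (rule continuous_compact_support_integrable[OF that])
  have full: "\<tau>\<^sup>2 / L\<^sup>2 * (\<integral>x. exp (2 * \<tau> * (x \<bullet> e)) * (norm (u x))\<^sup>2 \<partial>lborel) \<le> (\<integral>x. exp (2 * \<tau> * (x \<bullet> e)) * (norm (?F x))\<^sup>2 \<partial>lborel)" for \<tau>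
  proof -
    \<comment> \<open>The two components Re G and Im G = Re (- i G) recombine to the modulus.\<close>
    have split: "(\<integral>x. exp (2 * \<tau> * (x \<bullet> e)) * (?c * Re (1 * G x))\<^sup>2 \<partial>lborel) + (\<integral>x. exp (2 * \<tau> * (x \<bullet> e)) * (?c * Re (- \<i> * G x))\<^sup>2 \<partial>lborel) =
       ?c\<^sup>2 * (\<integral>x. exp (2 * \<tau> * (x \<bullet> e)) * (norm (G x))\<^sup>2 \<partial>lborel)" if G: "continuous_on UNIV G" "\<And>x. norm x > R \<Longrightarrow> G x = 0" for G :: "'a \<Rightarrow> complex"
    proof -
      have "(\<integral>x. exp (2 * \<tau> * (x \<bullet> e)) * (?c * Re (1 * G x))\<^sup>2 \<partial>lborel) + (\<integral>x. exp (2 * \<tau> * (x \<bullet> e)) * (?c * Re (- \<i> * G x))\<^sup>2 \<partial>lborel) =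
        (\<integral>x. exp (2 * \<tau> * (x \<bullet> e)) * (?c * Re (1 * G x))\<^sup>2 + exp (2 * \<tau> * (x \<bullet> e)) * (?c * Re (- \<i> * G x))\<^sup>2 \<partial>lborel)"
        by (intro Bochner_Integration.integral_add[symmetric] csi continuous_intros G) (auto simp: G(2))
      also have "\<dots> = (\<integral>x. ?c\<^sup>2 * (exp (2 * \<tau> * (x \<bullet> e)) * (norm (G x))\<^sup>2) \<partial>lborel)"
        by (intro Bochner_Integration.integral_cong refl) (simp add: cmod_power2 power_mult_distrib algebra_simps)
      finally show ?thesis by simp
    qed
    have "\<tau>\<^sup>2 / L\<^sup>2 * (?c\<^sup>2 * (\<integral>x. exp (2 * \<tau> * (x \<bullet> e)) * (norm (u x))\<^sup>2 \<partial>lborel)) \<le> ?c\<^sup>2 * (\<integral>x. exp (2 * \<tau> * (x \<bullet> e)) * (norm (?F x))\<^sup>2 \<partial>lborel)"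
      using add_mono[OF est'[of \<tau> 1] est'[of \<tau> "- \<i>"]] split[OF u supp] split[OF Fc Fs]
      by (simp only: distrib_left[symmetric])
    then have "?c\<^sup>2 * (\<tau>\<^sup>2 / L\<^sup>2 * (\<integral>x. exp (2 * \<tau> * (x \<bullet> e)) * (norm (u x))\<^sup>2 \<partial>lborel)) \<le> ?c\<^sup>2 * (\<integral>x. exp (2 * \<tau> * (x \<bullet> e)) * (norm (?F x))\<^sup>2 \<partial>lborel)"
      by (simp only: mult.left_commute)
    then show ?thesis by (rule mult_left_le_imp_le) (use c in simp)
  qed
  have "compact (u ` cball 0 R)" by (intro compact_continuous_image continuous_on_subset[OF u]) auto
  then obtain B' where B': "\<And>x. norm x \<le> R \<Longrightarrow> norm (u x) \<le> B'"
    using compact_imp_bounded bounded_iff by (metis imageI mem_cball_0)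
  define K where "K = 1 + norm lam * B'\<^sup>2"
  have K: "K > 0" by (simp add: K_def add_pos_nonneg)
  have FK: "norm (?F x) \<le> K * norm (u x)" for x
  proof (cases "norm x \<le> R")
    case True
    have "norm (?F x) \<le> norm (u x) + norm lam * ((norm (u x))\<^sup>2 * norm (u x))"
      using norm_triangle_ineq4[of "u x" "lam * u x ^ 3"] by (simp add: norm_mult power2_eq_square power3_eq_cube mult_ac)
    also have "\<dots> \<le> norm (u x) + norm lam * (B'\<^sup>2 * norm (u x))"
      using B'[OF True] by (intro add_left_mono mult_left_mono mult_right_mono power_mono) auto
    finally show ?thesis by (simp add: K_def algebra_simps)
  qed (simp add: supp)
  \<comment> \<open>Any larger value works as well; the gap between K + 1 and K is what gives the contradiction.\<close>
  define \<tau> where "\<tau> = L * (K + 1)"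
  let ?I = "\<integral>x. exp (2 * \<tau> * (x \<bullet> e)) * (norm (u x))\<^sup>2 \<partial>lborel"
  have iu: "integrable lborel (\<lambda>x. exp (2 * \<tau> * (x \<bullet> e)) * (norm (u x))\<^sup>2)"
    by (intro csi continuous_intros u) (simp add: supp)
  have "(K + 1)\<^sup>2 * ?I = \<tau>\<^sup>2 / L\<^sup>2 * ?I" using L by (simp add: \<tau>_def power_mult_distrib)
  also have "\<dots> \<le> (\<integral>x. exp (2 * \<tau> * (x \<bullet> e)) * (norm (?F x))\<^sup>2 \<partial>lborel)" by (rule full)
  also have "\<dots> \<le> (\<integral>x. K\<^sup>2 * (exp (2 * \<tau> * (x \<bullet> e)) * (norm (u x))\<^sup>2) \<partial>lborel)"
  proof (rule integral_mono)
    show "integrable lborel (\<lambda>x. exp (2 * \<tau> * (x \<bullet> e)) * (norm (?F x))\<^sup>2)"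
      by (intro csi continuous_intros u) (simp add: supp)
    show "integrable lborel (\<lambda>x. K\<^sup>2 * (exp (2 * \<tau> * (x \<bullet> e)) * (norm (u x))\<^sup>2))" using iu by simp
    fix x
    have "(norm (?F x))\<^sup>2 \<le> (K * norm (u x))\<^sup>2" using FK by (rule power_mono) simp
    then have "exp (2 * \<tau> * (x \<bullet> e)) * (norm (?F x))\<^sup>2 \<le> exp (2 * \<tau> * (x \<bullet> e)) * (K * norm (u x))\<^sup>2" by (rule mult_left_mono) simp
    then show "exp (2 * \<tau> * (x \<bullet> e)) * (norm (?F x))\<^sup>2 \<le> K\<^sup>2 * (exp (2 * \<tau> * (x \<bullet> e)) * (norm (u x))\<^sup>2)"
      by (simp add: power_mult_distrib mult_ac)
  qed
  also have "\<dots> = K\<^sup>2 * ?I" by simp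
  finally have "((K + 1)\<^sup>2 - K\<^sup>2) * ?I \<le> 0" by (simp add: left_diff_distrib)
  moreover have "(K + 1)\<^sup>2 - K\<^sup>2 > 0" using K by (simp add: power2_eq_square algebra_simps)
  ultimately have "?I \<le> 0" by (simp add: mult_le_0_iff)
  moreover have "?I \<ge> 0" by simp
  ultimately have "?I = 0" by linarith
  moreover have "?I = 0 \<longleftrightarrow> (AE x in lborel. exp (2 * \<tau> * (x \<bullet> e)) * (norm (u x))\<^sup>2 = 0)"
    by (rule integral_nonneg_eq_0_iff_AE[OF iu]) simp
  ultimately show ?thesis by simp
qed

section \<open>Vanishing of the solution\<close>

lemma integral_tail_small:
  fixes q :: "'a::euclidean_space \<Rightarrow> real"
  assumes q: "integrable lborel q" and \<delta>: "\<delta> > 0"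
  obtains R where "(\<integral>y. indicator {y. R \<le> norm y} y * q y \<partial>lborel) \<le> \<delta>"
proof -
  have [measurable]: "q \<in> borel_measurable borel" using q by auto
  have "(\<lambda>n. \<integral>y. indicator {y. real n \<le> norm y} y * q y \<partial>lborel) \<longlonglongrightarrow> (\<integral>y. 0 \<partial>(lborel :: 'a measure))"
  proof (rule integral_dominated_convergence[where w = "\<lambda>y. norm (q y)"])
    show "AE y in lborel. (\<lambda>n. indicator {y. real n \<le> norm y} y * q y) \<longlonglongrightarrow> 0"
    proof (rule AE_I2)
      fix y :: 'a
      obtain m :: nat where m: "norm y < real m" using reals_Archimedean2 by blast
      have "eventually (\<lambda>n. indicator {y. real n \<le> norm y} y * q y = 0) sequentially"
        unfolding eventually_sequentially by (rule exI[of _ m]) (use m in \<open>auto simp: indicator_def\<close>)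
      then show "(\<lambda>n. indicator {y. real n \<le> norm y} y * q y) \<longlonglongrightarrow> 0" by (rule tendsto_eventually)
    qed
    show "AE y in lborel. norm (indicator {y. real n \<le> norm y} y * q y) \<le> norm (q y)" for n
      by (intro AE_I2) (auto simp: indicator_def)
  qed (use q in auto)
  then have "eventually (\<lambda>n. (\<integral>y. indicator {y. real n \<le> norm y} y * q y \<partial>lborel) < \<delta>) sequentially"
    using \<delta> by (intro order_tendstoD(2)) auto
  then obtain n where "(\<integral>y. indicator {y. real n \<le> norm y} y * q y \<partial>lborel) < \<delta>"
    unfolding eventually_sequentially by blast
  then show ?thesis using that less_imp_le by blast
qed

lemma norm_integral_le_nn_integral:
  fixes f :: "'a \<Rightarrow> real"
  assumes "(\<integral>\<^sup>+x. ennreal \<bar>f x\<bar> \<partial>M) \<le> ennreal B" "B \<ge> 0"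
  shows "\<bar>integral\<^sup>L M f\<bar> \<le> B"
  using order_trans[OF integral_norm_bound_nn[of M f], of "ennreal B"] assms by simp

text \<open>Near the singularity the Kato bound has the exponent \<open>e\<close> to spare, which makes the contribution of
  small balls small uniformly in \<open>x\<close>. Away from it the kernels are bounded and only the tail of the
  integral of \<open>|u|^2\<close> is seen. Uniformity in \<open>\<rho>\<close> is needed because the maximum principle works with
  mollified potentials.\<close>
lemma kernel_convolutions_small_at_infinity:
  fixes u :: "'a::euclidean_space \<Rightarrow> complex"
  assumes u[measurable]: "u \<in> borel_measurable borel" and q: "integrable lborel (\<lambda>y. (norm (u y))\<^sup>2)"
    and a: "a > 0" "a > real DIM('a) - 2" and e: "e > 0" and K: "K \<ge> 0"
    and kato: "\<And>x. (\<integral>\<^sup>+y. ennreal ((norm (u y))\<^sup>2 * singularity (y - x) powr (a + e)) * indicator (cball x 1) y \<partial>lborel) \<le> ennreal K"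
    and \<delta>: "\<delta> > 0"
  obtains R where
    "\<And>\<rho> x. 0 < \<rho> \<Longrightarrow> R \<le> norm x \<Longrightarrow> \<bar>conv (newton_kernel \<rho>) (\<lambda>y. (norm (u y))\<^sup>2) x\<bar> \<le> \<delta>"
    "\<And>\<rho> x. 0 < \<rho> \<Longrightarrow> R \<le> norm x \<Longrightarrow> \<bar>conv (remainder_kernel \<rho>) (\<lambda>y. (norm (u y))\<^sup>2) x\<bar> \<le> \<delta>"
proof -
  obtain N where N: "N > 0" "\<And>z::'a. z \<noteq> 0 \<Longrightarrow> \<bar>newton_kernel 0 z\<bar> \<le> N * singularity z powr a"
    using newton_kernel_le_singularity[OF a] by blast
  obtain L where L: "L > 0" "\<And>\<rho> z::'a. 0 \<le> \<rho> \<Longrightarrow> \<bar>remainder_kernel \<rho> z\<bar> \<le> L"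
    using remainder_kernel_bounded by blast
  define r where "r = min 1 ((\<delta> / (2 * N * (K + 1))) powr (1 / e))"
  have r: "r > 0" "r \<le> 1" using \<delta> N K by (auto simp: r_def)
  have re: "N * r powr e * K \<le> \<delta> / 2"
  proof -
    have "K + 1 > 0" using K by simp
    have "r powr e \<le> ((\<delta> / (2 * N * (K + 1))) powr (1 / e)) powr e"
      using r e by (intro powr_mono2) (auto simp: r_def)
    also have "\<dots> = \<delta> / (2 * N * (K + 1))" using \<delta> N K e by (simp add: powr_powr)
    finally have "N * r powr e * (K + 1) \<le> N * (\<delta> / (2 * N * (K + 1))) * (K + 1)"
      using N K by (intro mult_right_mono mult_left_mono) auto
    also have "\<dots> = \<delta> / 2" proof -
      have gen: "N * (\<delta> / (2 * N * M)) * M = \<delta> / 2" if "M > 0" for M using N(1) that by simp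
      show ?thesis by (rule gen) fact
    qed
    finally have "N * r powr e * (K + 1) \<le> \<delta> / 2" .
    moreover have "N * r powr e * K \<le> N * r powr e * (K + 1)" using N by (intro mult_left_mono) auto
    ultimately show ?thesis by linarith
  qed
  define \<eta> where "\<eta> = min (\<delta> / L) (\<delta> / 2 / (N * (1 / r) powr a))"
  have \<eta>: "\<eta> > 0" using \<delta> L N r by (auto simp: \<eta>_def)
  have \<eta>': "L * \<eta> \<le> \<delta>" "N * (1 / r) powr a * \<eta> \<le> \<delta> / 2"
  proof -
    have "\<eta> \<le> \<delta> / L" "\<eta> \<le> \<delta> / 2 / (N * (1 / r) powr a)" by (auto simp: \<eta>_def)
    moreover have "N * (1 / r) powr a > 0" using N r by simp
    ultimately show "L * \<eta> \<le> \<delta>" "N * (1 / r) powr a * \<eta> \<le> \<delta> / 2"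
      using L by (simp_all only: pos_le_divide_eq mult.commute)
  qed
  obtain R where R: "(\<integral>y. indicator {y. R \<le> norm y} y * (norm (u y))\<^sup>2 \<partial>(lborel :: 'a measure)) \<le> \<eta>"
    using integral_tail_small[OF q \<eta>] by blast
  let ?T = "\<lambda>y. indicator {y. R \<le> norm y} y * (norm (u y))\<^sup>2"
  have iT: "integrable lborel ?T"
    by (rule Bochner_Integration.integrable_bound[OF q]) (auto simp: indicator_def)
  have T: "(\<integral>\<^sup>+y. ennreal (?T y) \<partial>lborel) \<le> ennreal \<eta>"
    using R by (subst nn_integral_eq_integral[OF iT]) (auto simp: ennreal_leI)
  have tail: "(\<integral>\<^sup>+y. ennreal (C * ?T y) \<partial>lborel) \<le> ennreal (C * \<eta>)" if "C \<ge> 0" for C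
  proof -
    have "(\<integral>\<^sup>+y. ennreal (C * ?T y) \<partial>lborel) = ennreal C * (\<integral>\<^sup>+y. ennreal (?T y) \<partial>lborel)"
      using that by (simp add: ennreal_mult nn_integral_cmult)
    also have "\<dots> \<le> ennreal C * ennreal \<eta>" by (intro mult_left_mono T) simp
    finally show ?thesis using that \<eta> by (simp add: ennreal_mult)
  qed
  have far: "R \<le> norm y" if "R + 2 \<le> norm x" "norm (y - x) \<le> 2" for x y :: 'a
    using that norm_triangle_ineq2[of x y] by (simp add: norm_minus_commute)
  show ?thesis
  proof (rule that)
    fix \<rho> :: real and x :: 'a
    assume \<rho>: "0 < \<rho>" and x: "R + 2 \<le> norm x"
    let ?near = "\<lambda>y. (norm (u y))\<^sup>2 * singularity (y - x) powr (a + e)"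
    have pt: "ennreal \<bar>newton_kernel \<rho> (y - x) * (norm (u y))\<^sup>2\<bar> \<le>
      ennreal (N * r powr e) * (ennreal (?near y) * indicator (cball x 1) y) + ennreal (N * (1 / r) powr a * ?T y)" if "y \<noteq> x" for y
    proof -
      have z: "y - x \<noteq> 0" using that by simp
      have "\<bar>newton_kernel \<rho> (y - x)\<bar> \<le> N * singularity (y - x) powr a"
        using newton_kernel_mono[OF z less_imp_le[OF \<rho>]] N(2)[OF z] by linarith
      then have k: "\<bar>newton_kernel \<rho> (y - x) * (norm (u y))\<^sup>2\<bar> \<le> N * singularity (y - x) powr a * (norm (u y))\<^sup>2"
        unfolding abs_mult by (simp add: mult_right_mono)
      consider "norm (y - x) < r" | "r \<le> norm (y - x)" "norm (y - x) \<le> 2" | "norm (y - x) > 2" by linarith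
      then show ?thesis
      proof cases
        case 1
        have H: "1 / r \<le> singularity (y - x)"
          using 1 r z by (simp add: singularity_def le_max_iff_disj frac_le)
        have "1 = r powr e * (1 / r) powr e" using r by (simp add: powr_divide)
        also have "\<dots> \<le> r powr e * singularity (y - x) powr e"
          using H r e by (intro mult_left_mono powr_mono2) auto
        finally have "N * singularity (y - x) powr a * (norm (u y))\<^sup>2 * 1 \<le> N * singularity (y - x) powr a * (norm (u y))\<^sup>2 * (r powr e * singularity (y - x) powr e)"
          using N by (intro mult_left_mono) auto
        also have "\<dots> = N * r powr e * ?near y" by (simp add: powr_add mult_ac)
        finally have "\<bar>newton_kernel \<rho> (y - x) * (norm (u y))\<^sup>2\<bar> \<le> N * r powr e * ?near y" using k by simp
        then have "ennreal \<bar>newton_kernel \<rho> (y - x) * (norm (u y))\<^sup>2\<bar> \<le> ennreal (N * r powr e * ?near y)" by (rule ennreal_leI)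
        also have "\<dots> = ennreal (N * r powr e) * (ennreal (?near y) * indicator (cball x 1) y)"
          using 1 r N by (simp add: ennreal_mult dist_norm norm_minus_commute)
        finally show ?thesis by (rule order_trans) simp
      next
        case 2
        have "singularity (y - x) \<le> 1 / r" using 2 r by (simp add: singularity_def frac_le)
        then have "singularity (y - x) powr a \<le> (1 / r) powr a" using singularity_pos[of "y - x"] a by (intro powr_mono2) auto
        then have "N * singularity (y - x) powr a * (norm (u y))\<^sup>2 \<le> N * (1 / r) powr a * (norm (u y))\<^sup>2"
          using N by (intro mult_right_mono mult_left_mono) auto
        also have "\<dots> = N * (1 / r) powr a * ?T y" using far[OF x 2(2)] by simp
        finally have "ennreal \<bar>newton_kernel \<rho> (y - x) * (norm (u y))\<^sup>2\<bar> \<le> ennreal (N * (1 / r) powr a * ?T y)" using k by (intro ennreal_leI) linarith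
        then show ?thesis by (rule order_trans) simp
      next
        case 3
        then show ?thesis using kernels_support(1)[OF 3 less_imp_le[OF \<rho>]] by simp
      qed
    qed
    have ne: "AE y in lborel. y \<noteq> x" by (rule AE_lborel_singleton)
    have "(\<integral>\<^sup>+y. ennreal \<bar>newton_kernel \<rho> (y - x) * (norm (u y))\<^sup>2\<bar> \<partial>lborel) \<le>
      (\<integral>\<^sup>+y. ennreal (N * r powr e) * (ennreal (?near y) * indicator (cball x 1) y) + ennreal (N * (1 / r) powr a * ?T y) \<partial>lborel)"
      by (rule nn_integral_mono_AE) (rule eventually_mono[OF ne pt])
    also have "\<dots> = ennreal (N * r powr e) * (\<integral>\<^sup>+y. ennreal (?near y) * indicator (cball x 1) y \<partial>lborel) + (\<integral>\<^sup>+y. ennreal (N * (1 / r) powr a * ?T y) \<partial>lborel)"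
      by (subst nn_integral_add) (simp_all add: nn_integral_cmult)
    also have "\<dots> \<le> ennreal (N * r powr e) * ennreal K + ennreal (N * (1 / r) powr a * \<eta>)"
      using N by (intro add_mono mult_left_mono kato tail) auto
    also have "\<dots> = ennreal (N * r powr e * K + N * (1 / r) powr a * \<eta>)"
      using N K \<eta> by (simp add: ennreal_mult)
    also have "\<dots> \<le> ennreal \<delta>" using re \<eta>'(2) by (intro ennreal_leI) linarith
    finally show "\<bar>conv (newton_kernel \<rho>) (\<lambda>y. (norm (u y))\<^sup>2) x\<bar> \<le> \<delta>"
      unfolding conv_def using \<delta> by (intro norm_integral_le_nn_integral) auto
    have "(\<integral>\<^sup>+y. ennreal \<bar>remainder_kernel \<rho> (y - x) * (norm (u y))\<^sup>2\<bar> \<partial>lborel) \<le> (\<integral>\<^sup>+y. ennreal (L * ?T y) \<partial>lborel)"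
    proof (rule nn_integral_mono)
      fix y
      show "ennreal \<bar>remainder_kernel \<rho> (y - x) * (norm (u y))\<^sup>2\<bar> \<le> ennreal (L * ?T y)"
      proof (cases "norm (y - x) \<le> 2")
        case True
        have "\<bar>remainder_kernel \<rho> (y - x) * (norm (u y))\<^sup>2\<bar> \<le> L * (norm (u y))\<^sup>2"
          unfolding abs_mult using L(2)[OF less_imp_le[OF \<rho>], of "y - x"] by (simp add: mult_right_mono)
        then show ?thesis using far[OF x True] by (intro ennreal_leI) simp
      next
        case False
        then show ?thesis using kernels_support(3)[of "y - x", OF _ less_imp_le[OF \<rho>]] by simp
      qed
    qed
    also have "\<dots> \<le> ennreal (L * \<eta>)" using L by (intro tail) simp
    also have "\<dots> \<le> ennreal \<delta>" by (intro ennreal_leI \<eta>')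
    finally show "\<bar>conv (remainder_kernel \<rho>) (\<lambda>y. (norm (u y))\<^sup>2) x\<bar> \<le> \<delta>"
      unfolding conv_def using \<delta> by (intro norm_integral_le_nn_integral) auto
  qed
qed

theorem corollary2:
  fixes w :: "'a::euclidean_space \<Rightarrow> complex"
    and lam :: complex and s c \<alpha> :: real and k :: nat
  assumes "DIM('a) \<ge> 2"
    and "Re lam > 0"
    and "s > real DIM('a) / 2 - 1"
    and "real k \<ge> real DIM('a) / 2"
    and "w \<in> sobolev_H s \<inter> weighted_L2 k"
    and "distributional_solution lam w"
    and "c > 0"
    and "0 < \<alpha>" and "\<alpha> < 1"
    and "\<And>(n::nat) (\<xi>::'a). \<xi> \<in> sphere 0 1 \<Longrightarrow>
           continuous_rep w ((c * ln (real n + 1) powr \<alpha>) *\<^sub>R \<xi>) = 0"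
  shows "AE x in lborel. w x = 0"
proof -
  have w: "w \<in> sobolev_H s" using assms(5) by simp
  then have w0: "w \<in> weighted_L2 0" by (simp add: sobolev_H_def)
  then have wm[measurable]: "w \<in> borel_measurable borel" by (simp add: weighted_L2_def)
  obtain u a e K where u: "continuous_on UNIV u" and ae: "AE x in lborel. u x = w x"
    and a: "a > real DIM('a) - 2" "a > 0" and e: "e > 0" and K: "K \<ge> 0"
    and kato: "\<And>x. (\<integral>\<^sup>+y. ennreal ((norm (w y))\<^sup>2 * singularity (y - x) powr (a + e)) * indicator (cball x 1) y \<partial>lborel) \<le> ennreal K"
    using continuous_solution[OF assms(1,3) w assms(6)] by blast
  have um[measurable]: "u \<in> borel_measurable borel" by (rule borel_measurable_continuous_onI[OF u])
  have uq: "integrable lborel (\<lambda>y. (norm (u y))\<^sup>2)"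
  proof -
    have "integrable lborel (\<lambda>y. (norm (w y))\<^sup>2)" using w0 by (simp add: weighted_L2_def)
    then show ?thesis
      by (rule integrable_cong_AE_imp) (use ae in \<open>measurable, eventually_elim, simp\<close>)
  qed
  have kato_u: "(\<integral>\<^sup>+y. ennreal ((norm (u y))\<^sup>2 * singularity (y - x) powr (a + e)) * indicator (cball x 1) y \<partial>lborel) \<le> ennreal K" for x
  proof -
    have "(\<integral>\<^sup>+y. ennreal ((norm (u y))\<^sup>2 * singularity (y - x) powr (a + e)) * indicator (cball x 1) y \<partial>lborel) =
      (\<integral>\<^sup>+y. ennreal ((norm (w y))\<^sup>2 * singularity (y - x) powr (a + e)) * indicator (cball x 1) y \<partial>lborel)"
      by (rule nn_integral_cong_AE) (use ae in \<open>eventually_elim, simp\<close>)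
    then show ?thesis using kato by simp
  qed
  define r where "r n = c * ln (real n + 1) powr \<alpha>" for n
  have r_top: "filterlim r at_top sequentially" unfolding r_def using assms(7,8) by real_asymp
  have rep: "continuous_rep w = u" by (rule continuous_rep_eq[OF u ae])
  have zero: "u x = 0" if "norm x = r n" "r n > 0" for x n
  proof -
    have "x = r n *\<^sub>R (x /\<^sub>R norm x)" "x /\<^sub>R norm x \<in> sphere 0 1" using that by auto
    then show ?thesis using assms(10)[of "x /\<^sub>R norm x" n] unfolding rep r_def by simp
  qed
  let ?c = "mollifier_mass TYPE('a)"
  \<comment> \<open>The shell argument needs 3 |lam| \<delta> to be less than the mass; the 1 covers lam = 0.\<close>
  define \<delta> where "\<delta> = ?c / (4 * (norm lam + 1))"
  have \<delta>: "\<delta> > 0" using mollifier_mass_pos[where 'a = 'a] by (simp add: \<delta>_def add_nonneg_pos)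
  have small: "norm lam * (\<delta> + 2 * \<delta>) < ?c"
  proof -
    have "4 * (norm lam + 1) * \<delta> = ?c"
      using norm_ge_zero[of lam] by (simp add: \<delta>_def add_nonneg_eq_0_iff del: norm_ge_zero)
    moreover have "norm lam * \<delta> \<ge> 0" using \<delta> by simp
    moreover have "4 * (norm lam + 1) * \<delta> = 4 * (norm lam * \<delta>) + 4 * \<delta>" "norm lam * (\<delta> + 2 * \<delta>) = 3 * (norm lam * \<delta>)"
      by (simp_all add: algebra_simps)
    ultimately show ?thesis using \<delta> by linarith
  qed
  obtain R where R: "\<And>\<rho> x. 0 < \<rho> \<Longrightarrow> R \<le> norm x \<Longrightarrow> \<bar>conv (newton_kernel \<rho>) (\<lambda>y. (norm (u y))\<^sup>2) x\<bar> \<le> \<delta>"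
    "\<And>\<rho> x. 0 < \<rho> \<Longrightarrow> R \<le> norm x \<Longrightarrow> \<bar>conv (remainder_kernel \<rho>) (\<lambda>y. (norm (u y))\<^sup>2) x\<bar> \<le> \<delta>"
    using kernel_convolutions_small_at_infinity[OF um uq a(2,1) e K kato_u \<delta>] by blast
  have unbounded: "\<exists>n. B < r n" for B
    using r_top by (auto simp: filterlim_at_top_dense eventually_sequentially)
  obtain n where n: "max R 0 < r n" using unbounded by blast
  have "u x = 0" if x: "norm x > r n" for x
  proof -
    obtain m where m: "norm x < r m" using unbounded by blast
    show ?thesis
    proof (rule shell_uniqueness[OF u ae wm assms(6), where ?R1.0 = "r n" and ?R2.0 = "r m" and \<kappa> = \<delta> and \<epsilon> = \<delta>])
      show "u y = 0" if "norm y = r n \<or> norm y = r m" for y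
        using that zero[of y n] zero[of y m] n m x by auto
    qed (use R n m x small in auto)
  qed
  then have "AE x in lborel. u x = 0" by (rule compact_support_uniqueness[OF u ae wm assms(6)])
  with ae show ?thesis by eventually_elim simp
qed

end
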